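(* Let $M$ be a Riemann surface, $n\ge3$, and let $f:M\to\mathbb S^n$ be a conformally immersed Willmore surface with Hopf differential $\kappa$ and Schwarzian $s$ with respect to a local complex coordinate $z$. For a complex function $\mu$ put $$\theta:=\mu_z-\tfrac12\mu^2-s,\qquad \eta:=D_{\bar z}\kappa+\tfrac{\bar\mu}{2}\kappa .$$ Then adjoint transforms of $f$ (that is, solutions $\mu$ of the system $\theta=0$, $\langle\eta,\eta\rangle=0$) always exist locally, and in general they are not unique. More precisely: (a) Suppose $\langle\kappa,\kappa\rangle\ne0$. Then $\langle\eta,\eta\rangle=0$ is a quadratic equation (in $\bar\mu$), which has two roots at every point. Either of these roots $\mu$ satisfies $\theta=0$ as well. Hence the Willmore condition guarantees a solution $\mu$ of the system $\theta=0$, $\langle\eta,\eta\rangle=0$, and so the existence of adjoint transforms of $f$. (b) Suppose $\langle\kappa,\kappa\rangle=0$ on an open subset. Then $\langle D_{\bar z}\kappa,\kappa\rangle=\langle D_{\bar z}\kappa,D_{\bar z}\kappa\rangle=0$ there, so $\langle\eta,\eta\rangle=0$ holds automatically for every $\mu$, and $\mu$ defines an adjoint transform of $f$ if and only if it solves the Riccati equation $\mu_z-\frac12\mu^2-s=0$. Moreover: (b1) If $f$ is S-Willmore, then where there are no umbilic points there is locally a function $\mu$ with $D_{\bar z}\kappa+\frac{\bar\mu}{2}\kappa=0$. This $\mu$ solves the Riccati equation and gives the dual Willmore surface. Even in this case there are locally still infinitely many adjoint transforms. (b2) If $f$ is not S-Willmore, then $\kappa$ and $D_{\bar z}\kappa$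 span a rank 2 holomorphic subbundle of $V^\perp_{\mathbb C}$ (at least on the open subset where $\kappa\wedge D_{\bar z}\kappa\ne0$, and this subbundle extends smoothly to the zeros of $\kappa\wedge D_{\bar z}\kappa$). There is a 1-1 correspondence between solutions $\mu$ of the Riccati equation and holomorphic line subbundles spanned by $D_{\bar z}\kappa+\frac{\bar\mu}{2}\kappa$. So there are infinitely many solutions $\mu$.
   Context: Light-cone model. $\mathbb R^{n+1,1}$ is Minkowski space with $\langle y,y\rangle=-y_0^2+\sum_{i=1}^{n+1}y_i^2$ (extended complex bilinearly), $\mathcal L$ is its light cone, and $\mathbb S^n\cong\mathbb P(\mathcal L)$ via $x\leftrightarrow[1:x]$. A (local) lift of $f:M\to\mathbb S^n$ is a map $F$ into $\mathcal L$ with $[F]=f$. A map $f$ of a Riemann surface is conformal iff $\langle F_z,F_z\rangle=0$. For a conformal immersion $f$, $V=\mathrm{Span}\{F,dF,F_{z\bar z}\}$ is a well-defined rank-4 Lorentzian subbundle of $M\times\mathbb R^{n+1,1}$; its orthogonal complement $V^\perp$ is space-like, with connection $D$ given by orthogonal projection of the derivative. $V_{\mathbb C}$ and $V^\perp_{\mathbb C}$ are the complexifications; $V^\perp_{\mathbb C}$ is a holomorphic bundle with respect to $D_{\bar z}$. The mean curvature sphere of $f$ at $p$ is the 2-sphere $\mathbb P(V_p\cap\mathcal L)$. Fix a coordinate $z$. The canonical lift $Y$ is the lift into the forward light cone with $|dY|^2=|dz|^2$. $N$ is the unique real section of $V$ with $\langle N,N\rangle=\langle N,Y_z\rangle=0$,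 $\langle Y,N\rangle=-1$. The Schwarzian $s$ (complex function) and the Hopf differential $\kappa\in\Gamma(V^\perp_{\mathbb C})$ are defined by $Y_{zz}+\frac s2Y=\kappa$. Umbilic points are the zeros of $\kappa$. Willmore surface: a critical point of the Willmore functional $W(f)=\frac i2\int_M\langle\kappa,\bar\kappa\rangle\,dz\wedge d\bar z$ with respect to any variations of the map and the induced conformal structures. For a conformal immersion this is equivalent to the Willmore condition $D_{\bar z}D_{\bar z}\kappa+\frac{\bar s}{2}\kappa=0$. A Willmore surface is S-Willmore if $D_{\bar z}\kappa$ depends linearly on $\kappa$. Adjoint transform: a function $\mu$ defines the map $\hat f=[\widehat Y]$ into $\mathbb S^n$ with $$\widehat Y=\tfrac12|\mu|^2Y+\bar\mu Y_z+\mu Y_{\bar z}+N,$$ whose value at each point lies on the mean curvature sphere of $f$. This $\hat f$ is called an adjoint transform of the Willmore surface $f$ (and $\mu$ is said to define it) iff $\mu$ satisfies both $\theta=0$ (co-touching) and $\langle\eta,\eta\rangle=0$ (conformality). The map $\hat f$ is allowed to be degenerate. The considerations are local, and singularities (branch points of $\hat f$, poles of $\mu\,dz$) are ignored.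
   Formalization: In (a), solutions μ are asserted near every point except a discrete set of zeros of the quadratic's discriminant at which no continuous root exists; "always exist locally" means on a nonempty open part of every open set, as μ may have poles at zeros of ⟨κ,κ⟩. *)

theory Defs
  imports "HOL-Analysis.Analysis"
begin

section \<open>Smooth maps and Wirtinger derivatives\<close>

primrec Ck_on :: "nat \<Rightarrow> 'a::real_normed_vector set \<Rightarrow> ('a \<Rightarrow> 'b::real_normed_vector) \<Rightarrow> bool" where
  "Ck_on 0 S f \<longleftrightarrow> continuous_on S f"
| "Ck_on (Suc k) S f \<longleftrightarrow>
     (\<forall>x\<in>S. f differentiable (at x)) \<and> (\<forall>v. Ck_on k S (\<lambda>x. frechet_derivative f (at x) v))"

text \<open>Only used on open sets, where it depends only on the values of the map on the set.\<close>

definition smooth_on :: "'a::real_normed_vector set \<Rightarrow> ('a \<Rightarrow> 'b::real_normed_vector) \<Rightarrow> bool" where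
  "smooth_on S f \<longleftrightarrow> (\<forall>k. Ck_on k S f)"

definition dir_deriv :: "complex \<Rightarrow> (complex \<Rightarrow> 'b::real_normed_vector) \<Rightarrow> complex \<Rightarrow> 'b" where
  "dir_deriv v F p = frechet_derivative F (at p) v"

definition dz :: "(complex \<Rightarrow> complex) \<Rightarrow> complex \<Rightarrow> complex" where
  "dz g p = (dir_deriv 1 g p - \<i> * dir_deriv \<i> g p) / 2"

definition dzbar :: "(complex \<Rightarrow> complex) \<Rightarrow> complex \<Rightarrow> complex" where
  "dzbar g p = (dir_deriv 1 g p + \<i> * dir_deriv \<i> g p) / 2"

definition vdz :: "(complex \<Rightarrow> complex ^ 'm) \<Rightarrow> complex \<Rightarrow> complex ^ 'm" where
  "vdz F p = (\<chi> j. dz (\<lambda>q. F q $ j) p)"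

definition vdzbar :: "(complex \<Rightarrow> complex ^ 'm) \<Rightarrow> complex \<Rightarrow> complex ^ 'm" where
  "vdzbar F p = (\<chi> j. dzbar (\<lambda>q. F q $ j) p)"

section \<open>Complexified Minkowski space and the light-cone model\<close>

text \<open>With \<open>CARD('n) = n + 1\<close>, the type \<open>real ^ 'n\<close> is the Euclidean space containing the unit sphere
  of dimension \<open>n\<close>, and \<open>'n mvec\<close> is the complexification of Minkowski space, the index
  \<open>None\<close> being the time direction. Real Minkowski vectors are those with real components.\<close>

type_synonym 'n mvec = "(complex, 'n option) vec"

definition mink :: "('n::finite) mvec \<Rightarrow> 'n mvec \<Rightarrow> complex" where
  "mink x y = - (x $ None * y $ None) + (\<Sum>i\<in>UNIV. x $ Some i * y $ Some i)"

definition real_vector :: "complex ^ 'm \<Rightarrow> bool" where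
  "real_vector x \<longleftrightarrow> (\<forall>j. x $ j \<in> \<real>)"

text \<open>The identification of the sphere with the projectivized light cone: \<open>x\<close> corresponds to \<open>[1 : x]\<close>.\<close>

definition null_vec :: "real ^ 'n \<Rightarrow> 'n mvec" where
  "null_vec x = (\<chi> j. case j of None \<Rightarrow> 1 | Some i \<Rightarrow> complex_of_real (x $ i))"

definition sphere_point :: "'n mvec \<Rightarrow> real ^ 'n" where
  "sphere_point y = (\<chi> i. Re (y $ Some i / y $ None))"

text \<open>\<open>V\<close> is a complex subspace; \<open>mink\<close> is complex bilinear, so this is the complexification of the
  real orthogonal complement when \<open>V\<close> is the complexification of a real subspace.\<close>

definition mperp :: "(('n::finite) mvec) set \<Rightarrow> ('n mvec) set" where
  "mperp V = {w. \<forall>v\<in>V. mink v w = 0}"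

definition perp_proj :: "(('n::finite) mvec) set \<Rightarrow> 'n mvec \<Rightarrow> 'n mvec" where
  "perp_proj V x = (THE w. w \<in> mperp V \<and> x - w \<in> V)"

section \<open>The Willmore functional\<close>

definition immersion_on :: "complex set \<Rightarrow> (complex \<Rightarrow> real ^ 'n) \<Rightarrow> bool" where
  "immersion_on U g \<longleftrightarrow> smooth_on U g \<and>
     (\<forall>p\<in>U. g p \<in> sphere 0 1 \<and> inj (frechet_derivative g (at p)))"

text \<open>The condition is independent of the lift; the one used is \<open>(1, g)\<close>.\<close>

definition conformal_on :: "complex set \<Rightarrow> (complex \<Rightarrow> real ^ 'n) \<Rightarrow> bool" where
  "conformal_on U g \<longleftrightarrow>
     (\<forall>p\<in>U. mink (vdz (null_vec \<circ> g) p) (vdz (null_vec \<circ> g) p) = 0)"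

text \<open>A variation of a conformal immersion need not stay conformal with respect to the fixed
  coordinate, so the Willmore functional has to be written for an arbitrary immersion \<open>g\<close> with the
  conformal structure that it induces. Let \<open>X = (1, g)\<close>, let \<open>g\<^sub>v\<^sub>w = \<langle>X\<^sub>v, X\<^sub>w\<rangle>\<close> be the induced metric with
  respect to the real coordinate frame \<open>{1, \<i>}\<close>, let \<open>V\<close> be the span of \<open>X\<close>, \<open>dX\<close> and the metric trace of
  the second derivatives of \<open>X\<close>, and let \<open>h\<^sub>v\<^sub>w\<close> be the part of \<open>X\<^sub>v\<^sub>w\<close> orthogonal to \<open>V\<close>. The density is
  \<open>|h|\<^sup>2 dA / 8\<close>, the norm and the area being taken in the induced metric. It does not depend on
  the coordinate, nor on the scaling of \<open>X\<close>. In a complex coordinate \<open>w\<close> of the induced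
  conformal structure the trace is a multiple of \<open>X\<^bsub>w wbar\<^esub>\<close>; rescaling \<open>X\<close> to the canonical lift, the metric
  becomes \<open>|dw|\<^sup>2\<close> and \<open>\<kappa> = h\<^bsub>ww\<^esub> = (h\<^sub>1\<^sub>1 - \<i> h\<^sub>1\<^sub>2) / 2\<close> with \<open>h\<^sub>2\<^sub>2 = - h\<^sub>1\<^sub>1\<close>, so that
  \<open>|h|\<^sup>2 / 8 = \<langle>\<kappa>, cnj \<kappa>\<rangle>\<close> and the density is \<open>(\<i>/2) \<langle>\<kappa>, cnj \<kappa>\<rangle> dw \<and> d wbar\<close>.\<close>

definition metric :: "(complex \<Rightarrow> real ^ 'n) \<Rightarrow> complex \<Rightarrow> complex \<Rightarrow> complex \<Rightarrow> real" where
  "metric g p v w = dir_deriv v g p \<bullet> dir_deriv w g p"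

definition metric_det :: "(complex \<Rightarrow> real ^ 'n) \<Rightarrow> complex \<Rightarrow> real" where
  "metric_det g p = metric g p 1 1 * metric g p \<i> \<i> - (metric g p 1 \<i>)\<^sup>2"

text \<open>The inverse of the 2 by 2 matrix of the metric: for \<open>v, w \<in> {1, \<i>}\<close>, multiplication by \<open>\<i>\<close> produces
  the cofactors.\<close>

definition cometric :: "(complex \<Rightarrow> real ^ 'n) \<Rightarrow> complex \<Rightarrow> complex \<Rightarrow> complex \<Rightarrow> real" where
  "cometric g p v w = metric g p (\<i> * v) (\<i> * w) / metric_det g p"

definition hess :: "(complex \<Rightarrow> real ^ 'n) \<Rightarrow> complex \<Rightarrow> complex \<Rightarrow> complex \<Rightarrow> 'n mvec" where
  "hess g p v w = dir_deriv w (dir_deriv v (null_vec \<circ> g)) p"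

definition induced_V :: "(complex \<Rightarrow> real ^ 'n) \<Rightarrow> complex \<Rightarrow> ('n mvec) set" where
  "induced_V g p = vec.span
     {null_vec (g p), dir_deriv 1 (null_vec \<circ> g) p, dir_deriv \<i> (null_vec \<circ> g) p,
      (\<Sum>v\<in>{1, \<i>}. \<Sum>w\<in>{1, \<i>}. complex_of_real (cometric g p v w) *s hess g p v w)}"

definition tracefree_hess ::
    "(complex \<Rightarrow> real ^ 'n) \<Rightarrow> complex \<Rightarrow> complex \<Rightarrow> complex \<Rightarrow> 'n mvec" where
  "tracefree_hess g p v w = perp_proj (induced_V g p) (hess g p v w)"

definition willmore_density :: "(complex \<Rightarrow> real ^ 'n) \<Rightarrow> complex \<Rightarrow> real" where
  "willmore_density g p = sqrt (metric_det g p) / 8 *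
     (\<Sum>v\<in>{1, \<i>}. \<Sum>w\<in>{1, \<i>}. \<Sum>v'\<in>{1, \<i>}. \<Sum>w'\<in>{1, \<i>}.
        cometric g p v v' * cometric g p w w' *
        Re (mink (tracefree_hess g p v w) (tracefree_hess g p v' w')))"

definition willmore_functional :: "complex set \<Rightarrow> (complex \<Rightarrow> real ^ 'n) \<Rightarrow> real" where
  "willmore_functional K g = integral K (willmore_density g)"

text \<open>\<open>\<phi> t\<close> is the immersion at time \<open>t\<close>; it differs from \<open>f\<close> only inside the compact set \<open>K\<close>, so only the
  functional over \<open>K\<close>, which is finite, has to be compared.\<close>

definition variation ::
    "complex set \<Rightarrow> (complex \<Rightarrow> real ^ 'n) \<Rightarrow> complex set \<Rightarrow> real \<Rightarrow> (real \<Rightarrow> complex \<Rightarrow> real ^ 'n) \<Rightarrow> bool" where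
  "variation U f K \<epsilon> \<phi> \<longleftrightarrow>
     compact K \<and> K \<subseteq> U \<and> 0 < \<epsilon> \<and>
     smooth_on ({-\<epsilon><..<\<epsilon>} \<times> U) (\<lambda>(t, p). \<phi> t p) \<and>
     (\<forall>t\<in>{-\<epsilon><..<\<epsilon>}. immersion_on U (\<phi> t)) \<and>
     (\<forall>p\<in>U. \<phi> 0 p = f p) \<and>
     (\<forall>t\<in>{-\<epsilon><..<\<epsilon>}. \<forall>p\<in>U - K. \<phi> t p = f p)"

text \<open>\<open>U\<close> is the domain of a complex coordinate of the Riemann surface.\<close>

definition willmore_surface :: "complex set \<Rightarrow> (complex \<Rightarrow> real ^ 'n) \<Rightarrow> bool" where
  "willmore_surface U f \<longleftrightarrow>
     immersion_on U f \<and> conformal_on U f \<and>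
     (\<forall>K \<epsilon> \<phi>. variation U f K \<epsilon> \<phi> \<longrightarrow>
        ((\<lambda>t. willmore_functional K (\<phi> t)) has_real_derivative 0) (at 0))"

section \<open>Invariants of a conformal immersion with respect to a coordinate\<close>

definition canonical_lift ::
    "complex set \<Rightarrow> (complex \<Rightarrow> real ^ 'n) \<Rightarrow> (complex \<Rightarrow> 'n mvec) \<Rightarrow> bool" where
  "canonical_lift U f Y \<longleftrightarrow> smooth_on U Y \<and>
     (\<forall>p\<in>U. (\<exists>c::real. 0 < c \<and> Y p = complex_of_real c *s null_vec (f p)) \<and>
        (\<forall>v. mink (dir_deriv v Y p) (dir_deriv v Y p) = complex_of_real ((norm v)\<^sup>2)))"

text \<open>The complexified bundle \<open>V\<close>, from an arbitrary lift \<open>F\<close>.\<close>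

definition Vbundle :: "(complex \<Rightarrow> ('n::finite) mvec) \<Rightarrow> complex \<Rightarrow> ('n mvec) set" where
  "Vbundle F p = vec.span {F p, vdz F p, vdzbar F p, vdzbar (vdz F) p}"

definition normal_section ::
    "complex set \<Rightarrow> (complex \<Rightarrow> ('n::finite) mvec) \<Rightarrow> (complex \<Rightarrow> 'n mvec) \<Rightarrow> bool" where
  "normal_section U Y N \<longleftrightarrow>
     (\<forall>p\<in>U. N p \<in> Vbundle Y p \<and> real_vector (N p) \<and>
        mink (N p) (N p) = 0 \<and> mink (N p) (vdz Y p) = 0 \<and> mink (Y p) (N p) = -1)"

definition hopf_schwarzian ::
    "complex set \<Rightarrow> (complex \<Rightarrow> ('n::finite) mvec) \<Rightarrow> (complex \<Rightarrow> 'n mvec) \<Rightarrow>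
     (complex \<Rightarrow> complex) \<Rightarrow> bool" where
  "hopf_schwarzian U Y \<kappa> s \<longleftrightarrow>
     (\<forall>p\<in>U. \<kappa> p \<in> mperp (Vbundle Y p) \<and> vdz (vdz Y) p + (s p / 2) *s Y p = \<kappa> p)"

definition Dzbar ::
    "(complex \<Rightarrow> ('n::finite) mvec) \<Rightarrow> (complex \<Rightarrow> 'n mvec) \<Rightarrow> complex \<Rightarrow> 'n mvec" where
  "Dzbar Y \<psi> p = perp_proj (Vbundle Y p) (vdzbar \<psi> p)"

text \<open>At umbilic points nothing is required: there \<open>\<kappa>\<close> and its derivative are linearly dependent anyway.\<close>

definition s_willmore ::
    "complex set \<Rightarrow> (complex \<Rightarrow> ('n::finite) mvec) \<Rightarrow> (complex \<Rightarrow> 'n mvec) \<Rightarrow> bool" where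
  "s_willmore U Y \<kappa> \<longleftrightarrow> (\<forall>p\<in>U. \<kappa> p \<noteq> 0 \<longrightarrow> Dzbar Y \<kappa> p \<in> vec.span {\<kappa> p})"

section \<open>Adjoint transforms\<close>

definition theta :: "(complex \<Rightarrow> complex) \<Rightarrow> (complex \<Rightarrow> complex) \<Rightarrow> complex \<Rightarrow> complex" where
  "theta s \<mu> p = dz \<mu> p - (\<mu> p)\<^sup>2 / 2 - s p"

text \<open>The argument \<open>m\<close> is the value of \<open>\<mu>\<close> at the point \<open>p\<close>.\<close>

definition eta ::
    "(complex \<Rightarrow> ('n::finite) mvec) \<Rightarrow> (complex \<Rightarrow> 'n mvec) \<Rightarrow> complex \<Rightarrow> complex \<Rightarrow> 'n mvec" where
  "eta Y \<kappa> m p = Dzbar Y \<kappa> p + (cnj m / 2) *s \<kappa> p"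

definition adjoint_lift ::
    "(complex \<Rightarrow> ('n::finite) mvec) \<Rightarrow> (complex \<Rightarrow> 'n mvec) \<Rightarrow> (complex \<Rightarrow> complex) \<Rightarrow>
     complex \<Rightarrow> 'n mvec" where
  "adjoint_lift Y N \<mu> p =
     complex_of_real ((cmod (\<mu> p))\<^sup>2 / 2) *s Y p + cnj (\<mu> p) *s vdz Y p + \<mu> p *s vdzbar Y p + N p"

definition adjoint_map ::
    "(complex \<Rightarrow> 'n mvec) \<Rightarrow> (complex \<Rightarrow> 'n mvec) \<Rightarrow> (complex \<Rightarrow> complex) \<Rightarrow>
     complex \<Rightarrow> real ^ 'n" where
  "adjoint_map Y N \<mu> p = sphere_point (adjoint_lift Y N \<mu> p)"

definition defines_adjoint ::
    "complex set \<Rightarrow> (complex \<Rightarrow> ('n::finite) mvec) \<Rightarrow> (complex \<Rightarrow> 'n mvec) \<Rightarrow>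
     (complex \<Rightarrow> complex) \<Rightarrow> (complex \<Rightarrow> complex) \<Rightarrow> bool" where
  "defines_adjoint W Y \<kappa> s \<mu> \<longleftrightarrow> smooth_on W \<mu> \<and>
     (\<forall>p\<in>W. theta s \<mu> p = 0 \<and> mink (eta Y \<kappa> (\<mu> p) p) (eta Y \<kappa> (\<mu> p) p) = 0)"

text \<open>Maps and functions on \<open>W\<close> are taken in \<open>extensional W\<close>, so that counting them counts what
  happens on \<open>W\<close> only.\<close>

definition adjoint_transforms ::
    "complex set \<Rightarrow> (complex \<Rightarrow> 'n mvec) \<Rightarrow> (complex \<Rightarrow> 'n mvec) \<Rightarrow>
     (complex \<Rightarrow> 'n mvec) \<Rightarrow> (complex \<Rightarrow> complex) \<Rightarrow> (complex \<Rightarrow> real ^ 'n) set" where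
  "adjoint_transforms W Y N \<kappa> s =
     {restrict (adjoint_map Y N \<mu>) W | \<mu>. defines_adjoint W Y \<kappa> s \<mu>}"

definition riccati_solutions :: "complex set \<Rightarrow> (complex \<Rightarrow> complex) \<Rightarrow> (complex \<Rightarrow> complex) set" where
  "riccati_solutions W s = {\<mu> \<in> extensional W. smooth_on W \<mu> \<and> (\<forall>p\<in>W. theta s \<mu> p = 0)}"

text \<open>The dual Willmore surface \<open>g\<close> is the second envelope of the mean curvature sphere congruence of \<open>f\<close>:
  conformal to \<open>f\<close>, nowhere equal to \<open>f\<close>, lying on and tangent to the mean curvature spheres of \<open>f\<close>. It may be
  degenerate; where it is immersed, it is Willmore with the same mean curvature spheres as \<open>f\<close>.\<close>

definition dual_willmore_surface ::
    "complex set \<Rightarrow> (complex \<Rightarrow> real ^ 'n) \<Rightarrow> (complex \<Rightarrow> real ^ 'n) \<Rightarrow> bool" where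
  "dual_willmore_surface W f g \<longleftrightarrow>
     smooth_on W g \<and> conformal_on W g \<and>
     (\<forall>p\<in>W. g p \<in> sphere 0 1 \<and> g p \<noteq> f p \<and>
        null_vec (g p) \<in> Vbundle (null_vec \<circ> f) p \<and>
        (\<forall>v. dir_deriv v (null_vec \<circ> g) p \<in> Vbundle (null_vec \<circ> f) p)) \<and>
     (let W' = {p \<in> W. inj (frechet_derivative g (at p))} in
        willmore_surface W' g \<and>
        (\<forall>p\<in>W'. Vbundle (null_vec \<circ> g) p = Vbundle (null_vec \<circ> f) p))"

section \<open>Subbundles of the complexified normal bundle\<close>

definition smooth_frame ::
    "complex set \<Rightarrow> nat \<Rightarrow> (nat \<Rightarrow> complex \<Rightarrow> complex ^ 'm) \<Rightarrow> (complex \<Rightarrow> (complex ^ 'm) set) \<Rightarrow> bool" where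
  "smooth_frame B k \<Psi> E \<longleftrightarrow>
     (\<forall>j<k. smooth_on B (\<Psi> j)) \<and>
     (\<forall>q\<in>B. E q = vec.span ((\<lambda>j. \<Psi> j q) ` {..<k}) \<and> vec.dim (E q) = k)"

definition smooth_subbundle ::
    "complex set \<Rightarrow> (complex \<Rightarrow> ('n::finite) mvec) \<Rightarrow> nat \<Rightarrow> (complex \<Rightarrow> ('n mvec) set) \<Rightarrow> bool" where
  "smooth_subbundle W Y k E \<longleftrightarrow>
     (\<forall>p\<in>W. E p \<subseteq> mperp (Vbundle Y p)) \<and>
     (\<forall>p\<in>W. \<exists>B \<Psi>. open B \<and> p \<in> B \<and> B \<subseteq> W \<and> smooth_frame B k \<Psi> E)"

definition holomorphic_subbundle ::
    "complex set \<Rightarrow> (complex \<Rightarrow> ('n::finite) mvec) \<Rightarrow> nat \<Rightarrow> (complex \<Rightarrow> ('n mvec) set) \<Rightarrow> bool" where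
  "holomorphic_subbundle W Y k E \<longleftrightarrow>
     (\<forall>p\<in>W. E p \<subseteq> mperp (Vbundle Y p)) \<and>
     (\<forall>p\<in>W. \<exists>B \<Psi>. open B \<and> p \<in> B \<and> B \<subseteq> W \<and> smooth_frame B k \<Psi> E \<and>
        (\<forall>j<k. \<forall>q\<in>B. Dzbar Y (\<Psi> j) q = 0))"

text \<open>The set where \<open>\<kappa> \<and> D\<^bsub>zbar\<^esub> \<kappa>\<close> does not vanish.\<close>

definition wedge_support ::
    "complex set \<Rightarrow> (complex \<Rightarrow> ('n::finite) mvec) \<Rightarrow> (complex \<Rightarrow> 'n mvec) \<Rightarrow> complex set" where
  "wedge_support B Y \<kappa> = {p \<in> B. vec.dim {\<kappa> p, Dzbar Y \<kappa> p} = 2}"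

end

theory Submission imports Defs "HOL-Complex_Analysis.Complex_Analysis" begin

text \<open>The first variation of the Willmore functional along a variation with normalized velocity \<open>v\<close> is the integral
  of \<open>2 Re \<langle>v, EL\<rangle>\<close>, where \<open>EL = D\<^bsub>zbar\<^esub> D\<^bsub>zbar\<^esub> \<kappa> + (cnj s / 2) \<kappa>\<close> is real by the Codazzi equation; hence the
  Willmore surfaces are those with \<open>EL = 0\<close>. This equation makes
  \<open>\<langle>D\<^bsub>zbar\<^esub> \<kappa>, \<kappa>\<rangle>\<^sup>2 - \<langle>\<kappa>, \<kappa>\<rangle> \<langle>D\<^bsub>zbar\<^esub> \<kappa>, D\<^bsub>zbar\<^esub> \<kappa>\<rangle>\<close> holomorphic. A continuous root of \<open>\<langle>\<eta>, \<eta>\<rangle> = 0\<close> is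
  determined by a continuous, hence holomorphic, square root of this function, and differentiating it gives \<open>\<theta> = 0\<close>.

  In the isotropic case only the Riccati equation is left. It linearizes to \<open>b\<^bsub>zbar zbar\<^esub> + (cnj s / 2) b = 0\<close>,
  a linear dbar system, whose local fundamental matrix is the limit of a Picard iteration with the Cauchy transform.
  For a solution \<open>b\<close> the section \<open>b D\<^bsub>zbar\<^esub> \<kappa> - b\<^bsub>zbar\<^esub> \<kappa>\<close> is holomorphic, so two independent solutions frame the span
  of \<open>\<kappa>\<close> and \<open>D\<^bsub>zbar\<^esub> \<kappa>\<close> by holomorphic sections. In a holomorphic trivialization these are a pair of holomorphic
  vector functions, and dividing vanishing combinations of them by powers of \<open>z - p\<close> extends their span over the point
  \<open>p\<close>. The lift \<open>Yhat\<close> of the dual surface satisfies \<open>Yhat\<^sub>z = (\<mu> / 2) Yhat + \<rho> (Y\<^sub>z + (\<mu> / 2) Y)\<close>; where \<open>\<rho> \<noteq> 0\<close>, its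
  canonical lift is \<open>Yhat / |\<rho>|\<close>, its bundle \<open>V\<close> is that of \<open>f\<close> and its Hopf differential is \<open>(\<rho> / |\<rho>|) \<kappa>\<close>, so that its
  own \<open>EL\<close> can be computed.\<close>

no_notation fps_nth (infixl \<open>$\<close> 75)

section \<open>Smooth maps\<close>

text \<open>The functional is varied through immersions that need not be conformal for the fixed
  coordinate. Its density is therefore differentiated in a general moving frame and specialized to
  the canonical lift only at time 0. Variations are real, so they detect only real parts of products
  with \<open>EL\<close>; its reality is what makes vanishing of the first variation equivalent to
  \<open>EL = 0\<close>. In part (a) the discriminant may have zeros of odd order, around which no
  continuous root exists; hence roots are asserted only off a set \<open>S\<close> without limit
  points in the given open set. In the isotropic case holomorphic sections have to be produced from
  merely smooth coefficients. The Weingarten equation makes the ambient dzbar derivative of a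
  D-holomorphic section a zero-order expression in that section, so a linear system on the constant
  bundle of rank n + 2 takes the place of a trivialization of the normal bundle. Failure of the
  S-Willmore condition is known at a single point only; holomorphic coordinates and the
  connectedness of \<open>U\<close> spread it to a dense set, and only then can the rank 2 bundle be
  extended.\<close>

definition ddir :: "'a::real_normed_vector \<Rightarrow> ('a \<Rightarrow> 'b::real_normed_vector) \<Rightarrow> 'a \<Rightarrow> 'b" where
  "ddir v F x = frechet_derivative F (at x) v"

text \<open>\<open>dir_deriv\<close> is confined to maps on the complex plane. \<open>ddir\<close>
  serves every normed space, in particular the product of time and plane on which variations
  live.\<close>

lemma dir_deriv_eq_ddir: "dir_deriv v F = ddir v F"
  by (rule ext) (simp add: dir_deriv_def ddir_def)

lemma ddir_eqI: "(F has_derivative D) (at x) \<Longrightarrow> ddir v F x = D v"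
  unfolding ddir_def by (metis frechet_derivative_at)

lemma has_derivative_ddir:
  "F differentiable (at x) \<Longrightarrow> (F has_derivative (\<lambda>v. ddir v F x)) (at x)"
  unfolding ddir_def using frechet_derivative_works by auto

text \<open>No differentiability is assumed: \<open>frechet_derivative\<close> chooses among the
  candidate derivatives at the point, and two maps that agree nearby have the same candidates, even
  if there are none.\<close>

lemma ddir_cong:
  assumes "open S" "x \<in> S" "\<And>y. y \<in> S \<Longrightarrow> f y = g y"
  shows "ddir v f x = ddir v g x"
proof (cases "f differentiable at x")
  case True
  have "(g has_derivative (\<lambda>v. ddir v f x)) (at x)"
    using has_derivative_transform_within_open[OF has_derivative_ddir[OF True] assms(1,2)] assms(3) by auto
  from ddir_eqI[OF this] show ?thesis by simp
next
  case False
  have *: "(\<lambda>D. (f has_derivative D) (at x)) = (\<lambda>D. (g has_derivative D) (at x))"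
    using has_derivative_transform_within_open[OF _ assms(1,2)] assms(3) by (metis (mono_tags))
  show ?thesis unfolding ddir_def frechet_derivative_def using * by metis
qed

lemma Ck_on_Suc:
  "Ck_on (Suc k) S F \<longleftrightarrow> (\<forall>x\<in>S. F differentiable (at x)) \<and> (\<forall>v. Ck_on k S (ddir v F))"
  by (simp add: ddir_def[abs_def])

lemmas [simp del] = Ck_on.simps(2)

lemma Ck_on_cong:
  assumes "open S" "Ck_on k S f" "\<And>x. x \<in> S \<Longrightarrow> f x = g x"
  shows "Ck_on k S g"
  using assms(2,3)
proof (induction k arbitrary: f g)
  case 0
  then show ?case by (auto cong: continuous_on_cong_simp intro: continuous_on_eq)
next
  case (Suc k)
  have "g differentiable at x" if "x \<in> S" for x
    using has_derivative_transform_within_open[OF has_derivative_ddir assms(1) that] Suc.prems that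
    unfolding Ck_on_Suc differentiable_def by metis
  moreover have "Ck_on k S (ddir v g)" for v
    by (rule Suc.IH[of "ddir v f"]) (use Suc.prems in \<open>auto simp: Ck_on_Suc intro: ddir_cong[OF assms(1)]\<close>)
  ultimately show ?case unfolding Ck_on_Suc by auto
qed

lemma Ck_on_SucI:
  assumes "open S" "\<And>x. x \<in> S \<Longrightarrow> (f has_derivative D x) (at x)" "\<And>v. Ck_on k S (\<lambda>x. D x v)"
  shows "Ck_on (Suc k) S f"
  unfolding Ck_on_Suc
proof (intro conjI ballI allI)
  show "f differentiable at x" if "x \<in> S" for x using assms(2)[OF that] differentiable_def by blast
  show "Ck_on k S (ddir v f)" for v
    by (rule Ck_on_cong[OF assms(1) assms(3)[of v]]) (simp add: ddir_eqI[OF assms(2)])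
qed

lemma Ck_on_imp_continuous_on: "Ck_on k S f \<Longrightarrow> continuous_on S f"
proof (cases k)
  case (Suc n)
  assume "Ck_on k S f"
  then show ?thesis using Suc unfolding Suc Ck_on_Suc
    by (meson continuous_at_imp_continuous_on differentiable_imp_continuous_within)
qed auto

lemma Ck_on_SucD: "Ck_on (Suc k) S f \<Longrightarrow> Ck_on k S f"
proof (induction k arbitrary: f)
  case 0 then show ?case using Ck_on_imp_continuous_on by auto
next
  case (Suc k)
  then show ?case unfolding Ck_on_Suc[of "Suc k"] Ck_on_Suc[of k] by (auto simp: Ck_on_Suc)
qed

lemma Ck_on_subset: "Ck_on k S f \<Longrightarrow> T \<subseteq> S \<Longrightarrow> Ck_on k T f"
  by (induction k arbitrary: f) (auto simp: Ck_on_Suc intro: continuous_on_subset)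

lemma Ck_on_const: "open S \<Longrightarrow> Ck_on k S (\<lambda>x. c)"
proof (induction k arbitrary: c)
  case (Suc k)
  show ?case by (rule Ck_on_SucI[OF Suc.prems, of _ "\<lambda>x v. 0"]) (use Suc in auto)
qed auto

lemma Ck_on_linear_comp:
  assumes "open S" "bounded_linear L" "Ck_on k S f"
  shows "Ck_on k S (\<lambda>x. L (f x))"
  using assms(3)
proof (induction k arbitrary: f)
  case 0
  then show ?case by (simp add: bounded_linear.continuous_on[OF assms(2)])
next
  case (Suc k)
  show ?case
  proof (rule Ck_on_SucI[OF assms(1)])
    fix x assume "x \<in> S"
    then have "f differentiable at x" using Suc.prems by (auto simp: Ck_on_Suc)
    from bounded_linear.has_derivative[OF assms(2) has_derivative_ddir[OF this]]
    show "((\<lambda>x. L (f x)) has_derivative (\<lambda>v. L (ddir v f x))) (at x)" .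
  next
    fix v show "Ck_on k S (\<lambda>x. L (ddir v f x))" using Suc by (auto simp: Ck_on_Suc)
  qed
qed

lemma Ck_on_ident: "open S \<Longrightarrow> Ck_on k S (\<lambda>x. x)"
  by (cases k) (auto intro!: Ck_on_SucI[where D = "\<lambda>x v. v"] Ck_on_const)

lemma Ck_on_add:
  assumes "open S" "Ck_on k S f" "Ck_on k S g"
  shows "Ck_on k S (\<lambda>x. f x + g x)"
  using assms(2,3)
proof (induction k arbitrary: f g)
  case 0
  then show ?case by (auto intro: continuous_intros)
next
  case (Suc k)
  show ?case
  proof (rule Ck_on_SucI[OF assms(1)])
    fix x assume "x \<in> S"
    then have "f differentiable at x" "g differentiable at x" using Suc.prems by (auto simp: Ck_on_Suc)
    from has_derivative_add[OF this[THEN has_derivative_ddir]]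
    show "((\<lambda>x. f x + g x) has_derivative (\<lambda>v. ddir v f x + ddir v g x)) (at x)" .
  qed (use Suc in \<open>auto simp: Ck_on_Suc\<close>)
qed

lemma Ck_on_bilinear:
  assumes "open S" "bounded_bilinear B" "Ck_on k S f" "Ck_on k S g"
  shows "Ck_on k S (\<lambda>x. B (f x) (g x))"
  using assms(3,4)
proof (induction k arbitrary: f g)
  case 0
  then show ?case by (simp add: bounded_bilinear.continuous_on[OF assms(2)])
next
  case (Suc k)
  show ?case
  proof (rule Ck_on_SucI[OF assms(1)])
    fix x assume "x \<in> S"
    then have "f differentiable at x" "g differentiable at x" using Suc.prems by (auto simp: Ck_on_Suc)
    from bounded_bilinear.FDERIV[OF assms(2) this[THEN has_derivative_ddir]]
    show "((\<lambda>x. B (f x) (g x)) has_derivative (\<lambda>v. B (f x) (ddir v g x) + B (ddir v f x) (g x))) (at x)" .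
  next
    fix v show "Ck_on k S (\<lambda>x. B (f x) (ddir v g x) + B (ddir v f x) (g x))"
      by (intro Ck_on_add[OF assms(1)] Suc.IH) (use Suc.prems Ck_on_SucD in \<open>auto simp: Ck_on_Suc intro: Ck_on_SucD\<close>)
  qed
qed

lemma Ck_on_sum:
  assumes "open S" "\<And>i. i \<in> I \<Longrightarrow> Ck_on k S (f i)"
  shows "Ck_on k S (\<lambda>x. \<Sum>i\<in>I. f i x)"
  using assms(2)
  by (induction I rule: infinite_finite_induct) (auto intro: Ck_on_const Ck_on_add assms(1))

text \<open>The derivative of the outer map is expanded over the basis of the middle space:
  \<open>Ck_on\<close> differentiates in constant directions only, whereas the chain rule produces
  the moving direction \<open>ddir v g x\<close>.\<close>

lemma Ck_on_compose:
  fixes f :: "'b::euclidean_space \<Rightarrow> 'c::real_normed_vector" and g :: "'a::real_normed_vector \<Rightarrow> 'b"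
  assumes "open S" "open T" "Ck_on k T f" "Ck_on k S g" "g ` S \<subseteq> T"
  shows "Ck_on k S (\<lambda>x. f (g x))"
  using assms(3,4)
proof (induction k arbitrary: f)
  case 0
  then show ?case using continuous_on_compose2[of T f S g] assms(5) by auto
next
  case (Suc k)
  show ?case
  proof (rule Ck_on_SucI[OF assms(1)])
    fix x assume "x \<in> S"
    then have d: "g differentiable at x" "f differentiable at (g x)"
      using Suc.prems assms(5) by (auto simp: Ck_on_Suc)
    have eq: "ddir w f (g x) = (\<Sum>b\<in>Basis. (w \<bullet> b) *\<^sub>R ddir b f (g x))" for w
    proof -
      have lin: "linear (\<lambda>w. ddir w f (g x))"
        using has_derivative_ddir[OF d(2)] has_derivative_linear by blast
      show ?thesis
        using linear_sum[OF lin, of "\<lambda>b. (w \<bullet> b) *\<^sub>R b" Basis] euclidean_representation[of w]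
        by (simp add: linear_cmul[OF lin] linear_scale[OF lin])
    qed
    have "((\<lambda>x. f (g x)) has_derivative (\<lambda>v. ddir (ddir v g x) f (g x))) (at x)"
      using has_derivative_compose[OF has_derivative_ddir[OF d(1)] has_derivative_ddir[OF d(2)]] by simp
    then show "((\<lambda>x. f (g x)) has_derivative
        (\<lambda>v. \<Sum>b\<in>Basis. (ddir v g x \<bullet> b) *\<^sub>R ddir b f (g x))) (at x)"
      by (subst (asm) eq)
  next
    fix v show "Ck_on k S (\<lambda>x. \<Sum>b\<in>Basis. (ddir v g x \<bullet> b) *\<^sub>R ddir b f (g x))"
    proof (intro Ck_on_sum[OF assms(1)] Ck_on_bilinear[OF assms(1) bounded_bilinear_scaleR])
      fix b :: 'b
      show "Ck_on k S (\<lambda>x. ddir v g x \<bullet> b)"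
        by (rule Ck_on_linear_comp[OF assms(1) bounded_linear_inner_left]) (use Suc.prems in \<open>auto simp: Ck_on_Suc\<close>)
      show "Ck_on k S (\<lambda>x. ddir b f (g x))"
        using Suc.IH[of "ddir b f"] Suc.prems Ck_on_SucD by (auto simp: Ck_on_Suc intro: Ck_on_SucD)
    qed
  qed
qed

lemma smooth_on_Ck: "smooth_on S f \<Longrightarrow> Ck_on k S f"
  by (simp add: smooth_on_def)

lemma smooth_on_cong: "\<lbrakk>open S; smooth_on S f; \<And>x. x \<in> S \<Longrightarrow> f x = g x\<rbrakk> \<Longrightarrow> smooth_on S g"
  unfolding smooth_on_def using Ck_on_cong by blast

lemma smooth_on_subset: "smooth_on S f \<Longrightarrow> T \<subseteq> S \<Longrightarrow> smooth_on T f"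
  unfolding smooth_on_def using Ck_on_subset by blast

lemma smooth_on_differentiable: "smooth_on S f \<Longrightarrow> x \<in> S \<Longrightarrow> f differentiable (at x)"
  using smooth_on_Ck[of S f 1] by (auto simp: Ck_on_Suc)

lemma smooth_on_has_derivative:
  "smooth_on S f \<Longrightarrow> x \<in> S \<Longrightarrow> (f has_derivative (\<lambda>v. ddir v f x)) (at x)"
  using has_derivative_ddir smooth_on_differentiable by blast

lemma smooth_on_continuous_on: "smooth_on S f \<Longrightarrow> continuous_on S f"
  using smooth_on_Ck[of S f 0] by auto

lemma smooth_on_ddir: "smooth_on S f \<Longrightarrow> smooth_on S (ddir v f)"
  unfolding smooth_on_def using Ck_on_Suc by blast

lemma smooth_onI:
  assumes "open S" "\<And>x. x \<in> S \<Longrightarrow> (f has_derivative D x) (at x)" "\<And>v. smooth_on S (\<lambda>x. D x v)"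
  shows "smooth_on S f"
  unfolding smooth_on_def
proof
  fix k show "Ck_on k S f"
  proof (cases k)
    case 0
    have "continuous (at x) f" if "x \<in> S" for x using has_derivative_continuous[OF assms(2)[OF that]] .
    then show ?thesis unfolding 0 by (simp add: continuous_at_imp_continuous_on)
  next
    case (Suc m)
    show ?thesis unfolding Suc by (rule Ck_on_SucI[OF assms(1,2) smooth_on_Ck[OF assms(3)]])
  qed
qed

lemma smooth_on_local:
  assumes "\<And>x. x \<in> S \<Longrightarrow> \<exists>T. x \<in> T \<and> open T \<and> smooth_on T f"
  shows "smooth_on S f"
  unfolding smooth_on_def
proof
  have "Ck_on k S f" if "\<And>x. x \<in> S \<Longrightarrow> \<exists>T. x \<in> T \<and> open T \<and> Ck_on k T f" for k
    using that
  proof (induction k arbitrary: f)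
    case 0
    show ?case unfolding Ck_on.simps
      by (rule continuous_at_imp_continuous_on)
         (use 0 in \<open>force simp: continuous_on_eq_continuous_at\<close>)
  next
    case (Suc k)
    have "f differentiable at x" if "x \<in> S" for x
      using Suc.prems[OF that] by (auto simp: Ck_on_Suc)
    moreover have "Ck_on k S (ddir v f)" for v
      by (rule Suc.IH) (use Suc.prems in \<open>meson Ck_on_Suc\<close>)
    ultimately show ?case by (auto simp: Ck_on_Suc)
  qed
  then show "Ck_on k S f" for k using assms smooth_on_Ck by metis
qed

named_theorems smooth_intros

lemma smooth_on_const [smooth_intros]: "open S \<Longrightarrow> smooth_on S (\<lambda>x. c)"
  by (simp add: smooth_on_def Ck_on_const)

lemma smooth_on_ident [smooth_intros]: "open S \<Longrightarrow> smooth_on S (\<lambda>x. x)"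
  by (simp add: smooth_on_def Ck_on_ident)

lemma smooth_on_linear_comp:
  "\<lbrakk>bounded_linear L; open S; smooth_on S f\<rbrakk> \<Longrightarrow> smooth_on S (\<lambda>x. L (f x))"
  by (simp add: smooth_on_def Ck_on_linear_comp)

lemma smooth_on_bilinear:
  "\<lbrakk>bounded_bilinear B; open S; smooth_on S f; smooth_on S g\<rbrakk> \<Longrightarrow> smooth_on S (\<lambda>x. B (f x) (g x))"
  by (simp add: smooth_on_def Ck_on_bilinear)

lemma smooth_on_add [smooth_intros]:
  "\<lbrakk>open S; smooth_on S f; smooth_on S g\<rbrakk> \<Longrightarrow> smooth_on S (\<lambda>x. f x + g x)"
  by (simp add: smooth_on_def Ck_on_add)

lemma smooth_on_sum [smooth_intros]:
  "\<lbrakk>open S; \<And>i. i \<in> I \<Longrightarrow> smooth_on S (f i)\<rbrakk> \<Longrightarrow> smooth_on S (\<lambda>x. \<Sum>i\<in>I. f i x)"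
  by (simp add: smooth_on_def Ck_on_sum)

lemma smooth_on_compose:
  fixes f :: "'b::euclidean_space \<Rightarrow> 'c::real_normed_vector" and g :: "'a::real_normed_vector \<Rightarrow> 'b"
  shows "\<lbrakk>open S; open T; smooth_on T f; smooth_on S g; g ` S \<subseteq> T\<rbrakk> \<Longrightarrow> smooth_on S (\<lambda>x. f (g x))"
  by (simp add: smooth_on_def Ck_on_compose)

lemmas smooth_on_uminus [smooth_intros] = smooth_on_linear_comp[OF bounded_linear_minus[OF bounded_linear_ident]]
lemmas smooth_on_scaleR [smooth_intros] = smooth_on_bilinear[OF bounded_bilinear_scaleR]
lemmas smooth_on_inner [smooth_intros] = smooth_on_bilinear[OF bounded_bilinear_inner]
lemmas smooth_on_mult [smooth_intros] = smooth_on_bilinear[OF bounded_bilinear_mult]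
lemmas smooth_on_cnj [smooth_intros] = smooth_on_linear_comp[OF bounded_linear_cnj]
lemmas smooth_on_Re [smooth_intros] = smooth_on_linear_comp[OF bounded_linear_Re]
lemmas smooth_on_of_real [smooth_intros] = smooth_on_linear_comp[OF bounded_linear_of_real]
lemmas smooth_on_vec_nth [smooth_intros] = smooth_on_linear_comp[OF bounded_linear_vec_nth]
lemmas smooth_on_fst [smooth_intros] = smooth_on_linear_comp[OF bounded_linear_fst]
lemmas smooth_on_snd [smooth_intros] = smooth_on_linear_comp[OF bounded_linear_snd]

lemma smooth_on_diff [smooth_intros]:
  "\<lbrakk>open S; smooth_on S f; smooth_on S g\<rbrakk> \<Longrightarrow> smooth_on S (\<lambda>x. f x - g x)"
  using smooth_on_add[of S f "\<lambda>x. - g x"] smooth_on_uminus[of S g] by simp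

lemma smooth_on_power [smooth_intros]:
  fixes f :: "'a::real_normed_vector \<Rightarrow> 'b::real_normed_field"
  shows "\<lbrakk>open S; smooth_on S f\<rbrakk> \<Longrightarrow> smooth_on S (\<lambda>x. f x ^ n)"
  by (induction n) (auto intro: smooth_intros)

lemma smooth_on_vec_lambda [smooth_intros]:
  fixes f :: "'i::finite \<Rightarrow> 'a::real_normed_vector \<Rightarrow> 'b::real_normed_vector"
  assumes "open S" "\<And>i. smooth_on S (f i)"
  shows "smooth_on S (\<lambda>x. \<chi> i. f i x)"
proof -
  have bl: "bounded_linear (axis i :: 'b \<Rightarrow> 'b^'i)" for i
  proof (rule bounded_linear_intro[where K = 1])
    show "norm (axis i x :: 'b^'i) \<le> norm x * 1" for x :: 'b
    proof -
      have "norm (axis i x :: 'b^'i) \<le> (\<Sum>j\<in>UNIV. norm ((axis i x :: 'b^'i) $ j))"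
        unfolding norm_vec_def by (rule L2_set_le_sum) auto
      also have "\<dots> = (\<Sum>j\<in>UNIV. if j = i then norm x else 0)"
        by (rule sum.cong) (auto simp: axis_def)
      finally show ?thesis by simp
    qed
  qed (auto simp: axis_def vec_eq_iff)
  have "(\<lambda>x. \<chi> i. f i x) = (\<lambda>x. \<Sum>i\<in>UNIV. axis i (f i x))"
    by (auto simp: vec_eq_iff axis_def fun_eq_iff if_distrib cong: if_cong)
  then show ?thesis
    using smooth_on_sum[OF assms(1), of UNIV "\<lambda>i x. axis i (f i x)"]
      smooth_on_linear_comp[OF bl assms(1) assms(2)] by simp
qed

lemma smooth_on_vec_iff:
  fixes F :: "'a::real_normed_vector \<Rightarrow> 'b::real_normed_vector ^ 'i::finite"
  shows "open S \<Longrightarrow> smooth_on S F \<longleftrightarrow> (\<forall>i. smooth_on S (\<lambda>x. F x $ i))"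
  using smooth_on_vec_lambda[of S "\<lambda>i x. F x $ i"] smooth_on_vec_nth[of S F] by auto

lemma smooth_on_vscale [smooth_intros]:
  fixes F :: "'a::real_normed_vector \<Rightarrow> 'b::real_normed_field ^ 'i::finite"
  assumes "open S" "smooth_on S c" "smooth_on S F"
  shows "smooth_on S (\<lambda>x. c x *s F x)"
proof -
  have eq: "(\<lambda>x. c x *s F x) = (\<lambda>x. \<chi> i. c x * F x $ i)" by (auto simp: vec_eq_iff)
  show ?thesis unfolding eq by (intro smooth_intros assms)
qed

text \<open>The induction closes because the derivative of the inverse is a polynomial in the
  inverse itself. For \<open>smooth_on_sqrt\<close> it closes through the inverse of the
  root.\<close>

lemma smooth_on_inverse [smooth_intros]:
  fixes f :: "'a::real_normed_vector \<Rightarrow> 'b::{real_normed_field, euclidean_space}"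
  assumes "open S" "smooth_on S f" "\<And>x. x \<in> S \<Longrightarrow> f x \<noteq> 0"
  shows "smooth_on S (\<lambda>x. inverse (f x))"
proof -
  have "Ck_on k (- {0}) (inverse :: 'b \<Rightarrow> 'b)" for k
  proof (induction k)
    case 0 then show ?case by (auto intro!: continuous_intros)
  next
    case (Suc k)
    have o: "open (- {0::'b})" by auto
    show ?case
    proof (rule Ck_on_SucI[OF o])
      show "(inverse has_derivative (\<lambda>h. - (inverse x * h * inverse x))) (at x)" if "x \<in> - {0}" for x :: 'b
        using that by (auto intro!: derivative_eq_intros)
      have "Ck_on k (- {0}) (\<lambda>x::'b. - (inverse x * v * inverse x))" for v
        by (intro Ck_on_linear_comp[OF o bounded_linear_minus[OF bounded_linear_ident]]
            Ck_on_bilinear[OF o bounded_bilinear_mult] Suc Ck_on_const o)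
      then show "\<And>v. Ck_on k (- {0}) (\<lambda>x::'b. - (inverse x * v * inverse x))" .
    qed
  qed
  then have "smooth_on (- {0}) (inverse :: 'b \<Rightarrow> 'b)" by (simp add: smooth_on_def)
  moreover have "f ` S \<subseteq> - {0}" using assms(3) by auto
  ultimately show ?thesis using smooth_on_compose[OF assms(1) open_Compl[OF closed_singleton] _ assms(2)] by blast
qed

lemma smooth_on_divide [smooth_intros]:
  fixes f g :: "'a::real_normed_vector \<Rightarrow> 'b::{real_normed_field, euclidean_space}"
  shows "\<lbrakk>open S; smooth_on S f; smooth_on S g; \<And>x. x \<in> S \<Longrightarrow> g x \<noteq> 0\<rbrakk> \<Longrightarrow> smooth_on S (\<lambda>x. f x / g x)"
  unfolding divide_inverse by (intro smooth_intros)

lemma smooth_on_sqrt [smooth_intros]: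
  assumes "open S" "smooth_on S f" "\<And>x. x \<in> S \<Longrightarrow> (0::real) < f x"
  shows "smooth_on S (\<lambda>x. sqrt (f x))"
proof -
  have o: "open {0::real<..}" by auto
  have "Ck_on k {0<..} sqrt" for k
  proof (induction k)
    case 0 then show ?case by (auto intro!: continuous_intros)
  next
    case (Suc k)
    have inv: "Ck_on k {0<..} (\<lambda>x. inverse (sqrt x))"
      by (rule Ck_on_compose[OF o open_Compl[OF closed_singleton, of 0] _ Suc])
         (use smooth_on_inverse[of "-{0}" "\<lambda>x::real. x"] smooth_on_ident in \<open>auto intro!: smooth_on_Ck\<close>)
    show ?case
    proof (rule Ck_on_SucI[OF o])
      show "(sqrt has_derivative (\<lambda>h. h * (inverse (sqrt x) * inverse 2))) (at x)" if "x \<in> {0<..}" for x :: real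
        using that by (auto intro!: derivative_eq_intros simp: field_simps)
      show "Ck_on k {0<..} (\<lambda>x. v * (inverse (sqrt x) * inverse 2))" for v
        by (intro Ck_on_bilinear[OF o bounded_bilinear_mult] inv Ck_on_const o)
    qed
  qed
  then have "smooth_on {0<..} sqrt" by (simp add: smooth_on_def)
  moreover have "f ` S \<subseteq> {0<..}" using assms(3) by auto
  ultimately show ?thesis using smooth_on_compose[OF assms(1) o _ assms(2)] by blast
qed

text \<open>\<open>U\<close> and the complement of \<open>K\<close> are open and cover the space;
  the extension is \<open>f\<close> on the former and 0 on the latter.\<close>

lemma smooth_on_if_support:
  assumes "smooth_on U f" "open U" "closed K" "K \<subseteq> U" "\<And>x. x \<in> U - K \<Longrightarrow> f x = 0"
  shows "smooth_on UNIV (\<lambda>x. if x \<in> U then f x else 0)"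
proof (rule smooth_on_local)
  fix x
  show "\<exists>T. x \<in> T \<and> open T \<and> smooth_on T (\<lambda>x. if x \<in> U then f x else 0)"
  proof (cases "x \<in> U")
    case True
    then show ?thesis using smooth_on_cong[OF assms(2,1)] assms(2) by (intro exI[of _ U]) auto
  next
    case False
    have "smooth_on (-K) (\<lambda>x. if x \<in> U then f x else 0)"
      by (rule smooth_on_cong[OF _ smooth_on_const[of "-K" 0]]) (use assms in auto)
    then show ?thesis using False assms by (intro exI[of _ "-K"]) auto
  qed
qed

subsection \<open>Symmetry of second derivatives\<close>

text \<open>The mean value theorem is applied along \<open>v\<close> and along \<open>w\<close>. The
  second difference is symmetric in the two directions, its value as a derivative is not visibly so;
  comparing both orders for small \<open>h\<close> yields \<open>ddir_commute_real\<close>.\<close>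

lemma second_difference_mean_value:
  fixes F :: "'a::real_normed_vector \<Rightarrow> real"
  assumes sub: "ball x r \<subseteq> S" and C2: "Ck_on 2 S F" and h: "0 < h" "h * (norm v + norm w) < r"
  shows "\<exists>y. dist x y \<le> h * (norm v + norm w) \<and>
    F (x + h *\<^sub>R v + h *\<^sub>R w) - F (x + h *\<^sub>R v) - F (x + h *\<^sub>R w) + F x = h\<^sup>2 * ddir w (ddir v F) y"
proof -
  have near: "norm (a *\<^sub>R v + b *\<^sub>R w) \<le> h * (norm v + norm w)" if "0 \<le> a" "a \<le> h" "0 \<le> b" "b \<le> h" for a b
  proof -
    have "norm (a *\<^sub>R v + b *\<^sub>R w) \<le> a * norm v + b * norm w"
      using norm_triangle_ineq[of "a *\<^sub>R v" "b *\<^sub>R w"] that by simp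
    also have "\<dots> \<le> h * norm v + h * norm w" using that by (intro add_mono mult_right_mono) auto
    finally show ?thesis by (simp add: algebra_simps)
  qed
  have inS: "x + a *\<^sub>R v + b *\<^sub>R w \<in> S" if "0 \<le> a" "a \<le> h" "0 \<le> b" "b \<le> h" for a b
    using near[OF that] h sub
    by (metis (no_types, lifting) add.assoc dist_add_cancel dist_norm mem_ball add.right_neutral dist_0_norm
        dual_order.strict_trans2 subsetD)
  have dF: "(F has_derivative (\<lambda>u. ddir u F y)) (at y)" if "y \<in> S" for y
    using C2 that by (auto simp: Ck_on_Suc numeral_2_eq_2 intro: has_derivative_ddir)
  have dFv: "(ddir v F has_derivative (\<lambda>u. ddir u (ddir v F) y)) (at y)" if "y \<in> S" for y
    using C2 that by (auto simp: Ck_on_Suc numeral_2_eq_2 intro: has_derivative_ddir)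
  have d1: "((\<lambda>a. F (x + a *\<^sub>R v + b *\<^sub>R w)) has_real_derivative ddir v F (x + a *\<^sub>R v + b *\<^sub>R w)) (at a)"
    if "0 \<le> a" "a \<le> h" "0 \<le> b" "b \<le> h" for a b
  proof -
    have i: "((\<lambda>a. x + a *\<^sub>R v + b *\<^sub>R w) has_derivative (\<lambda>t. t *\<^sub>R v)) (at a)"
      by (auto intro!: derivative_eq_intros)
    have l: "linear (\<lambda>u. ddir u F (x + a *\<^sub>R v + b *\<^sub>R w))"
      using dF[OF inS[OF that]] has_derivative_linear by blast
    show ?thesis using has_derivative_compose[OF i dF[OF inS[OF that]]]
      unfolding has_field_derivative_def by (rule has_derivative_eq_rhs) (auto simp: linear_scale[OF l])
  qed
  have d2: "((\<lambda>b. ddir v F (x + a *\<^sub>R v + b *\<^sub>R w)) has_real_derivative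
       ddir w (ddir v F) (x + a *\<^sub>R v + b *\<^sub>R w)) (at b)"
    if "0 \<le> a" "a \<le> h" "0 \<le> b" "b \<le> h" for a b
  proof -
    have i: "((\<lambda>b. x + a *\<^sub>R v + b *\<^sub>R w) has_derivative (\<lambda>t. t *\<^sub>R w)) (at b)"
      by (auto intro!: derivative_eq_intros)
    have l: "linear (\<lambda>u. ddir u (ddir v F) (x + a *\<^sub>R v + b *\<^sub>R w))"
      using dFv[OF inS[OF that]] has_derivative_linear by blast
    show ?thesis using has_derivative_compose[OF i dFv[OF inS[OF that]]]
      unfolding has_field_derivative_def by (rule has_derivative_eq_rhs) (auto simp: linear_scale[OF l])
  qed
  define g where "g a = F (x + a *\<^sub>R v + h *\<^sub>R w) - F (x + a *\<^sub>R v + 0 *\<^sub>R w)" for a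
  have "\<exists>a. 0 < a \<and> a < h \<and> g h - g 0 = (h - 0) *
      (ddir v F (x + a *\<^sub>R v + h *\<^sub>R w) - ddir v F (x + a *\<^sub>R v + 0 *\<^sub>R w))"
  proof (rule MVT2[OF h(1)])
    fix a assume "0 \<le> a" "a \<le> h"
    then show "DERIV g a :> ddir v F (x + a *\<^sub>R v + h *\<^sub>R w) - ddir v F (x + a *\<^sub>R v + 0 *\<^sub>R w)"
      unfolding g_def using d1[of a h] d1[of a 0] h by (intro DERIV_diff) auto
  qed
  then obtain a where a: "0 < a" "a < h" "g h - g 0 = h *
      (ddir v F (x + a *\<^sub>R v + h *\<^sub>R w) - ddir v F (x + a *\<^sub>R v + 0 *\<^sub>R w))" by auto
  have "\<exists>b. 0 < b \<and> b < h \<and> ddir v F (x + a *\<^sub>R v + h *\<^sub>R w) - ddir v F (x + a *\<^sub>R v + 0 *\<^sub>R w)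
      = (h - 0) * ddir w (ddir v F) (x + a *\<^sub>R v + b *\<^sub>R w)"
    by (rule MVT2[OF h(1)]) (use d2 a in auto)
  then obtain b where b: "0 < b" "b < h" "ddir v F (x + a *\<^sub>R v + h *\<^sub>R w) - ddir v F (x + a *\<^sub>R v + 0 *\<^sub>R w)
      = h * ddir w (ddir v F) (x + a *\<^sub>R v + b *\<^sub>R w)" by auto
  show ?thesis
  proof (intro exI conjI)
    have "dist x (x + a *\<^sub>R v + b *\<^sub>R w) = norm (a *\<^sub>R v + b *\<^sub>R w)"
      by (metis add.assoc add.right_neutral dist_0_norm dist_add_cancel)
    then show "dist x (x + a *\<^sub>R v + b *\<^sub>R w) \<le> h * (norm v + norm w)"
      using near[of a b] a b by auto
    show "F (x + h *\<^sub>R v + h *\<^sub>R w) - F (x + h *\<^sub>R v) - F (x + h *\<^sub>R w) + F x =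
        h\<^sup>2 * ddir w (ddir v F) (x + a *\<^sub>R v + b *\<^sub>R w)"
      using a(3) b(3) unfolding g_def by (simp add: power2_eq_square)
  qed
qed

lemma ddir_commute_real:
  fixes F :: "'a::real_normed_vector \<Rightarrow> real"
  assumes "open S" "x \<in> S" "Ck_on 2 S F"
  shows "ddir v (ddir w F) x = ddir w (ddir v F) x"
proof (rule ccontr)
  assume ne: "\<not> ?thesis"
  \<comment> \<open>Half of the supposed gap: values within \<open>e\<close> of the two sides cannot
    coincide.\<close>
  define e where "e = \<bar>ddir v (ddir w F) x - ddir w (ddir v F) x\<bar> / 2"
  have e: "e > 0" using ne by (simp add: e_def)
  obtain r where r: "r > 0" "ball x r \<subseteq> S" using assms open_contains_ball by blast
  have c: "continuous_on S (ddir a (ddir b F))" for a b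
    using assms(3) by (auto simp: Ck_on_Suc numeral_2_eq_2)
  have "\<exists>d>0. \<forall>y\<in>S. dist y x < d \<longrightarrow> dist (ddir a (ddir b F) y) (ddir a (ddir b F) x) < e" for a b
    using c[of a b] assms(2) e unfolding continuous_on_iff by blast
  then obtain d1 d2 where d: "d1 > 0" "d2 > 0"
    "\<And>y. y \<in> S \<Longrightarrow> dist y x < d1 \<Longrightarrow> dist (ddir v (ddir w F) y) (ddir v (ddir w F) x) < e"
    "\<And>y. y \<in> S \<Longrightarrow> dist y x < d2 \<Longrightarrow> dist (ddir w (ddir v F) y) (ddir w (ddir v F) x) < e"
    by metis
  define m where "m = Min {r, d1, d2}"
  \<comment> \<open>The summand 1 keeps the denominator positive when both directions
    vanish.\<close>
  define h where "h = m / 2 / (norm v + norm w + 1)"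
  have m: "m > 0" "m \<le> r" "m \<le> d1" "m \<le> d2" using r d by (auto simp: m_def)
  have n: "norm v + norm w + 1 > 0" by (smt (verit) norm_ge_zero)
  have h: "h > 0" using m n by (simp add: h_def)
  have "h * (norm v + norm w) \<le> h * (norm v + norm w + 1)" using h by (simp add: mult_left_mono)
  also have "\<dots> = m / 2" unfolding h_def using n by (metis less_irrefl nonzero_eq_divide_eq)
  finally have hm: "h * (norm v + norm w) < m" using m by simp
  obtain y where y: "dist x y \<le> h * (norm v + norm w)"
     "F (x + h *\<^sub>R v + h *\<^sub>R w) - F (x + h *\<^sub>R v) - F (x + h *\<^sub>R w) + F x = h\<^sup>2 * ddir w (ddir v F) y"
    using second_difference_mean_value[OF r(2) assms(3) h] hm m by (metis order_less_le_trans)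
  obtain z where z: "dist x z \<le> h * (norm w + norm v)"
     "F (x + h *\<^sub>R w + h *\<^sub>R v) - F (x + h *\<^sub>R w) - F (x + h *\<^sub>R v) + F x = h\<^sup>2 * ddir v (ddir w F) z"
    using second_difference_mean_value[OF r(2) assms(3) h, of w v] hm m
    by (metis order_less_le_trans add.commute)
  have "h\<^sup>2 * ddir w (ddir v F) y = h\<^sup>2 * ddir v (ddir w F) z"
    using y(2) z(2) by (simp add: algebra_simps)
  then have eq: "ddir w (ddir v F) y = ddir v (ddir w F) z" using h by simp
  have "y \<in> S" "z \<in> S" using y(1) z(1) hm m r by (auto simp: add.commute intro!: subsetD[OF r(2)])
  moreover have "dist y x < d2" "dist z x < d1" using y(1) z(1) hm m by (auto simp: add.commute dist_commute)
  ultimately have "dist (ddir w (ddir v F) y) (ddir w (ddir v F) x) < e"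
    "dist (ddir v (ddir w F) z) (ddir v (ddir w F) x) < e" using d by auto
  then have "\<bar>ddir w (ddir v F) y - ddir w (ddir v F) x\<bar> < e"
    "\<bar>ddir w (ddir v F) y - ddir v (ddir w F) x\<bar> < e" by (simp_all add: dist_real_def eq)
  moreover have "\<bar>ddir v (ddir w F) x - ddir w (ddir v F) x\<bar> = e + e" by (simp add: e_def)
  ultimately show False by (smt (verit))
qed

lemma ddir_commute:
  fixes F :: "'a::real_normed_vector \<Rightarrow> 'b::euclidean_space"
  assumes "open S" "x \<in> S" "smooth_on S F"
  shows "ddir v (ddir w F) x = ddir w (ddir v F) x"
proof (rule euclidean_eqI)
  fix b :: 'b
  have 1: "ddir a (\<lambda>y. G y \<bullet> b) y = ddir a G y \<bullet> b" if "smooth_on S G" "y \<in> S" for a y and G :: "'a \<Rightarrow> 'b"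
    using ddir_eqI[OF bounded_linear.has_derivative[OF bounded_linear_inner_left
       smooth_on_has_derivative[OF that]]] by simp
  have 2: "ddir a (ddir c (\<lambda>y. F y \<bullet> b)) x = ddir a (ddir c F) x \<bullet> b" for a c
    using ddir_cong[OF assms(1,2) 1[OF assms(3)]] 1[OF smooth_on_ddir[OF assms(3)] assms(2)] by simp
  have "Ck_on 2 S (\<lambda>y. F y \<bullet> b)"
    using smooth_on_linear_comp[OF bounded_linear_inner_left assms(1,3)] smooth_on_Ck by blast
  from ddir_commute_real[OF assms(1,2) this]
  show "ddir v (ddir w F) x \<bullet> b = ddir w (ddir v F) x \<bullet> b" by (simp add: 2)
qed

subsection \<open>Bump functions\<close>

text \<open>The flat function exp(-1/x) times the n-th power of 1/x. The whole family is needed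
  because the derivative of one member combines the members n + 1 and n + 2.\<close>

definition flat_exp :: "nat \<Rightarrow> real \<Rightarrow> real" where
  "flat_exp n x = (if x \<le> 0 then 0 else exp (- inverse x) * inverse x ^ n)"

lemma flat_exp_tendsto_0: "(flat_exp n \<longlongrightarrow> 0) (at 0)"
proof -
  have "((\<lambda>y::real. y ^ n / exp y) \<longlongrightarrow> 0) at_top" by (rule tendsto_power_div_exp_0)
  then have "((\<lambda>x::real. inverse x ^ n / exp (inverse x)) \<longlongrightarrow> 0) (at_right 0)"
    using filterlim_compose filterlim_inverse_at_top_right by blast
  then have R: "(flat_exp n \<longlongrightarrow> 0) (at_right 0)"
    by (rule Lim_transform_eventually)
       (auto simp: eventually_at_filter flat_exp_def exp_minus divide_inverse)
  have L: "(flat_exp n \<longlongrightarrow> 0) (at_left 0)"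
    by (rule tendsto_eventually) (auto simp: eventually_at_filter flat_exp_def)
  show ?thesis using L R by (simp add: filterlim_split_at)
qed

lemma flat_exp_has_derivative:
  "(flat_exp n has_real_derivative (flat_exp (n + 2) x - real n * flat_exp (n + 1) x)) (at x)"
proof -
  consider "x < 0" | "x = 0" | "x > 0" by linarith
  then show ?thesis
  proof cases
    case 1
    have "((\<lambda>x. 0) has_real_derivative (flat_exp (n + 2) x - real n * flat_exp (n + 1) x)) (at x)"
      using 1 by (simp add: flat_exp_def)
    then show ?thesis
      by (rule has_field_derivative_transform_within_open[where S = "{..<0}"]) (use 1 in \<open>auto simp: flat_exp_def\<close>)
  next
    case 2
    \<comment> \<open>At 0 the difference quotient of \<open>flat_exp n\<close> is
      \<open>flat_exp (n + 1)\<close>.\<close>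
    have "((\<lambda>h. (flat_exp n (0 + h) - flat_exp n 0) / h) \<longlongrightarrow> 0) (at 0)"
      by (rule Lim_transform_eventually[OF flat_exp_tendsto_0[of "n+1"]])
         (auto simp: flat_exp_def eventually_at_filter field_simps)
    then show ?thesis using 2 by (simp add: DERIV_def flat_exp_def)
  next
    case 3
    have i: "(inverse has_real_derivative - (inverse x ^ 2)) (at x)"
      using DERIV_inverse[of x] 3 by (simp add: numeral_2_eq_2)
    have "((\<lambda>x. exp (- inverse x) * inverse x ^ n) has_real_derivative
       exp (- inverse x) * (inverse x)\<^sup>2 * inverse x ^ n
         + (real n * inverse x ^ (n - 1) * - (inverse x ^ 2)) * exp (- inverse x)) (at x)"
      using DERIV_mult[OF DERIV_chain2[OF DERIV_exp DERIV_minus[OF i]]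
        DERIV_power[OF i, of n]] by (simp add: mult.commute mult.left_commute)
    moreover have "exp (- inverse x) * (inverse x)\<^sup>2 * inverse x ^ n
         + (real n * inverse x ^ (n - 1) * - (inverse x ^ 2)) * exp (- inverse x)
      = flat_exp (n + 2) x - real n * flat_exp (n + 1) x"
      using 3 by (cases n) (simp_all add: flat_exp_def power2_eq_square algebra_simps)
    ultimately have "((\<lambda>x. exp (- inverse x) * inverse x ^ n) has_real_derivative
       (flat_exp (n + 2) x - real n * flat_exp (n + 1) x)) (at x)" by simp
    then show ?thesis
      by (rule has_field_derivative_transform_within_open[where S = "{0<..}"]) (use 3 in \<open>auto simp: flat_exp_def\<close>)
  qed
qed

lemma smooth_flat_exp: "smooth_on UNIV (flat_exp n)"
proof -
  have "Ck_on k UNIV (flat_exp n)" for k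
  proof (induction k arbitrary: n)
    case 0
    show ?case using flat_exp_has_derivative DERIV_isCont continuous_at_imp_continuous_on
      by (metis Ck_on.simps(1))
  next
    case (Suc k)
    have lin: "bounded_linear (\<lambda>x::real. c * x)" for c by (rule bounded_linear_mult_right)
    show ?case
    proof (rule Ck_on_SucI)
      show "(flat_exp n has_derivative (\<lambda>h. h * flat_exp (n + 2) x + h * - real n * flat_exp (n + 1) x)) (at x)" for x
        using flat_exp_has_derivative[of n x] unfolding has_field_derivative_def
        by (rule has_derivative_eq_rhs) (auto simp: algebra_simps)
      show "Ck_on k UNIV (\<lambda>x. v * flat_exp (n + 2) x + v * - real n * flat_exp (n + 1) x)" for v
        by (intro Ck_on_add Ck_on_linear_comp[OF _ lin] Suc) auto
    qed auto
  qed
  then show ?thesis by (simp add: smooth_on_def)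
qed

lemma flat_exp_pos: "x > 0 \<Longrightarrow> flat_exp n x > 0"
  and flat_exp_nonneg: "flat_exp n x \<ge> 0"
  and flat_exp_zero: "x \<le> 0 \<Longrightarrow> flat_exp n x = 0"
  by (auto simp: flat_exp_def)

lemma bump_function_exists:
  fixes p :: "'a::euclidean_space"
  assumes "r > 0"
  obtains u :: "'a \<Rightarrow> real" where "smooth_on UNIV u" "\<And>x. 0 \<le> u x" "\<And>x. u x \<le> 1"
    "\<And>x. dist p x \<ge> r \<Longrightarrow> u x = 0" "\<And>x. dist p x \<le> r / 2 \<Longrightarrow> u x = 1"
proof -
  define a where "a x = flat_exp 0 (r\<^sup>2 - (x - p) \<bullet> (x - p))" for x
  define b where "b x = flat_exp 0 ((x - p) \<bullet> (x - p) - (r/2)\<^sup>2)" for x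
  \<comment> \<open>\<open>a\<close> is positive exactly inside radius \<open>r\<close> and
    \<open>b\<close> exactly outside radius \<open>r / 2\<close>, so that their sum has no
    zero.\<close>
  define u where "u x = a x / (a x + b x)" for x
  have n: "(x - p) \<bullet> (x - p) = (dist p x)\<^sup>2" for x
    by (metis dist_commute dist_norm power2_norm_eq_inner)
  have pos: "a x + b x > 0" for x
  proof (cases "dist p x < r")
    case True
    then have "(dist p x)\<^sup>2 < r\<^sup>2" by (intro power_strict_mono) auto
    then have "a x > 0" unfolding a_def n by (intro flat_exp_pos) auto
    then show ?thesis using flat_exp_nonneg[of 0] by (simp add: b_def add_pos_nonneg)
  next
    case False
    then have "(r/2)\<^sup>2 < (dist p x)\<^sup>2" using assms by (intro power_strict_mono) auto
    then have "b x > 0" unfolding b_def n by (intro flat_exp_pos) auto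
    then show ?thesis using flat_exp_nonneg[of 0] by (simp add: a_def add_nonneg_pos)
  qed
  have sa: "smooth_on UNIV a" unfolding a_def
    by (rule smooth_on_compose[OF _ _ smooth_flat_exp]) (auto intro!: smooth_intros)
  have sb: "smooth_on UNIV b" unfolding b_def
    by (rule smooth_on_compose[OF _ _ smooth_flat_exp]) (auto intro!: smooth_intros)
  show ?thesis
  proof (rule that[of u])
    show "smooth_on UNIV u" unfolding u_def using pos by (intro smooth_intros sa sb) (auto simp: less_le)
    have nn: "a x \<ge> 0" "b x \<ge> 0" for x by (auto simp: a_def b_def flat_exp_nonneg)
    show "0 \<le> u x" "u x \<le> 1" for x using nn[of x] pos[of x] by (auto simp: u_def)
    show "u x = 0" if "dist p x \<ge> r" for x
    proof -
      have "r\<^sup>2 \<le> (dist p x)\<^sup>2" using that assms by (intro power_mono) auto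
      then show ?thesis by (simp add: u_def a_def n flat_exp_zero)
    qed
    show "u x = 1" if "dist p x \<le> r / 2" for x
    proof -
      have "(dist p x)\<^sup>2 \<le> (r/2)\<^sup>2" using that assms by (intro power_mono) auto
      then have "b x = 0" by (simp add: b_def n flat_exp_zero)
      then show ?thesis using pos[of x] by (simp add: u_def)
    qed
  qed
qed

section \<open>Wirtinger calculus\<close>

definition vcnj :: "complex ^ 'm \<Rightarrow> complex ^ 'm" where
  "vcnj x = (\<chi> j. cnj (x $ j))"

lemma vcnj_nth [simp]: "vcnj x $ j = cnj (x $ j)"
  by (simp add: vcnj_def)

lemma vcnj_simps [simp]:
  "vcnj (vcnj x) = x" "vcnj (x + y) = vcnj x + vcnj y" "vcnj (x - y) = vcnj x - vcnj y"
  "vcnj (c *s x) = cnj c *s vcnj x" "vcnj 0 = 0" "vcnj (- x) = - vcnj x"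
  by (simp_all add: vec_eq_iff)

lemma real_vector_iff_vcnj: "real_vector x \<longleftrightarrow> vcnj x = x"
  by (simp add: real_vector_def vec_eq_iff Reals_cnj_iff)

lemma smooth_on_vcnj [smooth_intros]: "open S \<Longrightarrow> smooth_on S F \<Longrightarrow> smooth_on S (\<lambda>p. vcnj (F p))"
  unfolding vcnj_def by (intro smooth_intros)

lemma smooth_on_mink [smooth_intros]:
  "open S \<Longrightarrow> smooth_on S F \<Longrightarrow> smooth_on S G \<Longrightarrow> smooth_on S (\<lambda>p. mink (F p) (G p))"
  unfolding mink_def by (intro smooth_intros)

lemma mink_simps [simp]:
  "mink (x + y) z = mink x z + mink y z" "mink x (y + z) = mink x y + mink x z"
  "mink (x - y) z = mink x z - mink y z" "mink x (y - z) = mink x y - mink x z"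
  "mink (c *s x) y = c * mink x y" "mink x (c *s y) = c * mink x y"
  "mink (- x) y = - mink x y" "mink x (- y) = - mink x y"
  "mink 0 x = 0" "mink x 0 = 0"
  by (simp_all add: mink_def algebra_simps sum.distrib sum_distrib_left sum_subtractf sum_negf)

lemma mink_commute: "mink x y = mink y x"
  by (simp add: mink_def mult.commute)

lemma mink_vcnj [simp]: "mink (vcnj x) (vcnj y) = cnj (mink x y)"
  by (simp add: mink_def)

lemma mink_vcnj_left: "mink (vcnj x) y = cnj (mink x (vcnj y))"
  using mink_vcnj[of x "vcnj y"] by simp

lemma mink_scaleR [simp]: "mink (r *\<^sub>R x) y = r *\<^sub>R mink x y" "mink x (r *\<^sub>R y) = r *\<^sub>R mink x y"
  unfolding mink_def vector_scaleR_component by (simp_all add: scaleR_conv_of_real algebra_simps sum_distrib_left)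

lemma bounded_bilinear_mink: "bounded_bilinear mink"
  by (intro bilinear_conv_bounded_bilinear[THEN iffD1])
     (auto simp: bilinear_def intro!: linearI)

lemma mperp_span4:
  "w \<in> mperp (vec.span {a, b, c, d}) \<longleftrightarrow> mink a w = 0 \<and> mink b w = 0 \<and> mink c w = 0 \<and> mink d w = 0"
proof
  assume "w \<in> mperp (vec.span {a, b, c, d})"
  then show "mink a w = 0 \<and> mink b w = 0 \<and> mink c w = 0 \<and> mink d w = 0"
    unfolding mperp_def using vec.span_base[of _ "{a, b, c, d}"] by auto
next
  assume *: "mink a w = 0 \<and> mink b w = 0 \<and> mink c w = 0 \<and> mink d w = 0"
  have "mink v w = 0" if "v \<in> vec.span {a, b, c, d}" for v
    using that by (induction rule: vec.span_induct_alt) (use * in auto)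
  then show "w \<in> mperp (vec.span {a, b, c, d})" by (auto simp: mperp_def)
qed

lemma in_span4:
  "v \<in> vec.span {a, b, c, d} \<longleftrightarrow>
    (\<exists>\<alpha> \<beta> \<gamma> \<delta>. v = \<alpha> *s a + \<beta> *s b + \<gamma> *s c + \<delta> *s (d :: complex ^ 'm))"
proof -
  have "v \<in> vec.span {a, b, c, d} \<longleftrightarrow>
    (\<exists>\<alpha> \<beta> \<gamma> \<delta>. v - \<alpha> *s a - \<beta> *s b - \<gamma> *s c - \<delta> *s d = 0)"
    by (simp add: vec.span_breakdown_eq)
  then show ?thesis by (simp add: algebra_simps)
qed

lemma span4_combI:
  "\<alpha> *s a + \<beta> *s b + \<gamma> *s c + \<delta> *s (d :: complex ^ 'm) \<in> vec.span {a, b, c, d}"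
  using in_span4 by blast

lemma perp_proj_eqI:
  assumes "vec.subspace V" "w \<in> mperp V" "x - w \<in> V" "\<And>v. v \<in> V \<Longrightarrow> v \<in> mperp V \<Longrightarrow> v = 0"
  shows "perp_proj V x = w"
  unfolding perp_proj_def
proof (rule the_equality)
  show "w \<in> mperp V \<and> x - w \<in> V" using assms by auto
next
  fix w' assume w': "w' \<in> mperp V \<and> x - w' \<in> V"
  have "w - w' \<in> mperp V" using w' assms(2) by (auto simp: mperp_def)
  moreover have "w - w' = (x - w') - (x - w)" by simp
  then have "w - w' \<in> V" using vec.subspace_diff[OF assms(1)] w' assms(3) by metis
  ultimately have "w - w' = 0" using assms(4) by blast
  then show "w' = w" by simp
qed

lemma ddir_vec_nth: "F differentiable at p \<Longrightarrow> ddir v (\<lambda>q. F q $ j) p = ddir v F p $ j"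
  by (rule ddir_eqI[OF bounded_linear.has_derivative[OF bounded_linear_vec_nth has_derivative_ddir], THEN trans]) auto

lemma ddir_rules:
  fixes c d :: "complex \<Rightarrow> complex" and F G :: "complex \<Rightarrow> complex ^ 'm"
    and A B :: "complex \<Rightarrow> 'b::real_normed_vector"
  shows "A differentiable at p \<Longrightarrow> B differentiable at p \<Longrightarrow> ddir v (\<lambda>q. A q + B q) p = ddir v A p + ddir v B p"
    "A differentiable at p \<Longrightarrow> B differentiable at p \<Longrightarrow> ddir v (\<lambda>q. A q - B q) p = ddir v A p - ddir v B p"
    "A differentiable at p \<Longrightarrow> ddir v (\<lambda>q. - A q) p = - ddir v A p"
    "c differentiable at p \<Longrightarrow> d differentiable at p \<Longrightarrow> ddir v (\<lambda>q. c q * d q) p = c p * ddir v d p + ddir v c p * d p"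
    "c differentiable at p \<Longrightarrow> ddir v (\<lambda>q. cnj (c q)) p = cnj (ddir v c p)"
    "ddir v (\<lambda>q. b) p = 0"
  subgoal by (rule ddir_eqI) (auto intro!: derivative_eq_intros has_derivative_ddir)
  subgoal by (rule ddir_eqI) (auto intro!: derivative_eq_intros has_derivative_ddir)
  subgoal by (rule ddir_eqI) (auto intro!: derivative_eq_intros has_derivative_ddir)
  subgoal by (rule ddir_eqI) (auto intro!: derivative_eq_intros has_derivative_ddir)
  subgoal by (rule ddir_eqI) (auto intro!: derivative_eq_intros has_derivative_ddir)
  subgoal by (rule ddir_eqI[where D = "\<lambda>v. 0"]) auto
  done

lemma differentiable_vec_nth: "F differentiable at p \<Longrightarrow> (\<lambda>q. F q $ j) differentiable at p"
  using bounded_linear.has_derivative[OF bounded_linear_vec_nth] unfolding differentiable_def by blast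

lemma bounded_bilinear_vscale: "bounded_bilinear (\<lambda>(c::complex) (x :: complex ^ 'm). c *s x)"
  by (intro bilinear_conv_bounded_bilinear[THEN iffD1])
     (auto simp: bilinear_def vec_eq_iff algebra_simps intro!: linearI)

lemma differentiable_vscale:
  fixes F :: "complex \<Rightarrow> complex ^ 'm"
  shows "c differentiable at p \<Longrightarrow> F differentiable at p \<Longrightarrow> (\<lambda>q. c q *s F q) differentiable at p"
  using bounded_bilinear.FDERIV[OF bounded_bilinear_vscale has_derivative_ddir has_derivative_ddir]
  unfolding differentiable_def by blast

lemma vdz_eq: "F differentiable at p \<Longrightarrow> vdz F p = (1/2) *s (ddir 1 F p - \<i> *s ddir \<i> F p)"
  and vdzbar_eq: "F differentiable at p \<Longrightarrow> vdzbar F p = (1/2) *s (ddir 1 F p + \<i> *s ddir \<i> F p)"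
  by (simp_all add: vdz_def vdzbar_def dz_def dzbar_def dir_deriv_eq_ddir vec_eq_iff ddir_vec_nth)

lemma dz_eq: "dz c p = (ddir 1 c p - \<i> * ddir \<i> c p) / 2"
  and dzbar_eq: "dzbar c p = (ddir 1 c p + \<i> * ddir \<i> c p) / 2"
  by (simp_all add: dz_def dzbar_def dir_deriv_eq_ddir)

lemma ddir_1_i: "F differentiable at p \<Longrightarrow> ddir 1 F p = vdz F p + vdzbar F p"
  "F differentiable at p \<Longrightarrow> ddir \<i> F p = \<i> *s (vdz F p - vdzbar F p)"
  for F :: "complex \<Rightarrow> complex ^ 'm"
  by (simp_all add: vdz_eq vdzbar_eq vec_eq_iff field_simps)

lemma ddir_complex:
  fixes F :: "complex \<Rightarrow> 'b::real_normed_vector"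
  assumes "F differentiable at p"
  shows "ddir v F p = Re v *\<^sub>R ddir 1 F p + Im v *\<^sub>R ddir \<i> F p"
proof -
  have l: "linear (\<lambda>v. ddir v F p)" using has_derivative_ddir[OF assms] has_derivative_linear by blast
  have "v = Re v *\<^sub>R 1 + Im v *\<^sub>R \<i>" by (simp add: complex_eq_iff)
  then show ?thesis by (metis linear_add[OF l] linear_scale[OF l])
qed

text \<open>The scalar identity behind dF = F_z dz + F_zbar dzbar, with F_z as \<open>a\<close> and
  F_zbar as \<open>b\<close>.\<close>

lemma complex_split_scale: "Re v *\<^sub>R (a + b) + Im v *\<^sub>R (\<i> * (a - b)) = v * a + cnj v * b"
  by (rule complex_eqI) (simp_all add: algebra_simps)

lemma ddir_vdz:
  fixes F :: "complex \<Rightarrow> complex ^ 'm"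
  assumes "F differentiable at p"
  shows "ddir v F p = v *s vdz F p + cnj v *s vdzbar F p"
  by (subst ddir_complex[OF assms])
     (simp only: ddir_1_i[OF assms] vec_eq_iff complex_split_scale vector_add_component vector_minus_component
       vector_scaleR_component vector_smult_component simp_thms)

lemma ddir_dz:
  assumes "c differentiable at p"
  shows "ddir v c p = v * dz c p + cnj v * dzbar c p"
proof -
  have "ddir 1 c p = dz c p + dzbar c p" "ddir \<i> c p = \<i> * (dz c p - dzbar c p)"
    by (simp_all add: dz_eq dzbar_eq field_simps)
  then show ?thesis by (subst ddir_complex[OF assms]) (simp add: complex_split_scale)
qed

lemma dz_rules:
  assumes "c differentiable at p" "d differentiable at p"
  shows "dz (\<lambda>q. c q + d q) p = dz c p + dz d p" "dzbar (\<lambda>q. c q + d q) p = dzbar c p + dzbar d p"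
    "dz (\<lambda>q. c q - d q) p = dz c p - dz d p" "dzbar (\<lambda>q. c q - d q) p = dzbar c p - dzbar d p"
    "dz (\<lambda>q. c q * d q) p = dz c p * d p + c p * dz d p"
    "dzbar (\<lambda>q. c q * d q) p = dzbar c p * d p + c p * dzbar d p"
  by (simp_all add: dz_eq dzbar_eq ddir_rules assms field_simps)

lemma dz_rules1:
  assumes "c differentiable at p"
  shows "dz (\<lambda>q. - c q) p = - dz c p" "dzbar (\<lambda>q. - c q) p = - dzbar c p"
    "dz (\<lambda>q. cnj (c q)) p = cnj (dzbar c p)" "dzbar (\<lambda>q. cnj (c q)) p = cnj (dz c p)"
    "dz (\<lambda>q. k * c q) p = k * dz c p" "dzbar (\<lambda>q. k * c q) p = k * dzbar c p"
    "dz (\<lambda>q. c q * k) p = dz c p * k" "dzbar (\<lambda>q. c q * k) p = dzbar c p * k"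
    "dz (\<lambda>q. c q / k) p = dz c p / k" "dzbar (\<lambda>q. c q / k) p = dzbar c p / k"
    "dz (\<lambda>q. (c q)\<^sup>2) p = 2 * c p * dz c p" "dzbar (\<lambda>q. (c q)\<^sup>2) p = 2 * c p * dzbar c p"
proof -
  have k: "(\<lambda>q::complex. k) differentiable at p" by simp
  have [simp]: "ddir v (\<lambda>q. k * c q) p = k * ddir v c p" "ddir v (\<lambda>q. c q * k) p = ddir v c p * k" for v k
    using ddir_rules(4)[OF _ assms, of "\<lambda>q. k" v] ddir_rules(4)[OF assms, of "\<lambda>q. k" v] ddir_rules(6)[of v k p]
    by simp_all
  show "dz (\<lambda>q. - c q) p = - dz c p" "dzbar (\<lambda>q. - c q) p = - dzbar c p"
    "dz (\<lambda>q. cnj (c q)) p = cnj (dzbar c p)" "dzbar (\<lambda>q. cnj (c q)) p = cnj (dz c p)"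
    "dz (\<lambda>q. k * c q) p = k * dz c p" "dzbar (\<lambda>q. k * c q) p = k * dzbar c p"
    "dz (\<lambda>q. c q * k) p = dz c p * k" "dzbar (\<lambda>q. c q * k) p = dzbar c p * k"
    by (simp_all add: dz_eq dzbar_eq ddir_rules(3,5)[OF assms] algebra_simps add_divide_distrib diff_divide_distrib)
  show "dz (\<lambda>q. c q / k) p = dz c p / k" "dzbar (\<lambda>q. c q / k) p = dzbar c p / k"
    unfolding divide_inverse by (simp_all add: dz_eq dzbar_eq algebra_simps add_divide_distrib diff_divide_distrib)
  show "dz (\<lambda>q. (c q)\<^sup>2) p = 2 * c p * dz c p" "dzbar (\<lambda>q. (c q)\<^sup>2) p = 2 * c p * dzbar c p"
    unfolding power2_eq_square dz_rules(5,6)[OF assms assms] by simp_all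
qed

lemma dz_const [simp]: "dz (\<lambda>q. k) p = 0" "dzbar (\<lambda>q. k) p = 0"
  by (simp_all add: dz_eq dzbar_eq ddir_rules)

lemma dz_inverse:
  assumes "c differentiable at p" "c p \<noteq> 0"
  shows "dz (\<lambda>q. inverse (c q)) p = - dz c p / (c p)\<^sup>2" "dzbar (\<lambda>q. inverse (c q)) p = - dzbar c p / (c p)\<^sup>2"
proof -
  have "ddir v (\<lambda>q. inverse (c q)) p = - (inverse (c p) * ddir v c p * inverse (c p))" for v
    by (rule ddir_eqI) (use assms in \<open>auto intro!: derivative_eq_intros has_derivative_ddir\<close>)
  then have *: "ddir v (\<lambda>q. inverse (c q)) p = - (inverse (c p))\<^sup>2 * ddir v c p" for v
    by (simp add: power2_eq_square)
  show "dz (\<lambda>q. inverse (c q)) p = - dz c p / (c p)\<^sup>2" "dzbar (\<lambda>q. inverse (c q)) p = - dzbar c p / (c p)\<^sup>2"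
    unfolding dz_eq dzbar_eq * using assms(2) by (simp_all add: field_simps)
qed

lemma vdz_nth: "vdz F p $ j = dz (\<lambda>q. F q $ j) p" "vdzbar F p $ j = dzbar (\<lambda>q. F q $ j) p"
  by (simp_all add: vdz_def vdzbar_def)

lemma vdz_rules:
  fixes F G :: "complex \<Rightarrow> complex ^ 'm"
  assumes "F differentiable at p" "G differentiable at p"
  shows "vdz (\<lambda>q. F q + G q) p = vdz F p + vdz G p" "vdzbar (\<lambda>q. F q + G q) p = vdzbar F p + vdzbar G p"
    "vdz (\<lambda>q. F q - G q) p = vdz F p - vdz G p" "vdzbar (\<lambda>q. F q - G q) p = vdzbar F p - vdzbar G p"
  using assms by (simp_all add: vec_eq_iff vdz_nth dz_rules differentiable_vec_nth)

lemma vdz_scale: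
  assumes "c differentiable at p" "F differentiable at p"
  shows "vdz (\<lambda>q. c q *s F q) p = dz c p *s F p + c p *s vdz F p"
    "vdzbar (\<lambda>q. c q *s F q) p = dzbar c p *s F p + c p *s vdzbar F p"
  using assms by (simp_all add: vec_eq_iff vdz_nth dz_rules differentiable_vec_nth)

lemma vdz_rules1:
  assumes "F differentiable at p"
  shows "vdz (\<lambda>q. vcnj (F q)) p = vcnj (vdzbar F p)" "vdzbar (\<lambda>q. vcnj (F q)) p = vcnj (vdz F p)"
    "vdz (\<lambda>q. k *s F q) p = k *s vdz F p" "vdzbar (\<lambda>q. k *s F q) p = k *s vdzbar F p"
    "vdz (\<lambda>q. - F q) p = - vdz F p" "vdzbar (\<lambda>q. - F q) p = - vdzbar F p"
  using assms by (simp_all add: vec_eq_iff vdz_nth dz_rules1 differentiable_vec_nth)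

lemma vdz_const [simp]: "vdz (\<lambda>q. x) p = 0" "vdzbar (\<lambda>q. x) p = 0"
  by (simp_all add: vec_eq_iff vdz_nth)

lemma dz_mink:
  assumes "F differentiable at p" "G differentiable at p"
  shows "dz (\<lambda>q. mink (F q) (G q)) p = mink (vdz F p) (G p) + mink (F p) (vdz G p)"
    "dzbar (\<lambda>q. mink (F q) (G q)) p = mink (vdzbar F p) (G p) + mink (F p) (vdzbar G p)"
proof -
  have "ddir v (\<lambda>q. mink (F q) (G q)) p = mink (F p) (ddir v G p) + mink (ddir v F p) (G p)" for v
    by (rule ddir_eqI[OF bounded_bilinear.FDERIV[OF bounded_bilinear_mink]])
       (auto intro!: has_derivative_ddir assms)
  then show "dz (\<lambda>q. mink (F q) (G q)) p = mink (vdz F p) (G p) + mink (F p) (vdz G p)"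
    "dzbar (\<lambda>q. mink (F q) (G q)) p = mink (vdzbar F p) (G p) + mink (F p) (vdzbar G p)"
    by (simp_all add: dz_eq dzbar_eq vdz_eq vdzbar_eq assms field_simps)
qed

lemma dz_cong:
  assumes "open S" "p \<in> S" "\<And>q. q \<in> S \<Longrightarrow> c q = d q"
  shows "dz c p = dz d p" "dzbar c p = dzbar d p"
  by (simp_all add: dz_eq dzbar_eq ddir_cong[OF assms(1,2), of c d] assms(3))

lemma vdz_cong:
  assumes "open S" "p \<in> S" "\<And>q. q \<in> S \<Longrightarrow> F q = G q"
  shows "vdz F p = vdz G p" "vdzbar F p = vdzbar G p"
  unfolding vec_eq_iff vdz_nth by (auto intro!: dz_cong[OF assms(1,2)] simp: assms(3))

lemma smooth_on_dz [smooth_intros]: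
  "open S \<Longrightarrow> smooth_on S c \<Longrightarrow> smooth_on S (dz c)" "open S \<Longrightarrow> smooth_on S c \<Longrightarrow> smooth_on S (dzbar c)"
  unfolding dz_eq[abs_def] dzbar_eq[abs_def] by (intro smooth_intros smooth_on_ddir; simp)+

lemma smooth_on_vdz [smooth_intros]:
  "open S \<Longrightarrow> smooth_on S F \<Longrightarrow> smooth_on S (vdz F)" "open S \<Longrightarrow> smooth_on S F \<Longrightarrow> smooth_on S (vdzbar F)"
  unfolding vdz_def[abs_def] vdzbar_def[abs_def] by (intro smooth_intros; simp)+

lemma dz_dzbar_commute:
  assumes "open S" "p \<in> S" "smooth_on S c"
  shows "dzbar (dz c) p = dz (dzbar c) p"
proof -
  have d: "ddir v c differentiable at p" for v
    using smooth_on_differentiable smooth_on_ddir assms by blast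
  have e: "ddir v (\<lambda>q. (ddir 1 c q + k * ddir \<i> c q) / 2) p
      = (ddir v (ddir 1 c) p + k * ddir v (ddir \<i> c) p) / 2" for v k
    by (rule ddir_eqI[OF bounded_linear.has_derivative[OF bounded_linear_divide
          has_derivative_add[OF has_derivative_ddir[OF d] has_derivative_mult_right[OF has_derivative_ddir[OF d]]]]])
  have m: "ddir 1 (ddir \<i> c) p = ddir \<i> (ddir 1 c) p" using ddir_commute[OF assms] .
  have e': "ddir v (\<lambda>q. (ddir 1 c q - \<i> * ddir \<i> c q) / 2) p
      = (ddir v (ddir 1 c) p - \<i> * ddir v (ddir \<i> c) p) / 2" for v
    using e[of v "- \<i>"] by simp
  show ?thesis unfolding dz_eq[abs_def] dzbar_eq[abs_def]
    unfolding e e' m by (simp add: field_simps)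
qed

lemma vdz_vdzbar_commute:
  assumes "open S" "p \<in> S" "smooth_on S F"
  shows "vdzbar (vdz F) p = vdz (vdzbar F) p"
  using dz_dzbar_commute[OF assms(1,2) smooth_on_vec_nth[OF assms(1,3)]]
  by (simp add: vec_eq_iff vdz_nth)

lemma dzbar_eq_0_holomorphic:
  assumes "open S" "smooth_on S c" "\<And>p. p \<in> S \<Longrightarrow> dzbar c p = 0"
  shows "c holomorphic_on S"
  unfolding holomorphic_on_def
proof
  fix p assume "p \<in> S"
  then have d: "c differentiable at p" using assms smooth_on_differentiable by blast
  have "(c has_derivative (\<lambda>v. dz c p * v)) (at p)"
    using has_derivative_ddir[OF d] assms(3)[OF \<open>p \<in> S\<close>] by (simp add: ddir_dz[OF d] mult.commute)
  then show "c field_differentiable at p within S"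
    unfolding field_differentiable_def has_field_derivative_def using has_derivative_at_withinI by blast
qed

lemma holomorphic_smooth:
  assumes "open S" "c holomorphic_on S"
  shows "smooth_on S c" "\<And>p. p \<in> S \<Longrightarrow> dzbar c p = 0" "\<And>p. p \<in> S \<Longrightarrow> dz c p = deriv c p"
proof -
  have D: "(g has_derivative (\<lambda>v. deriv g p * v)) (at p)" if "p \<in> S" "g holomorphic_on S" for p g
    using holomorphic_derivI[OF that(2) assms(1) that(1)] by (simp add: has_field_derivative_def)
  have "Ck_on k S g" if "g holomorphic_on S" for k g
    using that
  proof (induction k arbitrary: g)
    case 0 then show ?case by (simp add: holomorphic_on_imp_continuous_on)
  next
    case (Suc k)
    show ?case
      by (rule Ck_on_SucI[OF assms(1) D[OF _ Suc.prems]], assumption,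
          rule Ck_on_linear_comp[OF assms(1) bounded_linear_mult_left])
         (use Suc holomorphic_deriv assms(1) in blast)
  qed
  then show "smooth_on S c" using assms by (simp add: smooth_on_def)
  have e: "ddir v c p = v * deriv c p" if "p \<in> S" for v p
    using ddir_eqI[OF D[OF that assms(2)]] by (simp add: mult.commute)
  show "dzbar c p = 0" "dz c p = deriv c p" if "p \<in> S" for p
    using that by (simp_all add: dzbar_eq dz_eq e)
qed

section \<open>Structure equations of a conformal immersion\<close>

text \<open>Nearly all products between derivatives of the frame are found in this way, by
  differentiating a product that is already known to be constant.\<close>

lemma mink_const_derivative:
  assumes "open W" "smooth_on W F" "smooth_on W G" "p \<in> W" "\<And>q. q \<in> W \<Longrightarrow> mink (F q) (G q) = c"
  shows "mink (vdz F p) (G p) = - mink (F p) (vdz G p)"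
    "mink (vdzbar F p) (G p) = - mink (F p) (vdzbar G p)"
proof -
  have d: "F differentiable at p" "G differentiable at p" using assms smooth_on_differentiable by blast+
  have "dz (\<lambda>q. mink (F q) (G q)) p = dz (\<lambda>q. c) p" "dzbar (\<lambda>q. mink (F q) (G q)) p = dzbar (\<lambda>q. c) p"
    by (rule dz_cong[OF assms(1,4)], simp add: assms(5))+
  then show "mink (vdz F p) (G p) = - mink (F p) (vdz G p)"
    "mink (vdzbar F p) (G p) = - mink (F p) (vdzbar G p)"
    unfolding dz_mink[OF d] by (simp_all add: eq_neg_iff_add_eq_0)
qed

text \<open>Stated for a pair of conjugate fields and not for one real field, so that it can be
  iterated: from \<open>Y\<close> to the conjugate pair of its first derivatives and on to the
  second ones.\<close>

lemma vdzbar_real: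
  assumes "open W" "smooth_on W F" "p \<in> W" "\<And>q. q \<in> W \<Longrightarrow> vcnj (F q) = G q"
  shows "vdzbar G p = vcnj (vdz F p)" "vdz G p = vcnj (vdzbar F p)"
proof -
  have d: "F differentiable at p" using assms smooth_on_differentiable by blast
  have "vdzbar (\<lambda>q. vcnj (F q)) p = vdzbar G p" "vdz (\<lambda>q. vcnj (F q)) p = vdz G p"
    by (rule vdz_cong[OF assms(1,3)], simp add: assms(4))+
  then show "vdzbar G p = vcnj (vdz F p)" "vdz G p = vcnj (vdzbar F p)"
    unfolding vdz_rules1[OF d] by simp_all
qed

text \<open>The part of the theory that needs the canonical lift alone. It is split off because the
  dual surface has to be treated on this level before its Hopf differential is known.\<close>

locale conformal_lift =
  fixes U :: "complex set" and f :: "complex \<Rightarrow> real ^ 'n" and Y :: "complex \<Rightarrow> 'n mvec"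
  assumes open_U: "open U" and sphere_f: "\<And>p. p \<in> U \<Longrightarrow> f p \<in> sphere 0 1"
    and lift: "canonical_lift U f Y"
begin

lemma smooth_Y: "smooth_on U Y"
  using lift by (simp add: canonical_lift_def)

lemmas smY [smooth_intros] = smooth_Y smooth_on_vdz[OF open_U] smooth_on_dz[OF open_U]

lemma Y_pos: "p \<in> U \<Longrightarrow> \<exists>c::real. 0 < c \<and> Y p = complex_of_real c *s null_vec (f p)"
  using lift by (simp add: canonical_lift_def)

lemma Y_real: "p \<in> U \<Longrightarrow> vcnj (Y p) = Y p"
  using Y_pos by (force simp: vec_eq_iff null_vec_def split: option.splits)

lemma null_vec_null: "x \<in> sphere 0 1 \<Longrightarrow> mink (null_vec x) (null_vec x) = 0"
proof -
  assume "x \<in> sphere 0 1"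
  then have "(\<Sum>i\<in>UNIV. (x $ i)\<^sup>2) = 1"
    by (simp add: norm_vec_def L2_set_def)
  then have "complex_of_real (\<Sum>i\<in>UNIV. x $ i * x $ i) = 1" by (simp add: power2_eq_square)
  then show ?thesis by (simp add: mink_def null_vec_def)
qed

lemma Y_null: "p \<in> U \<Longrightarrow> mink (Y p) (Y p) = 0"
  using Y_pos[of p] null_vec_null[OF sphere_f[of p]] by auto

lemma Yb_eq: "p \<in> U \<Longrightarrow> vdzbar Y p = vcnj (vdz Y p)"
  using vdzbar_real[OF open_U smooth_Y _ Y_real] by blast

lemma Y_metric:
  assumes "p \<in> U"
  shows "mink (vdz Y p) (vdz Y p) = 0" "mink (vdz Y p) (vdzbar Y p) = 1/2"
proof -
  have d: "Y differentiable at p" using smooth_Y assms smooth_on_differentiable by blast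
  have m: "mink (ddir v Y p) (ddir v Y p) = complex_of_real ((norm v)\<^sup>2)" for v
    using lift assms by (simp add: canonical_lift_def dir_deriv_eq_ddir)
  define E G where "E = mink (vdz Y p) (vdz Y p)" and "G = mink (vdz Y p) (vdzbar Y p)"
  have E': "mink (vdzbar Y p) (vdzbar Y p) = cnj E" unfolding Yb_eq[OF assms] E_def by simp
  have eq: "v\<^sup>2 * E + 2 * (v * cnj v) * G + (cnj v)\<^sup>2 * cnj E = complex_of_real ((norm v)\<^sup>2)" for v
    using m[of v] unfolding ddir_vdz[OF d]
    by (simp add: E_def[symmetric] G_def[symmetric] E' mink_commute[of "vdzbar Y p" "vdz Y p"]
        power2_eq_square algebra_simps)
  have n: "norm (1 + \<i>) ^ 2 = 2" by (simp add: cmod_def)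
  \<comment> \<open>Three directions suffice: 1 and \<i> determine \<open>G\<close> and the real
    part of \<open>E\<close>, and 1 + \<i> the imaginary part of \<open>E\<close>.\<close>
  have e1: "E + 2 * G + cnj E = 1" using eq[of 1] by simp
  have e2: "- E + 2 * G - cnj E = 1" using eq[of "\<i>"] by simp
  have e3: "(1 + \<i>)\<^sup>2 * E + 2 * ((1 + \<i>) * (1 - \<i>)) * G + (1 - \<i>)\<^sup>2 * cnj E = 2"
    using eq[of "1 + \<i>"] n by simp
  have "2 * \<i> * E + 4 * G - 2 * \<i> * cnj E = 2" using e3 by (simp add: power2_eq_square algebra_simps)
  moreover have G: "4 * G = 2" using e1 e2 by algebra
  moreover have "\<i> * (2 * E - 2 * cnj E) = 2 * \<i> * E + 4 * G - 2 * \<i> * cnj E - 4 * G"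
    by (simp add: algebra_simps)
  ultimately have "\<i> * (2 * E - 2 * cnj E) = 0" by simp
  then have "2 * E - 2 * cnj E = 0" using complex_i_not_zero mult_eq_0_iff by blast
  then have "E = cnj E" by algebra
  moreover have "E + cnj E = 0" using e1 G by algebra
  ultimately show "mink (vdz Y p) (vdz Y p) = 0" "mink (vdz Y p) (vdzbar Y p) = 1/2"
    unfolding E_def[symmetric] G_def[symmetric] using G by (simp_all add: field_simps)
qed

abbreviation "Yz \<equiv> vdz Y"
abbreviation "Yb \<equiv> vdzbar Y"
abbreviation "Yzz \<equiv> vdz (vdz Y)"
abbreviation "Ybb \<equiv> vdzbar (vdzbar Y)"
abbreviation "Yzb \<equiv> vdzbar (vdz Y)"

lemma Yzb_commute: "p \<in> U \<Longrightarrow> vdz (vdzbar Y) p = Yzb p"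
  using vdz_vdzbar_commute[OF open_U _ smooth_Y] by simp

section \<open>Products of the first and second derivatives of the canonical lift\<close>

lemma mink_1:
  assumes "p \<in> U"
  shows "mink (Y p) (Yz p) = 0" "mink (Y p) (Yb p) = 0" "mink (Yb p) (Yb p) = 0" "mink (Yb p) (Yz p) = 1/2"
    "mink (Yz p) (Y p) = 0" "mink (Yb p) (Y p) = 0"
proof -
  show 1: "mink (Y p) (Yz p) = 0" "mink (Y p) (Yb p) = 0"
    using mink_const_derivative[OF open_U smooth_Y smooth_Y assms Y_null] by (simp_all add: mink_commute)
  show "mink (Yb p) (Yb p) = 0" using Y_metric(1)[OF assms] by (simp add: Yb_eq[OF assms])
  show "mink (Yb p) (Yz p) = 1/2" using Y_metric(2)[OF assms] by (simp add: mink_commute)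
  show "mink (Yz p) (Y p) = 0" "mink (Yb p) (Y p) = 0" using 1 by (simp_all add: mink_commute)
qed

lemma mink_2:
  assumes "p \<in> U"
  shows "mink (Yzz p) (Y p) = 0" "mink (Ybb p) (Y p) = 0" "mink (Yzb p) (Y p) = -1/2"
    "mink (Yzz p) (Yz p) = 0" "mink (Yzb p) (Yz p) = 0" "mink (Yzb p) (Yb p) = 0"
    "mink (Yzz p) (Yb p) = 0" "mink (Ybb p) (Yz p) = 0" "mink (Ybb p) (Yb p) = 0"
proof -
  note s1 = smooth_Y smooth_on_vdz[OF open_U smooth_Y]
  note c = mink_const_derivative[OF open_U _ _ assms]
  show "mink (Yzz p) (Y p) = 0" "mink (Yzb p) (Y p) = -1/2"
    using c[OF s1(2,1) mink_1(5)] Y_metric[OF assms] by simp_all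
  show "mink (Ybb p) (Y p) = 0" using c[OF s1(3,1) mink_1(6)] mink_1[OF assms] by simp_all
  show "mink (Yzz p) (Yz p) = 0" "mink (Yzb p) (Yz p) = 0"
    using c[OF s1(2,2) Y_metric(1)] by (simp_all add: mink_commute)
  show bz: "mink (Yzb p) (Yb p) = 0" and bb: "mink (Ybb p) (Yb p) = 0"
    using c[OF s1(3,3) mink_1(3)] by (simp_all add: mink_commute Yzb_commute[OF assms])
  show "mink (Yzz p) (Yb p) = 0" "mink (Ybb p) (Yz p) = 0"
    using c[OF s1(2,3) Y_metric(2)] \<open>mink (Yzb p) (Yb p) = 0\<close> \<open>mink (Yzb p) (Yz p) = 0\<close>
    by (simp_all add: mink_commute Yzb_commute[OF assms])
qed

lemma Yzb_real: "p \<in> U \<Longrightarrow> vcnj (Yzb p) = Yzb p"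
  using vdzbar_real(2)[OF open_U smooth_on_vdz(1)[OF open_U smooth_Y] _ Yb_eq[symmetric]] Yzb_commute by metis

text \<open>\<open>Yzb\<close> is real, orthogonal to \<open>Yz\<close>, and has product -1/2 with
  \<open>Y\<close>. Doubling normalizes this product, and the multiple of the null vector
  \<open>Y\<close> cancels the square of the doubled vector.\<close>

lemma normal_section_exists:
  "normal_section U Y (\<lambda>p. 2 *s Yzb p + (2 * mink (Yzb p) (Yzb p)) *s Y p)"
  unfolding normal_section_def
proof (intro ballI conjI)
  fix p assume p: "p \<in> U"
  note m = mink_1[OF p] mink_2[OF p] Y_metric[OF p] Y_null[OF p]
  have com: "mink (Y p) (Yzb p) = -1/2" "mink (Yz p) (Yzb p) = 0" using m by (simp_all add: mink_commute)
  have r: "cnj (mink (Yzb p) (Yzb p)) = mink (Yzb p) (Yzb p)" using Yzb_real[OF p] by (metis mink_vcnj)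
  show "2 *s Yzb p + (2 * mink (Yzb p) (Yzb p)) *s Y p \<in> Vbundle Y p"
    unfolding Vbundle_def in_span4
    by (rule exI[of _ "2 * mink (Yzb p) (Yzb p)"], rule exI[of _ 0], rule exI[of _ 0], rule exI[of _ 2]) simp
  show "real_vector (2 *s Yzb p + (2 * mink (Yzb p) (Yzb p)) *s Y p)"
    by (simp add: real_vector_iff_vcnj Yzb_real[OF p] Y_real[OF p] r)
  show "mink (2 *s Yzb p + (2 * mink (Yzb p) (Yzb p)) *s Y p) (2 *s Yzb p + (2 * mink (Yzb p) (Yzb p)) *s Y p) = 0"
    "mink (2 *s Yzb p + (2 * mink (Yzb p) (Yzb p)) *s Y p) (Yz p) = 0"
    "mink (Y p) (2 *s Yzb p + (2 * mink (Yzb p) (Yzb p)) *s Y p) = -1"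
    by (simp_all add: m com)
qed

end

section \<open>The frame of the mean curvature sphere and the projection to the normal
  bundle\<close>

locale conformal_surface = conformal_lift U f Y
  for U :: "complex set" and f :: "complex \<Rightarrow> real ^ 'n" and Y :: "complex \<Rightarrow> 'n mvec" +
  fixes N \<kappa> :: "complex \<Rightarrow> 'n mvec" and s :: "complex \<Rightarrow> complex"
  assumes normal: "normal_section U Y N" and hopf: "hopf_schwarzian U Y \<kappa> s"
begin

text \<open>\<open>normal_section\<close> imposes no smoothness on \<open>N\<close>; it is a
  consequence of this formula, which in turn expresses that the defining conditions determine all
  four coefficients.\<close>

lemma N_formula:
  assumes "p \<in> U"
  shows "N p = 2 *s Yzb p + (2 * mink (Yzb p) (Yzb p)) *s Y p"
proof -
  have n: "N p \<in> Vbundle Y p" "real_vector (N p)" "mink (N p) (N p) = 0" "mink (N p) (Yz p) = 0" "mink (Y p) (N p) = -1"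
    using normal assms by (auto simp: normal_section_def)
  obtain a b c d where N: "N p = a *s Y p + b *s Yz p + c *s Yb p + d *s Yzb p"
    using n(1) unfolding Vbundle_def in_span4 by blast
  have "mink (N p) (Yb p) = cnj (mink (N p) (Yz p))"
    using n(2) unfolding real_vector_iff_vcnj Yb_eq[OF assms] by (metis mink_vcnj)
  then have nb: "mink (N p) (Yb p) = 0" using n by simp
  note m = mink_1[OF assms] mink_2[OF assms] Y_metric[OF assms] Y_null[OF assms]
  have com: "mink (Y p) (Yzb p) = -1/2" "mink (Yz p) (Yzb p) = 0" "mink (Yb p) (Yzb p) = 0"
    using m by (simp_all add: mink_commute)
  have d: "d = 2" using n(5) unfolding N by (simp add: m com)
  have c: "c = 0" using n(4) unfolding N by (simp add: m com)
  have b: "b = 0" using nb unfolding N by (simp add: m com)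
  have "a = 2 * mink (Yzb p) (Yzb p)" using n(3) unfolding N b c d by (simp add: m com)
  then show ?thesis using N by (simp add: b c d)
qed

lemma smooth_N [smooth_intros]: "smooth_on U N"
  by (rule smooth_on_cong[OF open_U _ N_formula[symmetric]]) (intro smooth_intros open_U)

lemma N_real: "p \<in> U \<Longrightarrow> vcnj (N p) = N p"
  using normal by (simp add: normal_section_def real_vector_iff_vcnj)

lemma mink_N:
  assumes "p \<in> U"
  shows "mink (N p) (N p) = 0" "mink (N p) (Y p) = -1" "mink (Y p) (N p) = -1" "mink (N p) (Yz p) = 0"
    "mink (N p) (Yb p) = 0" "mink (Yz p) (N p) = 0" "mink (Yb p) (N p) = 0"
proof -
  have n: "real_vector (N p)" "mink (N p) (N p) = 0" "mink (N p) (Yz p) = 0" "mink (Y p) (N p) = -1"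
    using normal assms by (auto simp: normal_section_def)
  have "mink (N p) (Yb p) = cnj (mink (N p) (Yz p))"
    using n(1) unfolding real_vector_iff_vcnj Yb_eq[OF assms] by (metis mink_vcnj)
  then show "mink (N p) (N p) = 0" "mink (N p) (Y p) = -1" "mink (Y p) (N p) = -1" "mink (N p) (Yz p) = 0"
    "mink (N p) (Yb p) = 0" "mink (Yz p) (N p) = 0" "mink (Yb p) (N p) = 0"
    using n by (simp_all add: mink_commute)
qed

lemma mperp_iff:
  assumes "p \<in> U"
  shows "w \<in> mperp (Vbundle Y p) \<longleftrightarrow>
    mink w (Y p) = 0 \<and> mink w (Yz p) = 0 \<and> mink w (Yb p) = 0 \<and> mink w (N p) = 0"
  unfolding Vbundle_def mperp_span4 N_formula[OF assms] by (auto simp: mink_commute)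

lemma Vbundle_combI:
  assumes "p \<in> U" "x = a *s Y p + b *s Yz p + c *s Yb p + d *s N p"
  shows "x \<in> Vbundle Y p"
proof -
  have "x = (a + d * (2 * mink (Yzb p) (Yzb p))) *s Y p + b *s Yz p + c *s Yb p + (2 * d) *s Yzb p"
    unfolding assms(2) N_formula[OF assms(1)] by (simp add: vec_eq_iff algebra_simps)
  then show ?thesis unfolding Vbundle_def using span4_combI by metis
qed

text \<open>In the frame \<open>Y\<close>, \<open>Yz\<close>, \<open>Yb\<close>, \<open>N\<close>
  the only nonzero products are -1 between \<open>Y\<close> and \<open>N\<close> and 1/2 between
  \<open>Yz\<close> and \<open>Yb\<close>. These are the origin of the signs and of the factors
  2.\<close>

definition normal_part :: "complex \<Rightarrow> 'n mvec \<Rightarrow> 'n mvec" where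
  "normal_part p x = x - (2 * mink x (Yb p)) *s Yz p - (2 * mink x (Yz p)) *s Yb p
     + mink x (N p) *s Y p + mink x (Y p) *s N p"

lemmas mink_all = mink_1 Y_metric Y_null mink_N

lemma normal_part_mperp: "p \<in> U \<Longrightarrow> normal_part p x \<in> mperp (Vbundle Y p)"
  by (simp add: mperp_iff normal_part_def mink_all)

lemma normal_part_diff: "p \<in> U \<Longrightarrow> x - normal_part p x \<in> Vbundle Y p"
  by (rule Vbundle_combI[where a = "- mink x (N p)" and b = "2 * mink x (Yb p)" and c = "2 * mink x (Yz p)"
        and d = "- mink x (Y p)"]) (simp_all add: normal_part_def vec_eq_iff algebra_simps)

lemma normal_part_perp: "p \<in> U \<Longrightarrow> w \<in> mperp (Vbundle Y p) \<Longrightarrow> normal_part p w = w"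
  by (simp add: mperp_iff normal_part_def)

text \<open>Nondegeneracy of V. It makes the orthogonal projection unique, so that the description
  operator in \<open>perp_proj\<close> picks out \<open>normal_part\<close>.\<close>

lemma Vbundle_perp_0:
  assumes "p \<in> U" "v \<in> Vbundle Y p" "v \<in> mperp (Vbundle Y p)"
  shows "v = 0"
proof -
  have m: "mink v (Y p) = 0" "mink v (Yz p) = 0" "mink v (Yb p) = 0" "mink v (Yzb p) = 0"
    using assms(3) unfolding Vbundle_def mperp_span4 by (auto simp: mink_commute)
  obtain a b c d where v: "v = a *s Y p + b *s Yz p + c *s Yb p + d *s Yzb p"
    using assms(2) unfolding Vbundle_def in_span4 by blast
  note e = mink_all[OF assms(1)] mink_2[OF assms(1)]
  have com: "mink (Y p) (Yzb p) = -1/2" "mink (Yz p) (Yzb p) = 0" "mink (Yb p) (Yzb p) = 0"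
    using e by (simp_all add: mink_commute)
  have d: "d = 0" using m(1) unfolding v by (simp add: e com)
  have "c = 0" using m(2) unfolding v by (simp add: e com)
  moreover have "b = 0" using m(3) unfolding v by (simp add: e com)
  moreover have "a = 0" using m(4) d unfolding v by (simp add: e com)
  ultimately show ?thesis using d v by simp
qed

lemma perp_proj_eq: "p \<in> U \<Longrightarrow> perp_proj (Vbundle Y p) x = normal_part p x"
proof (rule perp_proj_eqI)
  show "vec.subspace (Vbundle Y p)" by (simp add: Vbundle_def vec.subspace_span)
qed (auto intro: normal_part_mperp normal_part_diff Vbundle_perp_0)

lemma Dzbar_eq: "p \<in> U \<Longrightarrow> Dzbar Y \<psi> p = normal_part p (vdzbar \<psi> p)"
  by (simp add: Dzbar_def perp_proj_eq)

lemma normal_part_add: "normal_part p (x + y) = normal_part p x + normal_part p y"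
  and normal_part_scale: "normal_part p (c *s x) = c *s normal_part p x"
  by (simp_all add: normal_part_def vec_eq_iff algebra_simps)

lemma normal_part_double: "normal_part p (2 * x) = 2 * normal_part p x"
  by (simp only: mult_2 normal_part_add)

lemma normal_part_minus: "normal_part p (x - y) = normal_part p x - normal_part p y"
  by (simp add: normal_part_def vec_eq_iff algebra_simps)

lemma normal_part_frame:
  assumes "p \<in> U"
  shows "normal_part p (Y p) = 0" "normal_part p (Yz p) = 0" "normal_part p (Yb p) = 0" "normal_part p (N p) = 0"
  by (simp_all add: normal_part_def mink_all[OF assms])

lemma normal_part_vcnj: "p \<in> U \<Longrightarrow> normal_part p (vcnj x) = vcnj (normal_part p x)"
  by (simp add: normal_part_def Yb_eq mink_vcnj_left N_real Y_real) 

lemma Dzbar_mperp: "p \<in> U \<Longrightarrow> Dzbar Y \<psi> p \<in> mperp (Vbundle Y p)"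
  by (simp add: Dzbar_eq normal_part_mperp)

lemma smooth_Dzbar:
  assumes "open W" "W \<subseteq> U" "smooth_on W \<psi>"
  shows "smooth_on W (Dzbar Y \<psi>)"
proof -
  note s = smooth_on_subset[OF _ assms(2)]
  show ?thesis
    by (rule smooth_on_cong[OF assms(1) _ Dzbar_eq[symmetric]])
       (use assms in \<open>auto simp: normal_part_def
         intro!: smooth_intros s[OF smooth_Y] s[OF smooth_on_vdz(1)[OF open_U smooth_Y]]
         s[OF smooth_on_vdz(2)[OF open_U smooth_Y]] s[OF smooth_N]\<close>)
qed

lemma \<kappa>_perp: "p \<in> U \<Longrightarrow> \<kappa> p \<in> mperp (Vbundle Y p)"
  and \<kappa>_eq: "p \<in> U \<Longrightarrow> \<kappa> p = Yzz p + (s p / 2) *s Y p"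
  using hopf by (auto simp: hopf_schwarzian_def)

text \<open>The smoothness of \<open>s\<close>, and with it that of \<open>\<kappa>\<close>, is not
  contained in \<open>hopf_schwarzian\<close> and is obtained from this expression.\<close>

lemma s_formula: "p \<in> U \<Longrightarrow> s p = 2 * mink (Yzz p) (N p)"
proof -
  assume p: "p \<in> U"
  have "mink (\<kappa> p) (N p) = 0" using \<kappa>_perp[OF p] mperp_iff[OF p] by simp
  then have "mink (Yzz p) (N p) - s p / 2 = 0" using mink_N(3)[OF p] by (simp add: \<kappa>_eq[OF p])
  then show ?thesis by (simp add: field_simps)
qed

lemma smooth_s [smooth_intros]: "smooth_on U s"
  by (rule smooth_on_cong[OF open_U _ s_formula[symmetric]]) (intro smooth_intros open_U)

lemma smooth_\<kappa> [smooth_intros]: "smooth_on U \<kappa>"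
  by (rule smooth_on_cong[OF open_U _ \<kappa>_eq[symmetric]]) (intro smooth_intros open_U; simp)+

lemma mink_\<kappa>:
  assumes "p \<in> U"
  shows "mink (\<kappa> p) (Y p) = 0" "mink (\<kappa> p) (Yz p) = 0" "mink (\<kappa> p) (Yb p) = 0" "mink (\<kappa> p) (N p) = 0"
  using \<kappa>_perp[OF assms] by (simp_all add: mperp_iff assms)

lemma vcnj_perp: "p \<in> U \<Longrightarrow> w \<in> mperp (Vbundle Y p) \<Longrightarrow> vcnj w \<in> mperp (Vbundle Y p)"
  using normal_part_mperp[of p "vcnj w"] by (simp add: normal_part_vcnj normal_part_perp)

lemma perp_dest:
  assumes "p \<in> U" "w \<in> mperp (Vbundle Y p)"
  shows "mink w (Y p) = 0" "mink w (Yz p) = 0" "mink w (Yb p) = 0" "mink w (N p) = 0"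
    "mink (Y p) w = 0" "mink (Yz p) w = 0" "mink (Yb p) w = 0" "mink (N p) w = 0"
  using assms by (simp_all add: mperp_iff mink_commute)

section \<open>The structure equations\<close>

definition nn :: "complex \<Rightarrow> complex" where "nn p = mink (\<kappa> p) (vcnj (\<kappa> p))"

lemma nn_real: "cnj (nn p) = nn p"
  by (simp add: nn_def mink_vcnj[symmetric] mink_commute)

lemma smooth_nn [smooth_intros]: "smooth_on U nn"
  unfolding nn_def[abs_def] by (intro smooth_intros open_U)

lemma Yzz_eq: "p \<in> U \<Longrightarrow> Yzz p = \<kappa> p - (s p / 2) *s Y p"
  by (simp add: \<kappa>_eq)

lemma Ybb_eq: "p \<in> U \<Longrightarrow> Ybb p = vcnj (\<kappa> p) - (cnj (s p) / 2) *s Y p"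
proof -
  assume p: "p \<in> U"
  have "vdzbar (vdzbar Y) p = vcnj (Yzz p)"
    using vdzbar_real(1)[OF open_U smooth_on_vdz(1)[OF open_U smooth_Y] p Yb_eq[symmetric]] .
  then show ?thesis by (simp add: Yzz_eq[OF p] Y_real[OF p])
qed

text \<open>The Gauss equation: the mixed third derivatives \<open>vdzbar Yzz\<close> and
  \<open>vdz Yzb\<close> agree, and each of them is paired with \<open>Yb\<close>.\<close>

lemma mink_Yzb_Yzb: "p \<in> U \<Longrightarrow> mink (Yzb p) (Yzb p) = nn p"
proof -
  assume p: "p \<in> U"
  note s2 = smooth_on_vdz[OF open_U smooth_on_vdz(1)[OF open_U smooth_Y]]
     and s1 = smooth_on_vdz[OF open_U smooth_Y]
  have "mink (vdzbar (Yzz) p) (Yb p) = - mink (Yzz p) (Ybb p)"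
    using mink_const_derivative(2)[OF open_U s2(1) s1(2) p mink_2(7)] .
  moreover have "mink (vdz Yzb p) (Yb p) = - mink (Yzb p) (Yzb p)"
    using mink_const_derivative(1)[OF open_U s2(2) s1(2) p mink_2(6)] by (simp add: Yzb_commute[OF p])
  moreover have "vdzbar Yzz p = vdz Yzb p" using vdz_vdzbar_commute[OF open_U p s1(1)] .
  ultimately have "mink (Yzb p) (Yzb p) = mink (Yzz p) (Ybb p)" by simp
  also have "\<dots> = nn p" using perp_dest[OF p vcnj_perp[OF p \<kappa>_perp[OF p]]] mink_\<kappa>[OF p] Y_null[OF p]
    by (simp add: Yzz_eq[OF p] Ybb_eq[OF p] nn_def)
  finally show ?thesis .
qed

lemma Yzb_eq: "p \<in> U \<Longrightarrow> Yzb p = (1/2) *s N p - nn p *s Y p"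
  by (simp add: N_formula mink_Yzb_Yzb vec_eq_iff algebra_simps)

text \<open>The tangential coefficients come from constant products. The normal part of
  \<open>vdz N\<close> is twice that of \<open>vdz Yzb\<close>; the latter equals
  \<open>vdzbar Yzz\<close>, which differs from \<open>vdzbar \<kappa>\<close> by vectors of
  V.\<close>

lemma Nz_eq:
  assumes p: "p \<in> U"
  shows "vdz N p = 2 *s Dzbar Y \<kappa> p - (2 * nn p) *s Yz p - s p *s Yb p"
proof -
  note c = mink_const_derivative(1)[OF open_U smooth_N _ p]
    and s1 = smooth_on_vdz[OF open_U smooth_Y]
  have 1: "mink (vdz N p) (Y p) = 0" using c[OF smooth_Y mink_N(2)] mink_N[OF p] by simp
  have 2: "mink (vdz N p) (N p) = 0" using c[OF smooth_N mink_N(1)] by (simp add: mink_commute)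
  have 3: "mink (vdz N p) (Yz p) = - s p / 2"
    using c[OF s1(1) mink_N(4)] s_formula[OF p] by (simp add: mink_commute)
  have 4: "mink (vdz N p) (Yb p) = - nn p"
    using c[OF s1(2) mink_N(5)] by (simp add: Yzb_commute[OF p] Yzb_eq[OF p] mink_N[OF p])
  have "normal_part p (vdz N p) = 2 *s Dzbar Y \<kappa> p"
  proof -
    have d: "Yzb differentiable at p" "nn differentiable at p" "Y differentiable at p" "Yzz differentiable at p"
       "(\<lambda>q. s q / 2) differentiable at p"
      using p by (auto intro!: smooth_on_differentiable[of U] smooth_intros open_U)
    have "vdz N p = vdz (\<lambda>q. 2 *s Yzb q + (2 * nn q) *s Y q) p"
      by (rule vdz_cong[OF open_U p]) (simp add: N_formula mink_Yzb_Yzb)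
    also have "\<dots> = 2 *s vdz Yzb p + (2 * dz nn p) *s Y p + (2 * nn p) *s Yz p"
      using d by (simp add: vdz_rules vdz_rules1 vdz_scale differentiable_vscale dz_rules1 differentiable_vscale[of "\<lambda>q. 2"])
    finally have *: "normal_part p (vdz N p) = 2 *s normal_part p (vdz Yzb p)"
      by (simp add: normal_part_add normal_part_scale normal_part_frame[OF p])
    have "vdzbar \<kappa> p = vdzbar (\<lambda>q. Yzz q + (s q / 2) *s Y q) p"
      by (rule vdz_cong[OF open_U p]) (simp add: \<kappa>_eq)
    also have "\<dots> = vdzbar Yzz p + dzbar (\<lambda>q. s q / 2) p *s Y p + (s p / 2) *s Yb p"
      using d by (simp add: vdz_rules vdz_scale differentiable_vscale)
    finally have "Dzbar Y \<kappa> p = normal_part p (vdzbar Yzz p)"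
      by (simp add: Dzbar_eq[OF p] normal_part_add normal_part_scale normal_part_frame[OF p])
    then show ?thesis using * vdz_vdzbar_commute[OF open_U p s1(1)] by simp
  qed
  then show ?thesis unfolding normal_part_def 1 2 3 4 by (simp add: vec_eq_iff algebra_simps)
qed

lemma Nb_eq:
  assumes p: "p \<in> U"
  shows "vdzbar N p = 2 *s vcnj (Dzbar Y \<kappa> p) - (2 * nn p) *s Yb p - cnj (s p) *s Yz p"
  using vdzbar_real(1)[OF open_U smooth_N p N_real] Nz_eq[OF p] by (simp add: Yb_eq[OF p] nn_real)

section \<open>Sections of the normal bundle and their dzbar derivatives\<close>

definition normal_field :: "complex set \<Rightarrow> (complex \<Rightarrow> 'n mvec) \<Rightarrow> bool" where
  "normal_field W \<psi> \<longleftrightarrow> open W \<and> W \<subseteq> U \<and> smooth_on W \<psi> \<and> (\<forall>p\<in>W. \<psi> p \<in> mperp (Vbundle Y p))"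

lemma normal_field_Dzbar: "normal_field W \<psi> \<Longrightarrow> normal_field W (Dzbar Y \<psi>)"
  by (auto simp: normal_field_def intro: smooth_Dzbar Dzbar_mperp)

lemma normal_field_\<kappa>: "open W \<Longrightarrow> W \<subseteq> U \<Longrightarrow> normal_field W \<kappa>"
  by (auto simp: normal_field_def intro: \<kappa>_perp smooth_on_subset[OF smooth_\<kappa>])

lemma mperp_add: "x \<in> mperp V \<Longrightarrow> y \<in> mperp V \<Longrightarrow> x + y \<in> mperp V"
  and mperp_scale: "x \<in> mperp V \<Longrightarrow> c *s x \<in> mperp V"
  by (simp_all add: mperp_def)

lemma normal_field_add: "normal_field W \<psi> \<Longrightarrow> normal_field W \<phi> \<Longrightarrow> normal_field W (\<lambda>p. \<psi> p + \<phi> p)"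
  by (auto simp: normal_field_def intro!: smooth_intros mperp_add)

lemma normal_field_scale: "smooth_on W c \<Longrightarrow> normal_field W \<psi> \<Longrightarrow> normal_field W (\<lambda>p. c p *s \<psi> p)"
  by (auto simp: normal_field_def intro!: smooth_intros mperp_scale)

text \<open>The Weingarten equation. The correction to \<open>Dzbar\<close> is of order zero in
  \<psi>; this is what allows D-holomorphic sections to be treated as solutions of a linear dbar
  system in the ambient space.\<close>

lemma vdzbar_normal_field:
  assumes "normal_field W \<psi>" "p \<in> W"
  shows "vdzbar \<psi> p = Dzbar Y \<psi> p - (2 * mink (\<psi> p) (vcnj (\<kappa> p))) *s Yz p
     + (2 * mink (\<psi> p) (vcnj (Dzbar Y \<kappa> p))) *s Y p"
proof -
  have W: "open W" "W \<subseteq> U" "smooth_on W \<psi>" and pp: "\<And>q. q \<in> W \<Longrightarrow> \<psi> q \<in> mperp (Vbundle Y q)"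
    using assms by (auto simp: normal_field_def)
  have p: "p \<in> U" using W assms by auto
  note sw = smooth_on_subset[OF _ W(2)]
  note c = mink_const_derivative(2)[OF W(1) W(3) sw assms(2), where c = 0]
    and s1 = smooth_on_vdz[OF open_U smooth_Y] and pd = perp_dest[OF subsetD[OF W(2)] pp]
  have 1: "mink (vdzbar \<psi> p) (Y p) = 0" using c[OF smooth_Y] pd assms(2) by simp
  have 2: "mink (vdzbar \<psi> p) (Yz p) = 0"
    using c[OF s1(1)] pd assms(2) by (simp add: Yzb_eq[OF p])
  have 3: "mink (vdzbar \<psi> p) (Yb p) = - mink (\<psi> p) (vcnj (\<kappa> p))"
    using c[OF s1(2)] pd assms(2) by (simp add: Ybb_eq[OF p])
  have 4: "mink (vdzbar \<psi> p) (N p) = - 2 * mink (\<psi> p) (vcnj (Dzbar Y \<kappa> p))"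
    using c[OF smooth_N] pd assms(2) by (simp add: Nb_eq[OF p])
  show ?thesis unfolding Dzbar_eq[OF p, of \<psi>] normal_part_def[of p "vdzbar \<psi> p"] 1 2 3 4
    by (simp add: vec_eq_iff algebra_simps)
qed

lemma Dzbar_add:
  assumes "normal_field W \<psi>" "normal_field W \<phi>" "p \<in> W"
  shows "Dzbar Y (\<lambda>q. \<psi> q + \<phi> q) p = Dzbar Y \<psi> p + Dzbar Y \<phi> p"
proof -
  have "p \<in> U" "\<psi> differentiable at p" "\<phi> differentiable at p"
    using assms smooth_on_differentiable by (auto simp: normal_field_def)
  then show ?thesis by (simp add: Dzbar_eq vdz_rules normal_part_add)
qed

lemma Dzbar_scale:
  assumes "normal_field W \<psi>" "smooth_on W c" "p \<in> W"
  shows "Dzbar Y (\<lambda>q. c q *s \<psi> q) p = dzbar c p *s \<psi> p + c p *s Dzbar Y \<psi> p"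
proof -
  have "p \<in> U" "\<psi> differentiable at p" "c differentiable at p"
    using assms smooth_on_differentiable by (auto simp: normal_field_def)
  then show ?thesis using assms
    by (simp add: Dzbar_eq vdz_scale normal_part_add normal_part_scale normal_part_perp normal_field_def)
qed

lemma Dzbar_cong:
  assumes "open W" "W \<subseteq> U" "p \<in> W" "\<And>q. q \<in> W \<Longrightarrow> \<psi> q = \<phi> q"
  shows "Dzbar Y \<psi> p = Dzbar Y \<phi> p"
  using vdz_cong(2)[OF assms(1,3), of \<psi> \<phi>] assms(4) by (simp add: Dzbar_def)

text \<open>Compatibility of D with the metric: the tangential corrections in
  \<open>vdzbar_normal_field\<close> are orthogonal to normal vectors.\<close>

lemma dzbar_mink_normal:
  assumes "normal_field W \<psi>" "normal_field W \<phi>" "p \<in> W"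
  shows "dzbar (\<lambda>q. mink (\<psi> q) (\<phi> q)) p = mink (Dzbar Y \<psi> p) (\<phi> p) + mink (\<psi> p) (Dzbar Y \<phi> p)"
proof -
  have p: "p \<in> U" "\<psi> differentiable at p" "\<phi> differentiable at p"
    "\<psi> p \<in> mperp (Vbundle Y p)" "\<phi> p \<in> mperp (Vbundle Y p)"
    using assms smooth_on_differentiable by (auto simp: normal_field_def)
  show ?thesis
    unfolding dz_mink[OF p(2,3)] vdzbar_normal_field[OF assms(1,3)] vdzbar_normal_field[OF assms(2,3)]
    using perp_dest[OF p(1,4)] perp_dest[OF p(1,5)] by simp
qed

section \<open>The Euler-Lagrange expression and integration by parts\<close>

definition EL :: "complex \<Rightarrow> 'n mvec" where
  "EL p = Dzbar Y (Dzbar Y \<kappa>) p + (cnj (s p) / 2) *s \<kappa> p"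

lemma smooth_D\<kappa>: "smooth_on U (Dzbar Y \<kappa>)" "smooth_on U (Dzbar Y (Dzbar Y \<kappa>))"
  using smooth_Dzbar[OF open_U] smooth_\<kappa> by auto

lemma smooth_EL: "smooth_on U EL"
  unfolding EL_def[abs_def] by (intro smooth_intros open_U smooth_D\<kappa>) simp

lemma EL_perp: "p \<in> U \<Longrightarrow> EL p \<in> mperp (Vbundle Y p)"
  unfolding EL_def by (intro mperp_add mperp_scale Dzbar_mperp \<kappa>_perp)

definition mm :: "complex \<Rightarrow> complex" where "mm p = mink (\<kappa> p) (vcnj (Dzbar Y \<kappa> p))"

lemma smooth_mm: "smooth_on U mm"
  unfolding mm_def[abs_def] by (intro smooth_intros open_U smooth_D\<kappa>)

lemma \<kappa>b_eq: "p \<in> U \<Longrightarrow> vdzbar \<kappa> p = Dzbar Y \<kappa> p - (2 * nn p) *s Yz p + (2 * mm p) *s Y p"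
  using vdzbar_normal_field[OF normal_field_\<kappa>[OF open_U order_refl]] by (simp add: nn_def mm_def)

text \<open>The derivative of \<open>nn q *s Yz q\<close> is deliberately left unexpanded. It lies
  in V, so it disappears from normal parts, and in \<open>variation_identity\<close> it is absorbed
  into the divergence.\<close>

lemma \<kappa>bb_eq:
  assumes p: "p \<in> U"
  shows "vdzbar (vdzbar \<kappa>) p + 2 *s vdzbar (\<lambda>q. nn q *s Yz q) p
    = Dzbar Y (Dzbar Y \<kappa>) p - (2 * cnj (mm p)) *s Yz p + (2 * mm p) *s Yb p
      + (2 * mink (Dzbar Y \<kappa> p) (vcnj (Dzbar Y \<kappa> p)) + 2 * dzbar mm p) *s Y p"
proof -
  note sm = smooth_D\<kappa>(1) smooth_nn smooth_mm smooth_Y smooth_on_vdz(1)[OF open_U smooth_Y]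
  note d = sm[THEN smooth_on_differentiable, OF p]
  have "vdzbar (vdzbar \<kappa>) p = vdzbar (\<lambda>q. Dzbar Y \<kappa> q - (2 * nn q) *s Yz q + (2 * mm q) *s Y q) p"
    by (rule vdz_cong[OF open_U p]) (simp add: \<kappa>b_eq)
  also have "\<dots> = vdzbar (\<lambda>q. Dzbar Y \<kappa> q - 2 *s (nn q *s Yz q) + 2 *s (mm q *s Y q)) p"
    by simp
  also have "\<dots> = vdzbar (Dzbar Y \<kappa>) p - 2 *s vdzbar (\<lambda>q. nn q *s Yz q) p
      + 2 *s (dzbar mm p *s Y p + mm p *s Yb p)"
    using d by (simp add: vdz_rules vdz_rules1 vdz_scale differentiable_vscale differentiable_vscale[of "\<lambda>q. 2"]
        dz_rules1 vec_eq_iff algebra_simps)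
  also have "vdzbar (Dzbar Y \<kappa>) p = Dzbar Y (Dzbar Y \<kappa>) p - (2 * mink (Dzbar Y \<kappa> p) (vcnj (\<kappa> p))) *s Yz p
     + (2 * mink (Dzbar Y \<kappa> p) (vcnj (Dzbar Y \<kappa> p))) *s Y p"
    by (rule vdzbar_normal_field[OF normal_field_Dzbar[OF normal_field_\<kappa>[OF open_U order_refl]] p])
  also have "mink (Dzbar Y \<kappa> p) (vcnj (\<kappa> p)) = cnj (mm p)"
    by (simp add: mm_def mink_vcnj[symmetric] mink_commute)
  finally show ?thesis by (simp add: vec_eq_iff algebra_simps)
qed

text \<open>\<open>EL\<close> is the normal part of the fourth derivative of \<open>Y\<close>, twice
  in z and twice in zbar, plus two lower-order terms that are conjugate to each other. Since
  derivatives commute and \<open>Y\<close> is real, the fourth derivative is real too.\<close>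

lemma EL_real:
  assumes p: "p \<in> U"
  shows "vcnj (EL p) = EL p"
proof -
  have sm: "smooth_on U (\<lambda>q. s q / 2)" "smooth_on U (dzbar (\<lambda>q. s q / 2))"
     "smooth_on U Yzz" "smooth_on U (vdzbar Yzz)" "smooth_on U Y" "smooth_on U Yb" "smooth_on U Yz" "smooth_on U nn"
    by (intro smooth_intros open_U; simp)+
  note d = sm[THEN smooth_on_differentiable]
  have 1: "vdzbar \<kappa> q = vdzbar Yzz q + dzbar (\<lambda>q. s q / 2) q *s Y q + (s q / 2) *s Yb q" if "q \<in> U" for q
  proof -
    have "vdzbar \<kappa> q = vdzbar (\<lambda>q. Yzz q + (s q / 2) *s Y q) q"
      by (rule vdz_cong[OF open_U that]) (simp add: \<kappa>_eq)
    then show ?thesis using d[OF that] by (simp add: vdz_rules vdz_scale differentiable_vscale)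
  qed
  have "vdzbar (vdzbar \<kappa>) p
      = vdzbar (\<lambda>q. vdzbar Yzz q + dzbar (\<lambda>q. s q / 2) q *s Y q + (s q / 2) *s Yb q) p"
    by (rule vdz_cong[OF open_U p]) (simp add: 1)
  also have "\<dots> = vdzbar (vdzbar Yzz) p + (dzbar (dzbar (\<lambda>q. s q / 2)) p *s Y p + dzbar (\<lambda>q. s q / 2) p *s Yb p)
      + (dzbar (\<lambda>q. s q / 2) p *s Yb p + (s p / 2) *s Ybb p)"
    using d[OF p] by (simp add: vdz_rules vdz_scale differentiable_vscale)
  finally have "normal_part p (vdzbar (vdzbar \<kappa>) p) = normal_part p (vdzbar (vdzbar Yzz) p) + (s p / 2) *s vcnj (\<kappa> p)"
    by (simp add: normal_part_add normal_part_scale normal_part_minus normal_part_double normal_part_frame[OF p] Ybb_eq[OF p]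
        normal_part_perp[OF p vcnj_perp[OF p \<kappa>_perp[OF p]]])
  moreover have "normal_part p (vdzbar (vdzbar \<kappa>) p) = Dzbar Y (Dzbar Y \<kappa>) p"
  proof -
    have "vdzbar (\<lambda>q. nn q *s Yz q) p = dzbar nn p *s Yz p + nn p *s ((1/2) *s N p - nn p *s Y p)"
      using d[OF p] by (simp add: vdz_scale Yzb_eq[OF p])
    then have "normal_part p (vdzbar (\<lambda>q. nn q *s Yz q) p) = 0"
      by (simp add: normal_part_add normal_part_scale normal_part_minus normal_part_double normal_part_frame[OF p])
    then have "normal_part p (vdzbar (vdzbar \<kappa>) p) =
       normal_part p (vdzbar (vdzbar \<kappa>) p + 2 *s vdzbar (\<lambda>q. nn q *s Yz q) p)"
      by (simp add: normal_part_add normal_part_scale)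
    also have "\<dots> = Dzbar Y (Dzbar Y \<kappa>) p"
      unfolding \<kappa>bb_eq[OF p]
      by (simp add: normal_part_add normal_part_scale normal_part_minus normal_part_double normal_part_frame[OF p]
          normal_part_perp[OF p Dzbar_mperp[OF p]])
    finally show ?thesis .
  qed
  ultimately have E: "EL p = normal_part p (vdzbar (vdzbar Yzz) p) + (s p / 2) *s vcnj (\<kappa> p) + (cnj (s p) / 2) *s \<kappa> p"
    by (simp add: EL_def)
  have c: "vdzbar (vdz F) q = vdz (vdzbar F) q" if "smooth_on U F" "q \<in> U" for F :: "complex \<Rightarrow> 'n mvec" and q
    using vdz_vdzbar_commute[OF open_U that(2,1)] .
  have sYb: "smooth_on U (vdz Yb)" by (intro smooth_intros open_U)
  have sYzb: "smooth_on U Yzb" by (intro smooth_intros open_U)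
  have e1: "vdzbar Yzz q = vdz (vdz Yb) q" if "q \<in> U" for q
    using c[OF sm(7) that] vdz_cong(1)[OF open_U that c[OF smooth_Y]] by simp
  have "vdzbar (vdzbar Yzz) p = vdzbar (vdz (vdz Yb)) p"
    by (rule vdz_cong[OF open_U p e1])
  also have "\<dots> = vdz (vdzbar (vdz Yb)) p" by (rule c[OF sYb p])
  also have "\<dots> = vdz (vdz (vdzbar Yb)) p" by (rule vdz_cong[OF open_U p c[OF sm(6)]])
  finally have X: "vdzbar (vdzbar Yzz) p = vdz (vdz Ybb) p" .
  have y1: "vdzbar Yzz q = vcnj (vdz Ybb q)" if "q \<in> U" for q
  proof -
    have "vcnj (Ybb r) = Yzz r" if "r \<in> U" for r
      by (simp add: Ybb_eq[OF that] Yzz_eq[OF that] Y_real[OF that])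
    from vdzbar_real(1)[OF open_U _ that this] show ?thesis using smooth_on_vdz(2)[OF open_U sm(6)] by simp
  qed
  have "vdzbar (vdzbar Yzz) p = vcnj (vdz (vdz Ybb) p)"
    by (rule vdzbar_real(1)[OF open_U _ p y1[symmetric]]) (intro smooth_intros open_U)
  then have "vcnj (vdzbar (vdzbar Yzz) p) = vdzbar (vdzbar Yzz) p" unfolding X by simp
  then have "vcnj (normal_part p (vdzbar (vdzbar Yzz) p)) = normal_part p (vdzbar (vdzbar Yzz) p)"
    using normal_part_vcnj[OF p] by metis
  then show ?thesis unfolding E by (simp add: add_ac)
qed

text \<open>Two integrations by parts in pointwise form, the \<open>dzbar\<close> term being the
  divergence. Orthogonality of \<open>v\<close> and \<open>Y\<close> removes the \<open>Y\<close>
  component of \<open>\<kappa>bb_eq\<close>; reality of \<open>v\<close> makes the two terms with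
  \<open>mm\<close> cancel in the real part.\<close>

lemma variation_identity:
  assumes p: "p \<in> U" and v: "smooth_on U v" "\<And>q. q \<in> U \<Longrightarrow> vcnj (v q) = v q" "\<And>q. q \<in> U \<Longrightarrow> mink (v q) (Y q) = 0"
  shows "Re (2 * mink (vdzbar (vdzbar v) p + (cnj (s p) / 2) *s v p) (\<kappa> p) - 4 * nn p * mink (vdzbar v p) (Yz p))
   = Re (dzbar (\<lambda>q. 2 * mink (vdzbar v q) (\<kappa> q) - 2 * mink (v q) (vdzbar \<kappa> q) - 4 * mink (v q) (nn q *s Yz q)) p)
     + 2 * Re (mink (v p) (EL p))"
proof -
  have sm: "smooth_on U v" "smooth_on U (vdzbar v)" "smooth_on U \<kappa>" "smooth_on U (vdzbar \<kappa>)" "smooth_on U (\<lambda>q. nn q *s Yz q)"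
    "smooth_on U (\<lambda>q. mink (vdzbar v q) (\<kappa> q))" "smooth_on U (\<lambda>q. mink (v q) (vdzbar \<kappa> q))"
    "smooth_on U (\<lambda>q. mink (v q) (nn q *s Yz q))"
    "smooth_on U (\<lambda>q. 2 * mink (vdzbar v q) (\<kappa> q))" "smooth_on U (\<lambda>q. 2 * mink (v q) (vdzbar \<kappa> q))"
    "smooth_on U (\<lambda>q. 4 * mink (v q) (nn q *s Yz q))"
    "smooth_on U (\<lambda>q. 2 * mink (vdzbar v q) (\<kappa> q) - 2 * mink (v q) (vdzbar \<kappa> q))"
    by (intro smooth_intros open_U v(1))+
  note d = sm[THEN smooth_on_differentiable, OF p]
  have D: "dzbar (\<lambda>q. 2 * mink (vdzbar v q) (\<kappa> q) - 2 * mink (v q) (vdzbar \<kappa> q) - 4 * mink (v q) (nn q *s Yz q)) p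
    = 2 * mink (vdzbar (vdzbar v) p) (\<kappa> p) - 4 * nn p * mink (vdzbar v p) (Yz p)
      - 2 * mink (v p) (vdzbar (vdzbar \<kappa>) p + 2 *s vdzbar (\<lambda>q. nn q *s Yz q) p)"
    unfolding dz_rules(4)[OF d(12,11)] dz_rules(4)[OF d(9,10)] dz_rules1(6)[OF d(6)] dz_rules1(6)[OF d(7)]
       dz_rules1(6)[OF d(8)] dz_mink(2)[OF d(2,3)] dz_mink(2)[OF d(1,4)] dz_mink(2)[OF d(1,5)]
    by (simp add: algebra_simps)
  have "mink (v p) (Yb p) = cnj (mink (v p) (Yz p))"
    using v(2)[OF p] unfolding Yb_eq[OF p] by (metis mink_vcnj)
  then have "Re (- 2 * cnj (mm p) * mink (v p) (Yz p) + 2 * mm p * mink (v p) (Yb p)) = 0"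
    by (simp add: algebra_simps)
  moreover have "mink (v p) (vdzbar (vdzbar \<kappa>) p + 2 *s vdzbar (\<lambda>q. nn q *s Yz q) p)
     = mink (v p) (Dzbar Y (Dzbar Y \<kappa>) p) + (- 2 * cnj (mm p) * mink (v p) (Yz p) + 2 * mm p * mink (v p) (Yb p))"
    unfolding \<kappa>bb_eq[OF p] using v(3)[OF p] by simp
  ultimately have "Re (mink (v p) (vdzbar (vdzbar \<kappa>) p + 2 *s vdzbar (\<lambda>q. nn q *s Yz q) p))
     = Re (mink (v p) (Dzbar Y (Dzbar Y \<kappa>) p))" by simp
  then have e: "Re (mink (v p) (vdzbar (vdzbar \<kappa>) p + 2 *s vdzbar (\<lambda>q. nn q *s Yz q) p) + cnj (s p) / 2 * mink (v p) (\<kappa> p))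
     = Re (mink (v p) (EL p))"
    by (simp only: EL_def mink_simps plus_complex.sel)
  have "2 * mink (vdzbar (vdzbar v) p + (cnj (s p) / 2) *s v p) (\<kappa> p) - 4 * nn p * mink (vdzbar v p) (Yz p)
    = (2 * mink (vdzbar (vdzbar v) p) (\<kappa> p) - 4 * nn p * mink (vdzbar v p) (Yz p)
      - 2 * mink (v p) (vdzbar (vdzbar \<kappa>) p + 2 *s vdzbar (\<lambda>q. nn q *s Yz q) p))
     + 2 * (mink (v p) (vdzbar (vdzbar \<kappa>) p + 2 *s vdzbar (\<lambda>q. nn q *s Yz q) p) + cnj (s p) / 2 * mink (v p) (\<kappa> p))"
    by (simp add: algebra_simps)
  moreover have "Re (x + 2 * y) = Re x + 2 * Re y" for x y by simp
  ultimately show ?thesis unfolding D e[symmetric] by (simp only:)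
qed

end

section \<open>Linear dbar systems\<close>

subsection \<open>Integrals depending on a parameter\<close>

lemma integral_smooth_parameter:
  fixes F :: "'a::euclidean_space \<times> 'b::euclidean_space \<Rightarrow> 'c::euclidean_space"
  assumes A: "open A" and F: "smooth_on (A \<times> UNIV) F" and z: "z \<in> A"
  shows "((\<lambda>z. integral (cbox a b) (\<lambda>x. F (z, x))) has_derivative
     (\<lambda>v. integral (cbox a b) (\<lambda>x. ddir (v, 0) F (z, x)))) (at z)"
proof -
  obtain e where e: "e > 0" "ball z e \<subseteq> A" using A z open_contains_ball by blast
  have o: "open (A \<times> (UNIV :: 'b set))" using A open_Times by blast
  have bl: "bounded_linear (\<lambda>v. ddir (v, 0) F y)" if "y \<in> A \<times> UNIV" for y
  proof -
    have "bounded_linear (\<lambda>v. ddir v F y)"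
      using smooth_on_has_derivative[OF F that] has_derivative_bounded_linear by blast
    from bounded_linear_compose[OF this bounded_linear_Pair[OF bounded_linear_ident bounded_linear_zero]]
    show ?thesis by simp
  qed
  \<comment> \<open>The Leibniz rule takes the derivative as a continuous map into bounded linear
    operators. Its continuity is checked on basis vectors, where it is that of the directional
    derivatives of \<open>F\<close>.\<close>
  define G where "G z x = Blinfun (\<lambda>v. ddir (v, 0) F (z, x))" for z x
  have G: "blinfun_apply (G z x) = (\<lambda>v. ddir (v, 0) F (z, x))" if "z \<in> A" for z x
    unfolding G_def using bl that by (simp add: bounded_linear_Blinfun_apply)
  have contG: "continuous_on (A \<times> UNIV) (\<lambda>(z, x). G z x)"
  proof (rule continuous_on_blinfun_componentwise)
    fix i :: 'a
    have "continuous_on (A \<times> UNIV) (ddir (i, 0) F)"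
      by (rule smooth_on_continuous_on[OF smooth_on_ddir[OF F]])
    then show "continuous_on (A \<times> UNIV) (\<lambda>y. blinfun_apply (case y of (z, x) \<Rightarrow> G z x) i)"
      by (rule continuous_on_eq) (auto simp: G)
  qed
  have contF: "continuous_on (A \<times> UNIV) F" by (rule smooth_on_continuous_on[OF F])
  have cont1: "continuous_on (cbox a b) (\<lambda>x. F (y, x))" if "y \<in> A" for y
    by (rule continuous_on_compose2[OF contF]) (use that in \<open>auto intro!: continuous_intros\<close>)
  have D: "((\<lambda>y. integral (cbox a b) (\<lambda>x. F (y, x))) has_derivative
     blinfun_apply (integral (cbox a b) (G z))) (at z within ball z e)"
  proof (rule leibniz_rule)
    fix y and x :: 'b assume y: "y \<in> ball z e"
    then have yA: "y \<in> A" using e by auto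
    have i: "((\<lambda>y. (y, x)) has_derivative (\<lambda>v. (v, 0))) (at y)"
      by (auto intro!: derivative_eq_intros)
    have "((\<lambda>y. F (y, x)) has_derivative (\<lambda>v. ddir (v, 0) F (y, x))) (at y)"
      using has_derivative_compose[OF i smooth_on_has_derivative[OF F]] yA by auto
    then show "((\<lambda>y. F (y, x)) has_derivative blinfun_apply (G y x)) (at y within ball z e)"
      unfolding G[OF yA] by (rule has_derivative_at_withinI)
  next
    show "(\<lambda>x. F (y, x)) integrable_on cbox a b" if "y \<in> ball z e" for y
      using cont1 that e by (intro integrable_continuous) auto
    show "continuous_on (ball z e \<times> cbox a b) (\<lambda>(z, x). G z x)"
      using contG by (rule continuous_on_subset) (use e in auto)
  qed (use e in auto)
  have GI: "G z integrable_on cbox a b"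
    by (intro integrable_continuous continuous_on_compose2[OF contG, of _ "\<lambda>x. (z, x)", simplified])
       (use z in \<open>auto intro!: continuous_intros\<close>)
  have "blinfun_apply (integral (cbox a b) (G z)) = (\<lambda>v. integral (cbox a b) (\<lambda>x. ddir (v, 0) F (z, x)))"
  proof
    fix v
    show "blinfun_apply (integral (cbox a b) (G z)) v = integral (cbox a b) (\<lambda>x. ddir (v, 0) F (z, x))"
      using integral_linear[OF GI blinfun.bounded_linear_left, of v] by (simp add: o_def G[OF z])
  qed
  then show ?thesis using D at_within_open[of z "ball z e"] e by simp
qed

lemma smooth_integral:
  fixes F :: "'a::euclidean_space \<times> 'b::euclidean_space \<Rightarrow> 'c::euclidean_space"
  assumes A: "open A" and F: "smooth_on (A \<times> UNIV) F"
  shows "smooth_on A (\<lambda>z. integral (cbox a b) (\<lambda>x. F (z, x)))"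
proof -
  have "Ck_on k A (\<lambda>z. integral (cbox a b) (\<lambda>x. F (z, x)))" for k
    using F
  proof (induction k arbitrary: F)
    case 0
    have "continuous (at z) (\<lambda>z. integral (cbox a b) (\<lambda>x. F (z, x)))" if "z \<in> A" for z
      using has_derivative_continuous[OF integral_smooth_parameter[OF A 0 that]] .
    then show ?case by (simp add: continuous_at_imp_continuous_on)
  next
    case (Suc k)
    show ?case
      by (rule Ck_on_SucI[OF A integral_smooth_parameter[OF A Suc.prems]], assumption,
          rule Suc.IH[OF smooth_on_ddir[OF Suc.prems]])
  qed
  then show ?thesis by (simp add: smooth_on_def)
qed

lemma ddir_Pair_left:
  assumes "F differentiable at (z, x)"
  shows "ddir (v, 0) F (z, x) = ddir v (\<lambda>z. F (z, x)) z"
proof -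
  have i: "((\<lambda>y. (y, x)) has_derivative (\<lambda>v. (v, 0))) (at z)"
    by (auto intro!: derivative_eq_intros)
  show ?thesis using ddir_eqI[OF has_derivative_compose[OF i has_derivative_ddir[OF assms]]] by simp
qed

lemma ddir_Pair_right:
  assumes "F differentiable at (z, x)"
  shows "ddir (0, v) F (z, x) = ddir v (\<lambda>x. F (z, x)) x"
proof -
  have i: "((\<lambda>y. (z, y)) has_derivative (\<lambda>v. (0, v))) (at x)"
    by (auto intro!: derivative_eq_intros)
  show ?thesis using ddir_eqI[OF has_derivative_compose[OF i has_derivative_ddir[OF assms]]] by simp
qed

subsection \<open>The Cauchy transform in polar coordinates\<close>

lemma smooth_cis: "smooth_on UNIV cis"
proof -
  have e: "smooth_on UNIV (exp :: complex \<Rightarrow> complex)"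
    by (rule holomorphic_smooth(1)[OF open_UNIV holomorphic_on_exp])
  have i: "smooth_on UNIV (\<lambda>t::real. \<i> * complex_of_real t)" by (intro smooth_intros open_UNIV)
  have "cis = (\<lambda>t. exp (\<i> * complex_of_real t))" by (rule ext) (simp add: cis_conv_exp)
  then show ?thesis using smooth_on_compose[OF open_UNIV open_UNIV e i] by simp
qed

lemma norm_vscale [simp]: "norm (c *s x) = norm c * norm (x :: complex ^ 'm)"
  unfolding norm_vec_def by (simp add: norm_mult L2_set_right_distrib)

lemma scaleR_eq_vscale: "r *\<^sub>R (x :: complex ^ 'm) = complex_of_real r *s x"
  unfolding vec_eq_iff vector_scaleR_component vector_smult_component by (simp add: scaleR_conv_of_real)

lemma scaleR_complex: "r *\<^sub>R (z :: complex) = complex_of_real r * z"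
  by (rule scaleR_conv_of_real)

definition cauchy_kernel :: "(complex \<Rightarrow> complex ^ 'm) \<Rightarrow> complex \<times> real \<times> real \<Rightarrow> complex ^ 'm" where
  "cauchy_kernel g = (\<lambda>(z, r, t). cis (- t) *s g (z - r *\<^sub>R cis t))"

text \<open>This is the convolution with \<open>1 / (pi w)\<close> over the disc of radius \<open>R\<close>: in polar coordinates the
  singularity of the kernel cancels against the Jacobian.\<close>

definition cauchy_transform :: "real \<Rightarrow> (complex \<Rightarrow> complex ^ 'm) \<Rightarrow> complex \<Rightarrow> complex ^ 'm" where
  "cauchy_transform R g z =
     (1 / pi) *\<^sub>R integral (cbox (0, 0) (R, 2 * pi)) (\<lambda>x. cauchy_kernel g (z, x))"

lemma smooth_cauchy_kernel:
  assumes "smooth_on UNIV g"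
  shows "smooth_on (UNIV \<times> UNIV) (cauchy_kernel g)"
proof -
  have c: "smooth_on UNIV (\<lambda>y::complex \<times> real \<times> real. cis (snd (snd y)))"
    "smooth_on UNIV (\<lambda>y::complex \<times> real \<times> real. cis (- snd (snd y)))"
    by (rule smooth_on_compose[OF _ _ smooth_cis]; auto intro!: smooth_intros)+
  have "smooth_on UNIV (\<lambda>y::complex \<times> real \<times> real. g (fst y - fst (snd y) *\<^sub>R cis (snd (snd y))))"
    by (rule smooth_on_compose[OF _ _ assms]) (auto intro!: smooth_intros c)
  then have "smooth_on UNIV (\<lambda>y::complex \<times> real \<times> real.
      cis (- snd (snd y)) *s g (fst y - fst (snd y) *\<^sub>R cis (snd (snd y))))"
    by (intro smooth_intros c) auto
  moreover have "cauchy_kernel g = (\<lambda>y. cis (- snd (snd y)) *s g (fst y - fst (snd y) *\<^sub>R cis (snd (snd y))))"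
    by (auto simp: cauchy_kernel_def fun_eq_iff)
  ultimately show ?thesis by simp
qed

lemma ddir_cauchy_kernel:
  assumes "smooth_on UNIV g"
  shows "ddir (v, 0) (cauchy_kernel g) y = cauchy_kernel (ddir v g) y"
proof -
  obtain z r t where y: "y = (z, r, t)" by (cases y) auto
  have d: "cauchy_kernel g differentiable at y"
    using smooth_on_differentiable[OF smooth_cauchy_kernel[OF assms]] by auto
  have s: "((\<lambda>z. z - r *\<^sub>R cis t) has_derivative (\<lambda>v. v)) (at z)"
    by (auto intro!: derivative_eq_intros)
  have gd: "(g has_derivative (\<lambda>v. ddir v g (z - r *\<^sub>R cis t))) (at (z - r *\<^sub>R cis t))"
    using smooth_on_has_derivative[OF assms] by auto
  have bl: "bounded_linear (\<lambda>x::complex^'a. cis (- t) *s x)"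
    using bounded_bilinear.bounded_linear_right[OF bounded_bilinear_vscale] .
  have "ddir v (\<lambda>z. cis (- t) *s g (z - r *\<^sub>R cis t)) z = cis (- t) *s ddir v g (z - r *\<^sub>R cis t)"
    by (rule ddir_eqI[OF bounded_linear.has_derivative[OF bl has_derivative_compose[OF s gd]]])
  then show ?thesis using ddir_Pair_left[OF d[unfolded y]] unfolding y by (simp add: cauchy_kernel_def)
qed

lemma cauchy_kernel_integrable:
  "smooth_on UNIV g \<Longrightarrow> (\<lambda>x. cauchy_kernel g (z, x)) integrable_on cbox a b"
  by (intro integrable_continuous continuous_on_compose2[OF smooth_on_continuous_on[OF smooth_cauchy_kernel]])
     (auto intro!: continuous_intros)

lemma cauchy_transform_smooth:
  assumes "smooth_on UNIV g"
  shows "smooth_on UNIV (cauchy_transform R g)"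
    and "ddir v (cauchy_transform R g) z = cauchy_transform R (ddir v g) z"
proof -
  note k = smooth_cauchy_kernel[OF assms]
  show "smooth_on UNIV (cauchy_transform R g)"
    unfolding cauchy_transform_def[abs_def] by (intro smooth_intros smooth_integral[OF _ k]) auto
  have "(cauchy_transform R g has_derivative
     (\<lambda>v. (1 / pi) *\<^sub>R integral (cbox (0, 0) (R, 2 * pi)) (\<lambda>x. ddir (v, 0) (cauchy_kernel g) (z, x)))) (at z)"
    unfolding cauchy_transform_def[abs_def]
    by (intro has_derivative_scaleR_right integral_smooth_parameter[OF _ k]) auto
  from ddir_eqI[OF this] show "ddir v (cauchy_transform R g) z = cauchy_transform R (ddir v g) z"
    by (simp add: ddir_cauchy_kernel[OF assms] cauchy_transform_def)
qed

lemma cauchy_transform_add: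
  assumes "smooth_on UNIV g" "smooth_on UNIV h"
  shows "cauchy_transform R (\<lambda>w. g w + h w) z = cauchy_transform R g z + cauchy_transform R h z"
proof -
  have "cauchy_kernel (\<lambda>w. g w + h w) y = cauchy_kernel g y + cauchy_kernel h y" for y
    by (auto simp: cauchy_kernel_def split_beta vec_eq_iff algebra_simps)
  then show ?thesis
    by (simp add: cauchy_transform_def integral_add cauchy_kernel_integrable assms scaleR_right_distrib)
qed

lemma cauchy_transform_scale:
  assumes "smooth_on UNIV g"
  shows "cauchy_transform R (\<lambda>w. c *s g w) z = c *s cauchy_transform R g z"
proof -
  have bl: "bounded_linear (\<lambda>x::complex^'a. c *s x)"
    using bounded_bilinear.bounded_linear_right[OF bounded_bilinear_vscale] .
  have "cauchy_kernel (\<lambda>w. c *s g w) y = c *s cauchy_kernel g y" for y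
    by (auto simp: cauchy_kernel_def split_beta vec_eq_iff algebra_simps)
  then have "integral (cbox (0, 0) (R, 2 * pi)) (\<lambda>x. cauchy_kernel (\<lambda>w. c *s g w) (z, x))
      = c *s integral (cbox (0, 0) (R, 2 * pi)) (\<lambda>x. cauchy_kernel g (z, x))"
    using integral_linear[OF cauchy_kernel_integrable[OF assms] bl] by (simp add: o_def)
  then show ?thesis unfolding cauchy_transform_def by (simp add: vec_eq_iff)
qed

lemma cauchy_transform_bound:
  assumes "smooth_on UNIV g" "\<And>w. norm (g w) \<le> M" "0 \<le> R"
  shows "norm (cauchy_transform R g z) \<le> 2 * R * M"
proof -
  have M: "0 \<le> M" using assms(2)[of 0] norm_ge_zero order_trans by blast
  have "norm (integral (cbox (0, 0) (R, 2 * pi)) (\<lambda>x. cauchy_kernel g (z, x)))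
     \<le> M * measure lborel (cbox (0::real, 0::real) (R, 2 * pi))"
    by (rule has_integral_bound[OF M integrable_integral[OF cauchy_kernel_integrable[OF assms(1)]]])
       (auto simp: cauchy_kernel_def assms(2))
  also have "measure lborel (cbox (0::real, 0::real) (R, 2 * pi)) = R * (2 * pi)"
    using assms(3) by (simp add: content_Pair)
  finally show ?thesis by (simp add: cauchy_transform_def field_simps)
qed

text \<open>The Cauchy-Pompeiu formula in polar coordinates about \<open>z\<close>. The kernel
  applied to \<open>vdzbar g\<close> is a combination of the radial derivative \<open>Hr\<close> and
  the angular derivative \<open>Ht\<close> of g. The angular one integrates to 0 by periodicity; the
  radial one gives the boundary values, which are 0 on the circle by \<open>supp\<close> and g(z) at
  the centre.\<close>

lemma cauchy_transform_dbar:
  assumes g: "smooth_on UNIV g" and R: "0 < R" and supp: "\<And>t. g (z - R *\<^sub>R cis t) = 0"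
  shows "vdzbar (cauchy_transform R g) z = g z"
proof -
  define H where "H = (\<lambda>(r, t). g (z - r *\<^sub>R cis t))"
  define Hr where "Hr = (\<lambda>(r, t). - (cis t *s vdz g (z - r *\<^sub>R cis t) + cis (- t) *s vdzbar g (z - r *\<^sub>R cis t)))"
  define Ht where "Ht = (\<lambda>(r::real, t). - (\<i> * r * cis t) *s vdz g (z - r *\<^sub>R cis t)
       + (\<i> * r * cis (- t)) *s vdzbar g (z - r *\<^sub>R cis t))"
  have gd: "g differentiable at w" for w using smooth_on_differentiable[OF g] by auto
  have dg: "(g has_derivative (\<lambda>v. v *s vdz g w + cnj v *s vdzbar g w)) (at w)" for w
    using has_derivative_ddir[OF gd] by (simp add: ddir_vdz[OF gd])
  have dr: "((\<lambda>r. H (r, t)) has_vector_derivative Hr (r, t)) (at r)" for r t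
  proof -
    have i: "((\<lambda>r. z - r *\<^sub>R cis t) has_derivative (\<lambda>h. - (h *\<^sub>R cis t))) (at r)"
      by (auto intro!: derivative_eq_intros)
    show ?thesis using has_derivative_compose[OF i dg]
      unfolding has_vector_derivative_def H_def Hr_def split
      by (rule has_derivative_eq_rhs) (auto simp: fun_eq_iff vec_eq_iff cis_cnj algebra_simps scaleR_eq_vscale scaleR_complex)
  qed
  have dt: "((\<lambda>t. H (r, t)) has_vector_derivative Ht (r, t)) (at t)" for r t
  proof -
    have "((\<lambda>t. \<i> * complex_of_real t) has_derivative (\<lambda>h. \<i> * complex_of_real h)) (at t)"
      by (intro has_derivative_mult_right has_derivative_of_real has_derivative_ident)
    from has_derivative_compose[OF this DERIV_exp[unfolded has_field_derivative_def]]
    have "(cis has_derivative (\<lambda>h. h *\<^sub>R (\<i> * cis t))) (at t)"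
      unfolding cis_conv_exp[abs_def] by (rule has_derivative_eq_rhs) (auto simp: scaleR_complex)
    then have i: "((\<lambda>t. z - r *\<^sub>R cis t) has_derivative (\<lambda>h. - (r *\<^sub>R h *\<^sub>R (\<i> * cis t)))) (at t)"
      by (auto intro!: derivative_eq_intros)
    show ?thesis using has_derivative_compose[OF i dg]
      unfolding has_vector_derivative_def H_def Ht_def split
      by (rule has_derivative_eq_rhs) (auto simp: fun_eq_iff vec_eq_iff cis_cnj algebra_simps scaleR_eq_vscale scaleR_complex)
  qed
  have sc: "continuous_on UNIV (\<lambda>x::real\<times>real. F (z - fst x *\<^sub>R cis (snd x)))" if "smooth_on UNIV F"
    for F :: "complex \<Rightarrow> complex ^ 'a"
    by (rule continuous_on_compose2[OF smooth_on_continuous_on[OF that]])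
       (auto intro!: continuous_intros simp: cis_conv_exp)
  have cc: "continuous_on UNIV (\<lambda>x::real\<times>real. c x *s F x)" if "continuous_on UNIV c" "continuous_on UNIV F"
    for F :: "real \<times> real \<Rightarrow> complex ^ 'a" and c
    by (rule bounded_bilinear.continuous_on[OF bounded_bilinear_vscale that])
  have contK: "continuous_on S (\<lambda>x. cauchy_kernel (vdzbar g) (z, x))" for S
    unfolding cauchy_kernel_def split_beta fst_conv snd_conv
    by (rule continuous_on_subset[OF cc[OF _ sc]])
       (auto intro!: continuous_intros smooth_intros g simp: cis_conv_exp)
  have contHr: "continuous_on S Hr" for S
  proof -
    have "continuous_on UNIV (\<lambda>x::real\<times>real. cis (snd x))" "continuous_on UNIV (\<lambda>x::real\<times>real. cis (- snd x))"
      by (auto intro!: continuous_intros simp: cis_conv_exp)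
    then have "continuous_on UNIV Hr"
      unfolding Hr_def split_beta
      by (intro continuous_on_minus continuous_on_add cc sc smooth_on_vdz open_UNIV g)
    then show ?thesis by (rule continuous_on_subset) simp
  qed
  have K: "cauchy_kernel (vdzbar g) (z, r, t) = - (1/2) *s Hr (r, t) + (1 / (2 * \<i> * r)) *s Ht (r, t)" if "r \<noteq> 0" for r t
    unfolding cauchy_kernel_def Hr_def Ht_def split using that by (simp add: vec_eq_iff field_simps)
  have I: "integral (cbox 0 (2 * pi)) (\<lambda>t. cauchy_kernel (vdzbar g) (z, r, t))
     = (- (1/2)) *\<^sub>R integral (cbox 0 (2 * pi)) (\<lambda>t. Hr (r, t))" if "r \<noteq> 0" for r
  proof -
    have bl: "bounded_linear (\<lambda>x::complex^'a. c *s x)" for c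
      using bounded_bilinear.bounded_linear_right[OF bounded_bilinear_vscale] .
    have 1: "((\<lambda>t. Ht (r, t)) has_integral 0) (cbox 0 (2 * pi))"
      using fundamental_theorem_of_calculus[of 0 "2 * pi" "\<lambda>t. H (r, t)" "\<lambda>t. Ht (r, t)"]
        dt[THEN has_vector_derivative_at_within] by (simp add: H_def)
    have 2: "((\<lambda>t. Hr (r, t)) has_integral integral (cbox 0 (2 * pi)) (\<lambda>t. Hr (r, t))) (cbox 0 (2 * pi))"
      by (intro integrable_integral integrable_continuous continuous_on_compose2[OF contHr[of UNIV]])
         (auto intro!: continuous_intros)
    have "((\<lambda>t. - (1/2) *s Hr (r, t) + (1 / (2 * \<i> * r)) *s Ht (r, t)) has_integral
        - (1/2) *s integral (cbox 0 (2 * pi)) (\<lambda>t. Hr (r, t)) + (1 / (2 * \<i> * r)) *s 0) (cbox 0 (2 * pi))"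
      using has_integral_add[OF has_integral_linear[OF 2 bl] has_integral_linear[OF 1 bl]] unfolding o_def .
    then show ?thesis unfolding K[OF that] by (simp add: integral_unique scaleR_eq_vscale)
  qed
  have J: "integral (cbox 0 R) (\<lambda>r. Hr (r, t)) = - g z" for t
  proof -
    have "((\<lambda>r. Hr (r, t)) has_integral (H (R, t) - H (0, t))) (cbox 0 R)"
      using fundamental_theorem_of_calculus[of 0 R "\<lambda>r. H (r, t)" "\<lambda>r. Hr (r, t)"] R
        dr[THEN has_vector_derivative_at_within] by simp
    then show ?thesis by (simp add: H_def supp integral_unique)
  qed
  have "integral (cbox (0, 0) (R, 2 * pi)) (\<lambda>x. cauchy_kernel (vdzbar g) (z, x))
     = integral (cbox 0 R) (\<lambda>r. integral (cbox 0 (2 * pi)) (\<lambda>t. cauchy_kernel (vdzbar g) (z, r, t)))"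
    by (rule integral_prod_continuous[OF contK])
  also have "\<dots> = integral (cbox 0 R) (\<lambda>r. (- (1/2)) *\<^sub>R integral (cbox 0 (2 * pi)) (\<lambda>t. Hr (r, t)))"
    \<comment> \<open>The splitting into \<open>Hr\<close> and \<open>Ht\<close> divides by the
      radius, so radius 0 is discarded as a null set.\<close>
    by (rule integral_spike[of "{0}"]) (use I in auto)
  also have "\<dots> = (- (1/2)) *\<^sub>R integral (cbox 0 R) (\<lambda>r. integral (cbox 0 (2 * pi)) (\<lambda>t. Hr (r, t)))"
    by (rule integral_cmul)
  also have "integral (cbox 0 R) (\<lambda>r. integral (cbox 0 (2 * pi)) (\<lambda>t. Hr (r, t)))
     = integral (cbox 0 (2 * pi)) (\<lambda>t. integral (cbox 0 R) (\<lambda>r. Hr (r, t)))"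
    by (rule integral_swap_continuous) (use contHr in simp)
  also have "\<dots> = (2 * pi) *\<^sub>R (- g z)" unfolding J by simp
  finally have "cauchy_transform R (vdzbar g) z = g z" by (simp add: cauchy_transform_def)
  moreover have "vdzbar (cauchy_transform R g) z = cauchy_transform R (vdzbar g) z"
  proof -
    have dT: "cauchy_transform R g differentiable at z"
      using smooth_on_differentiable[OF cauchy_transform_smooth(1)[OF g]] by auto
    have e: "vdzbar g = (\<lambda>w. (1/2) *s (ddir 1 g w + \<i> *s ddir \<i> g w))" using vdzbar_eq[OF gd] by blast
    have s: "smooth_on UNIV (ddir 1 g)" "smooth_on UNIV (\<lambda>w. \<i> *s ddir \<i> g w)"
      "smooth_on UNIV (\<lambda>w. ddir 1 g w + \<i> *s ddir \<i> g w)" "smooth_on UNIV (ddir \<i> g)"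
      by (auto intro!: smooth_intros smooth_on_ddir g)
    show ?thesis unfolding vdzbar_eq[OF dT] e cauchy_transform_scale[OF s(3)] cauchy_transform_add[OF s(1,2)]
        cauchy_transform_scale[OF s(4)] cauchy_transform_smooth(2)[OF g] ..
  qed
  ultimately show ?thesis by simp
qed

subsection \<open>Convergence of the Picard series with all derivatives\<close>

text \<open>Only the directions 1 and \<i> are bounded: derivatives are homogeneous in the
  direction, so one bound for all directions would force them to vanish.\<close>

primrec deriv_bound :: "nat \<Rightarrow> real \<Rightarrow> (complex \<Rightarrow> 'b::real_normed_vector) \<Rightarrow> bool" where
  "deriv_bound 0 M F \<longleftrightarrow> (\<forall>z. norm (F z) \<le> M)"
| "deriv_bound (Suc k) M F \<longleftrightarrow> (\<forall>z. norm (F z) \<le> M) \<and> (\<forall>v\<in>{1, \<i>}. deriv_bound k M (ddir v F))"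

lemma deriv_bound_norm: "deriv_bound k M F \<Longrightarrow> norm (F z) \<le> M"
  by (cases k) auto

lemma deriv_bound_nonneg: "deriv_bound k M F \<Longrightarrow> 0 \<le> M"
  using deriv_bound_norm[of k M F 0] norm_ge_zero[of "F 0"] by linarith

lemma deriv_bound_mono: "deriv_bound k M F \<Longrightarrow> M \<le> M' \<Longrightarrow> deriv_bound k M' F"
proof (induction k arbitrary: F)
  case 0 then show ?case by (auto intro: order_trans)
next
  case (Suc k) then show ?case by (auto intro: order_trans)
qed

lemma deriv_bound_SucD: "deriv_bound (Suc k) M F \<Longrightarrow> deriv_bound k M F"
proof (induction k arbitrary: F)
  case (Suc k)
  show ?case unfolding deriv_bound.simps(2)[of k]
    using Suc.prems[unfolded deriv_bound.simps(2)[of "Suc k"]] Suc.IH by blast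
qed auto

lemma deriv_bound_add:
  assumes "smooth_on UNIV F" "smooth_on UNIV G" "deriv_bound k M F" "deriv_bound k M' G"
  shows "deriv_bound k (M + M') (\<lambda>z. F z + G z)"
  using assms
proof (induction k arbitrary: F G)
  case 0 then show ?case by (auto intro: norm_triangle_mono)
next
  case (Suc k)
  have e: "ddir v (\<lambda>z. F z + G z) = (\<lambda>z. ddir v F z + ddir v G z)" for v
    using Suc.prems(1,2) by (auto intro!: ddir_rules(1) smooth_on_differentiable)
  show ?case using Suc.prems Suc.IH[OF smooth_on_ddir smooth_on_ddir]
    by (auto simp: e intro: norm_triangle_mono)
qed

lemma bounded_bilinear_matvec: "bounded_bilinear (\<lambda>(A :: complex ^ 'n ^ 'm) (x :: complex ^ 'n). A *v x)"
  by (intro bilinear_conv_bounded_bilinear[THEN iffD1])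
     (auto simp: bilinear_def vec_eq_iff matrix_vector_mult_def algebra_simps sum.distrib scaleR_sum_right intro!: linearI)

lemmas smooth_on_matvec [smooth_intros] = smooth_on_bilinear[OF bounded_bilinear_matvec]

lemma ddir_matvec:
  fixes B :: "complex \<Rightarrow> complex ^ 'n ^ 'm"
  assumes "smooth_on UNIV B" "smooth_on UNIV F"
  shows "ddir v (\<lambda>z. B z *v F z) = (\<lambda>z. B z *v ddir v F z + ddir v B z *v F z)"
proof (rule ext)
  fix z
  have "((\<lambda>z. B z *v F z) has_derivative (\<lambda>v. B z *v ddir v F z + ddir v B z *v F z)) (at z)"
    using bounded_bilinear.FDERIV[OF bounded_bilinear_matvec
        smooth_on_has_derivative[OF assms(1) UNIV_I] smooth_on_has_derivative[OF assms(2) UNIV_I]] .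
  from ddir_eqI[OF this] show "ddir v (\<lambda>z. B z *v F z) z = B z *v ddir v F z + ddir v B z *v F z" .
qed

text \<open>The constant depends neither on \<open>F\<close> nor on its bound, so the geometric
  decay of a sequence of functions survives multiplication by \<open>B\<close>.\<close>

lemma deriv_bound_matvec:
  fixes B :: "complex \<Rightarrow> complex ^ 'n ^ 'm"
  assumes "smooth_on UNIV B" "\<And>k. \<exists>M. deriv_bound k M B"
  shows "\<exists>K\<ge>0. \<forall>M F. smooth_on UNIV F \<longrightarrow> deriv_bound k M F \<longrightarrow> deriv_bound k (K * M) (\<lambda>z. B z *v F z)"
  using assms
proof (induction k arbitrary: B)
  case 0
  obtain L where L: "\<And>z. norm (B z) \<le> L" using 0(2)[of 0] by auto
  obtain K where K: "K > 0" "\<And>(A :: complex^'n^'m) x. norm (A *v x) \<le> norm A * norm x * K"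
    using bounded_bilinear.pos_bounded[OF bounded_bilinear_matvec] by blast
  have L0: "0 \<le> L" using L[of 0] norm_ge_zero order_trans by blast
  show ?case
  proof (intro exI[of _ "L * K"] conjI allI impI)
    show "0 \<le> L * K" using L0 K by simp
    fix M and F :: "complex \<Rightarrow> complex^'n" assume F: "deriv_bound 0 M F"
    have "norm (B z *v F z) \<le> L * K * M" for z
    proof -
      have "norm (B z *v F z) \<le> norm (B z) * norm (F z) * K" by (rule K)
      also have "\<dots> \<le> L * M * K" using L F L0 K by (intro mult_right_mono mult_mono) auto
      finally show ?thesis by (simp add: mult_ac)
    qed
    then show "deriv_bound 0 (L * K * M) (\<lambda>z. B z *v F z)" by simp
  qed
next
  case (Suc k)
  have bk: "\<exists>M. deriv_bound k M (ddir v B)" if "v \<in> {1, \<i>}" for v k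
    using Suc.prems(2)[of "Suc k"] that by auto
  obtain K0 where K0: "K0 \<ge> 0" "\<And>M F. smooth_on UNIV F \<Longrightarrow> deriv_bound k M F \<Longrightarrow> deriv_bound k (K0 * M) (\<lambda>z. B z *v F z)"
    using Suc.IH[OF Suc.prems] by metis
  have "\<exists>K\<ge>0. \<forall>M F. smooth_on UNIV F \<longrightarrow> deriv_bound k M F \<longrightarrow> deriv_bound k (K * M) (\<lambda>z. ddir v B z *v F z)"
    if "v \<in> {1, \<i>}" for v
    by (rule Suc.IH[OF smooth_on_ddir[OF Suc.prems(1)] bk[OF that]])
  then obtain Kv where Kv: "\<And>v. v \<in> {1, \<i>} \<Longrightarrow> Kv v \<ge> 0" "\<And>v M F. v \<in> {1, \<i>} \<Longrightarrow> smooth_on UNIV F \<Longrightarrow> deriv_bound k M F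
      \<Longrightarrow> deriv_bound k (Kv v * M) (\<lambda>z. ddir v B z *v F z)"
    by metis
  define K where "K = K0 + Kv 1 + Kv \<i>"
  show ?case
  proof (intro exI[of _ K] conjI allI impI)
    show "0 \<le> K" using K0 Kv(1) by (auto simp: K_def)
    fix M and F :: "complex \<Rightarrow> complex^'n" assume F: "smooth_on UNIV F" "deriv_bound (Suc k) M F"
    have M: "0 \<le> M" using F(2) by (rule deriv_bound_nonneg)
    have k1: "K0 * M \<le> K * M" using K0 Kv(1)[of 1] Kv(1)[of "\<i>"] M by (intro mult_right_mono) (auto simp: K_def)
    have k2: "K0 * M + Kv v * M \<le> K * M" if "v \<in> {1, \<i>}" for v
    proof -
      have "K0 + Kv v \<le> K" using that Kv(1)[of 1] Kv(1)[of "\<i>"] by (auto simp: K_def)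
      from mult_right_mono[OF this M] show ?thesis by (simp add: algebra_simps)
    qed
    have n: "norm (B z *v F z) \<le> K * M" for z
      using deriv_bound_norm[OF K0(2)[OF F(1) deriv_bound_SucD[OF F(2)]]] k1 order_trans by blast
    have "deriv_bound k (K * M) (ddir v (\<lambda>z. B z *v F z))" if v: "v \<in> {1, \<i>}" for v
      unfolding ddir_matvec[OF Suc.prems(1) F(1)]
    proof (rule deriv_bound_mono[OF deriv_bound_add k2[OF v]])
      have dv: "deriv_bound k M (ddir v F)" using F(2) v by auto
      show "deriv_bound k (K0 * M) (\<lambda>z. B z *v ddir v F z)" by (rule K0(2)[OF smooth_on_ddir[OF F(1)] dv])
      show "deriv_bound k (Kv v * M) (\<lambda>z. ddir v B z *v F z)"
        by (rule Kv(2)[OF v F(1) deriv_bound_SucD[OF F(2)]])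
    qed (intro smooth_intros Suc.prems F smooth_on_ddir; simp)+
    then show "deriv_bound (Suc k) (K * M) (\<lambda>z. B z *v F z)" using n by auto
  qed
qed

lemma deriv_bound_compact_support:
  fixes B :: "complex \<Rightarrow> 'b::euclidean_space"
  assumes "smooth_on UNIV B" "compact C" "\<And>z. z \<notin> C \<Longrightarrow> B z = 0"
  shows "\<exists>M. deriv_bound k M B"
  using assms(1,3)
proof (induction k arbitrary: B)
  case 0
  have "compact (B ` C)"
    by (rule compact_continuous_image[OF continuous_on_subset[OF smooth_on_continuous_on[OF 0(1)]] assms(2)]) auto
  then obtain M where M: "\<And>z. z \<in> C \<Longrightarrow> norm (B z) \<le> M" using compact_imp_bounded bounded_iff by (metis imageI)
  have "norm (B z) \<le> max M 0" for z using M[of z] 0(2)[of z] by (cases "z \<in> C") (auto simp: le_max_iff_disj)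
  then show ?case by auto
next
  case (Suc k)
  have z: "ddir v B z = 0" if "z \<notin> C" for v z
  proof -
    have "ddir v B z = ddir v (\<lambda>z. 0) z"
      by (rule ddir_cong[of "-C"]) (use that Suc.prems assms(2) compact_imp_closed in auto)
    also have "\<dots> = 0" by (rule ddir_eqI[where D = "\<lambda>v. 0"]) auto
    finally show ?thesis .
  qed
  obtain M0 where M0: "deriv_bound k M0 B" using Suc.IH[OF Suc.prems] by auto
  obtain M1 where M1: "deriv_bound k M1 (ddir 1 B)" using Suc.IH[OF smooth_on_ddir[OF Suc.prems(1)] z] by auto
  obtain M2 where M2: "deriv_bound k M2 (ddir \<i> B)" using Suc.IH[OF smooth_on_ddir[OF Suc.prems(1)] z] by auto
  define M where "M = max M0 (max M1 M2)"
  have "deriv_bound k M (ddir v B)" if "v \<in> {1, \<i>}" for v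
    using that deriv_bound_mono[OF M1, of M] deriv_bound_mono[OF M2, of M] by (auto simp: M_def)
  moreover have "norm (B z) \<le> M" for z using deriv_bound_norm[OF deriv_bound_mono[OF M0, of M]] by (auto simp: M_def)
  ultimately show ?case by auto
qed

text \<open>The inhomogeneity \<open>e\<close> is needed to run the induction over the order of differentiation: a derivative
  of a solution satisfies the same recursion up to terms containing lower derivatives.\<close>

lemma picard_derivative_bounds:
  fixes B :: "complex \<Rightarrow> complex ^ 'm ^ 'm"
  assumes B: "smooth_on UNIV B" "\<And>k. \<exists>M. deriv_bound k M B"
    and small: "\<And>z x. norm (B z *v x) \<le> \<beta> * norm x" "2 * R * \<beta> \<le> 1/2" "0 \<le> R" "0 \<le> \<beta>"
    and d: "\<And>j. smooth_on UNIV (d j)" "\<And>j. smooth_on UNIV (e j)"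
      "\<And>j z. d (Suc j) z = cauchy_transform R (\<lambda>w. B w *v d j w + e j w) z"
    and bd: "\<exists>M. deriv_bound k M (d 0)" "\<exists>E. \<forall>j. deriv_bound k (E * (3/4) ^ j) (e j)"
  shows "\<exists>C. \<forall>j. deriv_bound k (C * (3/4) ^ j) (d j)"
  using d bd
proof (induction k arbitrary: d e)
  case 0
  obtain M where M: "\<And>z. norm (d 0 z) \<le> M" using 0(4) by auto
  obtain E where E: "\<And>j z. norm (e j z) \<le> E * (3/4) ^ j" using 0(5) by auto
  \<comment> \<open>The contraction contributes the factor 1/2, and the inhomogeneity at most 1/4
    because of \<open>8 * R * E \<le> C\<close>. Their sum is the ratio 3/4.\<close>
  define C where "C = max M (8 * R * E)"
  have C: "M \<le> C" "8 * R * E \<le> C" by (auto simp: C_def)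
  have "norm (d j z) \<le> C * (3/4) ^ j" for j z
  proof (induction j arbitrary: z)
    case 0 then show ?case using M[of z] C by simp
  next
    case (Suc j)
    have nn: "0 \<le> C * (3/4) ^ j" using Suc norm_ge_zero order_trans by blast
    have "norm (B w *v d j w + e j w) \<le> \<beta> * (C * (3/4) ^ j) + E * (3/4) ^ j" for w
      by (rule norm_triangle_mono[OF order_trans[OF small(1) mult_left_mono[OF Suc small(4)]] E])
    then have "norm (d (Suc j) z) \<le> 2 * R * (\<beta> * (C * (3/4) ^ j) + E * (3/4) ^ j)"
      unfolding 0(3) by (intro cauchy_transform_bound small smooth_intros B 0(1,2)) auto
    also have "\<dots> = (2 * R * \<beta>) * (C * (3/4) ^ j) + (8 * R * E) * (3/4) ^ j / 4" by (simp add: algebra_simps)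
    also have "\<dots> \<le> 1/2 * (C * (3/4) ^ j) + C * (3/4) ^ j / 4"
      by (intro add_mono mult_right_mono divide_right_mono small nn C) auto
    also have "\<dots> = C * (3/4) ^ Suc j" by simp
    finally show ?case .
  qed
  then show ?case by auto
next
  case (Suc k)
  have "\<exists>C. \<forall>j. deriv_bound k (C * (3/4) ^ j) (d j)"
  proof (rule Suc.IH[where e = e and d = d])
    show "\<exists>M. deriv_bound k M (d 0)" using Suc.prems(4) deriv_bound_SucD by blast
    show "\<exists>E. \<forall>j. deriv_bound k (E * (3/4) ^ j) (e j)" using Suc.prems(5) deriv_bound_SucD by blast
  qed (rule Suc.prems)+
  then obtain C0 where C0: "\<And>j. deriv_bound k (C0 * (3/4) ^ j) (d j)" by auto
  obtain E where E: "\<And>j. deriv_bound (Suc k) (E * (3/4) ^ j) (e j)" using Suc.prems(5) by auto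
  have "\<exists>C. \<forall>j. deriv_bound k (C * (3/4) ^ j) (ddir v (d j))" if v: "v \<in> {1, \<i>}" for v
  proof (rule Suc.IH[where e = "\<lambda>j z. ddir v B z *v d j z + ddir v (e j) z"])
    show "smooth_on UNIV (ddir v (d j))" for j by (rule smooth_on_ddir[OF Suc.prems(1)])
    show "smooth_on UNIV (\<lambda>z. ddir v B z *v d j z + ddir v (e j) z)" for j
      by (intro smooth_intros smooth_on_ddir B Suc.prems) auto
    show "ddir v (d (Suc j)) z = cauchy_transform R (\<lambda>w. B w *v ddir v (d j) w + (ddir v B w *v d j w + ddir v (e j) w)) z" for j z
    proof -
      have s: "smooth_on UNIV (\<lambda>w. B w *v d j w)" "smooth_on UNIV (e j)" "smooth_on UNIV (\<lambda>w. B w *v d j w + e j w)"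
        by (intro smooth_intros B Suc.prems; simp)+
      have "d (Suc j) = cauchy_transform R (\<lambda>w. B w *v d j w + e j w)" using Suc.prems(3) by blast
      then have "ddir v (d (Suc j)) z = cauchy_transform R (ddir v (\<lambda>w. B w *v d j w + e j w)) z"
        using cauchy_transform_smooth(2)[OF s(3)] by simp
      also have "ddir v (\<lambda>w. B w *v d j w + e j w) = (\<lambda>w. ddir v (\<lambda>w. B w *v d j w) w + ddir v (e j) w)"
        using s by (auto intro!: ddir_rules(1) smooth_on_differentiable)
      finally show ?thesis unfolding ddir_matvec[OF B(1) Suc.prems(1)] by (simp add: add.assoc)
    qed
    show "\<exists>M. deriv_bound k M (ddir v (d 0))" using Suc.prems(4) v by auto
    have "\<And>k. \<exists>M. deriv_bound k M (ddir v B)" using B(2)[of "Suc _"] v by auto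
    from deriv_bound_matvec[OF smooth_on_ddir[OF B(1)] this]
    obtain K where K: "\<And>M F. smooth_on UNIV F \<Longrightarrow> deriv_bound k M F \<Longrightarrow> deriv_bound k (K * M) (\<lambda>z. ddir v B z *v F z)"
      by metis
    have "deriv_bound k ((K * C0 + E) * (3/4) ^ j) (\<lambda>z. ddir v B z *v d j z + ddir v (e j) z)" for j
    proof -
      have "deriv_bound k (K * (C0 * (3/4) ^ j)) (\<lambda>z. ddir v B z *v d j z)"
        by (rule K[OF Suc.prems(1) C0])
      moreover have "deriv_bound k (E * (3/4) ^ j) (ddir v (e j))" using E v by auto
      ultimately have "deriv_bound k (K * (C0 * (3/4) ^ j) + E * (3/4) ^ j) (\<lambda>z. ddir v B z *v d j z + ddir v (e j) z)"
        by (intro deriv_bound_add smooth_intros smooth_on_ddir B Suc.prems) auto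
      then show ?thesis by (simp add: algebra_simps)
    qed
    then show "\<exists>E. \<forall>j. deriv_bound k (E * (3/4) ^ j) (\<lambda>z. ddir v B z *v d j z + ddir v (e j) z)" by blast
  qed
  from this[of 1] this[of "\<i>"] obtain C1 C2 where C12: "\<And>j. deriv_bound k (C1 * (3/4) ^ j) (ddir 1 (d j))"
    "\<And>j. deriv_bound k (C2 * (3/4) ^ j) (ddir \<i> (d j))" by auto
  define C where "C = max C0 (max C1 C2)"
  have le: "C0 * (3/4) ^ j \<le> C * (3/4) ^ j" "C1 * (3/4) ^ j \<le> C * (3/4) ^ j" "C2 * (3/4) ^ j \<le> C * (3/4) ^ j" for j
    by (auto simp: C_def intro!: mult_right_mono)
  have n: "norm (d j z) \<le> C * (3/4) ^ j" for j z
    by (rule order_trans[OF deriv_bound_norm[OF C0] le(1)])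
  have "deriv_bound (Suc k) (C * (3/4) ^ j) (d j)" for j
    using n deriv_bound_mono[OF C12(1) le(2)] deriv_bound_mono[OF C12(2) le(3)] by simp
  then show ?case by blast
qed

lemma geometric_tail:
  fixes a :: "nat \<Rightarrow> 'b::banach"
  assumes "\<And>i. norm (a i) \<le> C * (3/4) ^ i"
  shows "summable a" "norm (suminf a - (\<Sum>i<n. a i)) \<le> 4 * C * (3/4) ^ n"
proof -
  have g: "summable (\<lambda>i. C * (3/4::real) ^ i)" by (intro summable_mult summable_geometric) auto
  show s: "summable a" by (rule summable_comparison_test'[OF g, of 0]) (use assms in auto)
  have "suminf a - (\<Sum>i<n. a i) = (\<Sum>i. a (i + n))" using suminf_minus_initial_segment[OF s, of n] by simp
  also have "norm \<dots> \<le> (\<Sum>i. C * (3/4::real) ^ (i + n))"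
    by (rule norm_suminf_le) (use assms summable_ignore_initial_segment[OF g, of n] in auto)
  also have "(\<Sum>i. C * (3/4::real) ^ (i + n)) = (\<Sum>i. (C * (3/4) ^ n) * (3/4::real) ^ i)"
    by (simp add: power_add mult_ac)
  also have "\<dots> = (C * (3/4) ^ n) * (\<Sum>i. (3/4::real) ^ i)"
    by (rule suminf_mult) (auto intro: summable_geometric)
  also have "(\<Sum>i. (3/4::real) ^ i) = 4" by (simp add: suminf_geometric)
  finally show "norm (suminf a - (\<Sum>i<n. a i)) \<le> 4 * C * (3/4) ^ n" by simp
qed

text \<open>The derivative of the sum is written out through 1 and \<i>, the directions that
  \<open>deriv_bound\<close> controls; the tails of the two series of derivatives are uniformly
  small.\<close>

lemma has_derivative_suminf:
  fixes d :: "nat \<Rightarrow> complex \<Rightarrow> 'b::banach"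
  assumes d: "\<And>j. smooth_on UNIV (d j)" and C: "\<And>j. deriv_bound (Suc 0) (C * (3/4) ^ j) (d j)"
  shows "((\<lambda>z. \<Sum>j. d j z) has_derivative
     (\<lambda>v. Re v *\<^sub>R (\<Sum>j. ddir 1 (d j) z) + Im v *\<^sub>R (\<Sum>j. ddir \<i> (d j) z))) (at z)"
proof -
  have b: "norm (d j z) \<le> C * (3/4) ^ j" "norm (ddir 1 (d j) z) \<le> C * (3/4) ^ j" "norm (ddir \<i> (d j) z) \<le> C * (3/4) ^ j" for j z
    using C[of j] by auto
  define D where "D z v = Re v *\<^sub>R (\<Sum>j. ddir 1 (d j) z) + Im v *\<^sub>R (\<Sum>j. ddir \<i> (d j) z)" for z v
  have dd: "ddir v (d j) z = Re v *\<^sub>R ddir 1 (d j) z + Im v *\<^sub>R ddir \<i> (d j) z" for v j z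
    by (rule ddir_complex, rule smooth_on_differentiable[OF d]) simp
  have C0: "0 \<le> C" using order_trans[OF norm_ge_zero b(1)[of 0 0]] by simp
  \<comment> \<open>The factor 8 collects the tail bound with factor 4 from each of the two
    directions.\<close>
  have lim: "(\<lambda>n. 8 * C * (3/4::real) ^ n) \<longlonglongrightarrow> 0"
    using tendsto_mult_right_zero[OF LIMSEQ_realpow_zero[of "3/4"], of "8 * C"] by simp
  have "\<exists>g. \<forall>z\<in>UNIV. (\<lambda>n. d n z) sums g z \<and> (g has_derivative D z) (at z within UNIV)"
  proof (rule has_derivative_series[where f' = "\<lambda>j z v. ddir v (d j) z" and x = 0 and l = "suminf (\<lambda>n. d n 0)"])
    show "(d n has_derivative (\<lambda>v. ddir v (d n) x)) (at x within UNIV)" for n x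
      using smooth_on_has_derivative[OF d] by simp
    show "(\<lambda>n. d n 0) sums (\<Sum>n. d n 0)" using geometric_tail(1)[OF b(1)] by (rule summable_sums)
    fix e :: real assume e: "e > 0"
    have "\<forall>\<^sub>F n in sequentially. 8 * C * (3/4::real) ^ n < e"
      by (rule order_tendstoD(2)[OF lim e])
    then show "\<forall>\<^sub>F n in sequentially. \<forall>x\<in>UNIV. \<forall>h. norm ((\<Sum>i<n. ddir h (d i) x) - D x h) \<le> e * norm h"
    proof (rule eventually_mono, intro ballI allI)
      fix n x h assume n: "8 * C * (3/4::real) ^ n < e"
      have "(\<Sum>i<n. ddir h (d i) x) - D x h =
         - (Re h *\<^sub>R ((\<Sum>j. ddir 1 (d j) x) - (\<Sum>i<n. ddir 1 (d i) x)) +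
            Im h *\<^sub>R ((\<Sum>j. ddir \<i> (d j) x) - (\<Sum>i<n. ddir \<i> (d i) x)))"
        by (subst dd) (simp add: D_def sum.distrib scaleR_sum_right[symmetric] algebra_simps)
      also have "norm \<dots> \<le> \<bar>Re h\<bar> * (4 * C * (3/4) ^ n) + \<bar>Im h\<bar> * (4 * C * (3/4) ^ n)"
        unfolding norm_minus_cancel
        by (rule norm_triangle_mono; unfold norm_scaleR)
           (intro mult_left_mono geometric_tail(2)[OF b(2)] geometric_tail(2)[OF b(3)] abs_ge_zero)+
      also have "\<dots> \<le> norm h * (4 * C * (3/4) ^ n) + norm h * (4 * C * (3/4) ^ n)"
        using C0 abs_Re_le_cmod[of h] abs_Im_le_cmod[of h] by (intro add_mono mult_right_mono) auto
      also have "\<dots> = 8 * C * (3/4) ^ n * norm h" by simp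
      also have "\<dots> \<le> e * norm h" using n by (intro mult_right_mono) auto
      finally show "norm ((\<Sum>i<n. ddir h (d i) x) - D x h) \<le> e * norm h" .
    qed
  qed auto
  then obtain g where g0: "\<forall>z\<in>UNIV. (\<lambda>n. d n z) sums g z \<and> (g has_derivative D z) (at z within UNIV)" by blast
  have g: "(\<lambda>n. d n z) sums g z" "(g has_derivative D z) (at z)" for z using bspec[OF g0, of z] by simp_all
  have "(\<lambda>z. \<Sum>j. d j z) = g" using sums_unique[OF g(1)] by (intro ext) simp
  then show ?thesis using g(2)[of z] by (simp add: D_def[abs_def])
qed

lemma smooth_suminf:
  fixes d :: "nat \<Rightarrow> complex \<Rightarrow> 'b::banach"
  assumes d: "\<And>j. smooth_on UNIV (d j)" and C: "\<And>k. \<exists>C. \<forall>j. deriv_bound k (C * (3/4) ^ j) (d j)"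
  shows "smooth_on UNIV (\<lambda>z. \<Sum>j. d j z)"
proof -
  have "Ck_on k UNIV (\<lambda>z. \<Sum>j. d j z)" for k
    using assms
  proof (induction k arbitrary: d)
    case 0
    obtain C where "\<And>j. deriv_bound (Suc 0) (C * (3/4) ^ j) (d j)" using 0(2) by blast
    from has_derivative_continuous[OF has_derivative_suminf[OF 0(1) this]]
    show ?case by (simp add: continuous_at_imp_continuous_on)
  next
    case (Suc k)
    obtain C where C: "\<And>j. deriv_bound (Suc 0) (C * (3/4) ^ j) (d j)" using Suc.prems(2) by blast
    have b: "\<exists>C. \<forall>j. deriv_bound k (C * (3/4) ^ j) (ddir v (d j))" if "v \<in> {1, \<i>}" for k v
      using Suc.prems(2)[of "Suc k"] that by auto
    have I: "Ck_on k UNIV (\<lambda>z. \<Sum>j. ddir v (d j) z)" if "v \<in> {1, \<i>}" for v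
      by (rule Suc.IH[OF smooth_on_ddir[OF Suc.prems(1)] b[OF that]])
    show ?case
      by (rule Ck_on_SucI[OF _ has_derivative_suminf[OF Suc.prems(1) C]])
         (auto intro!: Ck_on_add Ck_on_linear_comp[OF _ bounded_linear_scaleR_right] I)
  qed
  then show ?thesis by (simp add: smooth_on_def)
qed

text \<open>The Neumann series for u = c + T(B u). Two rates of decay are used: 3/4 for the terms
  with all their derivatives, which gives smoothness, and the possibly much smaller \<open>q\<close>
  in the supremum norm, which keeps the solution close to the constant \<open>c\<close>.\<close>

lemma cauchy_transform_fixed_point:
  fixes B :: "complex \<Rightarrow> complex ^ 'm ^ 'm" and c :: "complex ^ 'm"
  assumes B: "smooth_on UNIV B" "\<And>k. \<exists>M. deriv_bound k M B"
    and small: "\<And>z x. norm (B z *v x) \<le> \<beta> * norm x" "2 * R * \<beta> \<le> q" "q \<le> 1/2" "0 \<le> R" "0 \<le> \<beta>"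
  obtains u where "smooth_on UNIV u" "\<And>z. u z = c + cauchy_transform R (\<lambda>w. B w *v u w) z"
    "\<And>z. norm (u z - c) \<le> 2 * q * norm c"
proof -
  define d where "d = rec_nat (\<lambda>z. c) (\<lambda>j f. cauchy_transform R (\<lambda>w. B w *v f w))"
  have d0: "d 0 = (\<lambda>z. c)" and dS: "d (Suc j) = cauchy_transform R (\<lambda>w. B w *v d j w)" for j
    by (simp_all add: d_def)
  have sd: "smooth_on UNIV (d j)" for j
    by (induction j) (auto simp: d0 dS intro!: smooth_intros cauchy_transform_smooth(1) B)
  have q0: "0 \<le> q" using small by (smt (verit) mult_nonneg_nonneg)
  have bd: "\<exists>C. \<forall>j. deriv_bound k (C * (3/4) ^ j) (d j)" for k
  proof (rule picard_derivative_bounds[OF B small(1) _ small(4,5), where e = "\<lambda>j z. 0"])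
    show "2 * R * \<beta> \<le> 1/2" using small by linarith
    have const: "deriv_bound k (norm x) (\<lambda>z::complex. x :: complex ^ 'm)" for k x
    proof (induction k arbitrary: x)
      case (Suc k)
      have "ddir v (\<lambda>z::complex. x) = (\<lambda>z. 0)" for v
        by (rule ext, rule ddir_eqI[where D = "\<lambda>v. 0", THEN trans]) auto
      moreover have "deriv_bound k (norm x) (\<lambda>z::complex. 0 :: complex ^ 'm)"
        using deriv_bound_mono[OF Suc[of 0]] by simp
      ultimately show ?case by simp
    qed auto
    show "\<exists>M. deriv_bound k M (d 0)" using const d0 by metis
    show "\<exists>E. \<forall>j. deriv_bound k (E * (3/4) ^ j) (\<lambda>z::complex. 0 :: complex ^ 'm)"
      using const[of k 0] by (intro exI[of _ 0]) simp
  qed (auto simp: dS sd intro!: smooth_intros)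
  define u where "u z = (\<Sum>j. d j z)" for z
  have su: "smooth_on UNIV u" unfolding u_def by (rule smooth_suminf[OF sd bd])
  obtain C where C: "\<And>j z. norm (d j z) \<le> C * (3/4) ^ j" using bd[of 0] by auto
  have C0: "0 \<le> C" using order_trans[OF norm_ge_zero C[of 0 0]] by simp
  have dq: "norm (d j z) \<le> q ^ j * norm c" for j z
  proof (induction j arbitrary: z)
    case (Suc j)
    have "norm (d (Suc j) z) \<le> 2 * R * (\<beta> * (q ^ j * norm c))"
      unfolding dS by (rule cauchy_transform_bound[OF _ order_trans[OF small(1) mult_left_mono[OF Suc small(5)]] small(4)])
        (auto intro!: smooth_intros B sd)
    also have "\<dots> = (2 * R * \<beta>) * (q ^ j * norm c)" by simp
    also have "\<dots> \<le> q * (q ^ j * norm c)" using small q0 by (intro mult_right_mono) auto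
    finally show ?case by simp
  qed (simp add: d0)
  have sum_d: "(\<Sum>j<n. d (Suc j) z) = cauchy_transform R (\<lambda>w. B w *v (\<Sum>j<n. d j w)) z" for n z
  proof (induction n)
    case 0
    have "cauchy_transform R (\<lambda>w. 0 *s (0::complex^'m)) z = 0 *s cauchy_transform R (\<lambda>w. 0::complex^'m) z"
      by (rule cauchy_transform_scale) (auto intro!: smooth_intros)
    then show ?case by simp
  next
    case (Suc n)
    have "cauchy_transform R (\<lambda>w. B w *v (\<Sum>j<Suc n. d j w)) z =
        cauchy_transform R (\<lambda>w. B w *v (\<Sum>j<n. d j w) + B w *v d n w) z"
      by (simp add: matrix_vector_right_distrib)
    also have "\<dots> = cauchy_transform R (\<lambda>w. B w *v (\<Sum>j<n. d j w)) z + cauchy_transform R (\<lambda>w. B w *v d n w) z"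
      by (rule cauchy_transform_add) (auto intro!: smooth_intros B sd)
    finally show ?case using Suc by (simp add: dS)
  qed
  have fix_u: "u z = c + cauchy_transform R (\<lambda>w. B w *v u w) z" for z
  proof -
    \<comment> \<open>The transform is only ever split over finite sums; the remainder is estimated
      by the tail of the series and disappears in the limit.\<close>
    have "norm (u z - (c + cauchy_transform R (\<lambda>w. B w *v u w) z)) \<le> 8 * C * (3/4) ^ n" for n
    proof -
      have s: "smooth_on UNIV (\<lambda>w. B w *v (\<Sum>j<n. d j w))" "smooth_on UNIV (\<lambda>w. B w *v (u w - (\<Sum>j<n. d j w)))"
        by (auto intro!: smooth_intros B sd su)
      have "cauchy_transform R (\<lambda>w. B w *v u w) z
         = cauchy_transform R (\<lambda>w. B w *v (\<Sum>j<n. d j w) + B w *v (u w - (\<Sum>j<n. d j w))) z"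
        by (simp add: matrix_vector_right_distrib[symmetric])
      also have "\<dots> = (\<Sum>j<n. d (Suc j) z) + cauchy_transform R (\<lambda>w. B w *v (u w - (\<Sum>j<n. d j w))) z"
        unfolding sum_d by (rule cauchy_transform_add[OF s])
      finally have "c + cauchy_transform R (\<lambda>w. B w *v u w) z
         = (\<Sum>j<Suc n. d j z) + cauchy_transform R (\<lambda>w. B w *v (u w - (\<Sum>j<n. d j w))) z"
        by (simp add: sum.lessThan_Suc_shift d0 del: sum.lessThan_Suc)
      then have "u z - (c + cauchy_transform R (\<lambda>w. B w *v u w) z)
         = (u z - (\<Sum>j<Suc n. d j z)) - cauchy_transform R (\<lambda>w. B w *v (u w - (\<Sum>j<n. d j w))) z"
        by simp
      also have "norm \<dots> \<le> 4 * C * (3/4) ^ Suc n + 2 * R * (\<beta> * (4 * C * (3/4) ^ n))"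
      proof (rule order_trans[OF norm_triangle_ineq4 add_mono])
        show "norm (u z - (\<Sum>j<Suc n. d j z)) \<le> 4 * C * (3/4) ^ Suc n"
          unfolding u_def by (rule geometric_tail(2)[OF C])
        show "norm (cauchy_transform R (\<lambda>w. B w *v (u w - (\<Sum>j<n. d j w))) z) \<le> 2 * R * (\<beta> * (4 * C * (3/4) ^ n))"
          unfolding u_def by (rule cauchy_transform_bound[OF s(2)[unfolded u_def]
              order_trans[OF small(1) mult_left_mono[OF geometric_tail(2)[OF C] small(5)]] small(4)])
      qed
      also have "\<dots> = 3 * C * (3/4) ^ n + (2 * R * \<beta>) * (4 * C * (3/4) ^ n)" by simp
      also have "\<dots> \<le> 3 * C * (3/4) ^ n + 1/2 * (4 * C * (3/4) ^ n)"
        using small C0 by (intro add_left_mono mult_right_mono) auto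
      also have "\<dots> \<le> 8 * C * (3/4) ^ n" using C0 by simp
      finally show ?thesis .
    qed
    moreover have "(\<lambda>n. 8 * C * (3/4::real) ^ n) \<longlonglongrightarrow> 0"
      using tendsto_mult_right_zero[OF LIMSEQ_realpow_zero[of "3/4"], of "8 * C"] by simp
    ultimately have "norm (u z - (c + cauchy_transform R (\<lambda>w. B w *v u w) z)) \<le> 0"
      using LIMSEQ_le_const by blast
    then show ?thesis by simp
  qed
  have un: "norm (u z) \<le> 2 * norm c" for z
  proof -
    have g: "summable (\<lambda>j. q ^ j * norm c)" using q0 small by (intro summable_mult2 summable_geometric) auto
    have "norm (u z) \<le> (\<Sum>j. q ^ j * norm c)" unfolding u_def by (rule norm_suminf_le[OF dq g])
    also have "\<dots> = (\<Sum>j. q ^ j) * norm c"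
      using q0 small by (intro suminf_mult2[symmetric] summable_geometric) auto
    also have "(\<Sum>j. q ^ j) = 1 / (1 - q)" using q0 small by (intro suminf_geometric) auto
    also have "1 / (1 - q) * norm c \<le> 2 * norm c"
      using small by (intro mult_right_mono) (auto simp: field_simps)
    finally show ?thesis .
  qed
  have "norm (u z - c) \<le> 2 * q * norm c" for z
  proof -
    have "norm (u z - c) = norm (cauchy_transform R (\<lambda>w. B w *v u w) z)" using fix_u[of z] by (metis add_diff_cancel_left')
    also have "\<dots> \<le> 2 * R * (\<beta> * (2 * norm c))"
      by (rule cauchy_transform_bound[OF _ order_trans[OF small(1) mult_left_mono[OF un small(5)]] small(4)])
         (auto intro!: smooth_intros B su)
    also have "\<dots> = (2 * R * \<beta>) * (2 * norm c)" by simp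
    also have "\<dots> \<le> q * (2 * norm c)" using small by (intro mult_right_mono) auto
    finally show ?thesis by simp
  qed
  then show ?thesis using that su fix_u by blast
qed

subsection \<open>Local fundamental matrices\<close>

text \<open>Cutting \<open>A\<close> off outside a small disc makes the integral operator a
  contraction. The fixed points belonging to the unit vectors are the columns of a matrix close to
  the identity. They solve the original equation where the cut-off function is 1.\<close>

theorem dbar_fundamental_matrix:
  fixes A :: "complex \<Rightarrow> complex ^ 'm ^ 'm"
  assumes U: "open U" "p \<in> U" and A: "smooth_on U A"
  obtains W \<Phi> where "open W" "p \<in> W" "W \<subseteq> U" "smooth_on W \<Phi>" "\<Phi> p = mat 1"
    "\<And>z. z \<in> W \<Longrightarrow> invertible (\<Phi> z)" "\<And>z c. z \<in> W \<Longrightarrow> vdzbar (\<lambda>w. \<Phi> w *v c) z = A z *v (\<Phi> z *v c)"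
proof -
  obtain r where r: "r > 0" "cball p r \<subseteq> U" using U open_contains_cball by blast
  have "compact (A ` cball p r)"
    by (rule compact_continuous_image[OF continuous_on_subset[OF smooth_on_continuous_on[OF A] r(2)]]) auto
  then obtain L where L: "\<And>z. z \<in> cball p r \<Longrightarrow> norm (A z) \<le> L" using compact_imp_bounded bounded_iff by (metis imageI)
  obtain K where K: "K > 0" "\<And>(A :: complex^'m^'m) x. norm (A *v x) \<le> norm A * norm x * K"
    using bounded_bilinear.pos_bounded[OF bounded_bilinear_matvec] by blast
  have L0: "0 \<le> L" using order_trans[OF norm_ge_zero L[of p]] r by simp
  define \<beta> where "\<beta> = L * K"
  \<comment> \<open>With m the dimension, each column differs from its unit vector by at most 2 q =
    1/(2 m). Summed over the columns the deviation is at most 1/2, which excludes a kernel.\<close>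
  define q where "q = 1 / (4 * real CARD('m))"
  have card: "real CARD('m) \<ge> 1" using zero_less_card_finite[where 'a = 'm] by linarith
  have "1 \<le> real CARD('m) * 2" using card by linarith
  then have q: "0 < q" "q \<le> 1/2" by (auto simp: q_def field_simps)
  \<comment> \<open>The transform is taken over radius 2 \<delta> and its bound has another factor
    2, hence the 4. The summand 1 covers \<beta> = 0.\<close>
  define \<delta> where "\<delta> = min r (q / (4 * (\<beta> + 1)))"
  have \<beta>: "0 \<le> \<beta>" using L0 K by (simp add: \<beta>_def)
  have \<delta>: "0 < \<delta>" "\<delta> \<le> r" "4 * \<delta> * \<beta> \<le> q"
  proof -
    show "0 < \<delta>" "\<delta> \<le> r" using r q \<beta> by (auto simp: \<delta>_def)
    have "4 * \<delta> * \<beta> \<le> 4 * (q / (4 * (\<beta> + 1))) * \<beta>" using \<beta> by (intro mult_right_mono) (auto simp: \<delta>_def)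
    also have "\<dots> \<le> q" using \<beta> q by (simp add: field_simps)
    finally show "4 * \<delta> * \<beta> \<le> q" .
  qed
  obtain \<psi> :: "complex \<Rightarrow> real" where \<psi>: "smooth_on UNIV \<psi>" "\<And>x. 0 \<le> \<psi> x" "\<And>x. \<psi> x \<le> 1"
    "\<And>x. dist p x \<ge> \<delta> \<Longrightarrow> \<psi> x = 0" "\<And>x. dist p x \<le> \<delta> / 2 \<Longrightarrow> \<psi> x = 1"
    using bump_function_exists[OF \<delta>(1)] by blast
  define B where "B z = (if z \<in> U then \<psi> z *\<^sub>R A z else 0)" for z
  have cb: "cball p \<delta> \<subseteq> U" using r \<delta> by auto
  have sB: "smooth_on UNIV B" unfolding B_def[abs_def]
    by (rule smooth_on_if_support[OF _ U(1) closed_cball cb])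
       (auto intro!: smooth_intros U A \<psi> smooth_on_subset[OF \<psi>(1)])
  have B0: "B z = 0" if "z \<notin> ball p \<delta>" for z using that \<psi>(4)[of z] by (auto simp: B_def)
  have bB: "\<exists>M. deriv_bound k M B" for k
    by (rule deriv_bound_compact_support[OF sB compact_cball[of p \<delta>]]) (use B0 in auto)
  have nB: "norm (B z *v x) \<le> \<beta> * norm x" for z x
  proof (cases "z \<in> ball p \<delta>")
    case True
    then have z: "z \<in> cball p r" "z \<in> U" using \<delta> cb by auto
    have "norm (B z) \<le> 1 * L"
    proof -
      have "norm (B z) = \<psi> z * norm (A z)" using z \<psi>(2)[of z] by (simp add: B_def)
      also have "\<dots> \<le> 1 * L" by (rule mult_mono[OF \<psi>(3) L[OF z(1)]]) auto
      finally show ?thesis .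
    qed
    then have "norm (B z) * norm x * K \<le> L * norm x * K" using K by (intro mult_right_mono) auto
    then show ?thesis using K(2)[of "B z" x] by (simp add: \<beta>_def mult_ac)
  next
    case False then show ?thesis using B0 \<beta> by simp
  qed
  \<comment> \<open>The radius 2 \<delta> is chosen because, for z in the \<delta>-ball about
    \<open>p\<close>, the circle of that radius about z lies outside the support of
    \<open>B\<close>.\<close>
  have "\<exists>u. smooth_on UNIV u \<and> (\<forall>z. u z = c + cauchy_transform (2 * \<delta>) (\<lambda>w. B w *v u w) z) \<and>
    (\<forall>z. norm (u z - c) \<le> 2 * q * norm c)" for c
    using cauchy_transform_fixed_point[OF sB bB nB, of "2 * \<delta>" q c] \<delta> q \<beta> by (smt (verit))
  then obtain u where u: "\<And>c. smooth_on UNIV (u c)" "\<And>c z. u c z = c + cauchy_transform (2 * \<delta>) (\<lambda>w. B w *v u c w) z"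
    "\<And>c z. norm (u c z - c) \<le> 2 * q * norm c" by metis
  have eq: "vdzbar (u c) z = B z *v u c z" if z: "z \<in> ball p \<delta>" for c z
  proof -
    have s: "smooth_on UNIV (\<lambda>w. B w *v u c w)" by (intro smooth_intros sB u) auto
    have "u c = (\<lambda>z. c + cauchy_transform (2 * \<delta>) (\<lambda>w. B w *v u c w) z)" using u(2) by blast
    then have "vdzbar (u c) z = vdzbar (\<lambda>z. c + cauchy_transform (2 * \<delta>) (\<lambda>w. B w *v u c w) z) z" by simp
    also have "\<dots> = vdzbar (cauchy_transform (2 * \<delta>) (\<lambda>w. B w *v u c w)) z"
      using smooth_on_differentiable[OF cauchy_transform_smooth(1)[OF s]] by (simp add: vdz_rules)
    also have "\<dots> = B z *v u c z"
    proof (rule cauchy_transform_dbar[OF s])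
      fix t
      have "norm ((2 * \<delta>) *\<^sub>R cis t) \<le> norm (z - p) + norm (z - (2 * \<delta>) *\<^sub>R cis t - p)"
        using norm_triangle_ineq4[of "z - p" "z - (2 * \<delta>) *\<^sub>R cis t - p"] by simp
      then have "dist p (z - (2 * \<delta>) *\<^sub>R cis t) \<ge> \<delta>" using z \<delta> by (simp add: dist_norm norm_minus_commute)
      then have "B (z - (2 * \<delta>) *\<^sub>R cis t) = 0" by (intro B0) auto
      then show "B (z - (2 * \<delta>) *\<^sub>R cis t) *v u c (z - (2 * \<delta>) *\<^sub>R cis t) = 0" by simp
    qed (use \<delta> in auto)
    finally show ?thesis .
  qed
  define \<Phi>0 where "\<Phi>0 z = (\<chi> i j. u (axis j 1) z $ i)" for z
  have mv: "\<Phi>0 z *v c = (\<Sum>j\<in>UNIV. c $ j *s u (axis j 1) z)" for z c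
    by (simp add: \<Phi>0_def matrix_vector_mult_def vec_eq_iff mult.commute)
  have s0: "smooth_on UNIV \<Phi>0" unfolding \<Phi>0_def[abs_def] by (intro smooth_intros u) auto
  have inv0: "invertible (\<Phi>0 z)" for z
  proof -
    have "x = 0" if x: "\<Phi>0 z *v x = 0" for x
    proof (rule ccontr)
      assume "x \<noteq> 0"
      have "x = (\<Sum>j\<in>UNIV. x $ j *s axis j 1)" by (simp add: vec_eq_iff axis_def if_distrib cong: if_cong)
      then have "- x = (\<Sum>j\<in>UNIV. x $ j *s (u (axis j 1) z - axis j 1))"
        using x unfolding mv by (simp add: vector_ssub_ldistrib sum_subtractf)
      then have "norm x = norm (\<Sum>j\<in>UNIV. x $ j *s (u (axis j 1) z - axis j 1))"
        using norm_minus_cancel[of x] by simp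
      also have "\<dots> \<le> (\<Sum>j\<in>UNIV. norm (x $ j *s (u (axis j 1) z - axis j 1)))"
        by (rule norm_sum)
      also have "\<dots> \<le> (\<Sum>j\<in>(UNIV::'m set). norm x * (2 * q))"
      proof (rule sum_mono)
        fix j :: 'm
        have "norm (axis j 1 :: complex ^ 'm) = 1" by simp
        then have "norm (u (axis j 1) z - axis j 1) \<le> 2 * q" using u(3)[of "axis j 1" z] by simp
        then show "norm (x $ j *s (u (axis j 1) z - axis j 1)) \<le> norm x * (2 * q)"
          unfolding norm_vscale by (intro mult_mono Finite_Cartesian_Product.norm_nth_le) auto
      qed
      also have "\<dots> = norm x / 2" using card by (simp add: q_def)
      finally show False using \<open>x \<noteq> 0\<close> by simp
    qed
    then show ?thesis using matrix_left_invertible_ker invertible_left_inverse by blast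
  qed
  define W where "W = ball p (\<delta> / 2)"
  \<comment> \<open>Multiplication by a constant matrix on the right preserves the equation and
    normalizes the value at \<open>p\<close>.\<close>
  obtain M where M: "\<Phi>0 p ** M = mat 1" "M ** \<Phi>0 p = mat 1" using inv0[of p] unfolding invertible_def by blast
  define \<Phi> where "\<Phi> z = \<Phi>0 z ** M" for z
  show ?thesis
  proof (rule that[of W \<Phi>])
    show "open W" "p \<in> W" "W \<subseteq> U" using \<delta> cb by (auto simp: W_def)
    have "smooth_on UNIV \<Phi>" unfolding \<Phi>_def[abs_def] matrix_matrix_mult_def
      by (intro smooth_intros s0) auto
    then show "smooth_on W \<Phi>" using smooth_on_subset by blast
    show "\<Phi> p = mat 1" by (simp add: \<Phi>_def M)
    show "invertible (\<Phi> z)" for z unfolding \<Phi>_def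
      by (intro invertible_mult inv0) (use M invertible_def in blast)
    fix z c assume z: "z \<in> W"
    define e where "e = M *v c"
    have "vdzbar (\<lambda>w. \<Phi> w *v c) z = vdzbar (\<lambda>w. \<Sum>j\<in>UNIV. e $ j *s u (axis j 1) w) z"
      by (simp add: \<Phi>_def mv[symmetric] e_def matrix_vector_mul_assoc)
    also have "\<dots> = (\<Sum>j\<in>UNIV. e $ j *s vdzbar (u (axis j 1)) z)"
    proof -
      have "finite S \<Longrightarrow> vdzbar (\<lambda>w. \<Sum>j\<in>S. e $ j *s u (axis j 1) w) z = (\<Sum>j\<in>S. e $ j *s vdzbar (u (axis j 1)) z)" for S
      proof (induction S rule: finite_induct)
        case (insert j S)
        have d: "(\<lambda>w. e $ j *s u (axis j 1) w) differentiable at z" "(\<lambda>w. \<Sum>j\<in>S. e $ j *s u (axis j 1) w) differentiable at z"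
          by (auto intro!: smooth_on_differentiable[of UNIV] smooth_intros u)
        have d2: "u (axis j 1) differentiable at z" by (auto intro!: smooth_on_differentiable[of UNIV] u)
        show ?case using insert by (simp add: vdz_rules(2)[OF d] vdz_rules1(4)[OF d2])
      qed simp
      then show ?thesis by simp
    qed
    also have "\<dots> = (\<Sum>j\<in>UNIV. e $ j *s (A z *v u (axis j 1) z))"
    proof (rule sum.cong[OF refl])
      have zz0: "z \<in> ball p \<delta>" "z \<in> U" using z \<delta> cb by (auto simp: W_def)
      have zz: "z \<in> ball p \<delta>" "B z = A z" using zz0 z \<psi>(5)[of z] by (auto simp: W_def B_def)
      show "e $ j *s vdzbar (u (axis j 1)) z = e $ j *s (A z *v u (axis j 1) z)" for j
        using eq[OF zz(1)] zz(2) by simp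
    qed
    also have "\<dots> = A z *v (\<Sum>j\<in>UNIV. e $ j *s u (axis j 1) z)"
      by (simp add: vec.linear_sum[OF matrix_vector_mul_linear_gen] vec.linear_scale[OF matrix_vector_mul_linear_gen])
    also have "\<dots> = A z *v (\<Phi> z *v c)" by (simp add: \<Phi>_def mv[symmetric] e_def matrix_vector_mul_assoc)
    finally show "vdzbar (\<lambda>w. \<Phi> w *v c) z = A z *v (\<Phi> z *v c)" .
  qed
qed

section \<open>The Willmore density in terms of a moving frame\<close>

text \<open>The Gram determinant with the opposite sign; this sign makes it positive on the
  conjugate pair X_z, X_zbar of an immersion.\<close>

definition "frame_det a b = (mink a b)\<^sup>2 - mink a a * mink b b"

text \<open>Orthogonal projection onto the span of \<open>a\<close> and \<open>b\<close>, with the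
  coefficients solved by Cramer's rule.\<close>

definition "tangent_part a b y =
     ((mink a b * mink y b - mink b b * mink y a) / frame_det a b) *s a
   + ((mink a b * mink y a - mink a a * mink y b) / frame_det a b) *s b"

text \<open>Given \<open>\<langle>x, m\<rangle> = - 2 frame_det a b\<close>, this is the null vector of the span of \<open>x, a, b, m\<close> that is
  orthogonal to \<open>a, b\<close> and has product \<open>-1\<close> with \<open>x\<close>.\<close>

definition "null_normal x a b m =
     (1 / (2 * frame_det a b)) *s (m - tangent_part a b m)
     + (mink (m - tangent_part a b m) (m - tangent_part a b m) / (8 * (frame_det a b)\<^sup>2)) *s x"

definition "frame_perp x a b m y = y - tangent_part a b y + mink y (null_normal x a b m) *s x + mink y x *s null_normal x a b m"

lemma tangent_part_mink:
  assumes "frame_det a b \<noteq> 0"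
  shows "mink (tangent_part a b y) a = mink y a" "mink (tangent_part a b y) b = mink y b"
proof -
  have e: "(G * Y - F * X) / D * E + (G * X - E * Y) / D * G = X \<and> (G * Y - F * X) / D * G + (G * X - E * Y) / D * F = Y"
    if "D = G\<^sup>2 - E * F" "D \<noteq> 0" for D E F G X Y :: complex
  proof -
    have "(G * Y - F * X) * E + (G * X - E * Y) * G = X * D" "(G * Y - F * X) * G + (G * X - E * Y) * F = Y * D"
      unfolding that(1) by (simp_all add: algebra_simps power2_eq_square)
    then show ?thesis using that(2) by (simp add: field_simps)
  qed
  show "mink (tangent_part a b y) a = mink y a" "mink (tangent_part a b y) b = mink y b"
    using e[OF frame_det_def assms, of "mink y b" "mink y a"]
    by (simp_all add: tangent_part_def mink_commute[of b a])
qed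

text \<open>The model is a lift X with \<open>a\<close> = X_z, \<open>b\<close> = X_zbar and
  \<open>m\<close> the unnormalized metric trace of the second derivatives. Differentiating the
  equations saying that X is null gives exactly the product of \<open>x\<close> and \<open>m\<close>
  assumed last.\<close>

locale null_frame =
  fixes x a b m :: "'n::finite mvec"
  assumes det: "frame_det a b \<noteq> 0" and x: "mink x x = 0" "mink x a = 0" "mink x b = 0"
    and m: "mink x m = - 2 * frame_det a b"
begin

lemma x': "mink a x = 0" "mink b x = 0" "mink m x = - 2 * frame_det a b"
  using x m by (simp_all add: mink_commute)

lemma null_normal_mink:
  "mink (null_normal x a b m) x = -1" "mink (null_normal x a b m) a = 0" "mink (null_normal x a b m) b = 0"
  "mink (null_normal x a b m) (null_normal x a b m) = 0"
proof -
  define l where "l = m - tangent_part a b m"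
  have nn: "null_normal x a b m = (1 / (2 * frame_det a b)) *s l + (mink l l / (8 * (frame_det a b)\<^sup>2)) *s x"
    by (simp add: null_normal_def l_def)
  have t: "mink (tangent_part a b m) x = 0" by (simp add: tangent_part_def x')
  have l: "mink l x = - 2 * frame_det a b" "mink l a = 0" "mink l b = 0"
    using tangent_part_mink[OF det] x' t by (simp_all add: l_def)
  have l': "mink x l = - 2 * frame_det a b" using l(1) by (simp add: mink_commute)
  show "mink (null_normal x a b m) x = -1" "mink (null_normal x a b m) a = 0" "mink (null_normal x a b m) b = 0"
    unfolding nn using det by (simp_all add: l x)
  have "mink (null_normal x a b m) (null_normal x a b m) =
     (1 / (2 * frame_det a b)) * (1 / (2 * frame_det a b)) * mink l l
     + 2 * (1 / (2 * frame_det a b)) * (mink l l / (8 * (frame_det a b)\<^sup>2)) * (- 2 * frame_det a b)"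
    unfolding nn by (simp add: l l' x algebra_simps)
  also have "\<dots> = 0" using det by (simp add: field_simps power2_eq_square)
  finally show "mink (null_normal x a b m) (null_normal x a b m) = 0" .
qed

lemma null_normal_comb: "\<exists>\<alpha> \<beta> \<gamma>. null_normal x a b m = \<alpha> *s x + \<beta> *s a + \<gamma> *s b + (1 / (2 * frame_det a b)) *s m"
proof -
  obtain \<beta> \<gamma> where t: "tangent_part a b m = \<beta> *s a + \<gamma> *s b" unfolding tangent_part_def by blast
  define \<alpha> where "\<alpha> = mink (m - tangent_part a b m) (m - tangent_part a b m) / (8 * (frame_det a b)\<^sup>2)"
  define k where "k = 1 / (2 * frame_det a b)"
  have "null_normal x a b m = k *s (m - (\<beta> *s a + \<gamma> *s b)) + \<alpha> *s x"
    by (simp only: null_normal_def \<alpha>_def k_def t)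
  also have "\<dots> = \<alpha> *s x + (- k * \<beta>) *s a + (- k * \<gamma>) *s b + k *s m"
    by (simp add: vec_eq_iff algebra_simps)
  finally show ?thesis unfolding k_def by blast
qed

lemma frame_perp_mink:
  "mink (frame_perp x a b m y) x = 0" "mink (frame_perp x a b m y) a = 0"
  "mink (frame_perp x a b m y) b = 0" "mink (frame_perp x a b m y) (null_normal x a b m) = 0"
proof -
  note nn = null_normal_mink
  have nx: "mink x (null_normal x a b m) = -1" using nn(1) by (simp add: mink_commute)
  have tn: "mink (tangent_part a b y) (null_normal x a b m) = 0" "mink (tangent_part a b y) x = 0"
    using nn mink_commute[of a "null_normal x a b m"] mink_commute[of b "null_normal x a b m"]
    by (simp_all add: tangent_part_def x')
  show "mink (frame_perp x a b m y) x = 0" "mink (frame_perp x a b m y) a = 0"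
    "mink (frame_perp x a b m y) b = 0" "mink (frame_perp x a b m y) (null_normal x a b m) = 0"
    unfolding frame_perp_def by (simp_all add: nn x x' nx tn tangent_part_mink[OF det])
qed

lemma frame_perp_m: "mink (frame_perp x a b m y) m = 0"
proof -
  obtain \<alpha> \<beta> \<gamma> where n: "null_normal x a b m = \<alpha> *s x + \<beta> *s a + \<gamma> *s b + (1 / (2 * frame_det a b)) *s m"
    using null_normal_comb by blast
  have "mink (frame_perp x a b m y) (\<alpha> *s x + \<beta> *s a + \<gamma> *s b + (1 / (2 * frame_det a b)) *s m) = 0"
    using frame_perp_mink(4)[of y] unfolding n .
  then show "mink (frame_perp x a b m y) m = 0"
    using frame_perp_mink[of y] det by simp
qed

lemma frame_perp_mperp: "frame_perp x a b m y \<in> mperp (vec.span {x, a, b, m})"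
  unfolding mperp_span4 using frame_perp_mink[of y] frame_perp_m[of y] by (simp add: mink_commute)

lemma frame_perp_diff_span: "y - frame_perp x a b m y \<in> vec.span {x, a, b, m}"
proof -
  obtain \<alpha> \<beta> \<gamma> where n: "null_normal x a b m = \<alpha> *s x + \<beta> *s a + \<gamma> *s b + (1 / (2 * frame_det a b)) *s m"
    using null_normal_comb by blast
  obtain \<beta>' \<gamma>' where t: "tangent_part a b y = \<beta>' *s a + \<gamma>' *s b" unfolding tangent_part_def by blast
  define c d where "c = mink y (null_normal x a b m)" and "d = mink y x"
  have "y - frame_perp x a b m y = (- c - d * \<alpha>) *s x + (\<beta>' - d * \<beta>) *s a + (\<gamma>' - d * \<gamma>) *s b
     + (- d * (1 / (2 * frame_det a b))) *s m"
    unfolding frame_perp_def c_def[symmetric] d_def[symmetric] t unfolding n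
    by (simp add: vec_eq_iff algebra_simps)
  then show ?thesis using span4_combI by metis
qed

lemma span_perp_zero:
  assumes v: "v \<in> vec.span {x, a, b, m}" "v \<in> mperp (vec.span {x, a, b, m})"
  shows "v = 0"
proof -
  have p: "mink x v = 0" "mink a v = 0" "mink b v = 0" "mink m v = 0" using v(2) unfolding mperp_span4 by auto
  obtain c1 c2 c3 c4 where e: "v = c1 *s x + c2 *s a + c3 *s b + c4 *s m" using v(1) unfolding in_span4 by blast
  have 4: "c4 = 0" using p(1) det unfolding e by (simp add: x m)
  have q: "c2 * mink a a + c3 * mink a b = 0" "c2 * mink a b + c3 * mink b b = 0"
    using p(2,3) unfolding e 4 by (simp_all add: x' mink_commute[of b a])
  have "c2 * frame_det a b = (c2 * mink a b + c3 * mink b b) * mink a b - (c2 * mink a a + c3 * mink a b) * mink b b"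
    "c3 * frame_det a b = (c2 * mink a a + c3 * mink a b) * mink a b - (c2 * mink a b + c3 * mink b b) * mink a a"
    unfolding frame_det_def by (simp_all add: algebra_simps power2_eq_square)
  then have "c2 * frame_det a b = 0" "c3 * frame_det a b = 0" unfolding q by simp_all
  then have 23: "c2 = 0" "c3 = 0" using det by simp_all
  have "c1 = 0" using p(4) det unfolding e 4 23 by (simp add: x')
  then show "v = 0" using e 4 23 by simp
qed

text \<open>Replaces the implicitly defined projection by a rational expression in the frame, from
  which smooth dependence on a variation parameter can be read off.\<close>

lemma perp_proj_frame: "perp_proj (vec.span {x, a, b, m}) y = frame_perp x a b m y"
  by (rule perp_proj_eqI[OF vec.subspace_span frame_perp_mperp frame_perp_diff_span span_perp_zero])

lemma frame_perp_self: "frame_perp x a b m m = 0"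
proof (rule span_perp_zero[OF _ frame_perp_mperp])
  have "m \<in> vec.span {x, a, b, m}" by (simp add: vec.span_base)
  from vec.span_diff[OF this frame_perp_diff_span[of m]] show "frame_perp x a b m m \<in> vec.span {x, a, b, m}" by simp
qed

end

lemma tangent_part_linear:
  "tangent_part a b (y + z) = tangent_part a b y + tangent_part a b z"
  "tangent_part a b (c *s y) = c *s tangent_part a b y"
  unfolding tangent_part_def by (simp_all add: vec_eq_iff algebra_simps add_divide_distrib diff_divide_distrib)

lemma frame_perp_linear:
  "frame_perp x a b m (y + z) = frame_perp x a b m y + frame_perp x a b m z"
  "frame_perp x a b m (c *s y) = c *s frame_perp x a b m y"
  unfolding frame_perp_def tangent_part_linear by (simp_all add: vec_eq_iff algebra_simps)

lemma frame_perp_diff: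
  "frame_perp x a b m (y - z) = frame_perp x a b m y - frame_perp x a b m z"
  using frame_perp_linear(1)[of x a b m y "(-1) *s z"] frame_perp_linear(2)[of x a b m "-1" z] by simp

text \<open>For a trace-free symmetric 2 by 2 form the squared norm is -2 times the determinant.
  Here the values are vectors, and trace and norm are taken with the inverse metric with entries
  \<open>p\<close>, \<open>q\<close>, \<open>r\<close>; the identity arises by subtracting the
  square of the vanishing trace.\<close>

lemma tracefree_contraction:
  fixes h11 h12 h22 :: "'n::finite mvec" and p q r :: real
  assumes T: "complex_of_real p *s h11 + complex_of_real (2 * q) *s h12 + complex_of_real r *s h22 = 0"
  shows "p * p * Re (mink h11 h11) + p * q * Re (mink h11 h12) + q * p * Re (mink h11 h12) + q * q * Re (mink h11 h22)
    + (p * q * Re (mink h12 h11) + p * r * Re (mink h12 h12) + q * q * Re (mink h12 h12) + q * r * Re (mink h12 h22))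
    + (q * p * Re (mink h12 h11) + q * q * Re (mink h12 h12) + r * p * Re (mink h12 h12) + r * q * Re (mink h12 h22))
    + (q * q * Re (mink h22 h11) + q * r * Re (mink h22 h12) + r * q * Re (mink h22 h12) + r * r * Re (mink h22 h22))
    = 2 * (p * r - q * q) * Re (mink h12 h12 - mink h11 h22)"
proof -
  define A B C D E F where "A = Re (mink h11 h11)" and "B = Re (mink h11 h12)" and "C = Re (mink h11 h22)"
    and "D = Re (mink h12 h12)" and "E = Re (mink h12 h22)" and "F = Re (mink h22 h22)"
  have "Re (mink (complex_of_real p *s h11 + complex_of_real (2 * q) *s h12 + complex_of_real r *s h22)
     (complex_of_real p *s h11 + complex_of_real (2 * q) *s h12 + complex_of_real r *s h22)) = 0"
    unfolding T by simp
  then have e: "p * (p * A) + 2 * p * (2 * q * B) + 2 * p * (r * C) + 2 * q * (2 * q * D) + 4 * q * (r * E) + r * (r * F) = 0"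
    unfolding A_def B_def C_def D_def E_def F_def
    by (simp add: mink_commute[of h12 h11] mink_commute[of h22 h11] mink_commute[of h22 h12] algebra_simps)
  have "?thesis \<longleftrightarrow> p * p * A + p * q * B + q * p * B + q * q * C + (p * q * B + p * r * D + q * q * D + q * r * E)
    + (q * p * B + q * q * D + r * p * D + r * q * E) + (q * q * C + q * r * E + r * q * E + r * r * F)
    = 2 * (p * r - q * q) * (D - C)"
    unfolding A_def B_def C_def D_def E_def F_def
    by (simp add: mink_commute[of h12 h11] mink_commute[of h22 h11] mink_commute[of h22 h12])
  also have "\<dots>" using e by (simp add: algebra_simps)
  finally show ?thesis by simp
qed

section \<open>The density of an immersion in Wirtinger derivatives\<close>

lemma smooth_null_vec: "open S \<Longrightarrow> smooth_on S g \<Longrightarrow> smooth_on S (\<lambda>q. null_vec (g q))"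
proof -
  assume a: "open S" "smooth_on S g"
  have "smooth_on S (\<lambda>x. case i of None \<Rightarrow> 1 | Some k \<Rightarrow> complex_of_real (g x $ k))" for i
    by (cases i) (auto intro!: smooth_intros a)
  then show ?thesis unfolding null_vec_def by (rule smooth_on_vec_lambda[OF a(1)])
qed

lemma null_vec_real: "vcnj (null_vec x) = null_vec x"
  by (auto simp: vec_eq_iff null_vec_def split: option.split)

lemma null_vec_mink: "mink (null_vec x) (null_vec y) = complex_of_real (x \<bullet> y) - 1"
  by (simp add: mink_def null_vec_def inner_vec_def)

lemma ddir_null_vec:
  assumes "g differentiable at p"
  shows "ddir v (\<lambda>q. null_vec (g q)) p = null_vec (ddir v g p) - null_vec 0"
proof -
  have bl: "bounded_linear (\<lambda>x :: real^'n. null_vec x - null_vec 0)"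
    unfolding linear_conv_bounded_linear[symmetric]
    by (rule linearI) (auto simp: vec_eq_iff null_vec_def scaleR_complex split: option.split)
  have "((\<lambda>q. null_vec (g q) - null_vec 0) has_derivative (\<lambda>v. null_vec (ddir v g p) - null_vec 0)) (at p)"
    by (rule bounded_linear.has_derivative[OF bl has_derivative_ddir[OF assms]])
  then have "((\<lambda>q. null_vec (g q) - null_vec 0 + null_vec 0) has_derivative (\<lambda>v. null_vec (ddir v g p) - null_vec 0)) (at p)"
    by (rule has_derivative_add_const)
  then show ?thesis using ddir_eqI by fastforce
qed

lemma mink_ddir_null_vec:
  assumes "g differentiable at p"
  shows "mink (ddir v (\<lambda>q. null_vec (g q)) p) (ddir w (\<lambda>q. null_vec (g q)) p) = complex_of_real (metric g p v w)"
  unfolding ddir_null_vec[OF assms] by (simp add: null_vec_mink metric_def dir_deriv_eq_ddir)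

lemma metric_det_pos_iff_inj:
  assumes "g differentiable at p"
  shows "metric_det g p > 0 \<longleftrightarrow> inj (frechet_derivative g (at p))"
proof -
  define u w where "u = ddir 1 g p" and "w = ddir \<i> g p"
  have D: "ddir v g p = Re v *\<^sub>R u + Im v *\<^sub>R w" for v unfolding u_def w_def by (rule ddir_complex[OF assms])
  have md: "metric_det g p = (u \<bullet> u) * (w \<bullet> w) - (u \<bullet> w)\<^sup>2"
    by (simp add: metric_det_def metric_def dir_deriv_eq_ddir u_def w_def)
  have lin: "linear (frechet_derivative g (at p))" using assms by (rule linear_frechet_derivative)
  have fd: "frechet_derivative g (at p) v = ddir v g p" for v by (simp add: ddir_def)
  \<comment> \<open>The component of \<open>u\<close> orthogonal to \<open>w\<close>, multiplied by
    the square of the norm of \<open>w\<close>: the defect in the Cauchy-Schwarz inequality.\<close>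
  define y where "y = (w \<bullet> w) *\<^sub>R u - (u \<bullet> w) *\<^sub>R w"
  have yy: "y \<bullet> y = (w \<bullet> w) * metric_det g p"
    by (simp add: y_def md inner_diff_left inner_diff_right inner_commute power2_eq_square algebra_simps)
  show ?thesis
  proof
    assume pos: "metric_det g p > 0"
    show "inj (frechet_derivative g (at p))"
      unfolding linear_injective_0[OF lin]
    proof (intro allI impI)
      fix v assume "frechet_derivative g (at p) v = 0"
      then have 0: "Re v *\<^sub>R u + Im v *\<^sub>R w = 0" by (simp add: fd D)
      have "u \<bullet> (Re v *\<^sub>R u + Im v *\<^sub>R w) = 0" "w \<bullet> (Re v *\<^sub>R u + Im v *\<^sub>R w) = 0" using 0 by simp_all
      then have e: "Re v * (u \<bullet> u) + Im v * (u \<bullet> w) = 0" "Re v * (u \<bullet> w) + Im v * (w \<bullet> w) = 0"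
        by (simp_all add: inner_add_right inner_commute[of w u])
      have "Re v * metric_det g p = (Re v * (u \<bullet> u) + Im v * (u \<bullet> w)) * (w \<bullet> w) - (Re v * (u \<bullet> w) + Im v * (w \<bullet> w)) * (u \<bullet> w)"
        "Im v * metric_det g p = (Re v * (u \<bullet> w) + Im v * (w \<bullet> w)) * (u \<bullet> u) - (Re v * (u \<bullet> u) + Im v * (u \<bullet> w)) * (u \<bullet> w)"
        by (simp_all add: md algebra_simps power2_eq_square)
      then have "Re v * metric_det g p = 0" "Im v * metric_det g p = 0" unfolding e by simp_all
      then show "v = 0" using pos by (simp add: complex_eq_iff)
    qed
  next
    assume inj: "inj (frechet_derivative g (at p))"
    then have z: "v = 0" if "ddir v g p = 0" for v
      using that unfolding linear_injective_0[OF lin] fd by blast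
    have w0: "w \<noteq> 0" using z[of \<i>] by (auto simp: w_def)
    have "y \<noteq> 0"
    proof
      assume "y = 0"
      then have "ddir (Complex (w \<bullet> w) (- (u \<bullet> w))) g p = 0" by (simp add: D y_def)
      from z[OF this] show False using w0 by (simp add: complex_eq_iff)
    qed
    then have "0 < (w \<bullet> w) * metric_det g p" using yy by (metis inner_gt_zero_iff)
    then show "metric_det g p > 0" using w0 inner_ge_zero[of w] by (auto simp: zero_less_mult_iff)
  qed
qed

text \<open>A multiple of the metric trace of the second derivatives.\<close>

definition trace_vec :: "(complex \<Rightarrow> 'n::finite mvec) \<Rightarrow> complex \<Rightarrow> 'n mvec" where
  "trace_vec X p = (2 * mink (vdz X p) (vdzbar X p)) *s vdzbar (vdz X) p
     - mink (vdzbar X p) (vdzbar X p) *s vdz (vdz X) p - mink (vdz X p) (vdz X p) *s vdzbar (vdzbar X) p"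

definition lift_perp :: "(complex \<Rightarrow> 'n::finite mvec) \<Rightarrow> complex \<Rightarrow> 'n mvec \<Rightarrow> 'n mvec" where
  "lift_perp X p = frame_perp (X p) (vdz X p) (vdzbar X p) (trace_vec X p)"

text \<open>Passage from the real coordinate frame, in which the functional is defined, to the
  Wirtinger frame.\<close>

lemma span4_cong:
  assumes "a' = a" "b' = b + c" "c' = \<i> *s (b - c)" "d' = k *s (d :: complex ^ 'm)" "k \<noteq> 0"
  shows "vec.span {a', b', c', d'} = vec.span {a, b, c, d}"
proof (rule set_eqI)
  fix v
  show "v \<in> vec.span {a', b', c', d'} \<longleftrightarrow> v \<in> vec.span {a, b, c, d}"
    unfolding in_span4
  proof
    assume "\<exists>\<alpha> \<beta> \<gamma> \<delta>. v = \<alpha> *s a' + \<beta> *s b' + \<gamma> *s c' + \<delta> *s d'"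
    then obtain \<alpha> \<beta> \<gamma> \<delta> where v: "v = \<alpha> *s a' + \<beta> *s b' + \<gamma> *s c' + \<delta> *s d'" by blast
    have "v = \<alpha> *s a + (\<beta> + \<gamma> * \<i>) *s b + (\<beta> - \<gamma> * \<i>) *s c + (\<delta> * k) *s d"
      unfolding v assms by (simp add: vec_eq_iff algebra_simps)
    then show "\<exists>\<alpha> \<beta> \<gamma> \<delta>. v = \<alpha> *s a + \<beta> *s b + \<gamma> *s c + \<delta> *s d" by blast
  next
    assume "\<exists>\<alpha> \<beta> \<gamma> \<delta>. v = \<alpha> *s a + \<beta> *s b + \<gamma> *s c + \<delta> *s d"
    then obtain \<alpha> \<beta> \<gamma> \<delta> where v: "v = \<alpha> *s a + \<beta> *s b + \<gamma> *s c + \<delta> *s d" by blast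
    have "v = \<alpha> *s a' + ((\<beta> + \<gamma>) / 2) *s b' + (\<i> * (\<gamma> - \<beta>) / 2) *s c' + (\<delta> / k) *s d'"
      unfolding v assms using assms(5) by (simp add: vec_eq_iff field_simps)
    then show "\<exists>\<alpha> \<beta> \<gamma> \<delta>. v = \<alpha> *s a' + \<beta> *s b' + \<gamma> *s c' + \<delta> *s d'" by blast
  qed
qed

lemma immersion_frame:
  fixes g :: "complex \<Rightarrow> real ^ 'n"
  defines "X \<equiv> \<lambda>q. null_vec (g q)"
  assumes U: "open U" and imm: "immersion_on U g" and p: "p \<in> U"
  shows "complex_of_real (metric_det g p) = 4 * frame_det (vdz X p) (vdzbar X p)"
    and "metric_det g p > 0"
    and "null_frame (X p) (vdz X p) (vdzbar X p) (trace_vec X p)"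
    and "vdzbar X p = vcnj (vdz X p)" "vdzbar (vdzbar X) p = vcnj (vdz (vdz X) p)" "vcnj (vdzbar (vdz X) p) = vdzbar (vdz X) p"
proof -
  have sg: "smooth_on U g" and sph: "\<And>q. q \<in> U \<Longrightarrow> g q \<in> sphere 0 1" and inj: "inj (frechet_derivative g (at p))"
    using imm p by (auto simp: immersion_on_def)
  have sX: "smooth_on U X" unfolding X_def by (rule smooth_null_vec[OF U sg])
  have dg: "g differentiable at p" using smooth_on_differentiable[OF sg p] .
  have dX: "X differentiable at p" using smooth_on_differentiable[OF sX p] .
  let ?a = "vdz X p" and ?b = "vdzbar X p"
  have m: "mink (ddir v X p) (ddir w X p) = complex_of_real (metric g p v w)" for v w
    unfolding X_def by (rule mink_ddir_null_vec[OF dg])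
  have m11: "complex_of_real (metric g p 1 1) = mink ?a ?a + 2 * mink ?a ?b + mink ?b ?b"
    and mii: "complex_of_real (metric g p \<i> \<i>) = 2 * mink ?a ?b - mink ?a ?a - mink ?b ?b"
    and m1i: "complex_of_real (metric g p 1 \<i>) = \<i> * (mink ?a ?a - mink ?b ?b)"
    unfolding m[symmetric] ddir_1_i[OF dX] by (simp_all add: mink_commute[of ?b ?a] algebra_simps)
  show md: "complex_of_real (metric_det g p) = 4 * frame_det ?a ?b"
    unfolding metric_det_def of_real_diff of_real_mult of_real_power m11 mii m1i frame_det_def
    by (simp add: algebra_simps power2_eq_square)
  show pos: "metric_det g p > 0" using metric_det_pos_iff_inj[OF dg] inj by simp
  then have det: "frame_det ?a ?b \<noteq> 0" using md by (metis mult_zero_right of_real_eq_0_iff less_irrefl)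
  have n: "mink (X q) (X q) = 0" if "q \<in> U" for q
    using sph[OF that] by (simp add: X_def null_vec_mink norm_eq_1)
  note s1 = smooth_on_vdz[OF U sX]
  have n1: "mink (X q) (vdz X q) = 0" "mink (X q) (vdzbar X q) = 0" if "q \<in> U" for q
    using mink_const_derivative[OF U sX sX that n] by (simp_all add: mink_commute)
  have n2: "mink (vdz X p) (vdz X p) = - mink (X p) (vdz (vdz X) p)"
     "mink (vdzbar X p) (vdz X p) = - mink (X p) (vdzbar (vdz X) p)"
     "mink (vdzbar X p) (vdzbar X p) = - mink (X p) (vdzbar (vdzbar X) p)"
    using mink_const_derivative[OF U sX s1(1) p n1(1)] mink_const_derivative[OF U sX s1(2) p n1(2)] by auto
  have n2': "mink (X p) (vdz (vdz X) p) = - mink ?a ?a" "mink (X p) (vdzbar (vdz X) p) = - mink ?a ?b"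
     "mink (X p) (vdzbar (vdzbar X) p) = - mink ?b ?b"
    using n2 by (simp_all add: mink_commute)
  show "null_frame (X p) ?a ?b (trace_vec X p)"
    unfolding null_frame_def using det n[OF p] n1[OF p]
    by (simp add: trace_vec_def n2' frame_det_def algebra_simps power2_eq_square)
  have r0: "vcnj (X q) = X q" for q by (simp add: X_def null_vec_real)
  have r1: "vcnj (vdz X q) = vdzbar X q" if "q \<in> U" for q using vdzbar_real(1)[OF U sX that r0] by simp
  show "?b = vcnj ?a" using r1[OF p] by simp
  show "vdzbar (vdzbar X) p = vcnj (vdz (vdz X) p)" using vdzbar_real(1)[OF U s1(1) p r1] .
  show "vcnj (vdzbar (vdz X) p) = vdzbar (vdz X) p"
    using vdzbar_real(2)[OF U s1(1) p r1] vdz_vdzbar_commute[OF U p sX] by simp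
qed

lemma frame_perp_real:
  assumes "null_frame x a (vcnj a) m" "vcnj x = x" "vcnj m = m"
  shows "frame_perp x a (vcnj a) m (vcnj y) = vcnj (frame_perp x a (vcnj a) m y)"
proof -
  interpret null_frame x a "vcnj a" m by fact
  have d: "cnj (frame_det a (vcnj a)) = frame_det a (vcnj a)"
    by (simp add: frame_det_def mink_vcnj[symmetric] mink_commute del: mink_vcnj)
  have g: "cnj (mink a (vcnj a)) = mink a (vcnj a)"
    using mink_vcnj[of a "vcnj a"] mink_commute[of a "vcnj a"] by simp
  have t: "tangent_part a (vcnj a) (vcnj y) = vcnj (tangent_part a (vcnj a) y)" for y
    unfolding tangent_part_def by (simp add: d g mink_vcnj_left mink_commute[of "vcnj a" a] add.commute)
  have "vcnj (m - tangent_part a (vcnj a) m) = m - tangent_part a (vcnj a) m"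
    using t[of m] assms(3) by simp
  moreover from this have "cnj (mink (m - tangent_part a (vcnj a) m) (m - tangent_part a (vcnj a) m))
     = mink (m - tangent_part a (vcnj a) m) (m - tangent_part a (vcnj a) m)"
    by (metis mink_vcnj)
  ultimately have n: "vcnj (null_normal x a (vcnj a) m) = null_normal x a (vcnj a) m"
    unfolding null_normal_def by (simp only: vcnj_simps) (simp add: d assms(2))
  show ?thesis unfolding frame_perp_def t
    by (simp add: n assms(2) mink_vcnj_left)
qed

text \<open>When the coordinate is not conformal, the normal parts of X_zz and of X_{z zbar} both
  contribute, the latter with a minus sign. In the conformal case \<open>trace_vec\<close> is a
  multiple of X_{z zbar}, and that contribution is 0. The denominator is the area density.\<close>

lemma willmore_density_frame:
  fixes g :: "complex \<Rightarrow> real ^ 'n"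
  defines "X \<equiv> \<lambda>q. null_vec (g q)"
  assumes U: "open U" and imm: "immersion_on U g" and p: "p \<in> U"
  shows "willmore_density g p =
    Re (mink (lift_perp X p (vdz (vdz X) p)) (vcnj (lift_perp X p (vdz (vdz X) p)))
      - mink (lift_perp X p (vdzbar (vdz X) p)) (lift_perp X p (vdzbar (vdz X) p)))
    / sqrt (Re (4 * frame_det (vdz X p) (vdzbar X p)))"
proof -
  have Xp: "X p = null_vec (g p)" by (simp add: X_def)
  note fr = immersion_frame[OF U imm p, folded X_def, folded Xp]
  have sg: "smooth_on U g" using imm by (auto simp: immersion_on_def)
  have sX: "smooth_on U X" unfolding X_def by (rule smooth_null_vec[OF U sg])
  have dg: "g differentiable at p" using smooth_on_differentiable[OF sg p] .
  have dX: "X differentiable at q" if "q \<in> U" for q using smooth_on_differentiable[OF sX that] .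
  note sX1 = smooth_on_ddir[OF sX]
  have dX1: "ddir v X differentiable at p" for v using smooth_on_differentiable[OF sX1 p] .
  interpret null_frame "X p" "vdz X p" "vdzbar X p" "trace_vec X p" by (rule fr(3))
  let ?a = "vdz X p" and ?b = "vdzbar X p" and ?c = "vdz (vdz X) p" and ?d = "vdzbar (vdz X) p"
    and ?e = "vdzbar (vdzbar X) p"
  have XX: "null_vec \<circ> g = X" by (simp add: X_def o_def)
  have h0: "hess g p v w = ddir w (ddir v X) p" for v w by (simp add: hess_def dir_deriv_eq_ddir XX)
  have e1: "ddir 1 X q = vdz X q + vdzbar X q" "ddir \<i> X q = \<i> *s (vdz X q - vdzbar X q)" if "q \<in> U" for q
    using ddir_1_i[OF dX[OF that]] by auto
  note s1 = smooth_on_vdz[OF U sX]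
  have d1: "vdz X differentiable at p" "vdzbar X differentiable at p" "(\<lambda>q. vdz X q - vdzbar X q) differentiable at p"
    using s1 smooth_on_differentiable p smooth_on_diff[OF U s1] by blast+
  have com: "vdz (vdzbar X) p = ?d" using vdz_vdzbar_commute[OF U p sX] by simp
  have z1: "vdz (ddir 1 X) p = ?c + ?d" "vdzbar (ddir 1 X) p = ?d + ?e"
    "vdz (ddir \<i> X) p = \<i> *s (?c - ?d)" "vdzbar (ddir \<i> X) p = \<i> *s (?d - ?e)"
    by (simp_all only: vdz_cong[OF U p, of "ddir 1 X" "\<lambda>q. vdz X q + vdzbar X q", OF e1(1)]
        vdz_cong[OF U p, of "ddir \<i> X" "\<lambda>q. \<i> *s (vdz X q - vdzbar X q)", OF e1(2)]
        vdz_rules[OF d1(1,2)] vdz_rules1[OF d1(3)] com)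
  have h: "hess g p 1 1 = ?c + 2 *s ?d + ?e" "hess g p 1 \<i> = \<i> *s (?c - ?e)" "hess g p \<i> 1 = \<i> *s (?c - ?e)"
    "hess g p \<i> \<i> = - (?c - 2 *s ?d + ?e)"
    unfolding h0 ddir_1_i[OF dX1] z1 by (simp_all add: vec_eq_iff algebra_simps)
  have m: "mink (ddir v X p) (ddir w X p) = complex_of_real (metric g p v w)" for v w
    unfolding X_def by (rule mink_ddir_null_vec[OF dg])
  define E F G D where "E = mink ?a ?a" and "F = mink ?b ?b" and "G = mink ?a ?b" and "D = frame_det ?a ?b"
  have m11: "complex_of_real (metric g p 1 1) = E + 2 * G + F"
    and mii: "complex_of_real (metric g p \<i> \<i>) = 2 * G - E - F"
    and m1i: "complex_of_real (metric g p 1 \<i>) = \<i> * (E - F)"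
    unfolding m[symmetric] e1[OF p] E_def F_def G_def by (simp_all add: mink_commute[of ?b ?a] algebra_simps)
  have mneg: "metric g p (-1) w = - metric g p 1 w" "metric g p w (-1) = - metric g p w 1" "metric g p \<i> 1 = metric g p 1 \<i>" for w
    unfolding metric_def dir_deriv_eq_ddir by (simp_all add: ddir_complex[OF dg, of "-1"] inner_commute)
  define \<Delta> where "\<Delta> = metric_det g p"
  have \<Delta>: "complex_of_real \<Delta> = 4 * D" "\<Delta> > 0" using fr(1,2) by (simp_all add: \<Delta>_def D_def)
  have D0: "D \<noteq> 0" using det by (simp add: D_def)
  define P Q R where "P = metric g p \<i> \<i> / \<Delta>" and "Q = - metric g p 1 \<i> / \<Delta>" and "R = metric g p 1 1 / \<Delta>"
  have co: "cometric g p 1 1 = P" "cometric g p 1 \<i> = Q" "cometric g p \<i> 1 = Q" "cometric g p \<i> \<i> = R"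
    by (simp_all add: cometric_def P_def Q_def R_def \<Delta>_def[symmetric] mneg)
  have ne: "(1::complex) \<noteq> \<i>" "\<i> \<noteq> 1" by (simp_all add: complex_eq_iff)
  \<comment> \<open>\<open>trace_vec\<close> is the metric trace up to the factor \<open>D\<close>;
    being nonzero, this factor does not affect the span.\<close>
  have tr: "complex_of_real P *s hess g p 1 1 + complex_of_real (2 * Q) *s hess g p 1 \<i> + complex_of_real R *s hess g p \<i> \<i>
     = (1 / D) *s trace_vec X p"
  proof -
        have co': "complex_of_real P = (2 * G - E - F) / (4 * D)" "complex_of_real (2 * Q) = - 2 * (\<i> * (E - F)) / (4 * D)"
      "complex_of_real R = (E + 2 * G + F) / (4 * D)"
      unfolding P_def Q_def R_def by (simp_all add: m11 mii m1i \<Delta>)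
    have comp: "(2 * G - E - F) / (4 * D) * (c + 2 * d + e) + (- 2 * (\<i> * (E - F)) / (4 * D)) * (\<i> * (c - e))
       + (E + 2 * G + F) / (4 * D) * (- (c - 2 * d + e)) = (1 / D) * ((2 * G) * d - F * c - E * e)" for c d e
    proof -
      have "(2 * G - E - F) * (c + 2 * d + e) + (- 2 * (\<i> * (E - F))) * (\<i> * (c - e))
         + (E + 2 * G + F) * (- (c - 2 * d + e)) = 4 * ((2 * G) * d - F * c - E * e)"
        by (simp add: algebra_simps)
      moreover have "a1 / k * x1 + a2 / k * x2 + a3 / k * x3 = (a1 * x1 + a2 * x2 + a3 * x3) / k" for a1 a2 a3 x1 x2 x3 k :: complex
        by (simp add: add_divide_distrib)
      moreover have "4 * z / (4 * D) = (1 / D) * z" for z by simp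
      ultimately show ?thesis by metis
    qed
    show ?thesis unfolding h trace_vec_def E_def[symmetric] F_def[symmetric] G_def[symmetric] co'
      by (simp only: vec_eq_iff vector_add_component vector_minus_component vector_smult_component vector_uminus_component comp simp_thms)
  qed
  have sumh: "(\<Sum>v\<in>{1, \<i>}. \<Sum>w\<in>{1, \<i>}. complex_of_real (cometric g p v w) *s hess g p v w)
     = complex_of_real P *s hess g p 1 1 + complex_of_real (2 * Q) *s hess g p 1 \<i> + complex_of_real R *s hess g p \<i> \<i>"
    using ne by (simp add: co h(2,3) vec_eq_iff algebra_simps)
  have V: "induced_V g p = vec.span {X p, ?a, ?b, trace_vec X p}"
    unfolding induced_V_def sumh tr XX dir_deriv_eq_ddir
    by (rule span4_cong[OF _ e1[OF p] refl]) (use D0 in \<open>auto simp: X_def\<close>)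
  have tf: "tracefree_hess g p v w = lift_perp X p (hess g p v w)" for v w
    unfolding tracefree_hess_def V lift_perp_def by (rule perp_proj_frame)
  define A B C where "A = lift_perp X p ?c" and "B = lift_perp X p ?d" and "C = lift_perp X p ?e"
  note lin = frame_perp_linear[of "X p" ?a ?b "trace_vec X p", folded lift_perp_def]
    frame_perp_diff[of "X p" ?a ?b "trace_vec X p", folded lift_perp_def]
  have um: "lift_perp X p (- y) = - lift_perp X p y" for y using lin(2)[of "-1" y] by simp
  have H: "tracefree_hess g p 1 1 = A + 2 *s B + C" "tracefree_hess g p 1 \<i> = \<i> *s (A - C)"
    "tracefree_hess g p \<i> 1 = \<i> *s (A - C)" "tracefree_hess g p \<i> \<i> = - (A - 2 *s B + C)"
    unfolding tf h A_def B_def C_def by (simp_all only: lin um)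
  have Tm: "lift_perp X p (trace_vec X p) = 0" unfolding lift_perp_def by (rule frame_perp_self)
  have T: "complex_of_real P *s tracefree_hess g p 1 1 + complex_of_real (2 * Q) *s tracefree_hess g p 1 \<i> + complex_of_real R *s tracefree_hess g p \<i> \<i> = 0"
    unfolding tf lin(1,2)[symmetric] tr unfolding lin(2) Tm by simp
  have C: "C = vcnj A"
  proof -
    have "vcnj (trace_vec X p) = trace_vec X p"
      unfolding trace_vec_def fr(4,5) by (simp add: fr(6) mink_vcnj_left mink_commute[of "vcnj ?a" ?a] vec_eq_iff)
        (simp add: mink_def mult.commute algebra_simps)
    then show ?thesis unfolding A_def C_def lift_perp_def fr(5)
      unfolding fr(4) by (intro frame_perp_real) (use fr(3,4) in \<open>auto simp: X_def null_vec_real\<close>)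
  qed
  have "willmore_density g p = sqrt \<Delta> / 8 * (2 * (P * R - Q * Q) *
      Re (mink (tracefree_hess g p 1 \<i>) (tracefree_hess g p 1 \<i>) - mink (tracefree_hess g p 1 1) (tracefree_hess g p \<i> \<i>)))"
    unfolding tracefree_contraction[OF T, symmetric] willmore_density_def \<Delta>_def[symmetric]
    using ne by (simp add: co H(2,3) mink_commute[of C A] add_ac)
  also have "P * R - Q * Q = 1 / \<Delta>"
  proof -
    have "P * R - Q * Q = (metric g p \<i> \<i> * metric g p 1 1 - (metric g p 1 \<i>)\<^sup>2) / (\<Delta> * \<Delta>)"
      by (simp add: P_def Q_def R_def power2_eq_square diff_divide_distrib)
    also have "metric g p \<i> \<i> * metric g p 1 1 - (metric g p 1 \<i>)\<^sup>2 = \<Delta>" by (simp add: \<Delta>_def metric_det_def mult.commute)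
    finally show ?thesis using \<Delta>(2) by simp
  qed
  also have "mink (tracefree_hess g p 1 \<i>) (tracefree_hess g p 1 \<i>) - mink (tracefree_hess g p 1 1) (tracefree_hess g p \<i> \<i>)
     = 4 * (mink A C - mink B B)"
    unfolding H by (simp add: mink_commute[of C A] mink_commute[of B A] mink_commute[of C B] algebra_simps)
  also have "sqrt \<Delta> / 8 * (2 * (1 / \<Delta>) * Re (4 * (mink A C - mink B B))) = Re (mink A C - mink B B) / sqrt \<Delta>"
  proof -
    have "\<Delta> = sqrt \<Delta> * sqrt \<Delta>" "sqrt \<Delta> > 0" using \<Delta>(2) by simp_all
    moreover have "k / 8 * (2 * (1 / (k * k)) * (4 * z)) = z / k" if "k > 0" for k z :: real using that by (simp add: field_simps)
    moreover have "Re (4 * (mink A C - mink B B)) = 4 * Re (mink A C - mink B B)" by simp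
    ultimately show ?thesis by metis
  qed
  finally show ?thesis unfolding A_def B_def C[unfolded A_def] using \<Delta>(1)
    by (simp add: D_def[symmetric] \<Delta>(1)[symmetric])
qed

section \<open>The first variation of the Willmore functional\<close>

lemma Vbundle_scale_subset:
  assumes "open U" "p \<in> U" "smooth_on U c" "smooth_on U F"
  shows "Vbundle (\<lambda>q. c q *s F q) p \<subseteq> Vbundle F p"
proof -
  note sm = smooth_on_differentiable
  have 1: "vdz (\<lambda>q. c q *s F q) q = dz c q *s F q + c q *s vdz F q" 
    "vdzbar (\<lambda>q. c q *s F q) q = dzbar c q *s F q + c q *s vdzbar F q" if "q \<in> U" for q
    using vdz_scale[OF sm[OF assms(3) that] sm[OF assms(4) that]] by auto
  have s: "smooth_on U (dz c)" "smooth_on U (vdz F)" "smooth_on U (\<lambda>q. dz c q *s F q)" "smooth_on U (\<lambda>q. c q *s vdz F q)"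
    by (intro smooth_intros assms)+
  note d = s[THEN sm, OF assms(2)] assms(3,4)[THEN sm, OF assms(2)]
  have "vdzbar (vdz (\<lambda>q. c q *s F q)) p = vdzbar (\<lambda>q. dz c q *s F q + c q *s vdz F q) p"
    by (rule vdz_cong[OF assms(1,2) 1(1)])
  then have 2: "vdzbar (vdz (\<lambda>q. c q *s F q)) p = dzbar (dz c) p *s F p + dz c p *s vdzbar F p
     + (dzbar c p *s vdz F p + c p *s vdzbar (vdz F) p)"
    by (simp add: vdz_rules(2)[OF d(3,4)] vdz_scale(2)[OF d(1,6)] vdz_scale(2)[OF d(5,2)])
  have b: "F p \<in> Vbundle F p" "vdz F p \<in> Vbundle F p" "vdzbar F p \<in> Vbundle F p" "vdzbar (vdz F) p \<in> Vbundle F p"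
    by (auto simp: Vbundle_def vec.span_base)
  note cl = vec.span_add[folded Vbundle_def] vec.span_scale[folded Vbundle_def]
  have sub: "vec.subspace (Vbundle F p)" by (simp add: Vbundle_def vec.subspace_span)
  show ?thesis unfolding Vbundle_def[of "\<lambda>q. c q *s F q"]
    by (rule vec.span_minimal[OF _ sub])
       (use b in \<open>auto simp: 1[OF assms(2)] 2 intro!: vec.subspace_add[OF sub] vec.subspace_scale[OF sub]\<close>)
qed

lemma Vbundle_cong:
  assumes "open U" "p \<in> U" "\<And>q. q \<in> U \<Longrightarrow> F q = G q"
  shows "Vbundle F p = Vbundle G p"
proof -
  have 1: "vdz F q = vdz G q" "vdzbar F q = vdzbar G q" if "q \<in> U" for q
    by (rule vdz_cong[OF assms(1) that assms(3)], assumption)+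
  have "vdzbar (vdz F) p = vdzbar (vdz G) p" by (rule vdz_cong(2)[OF assms(1,2) 1(1)])
  then show ?thesis using 1[OF assms(2)] assms(2,3) by (simp add: Vbundle_def)
qed

text \<open>The reverse inclusion is the inclusion already shown, applied to the inverse
  factor.\<close>

lemma Vbundle_scale:
  assumes "open U" "p \<in> U" "smooth_on U c" "smooth_on U F" "\<And>q. q \<in> U \<Longrightarrow> c q \<noteq> 0"
  shows "Vbundle (\<lambda>q. c q *s F q) p = Vbundle F p"
proof
  show "Vbundle (\<lambda>q. c q *s F q) p \<subseteq> Vbundle F p" by (rule Vbundle_scale_subset[OF assms(1-4)])
  have "Vbundle (\<lambda>q. inverse (c q) *s (c q *s F q)) p \<subseteq> Vbundle (\<lambda>q. c q *s F q) p"
    by (rule Vbundle_scale_subset[OF assms(1,2)]) (intro smooth_intros assms; simp add: assms)+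
  moreover have "Vbundle (\<lambda>q. inverse (c q) *s (c q *s F q)) p = Vbundle F p"
    by (rule Vbundle_cong[OF assms(1,2)]) (simp add: assms(5))
  ultimately show "Vbundle F p \<subseteq> Vbundle (\<lambda>q. c q *s F q) p" by simp
qed

lemma span4_scale_last:
  assumes "k \<noteq> 0"
  shows "vec.span {a, b, c, k *s d} = vec.span {a, b, c, d :: complex ^ 'm}"
proof (rule set_eqI)
  fix v
  show "v \<in> vec.span {a, b, c, k *s d} \<longleftrightarrow> v \<in> vec.span {a, b, c, d}"
    unfolding in_span4
  proof
    assume "\<exists>\<alpha> \<beta> \<gamma> \<delta>. v = \<alpha> *s a + \<beta> *s b + \<gamma> *s c + \<delta> *s (k *s d)"
    then obtain \<alpha> \<beta> \<gamma> \<delta> where "v = \<alpha> *s a + \<beta> *s b + \<gamma> *s c + \<delta> *s (k *s d)" by blast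
    then have "v = \<alpha> *s a + \<beta> *s b + \<gamma> *s c + (\<delta> * k) *s d" by simp
    then show "\<exists>\<alpha> \<beta> \<gamma> \<delta>. v = \<alpha> *s a + \<beta> *s b + \<gamma> *s c + \<delta> *s d" by blast
  next
    assume "\<exists>\<alpha> \<beta> \<gamma> \<delta>. v = \<alpha> *s a + \<beta> *s b + \<gamma> *s c + \<delta> *s d"
    then obtain \<alpha> \<beta> \<gamma> \<delta> where "v = \<alpha> *s a + \<beta> *s b + \<gamma> *s c + \<delta> *s d" by blast
    then have "v = \<alpha> *s a + \<beta> *s b + \<gamma> *s c + (\<delta> / k) *s (k *s d)" using assms by simp
    then show "\<exists>\<alpha> \<beta> \<gamma> \<delta>. v = \<alpha> *s a + \<beta> *s b + \<gamma> *s c + \<delta> *s (k *s d)" by blast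
  qed
qed

text \<open>Wirtinger derivatives in the plane at fixed time, taken on the product with time so that
  they are visibly smooth in both variables and commute with the time derivative.\<close>

definition pz :: "(real \<times> complex \<Rightarrow> complex ^ 'm) \<Rightarrow> real \<times> complex \<Rightarrow> complex ^ 'm" where
  "pz G y = (1/2) *s (ddir (0, 1) G y - \<i> *s ddir (0, \<i>) G y)"

definition pzb :: "(real \<times> complex \<Rightarrow> complex ^ 'm) \<Rightarrow> real \<times> complex \<Rightarrow> complex ^ 'm" where
  "pzb G y = (1/2) *s (ddir (0, 1) G y + \<i> *s ddir (0, \<i>) G y)"

lemma pz_eq:
  assumes "G differentiable at (t, p)"
  shows "pz G (t, p) = vdz (\<lambda>q. G (t, q)) p" "pzb G (t, p) = vdzbar (\<lambda>q. G (t, q)) p"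
proof -
  have "((\<lambda>q. (t, q)) has_derivative (\<lambda>v. (0, v))) (at p)" by (auto intro!: derivative_eq_intros)
  from has_derivative_compose[OF this has_derivative_ddir[OF assms]]
  have "(\<lambda>q. G (t, q)) differentiable at p" unfolding differentiable_def by blast
  then show "pz G (t, p) = vdz (\<lambda>q. G (t, q)) p" "pzb G (t, p) = vdzbar (\<lambda>q. G (t, q)) p"
    by (simp_all add: vdz_eq vdzbar_eq pz_def pzb_def ddir_Pair_right[OF assms])
qed

lemma smooth_on_pz [smooth_intros]:
  "open S \<Longrightarrow> smooth_on S G \<Longrightarrow> smooth_on S (pz G)" "open S \<Longrightarrow> smooth_on S G \<Longrightarrow> smooth_on S (pzb G)"
  unfolding pz_def[abs_def] pzb_def[abs_def] by (intro smooth_intros smooth_on_ddir; simp)+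

lemma ddir_pz:
  assumes "open S" "smooth_on S G" "y \<in> S"
  shows "ddir v (pz G) y = pz (ddir v G) y" "ddir v (pzb G) y = pzb (ddir v G) y"
proof -
  have bl: "bounded_linear (\<lambda>x::complex^'a. k *s x)" for k
    using bounded_bilinear.bounded_linear_right[OF bounded_bilinear_vscale] .
  note hd = smooth_on_has_derivative[OF smooth_on_ddir[OF assms(2)] assms(3)]
  have "((\<lambda>y. (1/2) *s (ddir (0, 1) G y - \<i> *s ddir (0, \<i>) G y)) has_derivative
     (\<lambda>v. (1/2) *s (ddir v (ddir (0, 1) G) y - \<i> *s ddir v (ddir (0, \<i>) G) y))) (at y)"
    by (intro bounded_linear.has_derivative[OF bl] has_derivative_diff hd)
  from ddir_eqI[OF this, of v] show "ddir v (pz G) y = pz (ddir v G) y"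
    by (simp only: pz_def[abs_def] ddir_commute[OF assms(1,3,2), of v "(0, 1)"] ddir_commute[OF assms(1,3,2), of v "(0, \<i>)"])
  have "((\<lambda>y. (1/2) *s (ddir (0, 1) G y + \<i> *s ddir (0, \<i>) G y)) has_derivative
     (\<lambda>v. (1/2) *s (ddir v (ddir (0, 1) G) y + \<i> *s ddir v (ddir (0, \<i>) G) y))) (at y)"
    by (intro bounded_linear.has_derivative[OF bl] has_derivative_add hd)
  from ddir_eqI[OF this, of v] show "ddir v (pzb G) y = pzb (ddir v G) y"
    by (simp only: pzb_def[abs_def] ddir_commute[OF assms(1,3,2), of v "(0, 1)"] ddir_commute[OF assms(1,3,2), of v "(0, \<i>)"])
qed

lemma smooth_on_frame_det: "open S \<Longrightarrow> smooth_on S a \<Longrightarrow> smooth_on S b \<Longrightarrow> smooth_on S (\<lambda>y. frame_det (a y) (b y))"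
  unfolding frame_det_def by (intro smooth_intros)

lemma smooth_on_frame_coeffs:
  assumes "open S" "smooth_on S x" "smooth_on S a" "smooth_on S b" "smooth_on S m" "smooth_on S y"
    "\<And>q. q \<in> S \<Longrightarrow> frame_det (a q) (b q) \<noteq> 0"
  shows "smooth_on S (\<lambda>q. (mink (a q) (b q) * mink (y q) (b q) - mink (b q) (b q) * mink (y q) (a q)) / frame_det (a q) (b q))"
    "smooth_on S (\<lambda>q. (mink (a q) (b q) * mink (y q) (a q) - mink (a q) (a q) * mink (y q) (b q)) / frame_det (a q) (b q))"
    "smooth_on S (\<lambda>q. null_normal (x q) (a q) (b q) (m q))"
    "smooth_on S (\<lambda>q. frame_perp (x q) (a q) (b q) (m q) (y q))"
proof -
  note d = smooth_on_frame_det[OF assms(1,3,4)]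
  have t: "smooth_on S (\<lambda>q. tangent_part (a q) (b q) (z q))" if "smooth_on S z" for z
    unfolding tangent_part_def by (intro smooth_intros assms that d; simp add: assms)
  show "smooth_on S (\<lambda>q. (mink (a q) (b q) * mink (y q) (b q) - mink (b q) (b q) * mink (y q) (a q)) / frame_det (a q) (b q))"
    "smooth_on S (\<lambda>q. (mink (a q) (b q) * mink (y q) (a q) - mink (a q) (a q) * mink (y q) (b q)) / frame_det (a q) (b q))"
    by (intro smooth_intros assms d; simp add: assms)+
  show n: "smooth_on S (\<lambda>q. null_normal (x q) (a q) (b q) (m q))"
    unfolding null_normal_def by (intro smooth_intros assms t d; simp add: assms)
  show "smooth_on S (\<lambda>q. frame_perp (x q) (a q) (b q) (m q) (y q))"
    unfolding frame_perp_def by (intro smooth_intros assms n t; simp)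
qed

abbreviation dt :: "(real \<times> complex \<Rightarrow> 'b::real_normed_vector) \<Rightarrow> real \<times> complex \<Rightarrow> 'b" where
  "dt \<equiv> ddir (1, 0)"

lemma time_derivative:
  assumes "smooth_on S G" "(t, p) \<in> S"
  shows "((\<lambda>t. G (t, p)) has_vector_derivative dt G (t, p)) (at t)"
proof -
  have i: "((\<lambda>t. (t, p)) has_derivative (\<lambda>h. (h, 0))) (at t)" by (auto intro!: derivative_eq_intros)
  have hd: "(G has_derivative (\<lambda>v. ddir v G (t, p))) (at (t, p))" by (rule smooth_on_has_derivative[OF assms])
  have l: "linear (\<lambda>v. ddir v G (t, p))" using hd has_derivative_linear by blast
  have e: "h *\<^sub>R (1, 0) = (h, 0)" for h :: real by simp
  have sc: "ddir (h, 0) G (t, p) = h *\<^sub>R dt G (t, p)" for h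
    using linear_scale[OF l, of h "(1, 0)"] unfolding e .
  show ?thesis unfolding has_vector_derivative_def
    by (rule has_derivative_eq_rhs[OF has_derivative_compose[OF i hd]]) (rule ext, rule sc)
qed

context conformal_surface begin

text \<open>The functional is written with the lift (1, f), the invariants with \<open>Y\<close>;
  this is the factor between the two, as \<open>null_vec (f q) = rr q *s Y q\<close>.\<close>

definition "rr q = inverse (Y q $ None)"
lemma Y0:
  assumes "q \<in> U"
  shows "cnj (Y q $ None) = Y q $ None" "Y q $ None \<noteq> 0" "Re (Y q $ None) > 0" "null_vec (f q) = rr q *s Y q"
proof -
  obtain c where c: "0 < c" "Y q = complex_of_real c *s null_vec (f q)" using Y_pos[OF assms] by blast
  have y: "Y q $ None = complex_of_real c" by (simp add: c(2) null_vec_def)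
  show "cnj (Y q $ None) = Y q $ None" "Y q $ None \<noteq> 0" "Re (Y q $ None) > 0" using c(1) by (simp_all add: y)
  show "null_vec (f q) = rr q *s Y q" unfolding rr_def y using c by (simp add: c(2))
qed

lemma smooth_rr: "smooth_on U rr"
  unfolding rr_def[abs_def] by (intro smooth_intros open_U smooth_Y) (rule Y0)

lemma rr: "q \<in> U \<Longrightarrow> cnj (rr q) = rr q" "q \<in> U \<Longrightarrow> rr q \<noteq> 0"
  using Y0 by (simp_all add: rr_def)

text \<open>Used with \<open>F\<close> as \<open>Y\<close> for the lift at time 0 and with
  \<open>F\<close> as the normalized velocity for its time derivative. Both expansions have the same
  coefficients, which is why the derivatives of \<open>rr\<close> eventually cancel.\<close>

lemma rr_product:
  assumes F: "smooth_on U F" and p: "p \<in> U" and G: "\<And>q. q \<in> U \<Longrightarrow> G q = rr q *s F q"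
  shows "vdz G p = dz rr p *s F p + rr p *s vdz F p" "vdzbar G p = cnj (dz rr p) *s F p + rr p *s vdzbar F p"
    "vdz (vdz G) p = dz (dz rr) p *s F p + (2 * dz rr p) *s vdz F p + rr p *s vdz (vdz F) p"
proof -
  note sm = smooth_on_differentiable
  have cr: "dzbar rr q = cnj (dz rr q)" if "q \<in> U" for q
    using dz_cong(2)[OF open_U that, of "\<lambda>q. cnj (rr q)" rr] rr(1) dz_rules1(4)[OF sm[OF smooth_rr that]] by simp
  have 1: "vdz G q = dz rr q *s F q + rr q *s vdz F q" "vdzbar G q = cnj (dz rr q) *s F q + rr q *s vdzbar F q" if "q \<in> U" for q
    using vdz_cong[OF open_U that, of G "\<lambda>q. rr q *s F q", OF G] vdz_scale[OF sm[OF smooth_rr that] sm[OF F that]] cr[OF that] by auto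
  show "vdz G p = dz rr p *s F p + rr p *s vdz F p" "vdzbar G p = cnj (dz rr p) *s F p + rr p *s vdzbar F p"
    using 1[OF p] by auto
  have s: "smooth_on U (dz rr)" "smooth_on U (vdz F)" "smooth_on U (\<lambda>q. dz rr q *s F q)" "smooth_on U (\<lambda>q. rr q *s vdz F q)"
    by (intro smooth_intros open_U smooth_rr F)+
  note d = s[THEN sm, OF p] sm[OF smooth_rr p] sm[OF F p]
  have "vdz (vdz G) p = vdz (\<lambda>q. dz rr q *s F q + rr q *s vdz F q) p" by (rule vdz_cong[OF open_U p 1(1)])
  then show "vdz (vdz G) p = dz (dz rr) p *s F p + (2 * dz rr p) *s vdz F p + rr p *s vdz (vdz F) p"
    by (simp add: vdz_rules(1)[OF d(3,4)] vdz_scale(1)[OF d(1,6)] vdz_scale(1)[OF d(5,2)])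
       (simp add: vec_eq_iff algebra_simps)
qed

end

section \<open>The derivative of the density at time 0\<close>

locale surface_variation = conformal_surface U f Y N \<kappa> s
  for U :: "complex set" and f :: "complex \<Rightarrow> real ^ 'n" and Y N \<kappa> :: "complex \<Rightarrow> 'n mvec" and s +
  fixes K :: "complex set" and \<epsilon> :: real and \<phi> :: "real \<Rightarrow> complex \<Rightarrow> real ^ 'n"
  assumes var: "variation U f K \<epsilon> \<phi>"
begin

abbreviation "S \<equiv> {-\<epsilon><..<\<epsilon>} \<times> U"

lemma open_S: "open S" by (intro open_Times open_U) auto

lemma eps: "0 < \<epsilon>" and K: "compact K" "K \<subseteq> U"
  and imm: "t \<in> {-\<epsilon><..<\<epsilon>} \<Longrightarrow> immersion_on U (\<phi> t)"
  and \<phi>0: "p \<in> U \<Longrightarrow> \<phi> 0 p = f p"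
  and \<phi>K: "t \<in> {-\<epsilon><..<\<epsilon>} \<Longrightarrow> p \<in> U - K \<Longrightarrow> \<phi> t p = f p"
  using var by (auto simp: variation_def)

definition "XX y = null_vec (\<phi> (fst y) (snd y))"

lemma smooth_XX: "smooth_on S XX"
proof -
  have "smooth_on S (\<lambda>y. \<phi> (fst y) (snd y))" using var by (simp add: variation_def case_prod_unfold)
  from smooth_null_vec[OF open_S this] show ?thesis by (simp add: XX_def[abs_def])
qed

abbreviation "xa \<equiv> pz XX"
abbreviation "xb \<equiv> pzb XX"
abbreviation "xc \<equiv> pz (pz XX)"
abbreviation "xd \<equiv> pzb (pz XX)"
abbreviation "xe \<equiv> pzb (pzb XX)"

definition "tr y = (2 * mink (xa y) (xb y)) *s xd y - mink (xb y) (xb y) *s xc y - mink (xa y) (xa y) *s xe y"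
definition "AA y = frame_perp (XX y) (xa y) (xb y) (tr y) (xc y)"
definition "BB y = frame_perp (XX y) (xa y) (xb y) (tr y) (xd y)"
definition "dens y = Re (mink (AA y) (vcnj (AA y)) - mink (BB y) (BB y)) / sqrt (Re (4 * frame_det (xa y) (xb y)))"

lemma jets:
  assumes "(t, p) \<in> S"
  shows "xa (t, p) = vdz (\<lambda>q. XX (t, q)) p" "xb (t, p) = vdzbar (\<lambda>q. XX (t, q)) p"
    "xc (t, p) = vdz (vdz (\<lambda>q. XX (t, q))) p" "xd (t, p) = vdzbar (vdz (\<lambda>q. XX (t, q))) p"
    "xe (t, p) = vdzbar (vdzbar (\<lambda>q. XX (t, q))) p"
proof -
  have p: "p \<in> U" and tq: "\<And>q. q \<in> U \<Longrightarrow> (t, q) \<in> S" using assms by auto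
  note d = smooth_on_differentiable[OF _ tq]
  have 1: "xa (t, q) = vdz (\<lambda>q. XX (t, q)) q" "xb (t, q) = vdzbar (\<lambda>q. XX (t, q)) q" if "q \<in> U" for q
    using pz_eq[OF d[OF smooth_XX that]] by auto
  show "xa (t, p) = vdz (\<lambda>q. XX (t, q)) p" "xb (t, p) = vdzbar (\<lambda>q. XX (t, q)) p" using 1[OF p] by auto
  have s: "smooth_on S xa" "smooth_on S xb" by (intro smooth_intros open_S smooth_XX)+
  show "xc (t, p) = vdz (vdz (\<lambda>q. XX (t, q))) p" "xd (t, p) = vdzbar (vdz (\<lambda>q. XX (t, q))) p"
    "xe (t, p) = vdzbar (vdzbar (\<lambda>q. XX (t, q))) p"
    unfolding pz_eq[OF d[OF s(1) p]] pz_eq[OF d[OF s(2) p]]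
    by (rule vdz_cong[OF open_U p 1(1)] vdz_cong[OF open_U p 1(2)], assumption)+
qed

lemma dens_eq:
  assumes "(t, p) \<in> S"
  shows "willmore_density (\<phi> t) p = dens (t, p)"
    and "Re (4 * frame_det (xa (t, p)) (xb (t, p))) > 0" "frame_det (xa (t, p)) (xb (t, p)) \<noteq> 0"
    and "null_frame (XX (t, p)) (xa (t, p)) (xb (t, p)) (tr (t, p))"
proof -
  have t: "t \<in> {-\<epsilon><..<\<epsilon>}" and p: "p \<in> U" using assms by auto
  have X: "XX (t, q) = null_vec (\<phi> t q)" for q by (simp add: XX_def)
  note j = jets[OF assms, unfolded X]
  have tr: "tr (t, p) = trace_vec (\<lambda>q. null_vec (\<phi> t q)) p" unfolding tr_def trace_vec_def j ..
  show "willmore_density (\<phi> t) p = dens (t, p)"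
    unfolding willmore_density_frame[OF open_U imm[OF t] p] dens_def AA_def BB_def lift_perp_def j tr X ..
  note fr = immersion_frame[OF open_U imm[OF t] p]
  show pos: "Re (4 * frame_det (xa (t, p)) (xb (t, p))) > 0"
    unfolding j fr(1)[symmetric] using fr(2) by simp
  then show "frame_det (xa (t, p)) (xb (t, p)) \<noteq> 0" by auto
  show "null_frame (XX (t, p)) (xa (t, p)) (xb (t, p)) (tr (t, p))" unfolding j tr X by (rule fr(3))
qed

lemma smooth_frame:
  "smooth_on S xa" "smooth_on S xb" "smooth_on S xc" "smooth_on S xd" "smooth_on S tr" "smooth_on S AA" "smooth_on S BB"
proof -
  show s: "smooth_on S xa" "smooth_on S xb" "smooth_on S xc" "smooth_on S xd" "smooth_on S tr"
    unfolding tr_def[abs_def] by (intro smooth_intros open_S smooth_XX)+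
  have nz: "frame_det (xa q) (xb q) \<noteq> 0" if "q \<in> S" for q using dens_eq(3) that by (cases q) blast
  show "smooth_on S AA" unfolding AA_def[abs_def]
    by (rule smooth_on_frame_coeffs(4)[OF open_S smooth_XX s(1,2,5,3) nz])
  show "smooth_on S BB" unfolding BB_def[abs_def]
    by (rule smooth_on_frame_coeffs(4)[OF open_S smooth_XX s(1,2,5,4) nz])
qed

lemma smooth_dens: "smooth_on S dens"
proof -
  have pos: "Re (4 * frame_det (xa q) (xb q)) > 0" if "q \<in> S" for q using dens_eq(2) that by (cases q) blast
  show ?thesis unfolding dens_def[abs_def]
    by (intro smooth_intros smooth_on_frame_det open_S smooth_frame) (use pos in \<open>force+\<close>)
qed

text \<open>The velocity of the lift (1, \<phi>) at time 0, rescaled by the factor that takes this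
  lift to \<open>Y\<close>.\<close>

definition "vv q = (Y q $ None) *s dt XX (0, q)"

abbreviation "hopf_variation p \<equiv> mink (vdz (vdz vv) p + (s p / 2) *s vv p) (vcnj (\<kappa> p))"

lemma in_S0: "q \<in> U \<Longrightarrow> (0, q) \<in> S" using eps by auto

lemma XX0: "q \<in> U \<Longrightarrow> XX (0, q) = rr q *s Y q"
  by (simp add: XX_def \<phi>0 Y0)

lemma smooth_at_0: "smooth_on S G \<Longrightarrow> smooth_on U (\<lambda>q. G (0, q))"
  for G :: "real \<times> complex \<Rightarrow> 'b::real_normed_vector"
proof (rule smooth_on_compose[OF open_U open_S])
  show "smooth_on U (\<lambda>q. (0::real, q))"
    by (rule smooth_on_linear_comp[OF bounded_linear_Pair[OF bounded_linear_zero bounded_linear_ident] open_U smooth_on_ident[OF open_U]])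
qed (use in_S0 in auto)

lemma dXX: "q \<in> U \<Longrightarrow> dt XX (0, q) = rr q *s vv q"
  using Y0 by (simp add: vv_def rr_def)

lemma smooth_vv: "smooth_on U vv"
  unfolding vv_def[abs_def] by (intro smooth_intros open_U smooth_Y smooth_at_0[OF smooth_on_ddir[OF smooth_XX]])

lemma bounded_linear_vcnj: "bounded_linear (vcnj :: complex ^ 'm \<Rightarrow> complex ^ 'm)"
  unfolding linear_conv_bounded_linear[symmetric] by (rule linearI) (simp_all add: vec_eq_iff)

lemma vv_real: "q \<in> U \<Longrightarrow> vcnj (vv q) = vv q"
proof -
  assume q: "q \<in> U"
  have "((\<lambda>y. vcnj (XX y)) has_derivative (\<lambda>v. vcnj (ddir v XX (0, q)))) (at (0, q))"
    by (rule bounded_linear.has_derivative[OF bounded_linear_vcnj smooth_on_has_derivative[OF smooth_XX in_S0[OF q]]])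
  from ddir_eqI[OF this, of "(1, 0)"]
  have d: "dt (\<lambda>y. vcnj (XX y)) (0, q) = vcnj (dt XX (0, q))" .
  have "(\<lambda>y. vcnj (XX y)) = XX" by (rule ext) (simp add: XX_def null_vec_real)
  with d have "dt XX (0, q) = vcnj (dt XX (0, q))" by metis
  then show ?thesis using Y0(1)[OF q] by (simp add: vv_def)
qed

lemma vv_Y: "q \<in> U \<Longrightarrow> mink (vv q) (Y q) = 0"
proof -
  assume q: "q \<in> U"
  let ?d = "dt XX (0, q)"
  have "((\<lambda>t. mink (XX (t, q)) (XX (t, q))) has_vector_derivative (mink (XX (0, q)) ?d + mink ?d (XX (0, q)))) (at 0)"
    by (intro bounded_bilinear.has_vector_derivative[OF bounded_bilinear_mink] time_derivative[OF smooth_XX in_S0[OF q]])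
  moreover have "((\<lambda>t. mink (XX (t, q)) (XX (t, q))) has_vector_derivative 0) (at 0)"
  proof (rule has_vector_derivative_transform_within_open[of "\<lambda>t. 0" _ _ "{-\<epsilon><..<\<epsilon>}"])
    fix t assume "t \<in> {-\<epsilon><..<\<epsilon>}"
    then have "\<phi> t q \<in> sphere 0 1" using imm q by (auto simp: immersion_on_def)
    then show "0 = mink (XX (t, q)) (XX (t, q))" using null_vec_null by (simp add: XX_def)
  qed (use eps in auto)
  ultimately have "mink (XX (0, q)) ?d + mink ?d (XX (0, q)) = 0" by (rule vector_derivative_unique_at)
  then have "mink ?d (XX (0, q)) = 0" by (simp add: mink_commute)
  then show ?thesis using rr[OF q] by (simp add: XX0[OF q] dXX[OF q])
qed

lemma vv_support: "q \<in> U - K \<Longrightarrow> vv q = 0"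
proof -
  assume q: "q \<in> U - K"
  have "((\<lambda>t. XX (t, q)) has_vector_derivative 0) (at 0)"
    by (rule has_vector_derivative_transform_within_open[of "\<lambda>t. null_vec (f q)" _ _ "{-\<epsilon><..<\<epsilon>}"])
       (use eps \<phi>K q in \<open>auto simp: XX_def\<close>)
  moreover have "((\<lambda>t. XX (t, q)) has_vector_derivative dt XX (0, q)) (at 0)"
    by (rule time_derivative[OF smooth_XX in_S0]) (use q in auto)
  ultimately have "dt XX (0, q) = 0" using vector_derivative_unique_at by blast
  then show ?thesis by (simp add: vv_def)
qed

text \<open>Two contributions survive: the change of \<open>AA\<close>, paired with
  \<open>\<kappa>\<close>, and the change of the area factor, multiplied by \<open>nn\<close>. The
  final form is the conjugate one because \<open>variation_identity\<close> is stated in zbar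
  derivatives.\<close>

lemma dens_derivative:
  assumes p: "p \<in> U"
  shows "dt dens (0, p) =
    Re (2 * mink (vdzbar (vdzbar vv) p + (cnj (s p) / 2) *s vv p) (\<kappa> p) - 4 * nn p * mink (vdzbar vv p) (Yz p))"
proof -
  note S0 = in_S0[OF p]
  let ?y = "(0 :: real, p)"
  define R Rz Rzz where "R = rr p" and "Rz = dz rr p" and "Rzz = dz (dz rr) p"
  have R: "cnj R = R" "R \<noteq> 0" using rr[OF p] by (simp_all add: R_def)
  note j = jets[OF S0]
  have x0: "XX ?y = R *s Y p" by (simp add: XX0[OF p] R_def)
  note pr = rr_product[OF smooth_Y p, of "\<lambda>q. XX (0, q)", OF XX0]
  have a0: "xa ?y = Rz *s Y p + R *s Yz p" unfolding j R_def Rz_def by (rule pr(1))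
  have b0: "xb ?y = cnj Rz *s Y p + R *s Yb p" unfolding j R_def Rz_def by (rule pr(2))
  have c0: "xc ?y = Rzz *s Y p + (2 * Rz) *s Yz p + R *s Yzz p" unfolding j R_def Rz_def Rzz_def by (rule pr(3))
  define dX where "dX = dt XX"
  have sdX: "smooth_on S dX" unfolding dX_def by (rule smooth_on_ddir[OF smooth_XX])
  have dX0: "\<And>q. q \<in> U \<Longrightarrow> dX (0, q) = rr q *s vv q" by (simp add: dX_def dXX)
  have x': "dt XX ?y = R *s vv p" using dXX[OF p] by (simp add: R_def)
  have sa: "smooth_on S (pz dX)" "smooth_on S (pz XX)" by (intro smooth_intros open_S sdX smooth_XX)+
  note sd = smooth_on_differentiable
  have pa: "pz dX (0, q) = vdz (\<lambda>q. dX (0, q)) q" "pzb dX (0, q) = vdzbar (\<lambda>q. dX (0, q)) q" if "q \<in> U" for q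
    using pz_eq[OF sd[OF sdX in_S0[OF that]]] by auto
  have da: "dt xa (0, q) = pz dX (0, q)" if "(0, q) \<in> S" for q
    unfolding dX_def by (rule ddir_pz(1)[OF open_S smooth_XX that])
  have a': "dt xa ?y = Rz *s vv p + R *s vdz vv p"
    unfolding da[OF S0] pa[OF p] R_def Rz_def by (rule rr_product[OF smooth_vv p dX0])
  have b': "dt xb ?y = cnj Rz *s vv p + R *s vdzbar vv p"
    unfolding ddir_pz(2)[OF open_S smooth_XX S0] dX_def[symmetric] pa[OF p] R_def Rz_def by (rule rr_product[OF smooth_vv p dX0])
  have c': "dt xc ?y = Rzz *s vv p + (2 * Rz) *s vdz vv p + R *s vdz (vdz vv) p"
  proof -
    have "dt xc ?y = pz (dt xa) ?y" by (rule ddir_pz(1)[OF open_S sa(2) S0])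
    also have "\<dots> = vdz (\<lambda>q. dt xa (0, q)) p"
      by (rule pz_eq(1)[OF sd[OF smooth_on_ddir[OF sa(2)] S0]])
    also have "\<dots> = vdz (vdz (\<lambda>q. dX (0, q))) p"
      by (rule vdz_cong[OF open_U p]) (simp add: da[OF in_S0] pa)
    also have "\<dots> = Rzz *s vv p + (2 * Rz) *s vdz vv p + R *s vdz (vdz vv) p"
      unfolding R_def Rz_def Rzz_def by (rule rr_product[OF smooth_vv p dX0])
    finally show ?thesis .
  qed
  note mk = mink_all[OF p] mink_2[OF p]
  have E0: "mink (xa ?y) (xa ?y) = 0" "mink (xb ?y) (xb ?y) = 0" and G0: "mink (xa ?y) (xb ?y) = R\<^sup>2 / 2"
    unfolding a0 b0 by (simp_all add: mk power2_eq_square)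
  have fd0: "frame_det (xa ?y) (xb ?y) = (R\<^sup>2 / 2)\<^sup>2" by (simp add: frame_det_def E0 G0)
  interpret fr: null_frame "XX ?y" "xa ?y" "xb ?y" "tr ?y" by (rule dens_eq(4)[OF S0])
  have V: "vec.span {XX ?y, xa ?y, xb ?y, tr ?y} = Vbundle Y p"
  proof -
    have tr0: "tr ?y = (R\<^sup>2) *s xd ?y" by (simp add: tr_def E0 G0)
    have "vec.span {XX ?y, xa ?y, xb ?y, tr ?y} = Vbundle (\<lambda>q. XX (0, q)) p"
      unfolding tr0 span4_scale_last[OF power_not_zero[OF R(2)]] Vbundle_def j ..
    also have "\<dots> = Vbundle (\<lambda>q. rr q *s Y q) p" by (rule Vbundle_cong[OF open_U p XX0])
    also have "\<dots> = Vbundle Y p" by (rule Vbundle_scale[OF open_U p smooth_rr smooth_Y rr(2)])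
    finally show ?thesis .
  qed
  have fp: "frame_perp (XX ?y) (xa ?y) (xb ?y) (tr ?y) w = normal_part p w" for w
    unfolding fr.perp_proj_frame[symmetric] V by (rule perp_proj_eq[OF p])
  have A0: "AA ?y = R *s \<kappa> p"
    unfolding AA_def fp c0
    by (simp add: normal_part_add normal_part_scale normal_part_frame[OF p] Yzz_eq[OF p] normal_part_minus normal_part_perp[OF p \<kappa>_perp[OF p]])
  have B0: "BB ?y = 0"
  proof -
    have "xd ?y \<in> Vbundle Y p"
    proof -
      have "xd ?y \<in> Vbundle (\<lambda>q. XX (0, q)) p" unfolding Vbundle_def j by (rule vec.span_base) simp
      also have "\<dots> = Vbundle (\<lambda>q. rr q *s Y q) p" by (rule Vbundle_cong[OF open_U p XX0])
      also have "\<dots> = Vbundle Y p" by (rule Vbundle_scale[OF open_U p smooth_rr smooth_Y rr(2)])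
      finally show ?thesis .
    qed
    then have "normal_part p (xd ?y) \<in> Vbundle Y p"
      using normal_part_diff[OF p, of "xd ?y"] vec.span_diff[of "xd ?y" "{Y p, Yz p, Yb p, Yzb p}" "xd ?y - normal_part p (xd ?y)"]
      by (simp add: Vbundle_def)
    then show ?thesis unfolding BB_def fp using Vbundle_perp_0[OF p _ normal_part_mperp[OF p]] by blast
  qed
  define nu where "nu y = null_normal (XX y) (xa y) (xb y) (tr y)" for y
  define al where "al y = (mink (xa y) (xb y) * mink (xc y) (xb y) - mink (xb y) (xb y) * mink (xc y) (xa y)) / frame_det (xa y) (xb y)" for y
  define be where "be y = (mink (xa y) (xb y) * mink (xc y) (xa y) - mink (xa y) (xa y) * mink (xc y) (xb y)) / frame_det (xa y) (xb y)" for y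
  define la where "la y = mink (xc y) (nu y)" for y
  define om where "om y = mink (xc y) (XX y)" for y
  have nz: "frame_det (xa q) (xb q) \<noteq> 0" if "q \<in> S" for q using dens_eq(3) that by (cases q) blast
  note sf = smooth_frame
  note co = smooth_on_frame_coeffs[OF open_S smooth_XX sf(1,2,5,3) nz]
  have snu: "smooth_on S nu" and sal: "smooth_on S al" and sbe: "smooth_on S be"
    unfolding nu_def[abs_def] al_def[abs_def] be_def[abs_def] by (rule co; assumption)+
  have sla: "smooth_on S la" "smooth_on S om" unfolding la_def[abs_def] om_def[abs_def]
    by (intro smooth_intros open_S sf snu smooth_XX)+
  \<comment> \<open>Instead of differentiating the projection, the vector \<open>xc\<close> is
    decomposed in the moving frame. Paired with the conjugate of \<open>\<kappa>\<close>, every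
    summand in which the frame vector is not differentiated vanishes. As \<open>be\<close> and
    \<open>om\<close> are 0 at time 0, the derivatives of \<open>xb\<close> and \<open>nu\<close>
    are never computed.\<close>
  have dec: "xc y = AA y + al y *s xa y + be y *s xb y - la y *s XX y - om y *s nu y" for y
    unfolding AA_def frame_perp_def tangent_part_def al_def be_def la_def om_def nu_def by (simp add: vec_eq_iff)
  note td = time_derivative[OF _ S0]
  note bv = bounded_bilinear.has_vector_derivative[OF bounded_bilinear_vscale]
  have "((\<lambda>t. AA (t, p) + al (t, p) *s xa (t, p) + be (t, p) *s xb (t, p) - la (t, p) *s XX (t, p) - om (t, p) *s nu (t, p))
     has_vector_derivative
      (dt AA ?y + (al ?y *s dt xa ?y + dt al ?y *s xa ?y)
       + (be ?y *s dt xb ?y + dt be ?y *s xb ?y)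
       - (la ?y *s dt XX ?y + dt la ?y *s XX ?y)
       - (om ?y *s dt nu ?y + dt om ?y *s nu ?y))) (at 0)"
    by (intro has_vector_derivative_add has_vector_derivative_diff bv td sf snu sal sbe sla smooth_XX)
  from vector_derivative_unique_at[OF td[OF sf(3)] this[folded dec]]
  have dc: "dt xc ?y = dt AA ?y + (al ?y *s dt xa ?y + dt al ?y *s xa ?y)
       + (be ?y *s dt xb ?y + dt be ?y *s xb ?y)
       - (la ?y *s dt XX ?y + dt la ?y *s XX ?y)
       - (om ?y *s dt nu ?y + dt om ?y *s nu ?y)" .
  have om0: "om ?y = 0" unfolding om_def c0 x0 by (simp add: mk)
  have be0: "be ?y = 0" unfolding be_def E0 by (simp add: c0 a0 mk)
  have al0: "al ?y = 2 * Rz / R"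
  proof -
    have "mink (xc ?y) (xb ?y) = Rz * R" by (simp add: c0 b0 mk)
    then show ?thesis unfolding al_def E0 G0 fd0 using R(2) by (simp add: field_simps power2_eq_square)
  qed
  \<comment> \<open>The \<open>Y\<close> component at time 0 is read off by pairing the
    decomposition with \<open>N\<close>.\<close>
  have la0: "la ?y = - (Rzz - R * s p / 2 - 2 * Rz\<^sup>2 / R) / R"
  proof -
    have "R *s \<kappa> p + (2 * Rz / R) *s xa ?y - la ?y *s (R *s Y p) = xc ?y"
      using dec[of ?y] unfolding A0 al0 be0 om0 x0 by simp
    then have "R *s \<kappa> p + (2 * Rz / R) *s (Rz *s Y p + R *s Yz p) - la ?y *s (R *s Y p)
       = Rzz *s Y p + (2 * Rz) *s Yz p + R *s (\<kappa> p - (s p / 2) *s Y p)" unfolding a0 c0 Yzz_eq[OF p] .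
    then have "mink (R *s \<kappa> p + (2 * Rz / R) *s (Rz *s Y p + R *s Yz p) - la ?y *s (R *s Y p)) (N p)
       = mink (Rzz *s Y p + (2 * Rz) *s Yz p + R *s (\<kappa> p - (s p / 2) *s Y p)) (N p)" by (simp only:)
    moreover have "mink (R *s \<kappa> p + (2 * Rz / R) *s (Rz *s Y p + R *s Yz p) - la ?y *s (R *s Y p)) (N p) = - (2 * Rz\<^sup>2 / R) + la ?y * R"
      by (simp add: mink_\<kappa>[OF p] mink_N[OF p] power2_eq_square)
    moreover have "mink (Rzz *s Y p + (2 * Rz) *s Yz p + R *s (\<kappa> p - (s p / 2) *s Y p)) (N p) = - Rzz + R * s p / 2"
      by (simp add: mink_\<kappa>[OF p] mink_N[OF p])
    ultimately have e: "- (2 * Rz\<^sup>2 / R) + la ?y * R = - Rzz + R * s p / 2" by metis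
    have "la ?y * R = 2 * Rz\<^sup>2 / R + (- (2 * Rz\<^sup>2 / R) + la ?y * R)" by simp
    also have "\<dots> = - (Rzz - R * s p / 2 - 2 * Rz\<^sup>2 / R)" unfolding e by simp
    finally have "la ?y * R = - (Rzz - R * s p / 2 - 2 * Rz\<^sup>2 / R)" .
    then show ?thesis using R(2) by (metis nonzero_mult_div_cancel_right)
  qed
  have perp: "mink w (vcnj (\<kappa> p)) = 0" if "w \<in> {xa ?y, xb ?y, XX ?y, nu ?y}" for w
  proof -
    have "nu ?y \<in> Vbundle Y p" using fr.null_normal_comb in_span4 V unfolding nu_def by blast
    moreover have "xa ?y \<in> Vbundle Y p" "xb ?y \<in> Vbundle Y p" "XX ?y \<in> Vbundle Y p"
      unfolding V[symmetric] by (auto intro: vec.span_base)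
    ultimately have "w \<in> Vbundle Y p" using that by auto
    then show ?thesis using vcnj_perp[OF p \<kappa>_perp[OF p]] by (auto simp: mperp_def)
  qed
  have "mink (dt xc ?y) (vcnj (\<kappa> p)) = mink (dt AA ?y) (vcnj (\<kappa> p))
     + al ?y * mink (dt xa ?y) (vcnj (\<kappa> p)) - la ?y * mink (dt XX ?y) (vcnj (\<kappa> p))"
    unfolding dc be0 om0 by (simp add: perp)
  then have "mink (dt AA ?y) (vcnj (\<kappa> p)) = mink (dt xc ?y) (vcnj (\<kappa> p))
     - al ?y * mink (dt xa ?y) (vcnj (\<kappa> p)) + la ?y * mink (dt XX ?y) (vcnj (\<kappa> p))" by simp
  \<comment> \<open>All derivatives of \<open>rr\<close> cancel; the scaling of the lift is left
    only in the factor \<open>R\<close>.\<close>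
  also have "\<dots> = R * hopf_variation p"
    unfolding c' a' x' al0 la0 using R(2) by (simp add: field_simps power2_eq_square)
  finally have A': "mink (dt AA ?y) (vcnj (\<kappa> p)) = R * hopf_variation p" .
  note mv = bounded_bilinear.has_vector_derivative[OF bounded_bilinear_mink]
  have tA: "((\<lambda>t. vcnj (AA (t, p))) has_vector_derivative vcnj (dt AA ?y)) (at 0)"
    by (rule bounded_linear.has_vector_derivative[OF bounded_linear_vcnj td[OF sf(6)]])
  define num where "num t = Re (mink (AA (t, p)) (vcnj (AA (t, p))) - mink (BB (t, p)) (BB (t, p)))" for t
  define q where "q t = Re (4 * frame_det (xa (t, p)) (xb (t, p)))" for t
  \<comment> \<open>\<open>BB\<close> enters quadratically and is 0 at time 0, so its derivative
    drops out.\<close>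
  have "((\<lambda>t. mink (AA (t, p)) (vcnj (AA (t, p))) - mink (BB (t, p)) (BB (t, p))) has_vector_derivative
     (mink (AA ?y) (vcnj (dt AA ?y)) + mink (dt AA ?y) (vcnj (AA ?y))
      - (mink (BB ?y) (dt BB ?y) + mink (dt BB ?y) (BB ?y)))) (at 0)"
    by (intro has_vector_derivative_diff mv tA td sf)
  from bounded_linear.has_vector_derivative[OF bounded_linear_Re this]
  have "(num has_real_derivative Re (mink (AA ?y) (vcnj (dt AA ?y)) + mink (dt AA ?y) (vcnj (AA ?y)))) (at 0)"
    unfolding num_def[abs_def] has_real_derivative_iff_has_vector_derivative by (simp add: B0)
  moreover have "Re (mink (AA ?y) (vcnj (dt AA ?y)) + mink (dt AA ?y) (vcnj (AA ?y)))
     = 2 * Re (R\<^sup>2 * hopf_variation p)"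
  proof -
    have "mink (AA ?y) (vcnj (dt AA ?y)) = cnj (mink (dt AA ?y) (vcnj (AA ?y)))"
      using mink_vcnj_left[of "dt AA ?y" "AA ?y"] by (simp add: mink_commute)
    moreover have "mink (dt AA ?y) (vcnj (AA ?y)) = R\<^sup>2 * hopf_variation p"
      unfolding A0 vcnj_simps R mink_simps(6) A' by (simp add: power2_eq_square)
    moreover have "Re (cnj w + w) = 2 * Re w" for w by simp
    ultimately show ?thesis by metis
  qed
  ultimately have num': "(num has_real_derivative 2 * Re (R\<^sup>2 * hopf_variation p)) (at 0)"
    by simp
  have Rr: "R = complex_of_real (Re R)" using R(1) by (metis Reals_cnj_iff of_real_Re)
  define r where "r = Re R"
  have r: "R = complex_of_real r" "r \<noteq> 0" using Rr R(2) by (auto simp: r_def)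
  have num0: "num 0 = r\<^sup>2 * Re (nn p)"
    unfolding num_def A0 B0 nn_def using r by (simp add: power2_eq_square mult.assoc)
  define G' where "G' = mink (xa ?y) (dt xb ?y) + mink (dt xa ?y) (xb ?y)"
  have "((\<lambda>t. mink (xa (t, p)) (xb (t, p)) * mink (xa (t, p)) (xb (t, p)) - mink (xa (t, p)) (xa (t, p)) * mink (xb (t, p)) (xb (t, p)))
     has_vector_derivative
     (mink (xa ?y) (xb ?y) * G' + G' * mink (xa ?y) (xb ?y) -
       (mink (xa ?y) (xa ?y) * (mink (xb ?y) (dt xb ?y) + mink (dt xb ?y) (xb ?y))
        + (mink (xa ?y) (dt xa ?y) + mink (dt xa ?y) (xa ?y)) * mink (xb ?y) (xb ?y)))) (at 0)"
    unfolding G'_def by (intro has_vector_derivative_diff has_vector_derivative_mult mv td sf)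
  then have "((\<lambda>t. frame_det (xa (t, p)) (xb (t, p))) has_vector_derivative R\<^sup>2 * G') (at 0)"
    unfolding E0 G0 frame_det_def by (simp add: power2_eq_square mult_ac)
  from bounded_linear.has_vector_derivative[OF bounded_linear_Re bounded_linear.has_vector_derivative[OF bounded_linear_mult_right[of 4] this]]
  have q': "(q has_real_derivative Re (4 * (R\<^sup>2 * G'))) (at 0)"
    unfolding q_def[abs_def] has_real_derivative_iff_has_vector_derivative .
  have "R ^ 4 = complex_of_real (r ^ 4)" unfolding r(1) by simp
  \<comment> \<open>The area density of the lift scaled by r is r^2; it reappears in both terms of
    the quotient rule and cancels.\<close>
  then have q0: "q 0 = (r\<^sup>2)\<^sup>2"
    unfolding q_def fd0 using r by (simp add: power_divide power2_eq_square power4_eq_xxxx)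
  then have sq0: "sqrt (q 0) = r\<^sup>2" by (intro real_sqrt_unique) auto
  have qpos: "q 0 > 0" using q0 r by simp
  have ReG: "Re G' = 2 * r\<^sup>2 * Re (mink (vdz vv p) (Yb p))"
  proof -
    note vY = vv_Y
    have vz: "mink (vdz vv p) (Y p) = - mink (vv p) (Yz p)" and vb: "mink (vdzbar vv p) (Y p) = - mink (vv p) (Yb p)"
      using mink_const_derivative[OF open_U smooth_vv smooth_Y p vv_Y] by simp_all
    have vbc: "mink (vv p) (Yb p) = cnj (mink (vv p) (Yz p))"
      using vv_real[OF p] unfolding Yb_eq[OF p] by (metis mink_vcnj)
    have vbz: "vdzbar vv p = vcnj (vdz vv p)" using vdzbar_real(1)[OF open_U smooth_vv p vv_real] .
    have vzb: "mink (vdzbar vv p) (Yz p) = cnj (mink (vdz vv p) (Yb p))"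
      unfolding vbz Yb_eq[OF p] by (simp add: mink_vcnj_left)
    have "mink (xa ?y) (dt xb ?y) = - Rz * R * cnj (mink (vv p) (Yz p)) + R * cnj Rz * mink (vv p) (Yz p) + R * R * cnj (mink (vdz vv p) (Yb p))"
      unfolding a0 b' using vb vzb vbc vY[OF p]
      by (simp add: mink_commute[of "Y p"] mink_commute[of "Yz p"] algebra_simps)
    moreover have "mink (dt xa ?y) (xb ?y) = Rz * R * cnj (mink (vv p) (Yz p)) - R * cnj Rz * mink (vv p) (Yz p) + R * R * mink (vdz vv p) (Yb p)"
      unfolding b0 a' using vz vbc vY[OF p] by (simp add: algebra_simps)
    ultimately have "G' = R * R * (mink (vdz vv p) (Yb p) + cnj (mink (vdz vv p) (Yb p)))"
      unfolding G'_def by (simp only:) (simp add: algebra_simps)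
    then show ?thesis unfolding r(1) by (simp add: power2_eq_square complex_add_cnj)
  qed
  have sq': "((\<lambda>t. sqrt (q t)) has_real_derivative (inverse (sqrt (q 0)) / 2 * Re (4 * (R\<^sup>2 * G')))) (at 0)"
    using DERIV_chain2[OF DERIV_real_sqrt[OF qpos] q'] .
  have "((\<lambda>t. num t / sqrt (q t)) has_real_derivative
     (2 * Re (R\<^sup>2 * hopf_variation p) * sqrt (q 0)
      - num 0 * (inverse (sqrt (q 0)) / 2 * Re (4 * (R\<^sup>2 * G')))) / (sqrt (q 0) * sqrt (q 0))) (at 0)"
    by (rule DERIV_divide[OF num' sq']) (use qpos in simp)
  moreover have "(2 * Re (R\<^sup>2 * hopf_variation p) * sqrt (q 0)
      - num 0 * (inverse (sqrt (q 0)) / 2 * Re (4 * (R\<^sup>2 * G')))) / (sqrt (q 0) * sqrt (q 0))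
     = 2 * Re (hopf_variation p) - 4 * Re (nn p) * Re (mink (vdz vv p) (Yb p))"
  proof -
    have a1: "Re (R\<^sup>2 * z) = r\<^sup>2 * Re z" for z unfolding r(1) by (simp add: power2_eq_square)
    have a2: "Re (4 * (R\<^sup>2 * G')) = 4 * (r\<^sup>2 * (2 * r\<^sup>2 * Re (mink (vdz vv p) (Yb p))))"
      using a1[of G'] ReG by simp
    have a3: "(2 * (k * x) * k - k * n * (inverse k / 2 * (4 * (k * (2 * k * w))))) / (k * k) = 2 * x - 4 * n * w"
      if "k \<noteq> 0" for k x n w :: real
      using that by (simp add: field_simps)
    show ?thesis unfolding sq0 num0 a2 a1 by (rule a3) (use r(2) in simp)
  qed
  ultimately have D: "((\<lambda>t. dens (t, p)) has_vector_derivative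
     (2 * Re (hopf_variation p) - 4 * Re (nn p) * Re (mink (vdz vv p) (Yb p)))) (at 0)"
    unfolding has_real_derivative_iff_has_vector_derivative[symmetric] dens_def num_def q_def by simp
  have "dt dens ?y = 2 * Re (hopf_variation p) - 4 * Re (nn p) * Re (mink (vdz vv p) (Yb p))"
    using vector_derivative_unique_at[OF td[OF smooth_dens] D] .
  also have "\<dots> = Re (2 * mink (vdzbar (vdzbar vv) p + (cnj (s p) / 2) *s vv p) (\<kappa> p) - 4 * nn p * mink (vdzbar vv p) (Yz p))"
  proof -
    have vb: "vdzbar vv q = vcnj (vdz vv q)" if "q \<in> U" for q using vdzbar_real(1)[OF open_U smooth_vv that vv_real] .
    have vbb: "vdzbar (vdzbar vv) p = vcnj (vdz (vdz vv) p)"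
      by (rule vdzbar_real(1)[OF open_U smooth_on_vdz(1)[OF open_U smooth_vv] p]) (simp add: vb)
    have "mink (vdzbar (vdzbar vv) p + (cnj (s p) / 2) *s vv p) (\<kappa> p) = cnj (hopf_variation p)"
      unfolding vbb mink_vcnj[symmetric] by (simp add: vv_real[OF p])
    moreover have "mink (vdzbar vv p) (Yz p) = cnj (mink (vdz vv p) (Yb p))"
      unfolding vb[OF p] Yb_eq[OF p] by (simp add: mink_vcnj_left)
    moreover have "Im (nn p) = 0" using nn_real[of p] by (metis complex_cnj_cancel_iff Reals_cnj_iff complex_is_Real_iff)
    ultimately show ?thesis by simp
  qed
  finally show ?thesis .
qed

end

text \<open>By translation invariance the integral of q(p + t v) does not depend on t, and its
  derivative at t = 0 is the integral in question. The box has to contain the supports of all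
  translates with |t| < 1, hence the radius \<open>R + norm v\<close>.\<close>

lemma integral_ddir_compact_support:
  fixes q :: "complex \<Rightarrow> 'c::euclidean_space"
  assumes q: "smooth_on UNIV q" and supp: "\<And>z. R \<le> norm z \<Longrightarrow> q z = 0" and cb: "ball 0 (R + norm v) \<subseteq> cbox a b"
  shows "integral (cbox a b) (ddir v q) = 0"
proof -
  define F where "F y = q (snd y + fst y *\<^sub>R v)" for y :: "real \<times> complex"
  have sF: "smooth_on ({-1<..<1} \<times> UNIV) F" unfolding F_def
    by (rule smooth_on_compose[OF _ open_UNIV q]) (auto intro!: smooth_intros open_Times)
  have D: "((\<lambda>t. integral (cbox a b) (\<lambda>p. F (t, p))) has_derivative
     (\<lambda>h. integral (cbox a b) (\<lambda>p. ddir (h, 0) F (0, p)))) (at 0)"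
    by (rule integral_smooth_parameter[OF _ sF]) auto
  have const: "integral (cbox a b) (\<lambda>p. F (t, p)) = integral UNIV q" if t: "\<bar>t\<bar> < 1" for t
  proof -
    have off: "F (t, p) = 0" if "p \<notin> cbox a b" for p
    proof -
      have "R + norm v \<le> norm p" using that cb by (auto simp: subset_iff not_less)
      moreover have "norm p \<le> norm (p + t *\<^sub>R v) + \<bar>t\<bar> * norm v"
        using norm_triangle_ineq4[of "p + t *\<^sub>R v" "t *\<^sub>R v"] by simp
      moreover have "\<bar>t\<bar> * norm v \<le> norm v" using t mult_right_mono[of "\<bar>t\<bar>" 1 "norm v"] by simp
      ultimately show ?thesis unfolding F_def by (simp add: supp)
    qed
    have qoff: "q p = 0" if "p \<notin> cbox a b" for p
    proof -
      have "R + norm v \<le> norm p" using that cb by (auto simp: subset_iff not_less)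
      then show ?thesis using supp[of p] norm_ge_zero[of v] by linarith
    qed
    have ci: "q integrable_on cbox a b"
      by (intro integrable_continuous continuous_on_subset[OF smooth_on_continuous_on[OF q]]) auto
    have resq: "(q has_integral integral (cbox a b) q) UNIV"
    proof -
      have "(\<lambda>x. if x \<in> cbox a b then q x else 0) = q" using qoff by auto
      then show ?thesis using has_integral_restrict_UNIV[of "cbox a b" q] integrable_integral[OF ci] by metis
    qed
    have "((\<lambda>p. q (1 *\<^sub>R p + t *\<^sub>R v)) has_integral (integral (cbox a b) q /\<^sub>R 1 ^ DIM(complex)))
        (cbox ((a - t *\<^sub>R v) /\<^sub>R 1) ((b - t *\<^sub>R v) /\<^sub>R 1))"
      by (rule has_integral_affinity'[OF integrable_integral[OF ci]]) simp
    then have sh: "((\<lambda>p. F (t, p)) has_integral integral (cbox a b) q) (cbox (a - t *\<^sub>R v) (b - t *\<^sub>R v))"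
      by (simp add: F_def)
    have off2: "F (t, p) = 0" if "p \<notin> cbox (a - t *\<^sub>R v) (b - t *\<^sub>R v)" for p
    proof -
      have "p + t *\<^sub>R v \<notin> cbox a b" using that by (auto simp: mem_box algebra_simps)
      then show ?thesis unfolding F_def by (simp add: qoff)
    qed
    have "((\<lambda>p. F (t, p)) has_integral integral (cbox a b) q) UNIV"
    proof -
      have "(\<lambda>x. if x \<in> cbox (a - t *\<^sub>R v) (b - t *\<^sub>R v) then F (t, x) else 0) = (\<lambda>p. F (t, p))" using off2 by auto
      then show ?thesis using has_integral_restrict_UNIV[of "cbox (a - t *\<^sub>R v) (b - t *\<^sub>R v)" "\<lambda>p. F (t, p)"] sh by metis
    qed
    moreover have "(\<lambda>p. if p \<in> cbox a b then F (t, p) else 0) = (\<lambda>p. F (t, p))" using off by auto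
    ultimately have "((\<lambda>p. F (t, p)) has_integral integral (cbox a b) q) (cbox a b)"
      using has_integral_restrict_UNIV[of "cbox a b" "\<lambda>p. F (t, p)"] by simp
    then show ?thesis using resq by (simp add: integral_unique)
  qed
  have "((\<lambda>t. integral (cbox a b) (\<lambda>p. F (t, p))) has_derivative (\<lambda>h. 0)) (at 0)"
    by (rule has_derivative_transform_within_open[OF has_derivative_const, of "{-1<..<1}"]) (auto simp: const)
  from has_derivative_unique[OF D this] have 0: "integral (cbox a b) (\<lambda>p. dt F (0, p)) = 0" by metis
  have "dt F (0, p) = ddir v q p" for p
  proof -
    have "((\<lambda>t. p + t *\<^sub>R v) has_derivative (\<lambda>h. h *\<^sub>R v)) (at 0)" by (auto intro!: derivative_eq_intros)
    moreover have "(q has_derivative (\<lambda>w. ddir w q (p + 0 *\<^sub>R v))) (at (p + 0 *\<^sub>R v))"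
      by (rule smooth_on_has_derivative[OF q]) simp
    ultimately have "((\<lambda>t. q (p + t *\<^sub>R v)) has_derivative (\<lambda>h. ddir (h *\<^sub>R v) q (p + 0 *\<^sub>R v))) (at 0)"
      by (rule has_derivative_compose)
    from ddir_eqI[OF this, of 1] have "ddir 1 (\<lambda>t. F (t, p)) 0 = ddir v q p" by (simp add: F_def)
    then show ?thesis using ddir_Pair_left[of F 0 p 1] smooth_on_differentiable[OF sF, of "(0, p)"] by simp
  qed
  then show ?thesis using 0 by simp
qed

context surface_variation begin

text \<open>The difference from the initial density vanishes off \<open>K\<close> and so extends
  smoothly by 0 to the whole plane, while the density itself need not.\<close>

definition "HH y = (if snd y \<in> U then dens y - dens (0, snd y) else 0)"

lemma dens_off_K:
  assumes "t \<in> {-\<epsilon><..<\<epsilon>}" "p \<in> U - K"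
  shows "dens (t, p) = dens (0, p)"
proof -
  have o: "open (U - K)" by (rule open_Diff[OF open_U compact_imp_closed[OF K(1)]])
  have e: "XX (t, q) = XX (0, q)" if "q \<in> U - K" for q
    using \<phi>K[OF assms(1) that] \<phi>0[of q] that by (simp add: XX_def)
  have v1: "vdz (\<lambda>q. XX (t, q)) q = vdz (\<lambda>q. XX (0, q)) q" "vdzbar (\<lambda>q. XX (t, q)) q = vdzbar (\<lambda>q. XX (0, q)) q"
    if "q \<in> U - K" for q
    by (rule vdz_cong[OF o that e], assumption)+
  have S: "(t, p) \<in> S" "(0, p) \<in> S" using assms eps by auto
  have x: "XX (t, p) = XX (0, p)" using e assms(2) by simp
  have a: "xa (t, p) = xa (0, p)" "xb (t, p) = xb (0, p)" unfolding jets[OF S(1)] jets[OF S(2)]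
    using v1 assms(2) by auto
  have c: "xc (t, p) = xc (0, p)" "xd (t, p) = xd (0, p)" "xe (t, p) = xe (0, p)"
    unfolding jets[OF S(1)] jets[OF S(2)]
    by (rule vdz_cong[OF o assms(2) v1(1)] vdz_cong[OF o assms(2) v1(2)], assumption)+
  show ?thesis unfolding dens_def AA_def BB_def tr_def a c x ..
qed

lemma smooth_HH: "smooth_on ({-\<epsilon><..<\<epsilon>} \<times> UNIV) HH"
proof (rule smooth_on_local)
  fix y assume y: "y \<in> {-\<epsilon><..<\<epsilon>} \<times> (UNIV :: complex set)"
  show "\<exists>T. y \<in> T \<and> open T \<and> smooth_on T HH"
  proof (cases "snd y \<in> U")
    case True
    have p: "smooth_on S (\<lambda>y. (0::real, snd y))"
    proof -
      have bl: "bounded_linear (\<lambda>y :: real \<times> complex. (0::real, snd y))"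
        by (intro bounded_linear_Pair bounded_linear_zero bounded_linear_snd)
      show ?thesis using smooth_on_linear_comp[OF bl open_S smooth_on_ident[OF open_S]] .
    qed
    have "smooth_on S (\<lambda>y. dens y - dens (0, snd y))"
      by (intro smooth_intros open_S smooth_dens smooth_on_compose[OF open_S open_S smooth_dens p]) (use eps in auto)
    then have "smooth_on S HH" by (rule smooth_on_cong[OF open_S]) (auto simp: HH_def)
    then show ?thesis using True y open_S by (intro exI[of _ S]) (auto simp: mem_Times_iff)
  next
    case False
    define T where "T = {-\<epsilon><..<\<epsilon>} \<times> (- K)"
    have oT: "open T" unfolding T_def using K compact_imp_closed by (intro open_Times) auto
    have "HH y = 0" if "y \<in> T" for y
    proof (cases "snd y \<in> U")
      case True
      have "dens (fst y, snd y) = dens (0, snd y)" by (rule dens_off_K) (use that True in \<open>auto simp: T_def\<close>)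
      then show ?thesis using True by (simp add: HH_def)
    qed (simp add: HH_def)
    then have "smooth_on T HH" by (intro smooth_on_cong[OF oT smooth_on_const[OF oT, of 0]]) simp
    then show ?thesis using False y K oT by (intro exI[of _ T]) (auto simp: T_def mem_Times_iff)
  qed
qed

lemma HH_derivative: "dt HH (0, p) = (if p \<in> U then dt dens (0, p) else 0)"
proof -
  have td: "((\<lambda>t. HH (t, p)) has_vector_derivative dt HH (0, p)) (at 0)"
    by (rule time_derivative[OF smooth_HH]) (use eps in auto)
  show ?thesis
  proof (cases "p \<in> U")
    case True
    have "((\<lambda>t. dens (t, p) - dens (0, p)) has_vector_derivative dt dens (0, p) - 0) (at 0)"
      by (intro has_vector_derivative_diff time_derivative[OF smooth_dens] has_vector_derivative_const) (use eps True in auto)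
    then show ?thesis using vector_derivative_unique_at[OF td] True by (simp add: HH_def)
  next
    case False
    have "((\<lambda>t. HH (t, p)) has_vector_derivative 0) (at 0)" using False by (simp add: HH_def)
    then show ?thesis using vector_derivative_unique_at[OF td] False by simp
  qed
qed

text \<open>\<open>K\<close> is an arbitrary compact set. Once the time dependence is carried by
  \<open>HH\<close>, it can be replaced by a box, on which differentiation under the integral sign
  is available.\<close>

lemma functional_eq:
  assumes t: "t \<in> {-\<epsilon><..<\<epsilon>}" and cb: "K \<subseteq> cbox a b"
  shows "willmore_functional K (\<phi> t) = integral K (\<lambda>p. dens (0, p)) + integral (cbox a b) (\<lambda>p. HH (t, p))"
proof -
  have "continuous_on K (\<lambda>p. dens (0, p))"
    using smooth_on_continuous_on[OF smooth_at_0[OF smooth_dens]] continuous_on_subset K by blast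
  then have "set_integrable lborel K (\<lambda>p. dens (0, p))"
    unfolding set_integrable_def by (rule borel_integrable_compact[OF K(1)])
  then have i0: "(\<lambda>p. dens (0, p)) integrable_on K" by (rule set_borel_integral_eq_integral(1))
  have cH: "continuous_on UNIV (\<lambda>p. HH (t, p))"
    by (rule continuous_on_compose2[OF smooth_on_continuous_on[OF smooth_HH]]) (use t in \<open>auto intro!: continuous_intros\<close>)
  have "((\<lambda>p. HH (t, p)) has_integral integral (cbox a b) (\<lambda>p. HH (t, p))) (cbox a b)"
    by (intro integrable_integral integrable_continuous continuous_on_subset[OF cH]) auto
  then have "((\<lambda>p. if p \<in> K then HH (t, p) else 0) has_integral integral (cbox a b) (\<lambda>p. HH (t, p))) (cbox a b)"
  proof (rule has_integral_eq[rotated])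
    show "HH (t, p) = (if p \<in> K then HH (t, p) else 0)" for p
      using dens_off_K[OF t, of p] by (cases "p \<in> U") (simp_all add: HH_def)
  qed
  then have iH: "((\<lambda>p. HH (t, p)) has_integral integral (cbox a b) (\<lambda>p. HH (t, p))) K"
    unfolding has_integral_restrict[OF cb] .
  have "willmore_functional K (\<phi> t) = integral K (\<lambda>p. dens (0, p) + HH (t, p))"
    unfolding willmore_functional_def
    by (rule integral_cong) (use K t dens_eq(1) in \<open>auto simp: HH_def\<close>)
  also have "\<dots> = integral K (\<lambda>p. dens (0, p)) + integral K (\<lambda>p. HH (t, p))"
    by (rule integral_add[OF i0]) (use iH in auto)
  finally show ?thesis using iH by (simp add: integral_unique)
qed

abbreviation "gradient_density \<equiv> \<lambda>p. if p \<in> U then 2 * Re (mink (vv p) (EL p)) else 0"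

theorem first_variation:
  obtains a b where "K \<subseteq> box a b"
    "((\<lambda>t. willmore_functional K (\<phi> t)) has_real_derivative
       integral (cbox a b) gradient_density) (at 0)"
proof -
  obtain R where R: "\<And>z. z \<in> K \<Longrightarrow> norm z < R" using compact_imp_bounded[OF K(1)] bounded_pos_less by blast
  \<comment> \<open>The margin 1 is the length of the two directions 1 and \<i> along which the
    divergence is integrated.\<close>
  obtain c where c: "ball 0 (R + 1) \<subseteq> cbox (-c) (c :: complex)" using bounded_subset_cbox_symmetric[OF bounded_ball] by blast
  define a b where "a = - c" and "b = c"
  have cb: "ball 0 (R + 1) \<subseteq> cbox a b" using c by (simp add: a_def b_def)
  have "ball 0 (R + 1) \<subseteq> interior (cbox a b)" by (rule interior_maximal[OF cb open_ball])
  then have Kb: "K \<subseteq> box a b" using R by (force simp: interior_cbox)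
  then have Kc: "K \<subseteq> cbox a b" using box_subset_cbox by blast
  \<comment> \<open>The quantity under \<open>dzbar\<close> in \<open>variation_identity\<close>. It
    is 0 off \<open>K\<close> together with the velocity, so its divergence integrates to 0.\<close>
  define Q where "Q q = 2 * mink (vdzbar vv q) (\<kappa> q) - 2 * mink (vv q) (vdzbar \<kappa> q) - 4 * mink (vv q) (nn q *s Yz q)" for q
  define Q' where "Q' q = (if q \<in> U then Q q else 0)" for q
  have oK: "open (U - K)" "open (- K)" "closed K" using open_U K compact_imp_closed by (auto simp: open_Diff)
  have sQ: "smooth_on U Q" unfolding Q_def[abs_def] by (intro smooth_intros open_U smooth_vv smooth_nn smooth_\<kappa>)
  have Q0: "Q q = 0" if "q \<in> U - K" for q
  proof -
    have "vdzbar vv q = vdzbar (\<lambda>q. 0) q" by (rule vdz_cong[OF oK(1) that]) (rule vv_support)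
    then show ?thesis using vv_support[OF that] by (simp add: Q_def)
  qed
  have sQ': "smooth_on UNIV Q'" unfolding Q'_def[abs_def]
    by (rule smooth_on_if_support[OF sQ open_U oK(3) K(2) Q0])
  have Q'0: "Q' q = 0" if "q \<notin> K" for q using that Q0 by (auto simp: Q'_def)
  have integrand: "dt HH (0, p) = Re (dzbar Q' p) + (if p \<in> U then 2 * Re (mink (vv p) (EL p)) else 0)" for p
  proof (cases "p \<in> U")
    case True
    have "dzbar Q' p = dzbar Q p" by (rule dz_cong[OF open_U True]) (simp add: Q'_def)
    then show ?thesis
      unfolding HH_derivative using True dens_derivative[OF True]
        variation_identity[OF True smooth_vv vv_real vv_Y] by (simp add: Q_def[abs_def])
  next
    case False
    have "dzbar Q' p = dzbar (\<lambda>q. 0) p" by (rule dz_cong[OF oK(2)]) (use False K Q'0 in auto)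
    then show ?thesis unfolding HH_derivative using False by simp
  qed
  have i1: "integral (cbox a b) (ddir v Q') = 0" if "norm v \<le> 1" for v
  proof (rule integral_ddir_compact_support[OF sQ', of R])
    show "Q' z = 0" if "R \<le> norm z" for z using Q'0[of z] R[of z] that by force
    show "ball 0 (R + norm v) \<subseteq> cbox a b" using cb that by (auto simp: subset_iff)
  qed
  have ci: "ddir v Q' integrable_on cbox a b" for v
    by (intro integrable_continuous continuous_on_subset[OF smooth_on_continuous_on[OF smooth_on_ddir[OF sQ']]]) auto
  have h1: "((\<lambda>p. ddir v Q' p) has_integral 0) (cbox a b)" if "norm v \<le> 1" for v
    using integrable_integral[OF ci[of v]] i1[OF that] by simp
  have "((\<lambda>p. (ddir 1 Q' p + \<i> * ddir \<i> Q' p) / 2) has_integral (0 + \<i> * 0) / 2) (cbox a b)"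
    by (intro has_integral_divide has_integral_add has_integral_mult_right h1) auto
  from has_integral_linear[OF this bounded_linear_Re]
  have hQ: "((\<lambda>p. Re (dzbar Q' p)) has_integral 0) (cbox a b)" by (simp add: o_def dzbar_eq)
  have cH: "continuous_on (cbox a b) (\<lambda>p. dt HH (0, p))"
    by (rule continuous_on_compose2[OF smooth_on_continuous_on[OF smooth_on_ddir[OF smooth_HH]]])
       (use eps in \<open>auto intro!: continuous_intros\<close>)
  have "((\<lambda>p. dt HH (0, p) - Re (dzbar Q' p)) has_integral integral (cbox a b) (\<lambda>p. dt HH (0, p)) - 0) (cbox a b)"
    by (intro has_integral_diff hQ integrable_integral integrable_continuous cH)
  then have I: "integral (cbox a b) (\<lambda>p. dt HH (0, p)) = integral (cbox a b) gradient_density"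
    unfolding integrand by (simp add: integral_unique)
  have D: "((\<lambda>t. integral (cbox a b) (\<lambda>p. HH (t, p))) has_derivative
     (\<lambda>h. integral (cbox a b) (\<lambda>p. ddir (h, 0) HH (0, p)))) (at 0)"
    by (rule integral_smooth_parameter[OF _ smooth_HH]) (use eps in auto)
  have lin: "integral (cbox a b) (\<lambda>p. ddir (h, 0) HH (0, p)) = integral (cbox a b) (\<lambda>p. dt HH (0, p)) * h" for h
    using linear_scale[OF has_derivative_linear[OF D], of h 1] by (simp add: mult.commute)
  have "((\<lambda>t. integral (cbox a b) (\<lambda>p. HH (t, p))) has_real_derivative integral (cbox a b) (\<lambda>p. dt HH (0, p))) (at 0)"
    unfolding has_field_derivative_def by (rule has_derivative_eq_rhs[OF D]) (rule ext, rule lin)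
  then have "((\<lambda>t. integral K (\<lambda>p. dens (0, p)) + integral (cbox a b) (\<lambda>p. HH (t, p))) has_real_derivative
     integral (cbox a b) gradient_density) (at 0)"
    unfolding I using DERIV_add[OF DERIV_const] by fastforce
  then have "((\<lambda>t. willmore_functional K (\<phi> t)) has_real_derivative
     integral (cbox a b) gradient_density) (at 0)"
    by (rule has_field_derivative_transform_within_open[where S = "{-\<epsilon><..<\<epsilon>}"]) (use eps functional_eq[OF _ Kc] in auto)
  then show ?thesis using that Kb by blast
qed

end

section \<open>The Euler-Lagrange equation\<close>

lemma bounded_linear_null_vec: "bounded_linear (\<lambda>x :: real^'n. null_vec x - null_vec 0)"
  unfolding linear_conv_bounded_linear[symmetric]
  by (rule linearI) (auto simp: vec_eq_iff null_vec_def scaleR_complex split: option.split)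

context conformal_surface begin

lemma conformal_f: "conformal_on U f"
  unfolding conformal_on_def
proof
  fix p assume p: "p \<in> U"
  have "vdz (null_vec \<circ> f) p = dz rr p *s Y p + rr p *s Yz p"
    by (rule rr_product(1)[OF smooth_Y p]) (simp add: Y0)
  then show "mink (vdz (null_vec \<circ> f) p) (vdz (null_vec \<circ> f) p) = 0" by (simp add: mink_all[OF p])
qed

theorem willmore_surface_if_EL:
  assumes imm: "immersion_on U f" and EL: "\<And>p. p \<in> U \<Longrightarrow> EL p = 0"
  shows "willmore_surface U f"
  unfolding willmore_surface_def
proof (intro conjI allI impI imm conformal_f)
  fix K \<epsilon> \<phi> assume "variation U f K \<epsilon> \<phi>"
  then interpret surface_variation U f Y N \<kappa> s K \<epsilon> \<phi> by unfold_locales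
  obtain a b where D: "((\<lambda>t. willmore_functional K (\<phi> t)) has_real_derivative
       integral (cbox a b) gradient_density) (at 0)"
    using first_variation by blast
  have "gradient_density = (\<lambda>p. 0)" by (auto simp: EL)
  then show "((\<lambda>t. willmore_functional K (\<phi> t)) has_real_derivative 0) (at 0)" using D by simp
qed

text \<open>The fundamental lemma of the calculus of variations, with a velocity built from
  \<open>EL\<close> itself. As \<open>f\<close> has to stay on the sphere, \<open>EL\<close> is
  replaced by a representative tangent to the sphere, cut off near \<open>p0\<close>.\<close>

theorem EL_if_willmore_surface:
  assumes W: "willmore_surface U f" and p0: "p0 \<in> U"
  shows "EL p0 = 0"
proof -
  have imm: "immersion_on U f" using W by (simp add: willmore_surface_def)
  have sf: "smooth_on U f" using imm by (simp add: immersion_on_def)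
  obtain r where r: "r > 0" "cball p0 r \<subseteq> U" using open_U p0 open_contains_cball by blast
  obtain \<psi> :: "complex \<Rightarrow> real" where \<psi>: "smooth_on UNIV \<psi>" "\<And>x. 0 \<le> \<psi> x"
    "\<And>x. dist p0 x \<ge> r \<Longrightarrow> \<psi> x = 0" "\<And>x. dist p0 x \<le> r / 2 \<Longrightarrow> \<psi> x = 1"
    using bump_function_exists[OF r(1)] by metis
  define E0 where "E0 q = Re (EL q $ None)" for q
  define sp :: "complex \<Rightarrow> real ^ 'n" where "sp q = (\<chi> i. Re (EL q $ Some i))" for q
  \<comment> \<open>\<open>EL\<close> is orthogonal to the null vector (1, f). Subtracting the
    multiple of it with the same time component changes no square and leaves a spatial vector,
    tangent to the sphere at \<open>f q\<close>.\<close>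
  define ee where "ee q = sp q - E0 q *\<^sub>R f q" for q
  have ff: "f q \<bullet> f q = 1" if "q \<in> U" for q using sphere_f[OF that] by (simp add: norm_eq_1)
  have ELr: "EL q $ None = complex_of_real (E0 q)" "EL q $ Some i = complex_of_real (sp q $ i)" if "q \<in> U" for q i
  proof -
    have r: "cnj (EL q $ j) = EL q $ j" for j using EL_real[OF that] by (simp add: vec_eq_iff)
    have rj: "EL q $ j = complex_of_real (Re (EL q $ j))" for j using r[of j] by (metis Reals_cnj_iff of_real_Re)
    show "EL q $ None = complex_of_real (E0 q)" unfolding E0_def by (rule rj)
    show "EL q $ Some i = complex_of_real (sp q $ i)" unfolding sp_def vec_lambda_beta by (rule rj)
  qed
  have spf: "sp q \<bullet> f q = E0 q" if q: "q \<in> U" for q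
  proof -
    have "mink (EL q) (null_vec (f q)) = 0" using perp_dest(1)[OF q EL_perp[OF q]] by (simp add: Y0(4)[OF q])
    then have "complex_of_real (sp q \<bullet> f q - E0 q) = 0"
      by (simp add: mink_def null_vec_def ELr[OF q] inner_vec_def)
    then show ?thesis by (simp only: of_real_eq_0_iff)
  qed
  have fe: "f q \<bullet> ee q = 0" if "q \<in> U" for q
    using spf[OF that] ff[OF that] by (simp add: ee_def inner_diff_right inner_commute)
  have see: "smooth_on U ee" unfolding ee_def[abs_def] sp_def E0_def
    by (intro smooth_intros open_U smooth_EL sf)
  define w where "w y = f (snd y) + (fst y * \<psi> (snd y)) *\<^sub>R ee (snd y)" for y :: "real \<times> complex"
  define \<phi> where "\<phi> t p = inverse (sqrt (w (t, p) \<bullet> w (t, p))) *\<^sub>R w (t, p)" for t p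
  let ?T = "(UNIV :: real set) \<times> U"
  have oT: "open ?T" by (intro open_Times open_U) auto
  have sf2: "smooth_on ?T (\<lambda>y. f (snd y))" "smooth_on ?T (\<lambda>y. ee (snd y))" "smooth_on ?T (\<lambda>y. \<psi> (snd y))"
    by (rule smooth_on_compose[OF oT open_U sf] smooth_on_compose[OF oT open_U see] smooth_on_compose[OF oT open_UNIV \<psi>(1)];
        auto intro!: smooth_intros oT)+
  have sw: "smooth_on ?T w" unfolding w_def[abs_def] by (intro smooth_intros oT sf2)
  have ww: "w (t, q) \<bullet> w (t, q) = 1 + t\<^sup>2 * ((\<psi> q)\<^sup>2 * (ee q \<bullet> ee q))" if "q \<in> U" for t q
    using ff[OF that] fe[OF that] by (simp add: w_def inner_add_left inner_add_right inner_commute power2_eq_square)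
  have wpos: "w (t, q) \<bullet> w (t, q) > 0" if "q \<in> U" for t q
    unfolding ww[OF that] by (intro add_pos_nonneg mult_nonneg_nonneg) auto
  have s\<phi>: "smooth_on ?T (\<lambda>y. \<phi> (fst y) (snd y))" unfolding \<phi>_def prod.collapse
    by (intro smooth_intros oT sw) (use wpos in \<open>force+\<close>)
  have \<phi>f: "\<phi> t q = f q" if "q \<in> U" "\<psi> q = 0 \<or> t = 0" for t q
  proof -
    have "w (t, q) = f q" using that by (auto simp: w_def)
    then show ?thesis using ff[OF that(1)] by (simp add: \<phi>_def)
  qed
  define K where "K = cball p0 r"
  have K: "compact K" "K \<subseteq> U" using r by (auto simp: K_def)
  have \<psi>K: "\<psi> q = 0" if "q \<notin> K" for q using that \<psi>(3)[of q] by (auto simp: K_def)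
  have d\<phi>: "\<phi> t differentiable (at q)" "ddir v (\<phi> t) q = ddir (0, v) (\<lambda>y. \<phi> (fst y) (snd y)) (t, q)" if "q \<in> U" for t q v
  proof -
    have d: "(\<lambda>y. \<phi> (fst y) (snd y)) differentiable at (t, q)" using smooth_on_differentiable[OF s\<phi>] that by auto
    have "((\<lambda>q. (t, q)) has_derivative (\<lambda>v. (0, v))) (at q)" by (auto intro!: derivative_eq_intros)
    from has_derivative_compose[OF this has_derivative_ddir[OF d]]
    show "\<phi> t differentiable (at q)" unfolding differentiable_def by auto
    show "ddir v (\<phi> t) q = ddir (0, v) (\<lambda>y. \<phi> (fst y) (snd y)) (t, q)" using ddir_Pair_right[OF d, of v] by simp
  qed
  define md where "md y = metric_det (\<phi> (fst y)) (snd y)" for y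
  have smd: "continuous_on ?T md"
  proof -
    let ?D = "\<lambda>v. ddir (0, v) (\<lambda>y. \<phi> (fst y) (snd y))"
    have "continuous_on ?T (\<lambda>y. (?D 1 y \<bullet> ?D 1 y) * (?D \<i> y \<bullet> ?D \<i> y) - (?D 1 y \<bullet> ?D \<i> y)\<^sup>2)"
      by (intro continuous_intros smooth_on_continuous_on[OF smooth_on_ddir[OF s\<phi>]])
    then show ?thesis
      by (rule continuous_on_eq) (auto simp: md_def metric_det_def metric_def dir_deriv_eq_ddir d\<phi>)
  qed
  define O' where "O' = {y \<in> ?T. md y > 0}"
  have oO: "open O'"
  proof -
    have "open (?T \<inter> md -` {0<..})" by (rule continuous_open_preimage[OF smd oT]) auto
    then show ?thesis by (simp add: O'_def vimage_def Int_def)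
  qed
  have off: "\<phi> t differentiable (at q)" "ddir v (\<phi> t) q = ddir v f q" if "q \<in> U" "q \<notin> K \<or> t = 0" for t q v
  proof -
    show "\<phi> t differentiable (at q)" by (rule d\<phi>(1)[OF that(1)])
    show "ddir v (\<phi> t) q = ddir v f q"
    proof (cases "t = 0")
      case True then show ?thesis by (intro ddir_cong[OF open_U that(1)]) (simp add: \<phi>f)
    next
      case False
      have "open (U - K)" by (rule open_Diff[OF open_U compact_imp_closed[OF K(1)]])
      then show ?thesis by (rule ddir_cong) (use that False \<phi>f \<psi>K in auto)
    qed
  qed
  have pos_off: "md (t, q) > 0" if "q \<in> U" "q \<notin> K \<or> t = 0" for t q
  proof -
    have "md (t, q) = metric_det f q" using off(2)[OF that] by (simp add: md_def metric_det_def metric_def dir_deriv_eq_ddir)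
    moreover have "metric_det f q > 0"
      using metric_det_pos_iff_inj[OF smooth_on_differentiable[OF sf that(1)]] imm that(1) by (simp add: immersion_on_def)
    ultimately show ?thesis by simp
  qed
  \<comment> \<open>Only over \<open>K\<close> can the map cease to be an immersion. Positivity of
    the metric determinant at time 0 extends, by compactness, to a time interval common to all
    points of \<open>K\<close>.\<close>
  have "compact ({0::real} \<times> K)" using K by (intro compact_Times) auto
  moreover have "{0::real} \<times> K \<subseteq> \<Union> {O'}" using pos_off K by (auto simp: O'_def)
  ultimately obtain e where e0: "e > 0" "\<And>x. x \<in> {0::real} \<times> K \<Longrightarrow> \<exists>G\<in>{O'}. ball x e \<subseteq> G"
    using Heine_Borel_lemma[of "{0::real} \<times> K" "{O'}"] oO by (metis singletonD)
  then have e: "e > 0" "\<And>x. x \<in> {0::real} \<times> K \<Longrightarrow> ball x e \<subseteq> O'" by auto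
  have var: "variation U f K e \<phi>"
    unfolding variation_def
  proof (intro conjI ballI)
    have "smooth_on ({-e<..<e} \<times> U) (\<lambda>y. \<phi> (fst y) (snd y))" by (rule smooth_on_subset[OF s\<phi>]) auto
    then show "smooth_on ({-e<..<e} \<times> U) (\<lambda>(t, p). \<phi> t p)" by (simp add: case_prod_unfold)
    show "\<phi> 0 p = f p" if "p \<in> U" for p using \<phi>f that by simp
    show "\<phi> t p = f p" if "p \<in> U - K" for t p using \<phi>f \<psi>K that by simp
    fix t assume t: "t \<in> {-e<..<e}"
    show "immersion_on U (\<phi> t)"
      unfolding immersion_on_def
    proof (intro conjI ballI)
      show "smooth_on U (\<phi> t)"
      proof -
        have "smooth_on U (\<lambda>q. (t, q))"
          by (rule smooth_onI[OF open_U, where D = "\<lambda>x v. (0, v)"]) (auto intro!: derivative_eq_intros smooth_intros open_U)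
        from smooth_on_compose[OF open_U oT s\<phi> this] show ?thesis by auto
      qed
      fix q assume q: "q \<in> U"
      have "norm (\<phi> t q) = 1"
      proof -
        have "norm (w (t, q)) > 0" using wpos[OF q, of t] by auto
        then show ?thesis unfolding \<phi>_def norm_eq_sqrt_inner[symmetric] norm_scaleR by simp
      qed
      then show "\<phi> t q \<in> sphere 0 1" by simp
      have "md (t, q) > 0"
      proof (cases "q \<in> K")
        case True
        have "dist (0, q) (t, q) < e" using t by (auto simp: dist_Pair_Pair)
        then have "(t, q) \<in> O'" using e(2)[of "(0, q)"] True by auto
        then show ?thesis by (simp add: O'_def)
      qed (use pos_off q in auto)
      then show "inj (frechet_derivative (\<phi> t) (at q))"
        using metric_det_pos_iff_inj[OF d\<phi>(1)[OF q]] by (simp add: md_def)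
    qed
  qed (use K e in auto)
  interpret surface_variation U f Y N \<kappa> s K e \<phi> by unfold_locales (rule var)
  obtain a b where ab: "K \<subseteq> box a b" and D: "((\<lambda>t. willmore_functional K (\<phi> t)) has_real_derivative
       integral (cbox a b) gradient_density) (at 0)"
    using first_variation by blast
  define I where "I p = (if p \<in> U then 2 * Re (mink (vv p) (EL p)) else 0)" for p
  have "((\<lambda>t. willmore_functional K (\<phi> t)) has_real_derivative 0) (at 0)"
    using W var by (simp add: willmore_surface_def)
  then have I0: "integral (cbox a b) I = 0" using DERIV_unique[OF D] by (simp add: I_def[abs_def])
  have dX: "dt XX (0, q) = null_vec (\<psi> q *\<^sub>R ee q) - null_vec 0" if q: "q \<in> U" for q
  proof -
    define k where "k = (\<psi> q)\<^sup>2 * (ee q \<bullet> ee q)"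
    have "k \<ge> 0" by (simp add: k_def)
    \<comment> \<open>The normalizing factor is even in t, because \<open>f\<close> and
      \<open>ee\<close> are orthogonal; hence it does not contribute to the velocity.\<close>
    have d1: "((\<lambda>t. inverse (sqrt (1 + t\<^sup>2 * k))) has_field_derivative 0) (at 0)"
      by (auto intro!: derivative_eq_intros)
    have d2: "((\<lambda>t. f q + (t * \<psi> q) *\<^sub>R ee q) has_vector_derivative \<psi> q *\<^sub>R ee q) (at 0)"
      by (auto intro!: derivative_eq_intros simp: has_vector_derivative_def)
    have "((\<lambda>t. inverse (sqrt (1 + t\<^sup>2 * k)) *\<^sub>R (f q + (t * \<psi> q) *\<^sub>R ee q)) has_vector_derivative
       (inverse (sqrt (1 + 0\<^sup>2 * k)) *\<^sub>R (\<psi> q *\<^sub>R ee q) + 0 *\<^sub>R (f q + (0 * \<psi> q) *\<^sub>R ee q))) (at 0)"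
      by (rule has_vector_derivative_scaleR[OF d1 d2])
    moreover have "(\<lambda>t. inverse (sqrt (1 + t\<^sup>2 * k)) *\<^sub>R (f q + (t * \<psi> q) *\<^sub>R ee q)) = (\<lambda>t. \<phi> t q)"
      unfolding \<phi>_def ww[OF q] k_def by (simp add: w_def)
    ultimately have "((\<lambda>t. \<phi> t q) has_vector_derivative \<psi> q *\<^sub>R ee q) (at 0)" by simp
    from bounded_linear.has_vector_derivative[OF bounded_linear_null_vec this]
    have "((\<lambda>t. null_vec (\<phi> t q) - null_vec 0 + null_vec 0) has_vector_derivative (null_vec (\<psi> q *\<^sub>R ee q) - null_vec 0) + 0) (at 0)"
      by (intro has_vector_derivative_add has_vector_derivative_const)
    then have "((\<lambda>t. XX (t, q)) has_vector_derivative (null_vec (\<psi> q *\<^sub>R ee q) - null_vec 0)) (at 0)"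
      by (simp add: XX_def)
    then show ?thesis using vector_derivative_unique_at[OF time_derivative[OF smooth_XX in_S0[OF q]]] by blast
  qed
  have I_eq: "I q = 2 * Re (Y q $ None) * \<psi> q * (ee q \<bullet> ee q)" if q: "q \<in> U" for q
  proof -
    have "mink (null_vec (\<psi> q *\<^sub>R ee q) - null_vec 0) (EL q) = complex_of_real (\<psi> q * (ee q \<bullet> sp q))"
      by (simp add: mink_def null_vec_def ELr[OF q] inner_vec_def sum_distrib_left mult.assoc)
    moreover have "ee q \<bullet> sp q = ee q \<bullet> ee q"
    proof -
      have "ee q \<bullet> ee q = ee q \<bullet> sp q - E0 q * (ee q \<bullet> f q)" by (simp add: ee_def[of q] inner_diff_right)
      then show ?thesis using fe[OF q] by (simp add: inner_commute)
    qed
    ultimately have "mink (vv q) (EL q) = Y q $ None * complex_of_real (\<psi> q * (ee q \<bullet> ee q))"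
      unfolding vv_def dX[OF q] mink_simps(5) by (simp only:)
    then show ?thesis using q by (simp add: I_def)
  qed
  have sI: "smooth_on UNIV I" unfolding I_def[abs_def]
  proof (rule smooth_on_if_support[OF _ open_U compact_imp_closed[OF K(1)] K(2)])
    show "smooth_on U (\<lambda>p. 2 * Re (mink (vv p) (EL p)))" by (intro smooth_intros open_U smooth_vv smooth_EL)
    show "2 * Re (mink (vv q) (EL q)) = 0" if "q \<in> U - K" for q using vv_support[OF that] by simp
  qed
  have "I p0 = 0"
  proof (rule has_integral_0_cbox_imp_0[where a = a and b = b])
    show c: "continuous_on (cbox a b) I" using smooth_on_continuous_on[OF sI] continuous_on_subset by blast
    show "0 \<le> I x" for x
    proof (cases "x \<in> U")
      case True then show ?thesis unfolding I_eq[OF True] using Y0(3)[OF True] \<psi>(2)[of x] by simp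
    qed (simp add: I_def)
    show "(I has_integral 0) (cbox a b)" using integrable_integral[OF integrable_continuous[OF c]] I0 by simp
    have "p0 \<in> K" using r by (simp add: K_def)
    then show "box a b \<noteq> {}" "p0 \<in> cbox a b" using ab box_subset_cbox by blast+
  qed
  then have "ee p0 = 0" unfolding I_eq[OF p0] using Y0(3)[OF p0] \<psi>(4)[of p0] r by simp
  \<comment> \<open>Definiteness on the sphere yields only that \<open>EL\<close> is a multiple of
    (1, f). Pairing with \<open>N\<close>, which is orthogonal to \<open>EL\<close> but not to
    \<open>Y\<close>, shows that the multiple is 0.\<close>
  then have "sp p0 = E0 p0 *\<^sub>R f p0" by (simp add: ee_def)
  then have "EL p0 $ j = complex_of_real (E0 p0) * (null_vec (f p0) $ j)" for j
    by (cases j) (simp_all add: ELr[OF p0] null_vec_def)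
  then have el: "EL p0 = complex_of_real (E0 p0) *s null_vec (f p0)" by (simp add: vec_eq_iff)
  have "mink (EL p0) (N p0) = 0" using perp_dest(4)[OF p0 EL_perp[OF p0]] .
  then have "E0 p0 = 0" unfolding el Y0(4)[OF p0] using rr(2)[OF p0] mink_N[OF p0] by simp
  then show ?thesis using el by simp
qed

end

section \<open>Continuous square roots of holomorphic functions\<close>

text \<open>Where \<open>h\<close> is nonzero, the difference quotient of \<open>g\<close> is that
  of \<open>h\<close> divided by a sum g(w) + g(z) bounded away from 0 near z. A zero of
  \<open>h\<close> is either isolated, hence a removable singularity of the continuous
  \<open>g\<close>, or has a neighbourhood on which both functions vanish.\<close>

lemma continuous_square_root_holomorphic:
  assumes W: "open W" and g: "continuous_on W g" and h: "h holomorphic_on W" and gh: "\<And>z. z \<in> W \<Longrightarrow> (g z)\<^sup>2 = h z"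
  shows "g holomorphic_on W"
proof -
  have diff: "g field_differentiable at z" if z: "z \<in> W" "h z \<noteq> 0" for z
  proof -
    have gz: "g z \<noteq> 0" using gh[OF z(1)] z(2) by auto
    have lim: "((\<lambda>w. (h w - h z) / (w - z)) \<longlongrightarrow> deriv h z) (at z)"
      using holomorphic_derivI[OF h W z(1)] by (simp add: has_field_derivative_iff)
    have cg: "(g \<longlongrightarrow> g z) (at z)" using g W z(1) continuous_on_eq_continuous_at isCont_def by blast
    have "((\<lambda>w. ((h w - h z) / (w - z)) / (g w + g z)) \<longlongrightarrow> deriv h z / (g z + g z)) (at z)"
      using gz by (intro tendsto_intros lim cg) auto
    moreover have "\<forall>\<^sub>F w in at z. ((h w - h z) / (w - z)) / (g w + g z) = (g w - g z) / (w - z)"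
    proof -
      have "((\<lambda>w. g w + g z) \<longlongrightarrow> g z + g z) (at z)" by (intro tendsto_intros cg)
      then have "\<forall>\<^sub>F w in at z. g w + g z \<noteq> 0" by (rule tendsto_imp_eventually_ne) (use gz in simp)
      moreover have "\<forall>\<^sub>F w in at z. w \<in> W" using W z(1) eventually_at_in_open' by blast
      ultimately show ?thesis
      proof eventually_elim
        case (elim w)
        have "h w - h z = (g w - g z) * (g w + g z)"
          using gh[OF elim(2)] gh[OF z(1)] by (simp add: power2_eq_square algebra_simps)
        then show ?case using elim(1) by simp
      qed
    qed
    ultimately have "((\<lambda>w. (g w - g z) / (w - z)) \<longlongrightarrow> deriv h z / (g z + g z)) (at z)"
      by (rule Lim_transform_eventually)
    then show ?thesis unfolding field_differentiable_def has_field_derivative_iff by blast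
  qed
  have local: "g field_differentiable at p" if p: "p \<in> W" for p
  proof -
    obtain r where r: "r > 0" "ball p r \<subseteq> W" using W p open_contains_ball by blast
    show ?thesis
    proof (cases "\<forall>z\<in>ball p r. h z = 0")
      case True
      then have "g z = 0" if "z \<in> ball p r" for z using gh[of z] r that by auto
      then have "g holomorphic_on ball p r"
        using holomorphic_transform[of "\<lambda>z. 0" "ball p r" g] by auto
      then show ?thesis using r(1) holomorphic_on_imp_differentiable_at by (metis centre_in_ball open_ball)
    next
      case False
      then obtain \<phi> where \<phi>: "\<phi> \<in> ball p r" "h \<phi> \<noteq> 0" by blast
      show ?thesis
      proof (cases "h p = 0")
        case False then show ?thesis by (rule diff[OF p])
      next
        case True
        have hb: "h holomorphic_on ball p r" using h r holomorphic_on_subset by blast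
        obtain e where e: "0 < e" "ball p e \<subseteq> ball p r" "\<And>z. z \<in> ball p e - {p} \<Longrightarrow> h z \<noteq> 0"
          using isolated_zeros[OF hb open_ball connected_ball _ True \<phi>] r by (metis centre_in_ball)
        have "g holomorphic_on ball p e - {p}"
          unfolding holomorphic_on_def using diff e r field_differentiable_at_within by blast
        moreover have "continuous_on (ball p e) g" using g e r continuous_on_subset by blast
        ultimately have "g holomorphic_on ball p e" using no_isolated_singularity[of "ball p e" g "{p}"] by auto
        then show ?thesis using e(1) holomorphic_on_imp_differentiable_at by (metis centre_in_ball open_ball)
      qed
    qed
  qed
  then show ?thesis unfolding holomorphic_on_def using field_differentiable_at_within by blast
qed

lemma local_continuous_square_root:
  assumes h: "continuous_on W h" "open W" "p \<in> W" "h p \<noteq> 0"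
  obtains V g where "open V" "p \<in> V" "V \<subseteq> W" "continuous_on V g" "\<And>z. z \<in> V \<Longrightarrow> (g z)\<^sup>2 = (h z :: complex)"
proof -
  define V where "V = {z \<in> W. Re (h z / h p) > 0}"
  have "continuous_on W (\<lambda>z. Re (h z / h p))" using h by (intro continuous_intros) auto
  then have "open (W \<inter> (\<lambda>z. Re (h z / h p)) -` {0<..})" by (rule continuous_open_preimage[OF _ h(2)]) auto
  then have o: "open V" by (simp add: V_def vimage_def Int_def)
  \<comment> \<open>Division by \<open>h p\<close> moves the values into the right half plane, away
    from the branch cut of \<open>csqrt\<close>.\<close>
  define g where "g z = csqrt (h p) * csqrt (h z / h p)" for z
  have "continuous_on V (\<lambda>z. csqrt (h z / h p))"
  proof (rule continuous_on_compose2[of "{z. Re z > 0}" csqrt])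
    have "isCont csqrt z" if "Re z > 0" for z using continuous_at_csqrt that complex_nonpos_Reals_iff by fastforce
    then show "continuous_on {z. 0 < Re z} csqrt" by (simp add: continuous_at_imp_continuous_on)
    show "continuous_on V (\<lambda>z. h z / h p)" using h continuous_on_subset[OF h(1), of V] by (intro continuous_intros) (auto simp: V_def)
  qed (auto simp: V_def)
  then have "continuous_on V g" unfolding g_def by (intro continuous_intros)
  moreover have "(g z)\<^sup>2 = h z" for z using h(4) by (simp add: g_def power_mult_distrib)
  moreover have "p \<in> V" using h by (simp add: V_def)
  ultimately show ?thesis using that[of V g] o by (auto simp: V_def)
qed

section \<open>The isotropic and the non-isotropic case\<close>

lemma restrict_riccati_solution:
  assumes "open W" "smooth_on W \<mu>" "\<And>q. q \<in> W \<Longrightarrow> theta s \<mu> q = 0"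
  shows "restrict \<mu> W \<in> riccati_solutions W s"
  unfolding riccati_solutions_def
proof (intro CollectI conjI ballI)
  show "smooth_on W (restrict \<mu> W)" by (rule smooth_on_cong[OF assms(1,2)]) simp
  fix q assume q: "q \<in> W"
  have "dz (restrict \<mu> W) q = dz \<mu> q" by (rule dz_cong(1)[OF assms(1) q]) simp
  then show "theta s (restrict \<mu> W) q = 0" using assms(3)[OF q] q by (simp add: theta_def)
qed simp

locale willmore_conformal_surface = conformal_surface +
  assumes EL0: "\<And>p. p \<in> U \<Longrightarrow> EL p = 0"
begin

section \<open>The quadratic equation and its discriminant\<close>

abbreviation "D1 \<equiv> Dzbar Y \<kappa>"
abbreviation "hopf_span q \<equiv> vec.span {\<kappa> q, D1 q}"
abbreviation "eta_sq m q \<equiv> mink (eta Y \<kappa> m q) (eta Y \<kappa> m q)"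

lemma DD\<kappa>: "p \<in> U \<Longrightarrow> Dzbar Y D1 p = - (cnj (s p) / 2) *s \<kappa> p"
  using EL0[of p] unfolding EL_def by (simp add: eq_neg_iff_add_eq_0)

definition "ka q = mink (\<kappa> q) (\<kappa> q)"
definition "kb q = mink (D1 q) (\<kappa> q)"
definition "kc q = mink (D1 q) (D1 q)"
text \<open>The discriminant of \<open>eta_sq m q\<close> as a polynomial in the conjugate of
  \<open>m\<close>; the usual factor 4 is absorbed by the leading coefficient
  \<open>ka q / 4\<close>.\<close>

definition "disc q = (kb q)\<^sup>2 - ka q * kc q"

abbreviation "continuous_root W \<mu> \<equiv> continuous_on W \<mu> \<and> (\<forall>q\<in>W. eta_sq (\<mu> q) q = 0)"
abbreviation "adjoint_pair W \<mu>1 \<mu>2 \<equiv>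
  defines_adjoint W Y \<kappa> s \<mu>1 \<and> defines_adjoint W Y \<kappa> s \<mu>2 \<and>
  (\<forall>q\<in>W. \<forall>m. eta_sq m q = ka q / 4 * (cnj m - cnj (\<mu>1 q)) * (cnj m - cnj (\<mu>2 q)))"

lemma smooth_k: "smooth_on U ka" "smooth_on U kb" "smooth_on U kc" "smooth_on U disc"
  unfolding ka_def[abs_def] kb_def[abs_def] kc_def[abs_def] disc_def[abs_def]
  by (intro smooth_intros open_U smooth_D\<kappa>)+

text \<open>The equation \<open>EL = 0\<close> closes the system: \<open>dzbar\<close> maps each of
  the three products to a combination of the three, and \<open>disc\<close> is annihilated by
  it.\<close>

lemma dzbar_k:
  assumes p: "p \<in> U"
  shows "dzbar ka p = 2 * kb p" "dzbar kb p = kc p - cnj (s p) / 2 * ka p" "dzbar kc p = - cnj (s p) * kb p"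
proof -
  note nf = normal_field_\<kappa>[OF open_U order_refl] normal_field_Dzbar[OF normal_field_\<kappa>[OF open_U order_refl]]
  show "dzbar ka p = 2 * kb p"
    unfolding ka_def[abs_def] dzbar_mink_normal[OF nf(1,1) p] by (simp add: kb_def mink_commute)
  show "dzbar kb p = kc p - cnj (s p) / 2 * ka p"
    unfolding kb_def[abs_def] dzbar_mink_normal[OF nf(2,1) p] DD\<kappa>[OF p] by (simp add: kc_def ka_def)
  show "dzbar kc p = - cnj (s p) * kb p"
    unfolding kc_def[abs_def] dzbar_mink_normal[OF nf(2,2) p] DD\<kappa>[OF p] by (simp add: kb_def mink_commute)
qed

lemma disc_holomorphic: "disc holomorphic_on U"
proof (rule dzbar_eq_0_holomorphic[OF open_U smooth_k(4)])
  fix p assume p: "p \<in> U"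
  have s: "smooth_on U (\<lambda>q. (kb q)\<^sup>2)" "smooth_on U (\<lambda>q. ka q * kc q)" by (intro smooth_intros open_U smooth_k)+
  note d = smooth_on_differentiable[OF _ p]
  have "dzbar disc p = 2 * kb p * dzbar kb p - (dzbar ka p * kc p + ka p * dzbar kc p)"
    unfolding disc_def[abs_def] dz_rules(4)[OF s[THEN d]] dz_rules(6)[OF smooth_k(1,3)[THEN d]] dz_rules1(12)[OF smooth_k(2)[THEN d]] ..
  then show "dzbar disc p = 0" unfolding dzbar_k[OF p] by (simp add: algebra_simps)
qed

lemma mink_eta: "eta_sq m p = kc p + cnj m * kb p + (cnj m)\<^sup>2 / 4 * ka p"
  by (simp add: eta_def kc_def kb_def ka_def mink_commute[of "\<kappa> p" "D1 p"] power2_eq_square algebra_simps)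

lemma theta_cnj: "\<mu> differentiable at p \<Longrightarrow>
  theta s \<mu> p = 0 \<longleftrightarrow> dzbar (\<lambda>q. cnj (\<mu> q)) p = (cnj (\<mu> p))\<^sup>2 / 2 + cnj (s p)"
proof -
  assume d: "\<mu> differentiable at p"
  have "theta s \<mu> p = 0 \<longleftrightarrow> dz \<mu> p = (\<mu> p)\<^sup>2 / 2 + s p" by (auto simp: theta_def algebra_simps)
  also have "\<dots> \<longleftrightarrow> cnj (dz \<mu> p) = cnj ((\<mu> p)\<^sup>2 / 2 + s p)" by (simp only: complex_cnj_cancel_iff)
  finally show ?thesis by (simp add: dz_rules1[OF d])
qed

lemma root_factorization:
  assumes "w\<^sup>2 = disc p" "ka p \<noteq> 0" "cnj m1 = 2 * (w - kb p) / ka p" "cnj m2 = 2 * (- w - kb p) / ka p"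
  shows "eta_sq m p = ka p / 4 * (cnj m - cnj m1) * (cnj m - cnj m2)"
proof -
  have e: "a / 4 * (x - 2 * (w - b) / a) * (x - 2 * (- w - b) / a) = (b\<^sup>2 - w\<^sup>2) / a + x * b + x\<^sup>2 / 4 * a"
    if "a \<noteq> 0" for a b x w :: complex
    using that by (simp add: field_simps power2_eq_square)
  have "(kb p)\<^sup>2 - w\<^sup>2 = ka p * kc p" using assms(1) by (simp add: disc_def)
  then show ?thesis unfolding mink_eta assms(3,4) e[OF assms(2)] using assms(2) by simp
qed

lemma root_square:
  assumes "eta_sq m p = 0"
  shows "(ka p * cnj m / 2 + kb p)\<^sup>2 = disc p"
proof -
  have "(ka p * cnj m / 2 + kb p)\<^sup>2 = ka p * (kc p + cnj m * kb p + (cnj m)\<^sup>2 / 4 * ka p) + disc p"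
    by (simp add: disc_def power2_eq_square algebra_simps)
  then show ?thesis using assms by (simp add: mink_eta)
qed

lemma continuous_root_defines_adjoint:
  assumes W: "open W" "W \<subseteq> U" and ka: "\<And>p. p \<in> W \<Longrightarrow> ka p \<noteq> 0" and c: "continuous_on W \<mu>"
    and root: "\<And>p. p \<in> W \<Longrightarrow> eta_sq (\<mu> p) p = 0"
  shows "defines_adjoint W Y \<kappa> s \<mu>"
proof -
  define g where "g q = ka q * cnj (\<mu> q) / 2 + kb q" for q
  note sk = smooth_on_subset[OF _ W(2)]
  have cg: "continuous_on W g" unfolding g_def
    by (intro continuous_intros c smooth_on_continuous_on sk smooth_k) auto
  have hg: "g holomorphic_on W"
    by (rule continuous_square_root_holomorphic[OF W(1) cg holomorphic_on_subset[OF disc_holomorphic W(2)]])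
       (simp add: g_def root_square root)
  note sg = holomorphic_smooth[OF W(1) hg]
  define \<nu> where "\<nu> q = 2 * (g q - kb q) / ka q" for q
  have s\<nu>: "smooth_on W \<nu>" unfolding \<nu>_def[abs_def] by (intro smooth_intros W sg(1) sk smooth_k ka)
  have \<nu>: "\<nu> q = cnj (\<mu> q)" if "q \<in> W" for q using ka[OF that] by (simp add: \<nu>_def g_def)
  have s\<mu>: "smooth_on W \<mu>"
    by (rule smooth_on_cong[OF W(1) smooth_on_cnj[OF W(1) s\<nu>]]) (simp add: \<nu>)
  have "theta s \<mu> p = 0" if p: "p \<in> W" for p
  proof -
    have pU: "p \<in> U" using p W by auto
    have g2: "g q = ka q * \<nu> q / 2 + kb q" if "q \<in> W" for q using \<nu>[OF that] by (simp add: g_def)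
    have s: "smooth_on W ka" "smooth_on W kb" "smooth_on W (\<lambda>q. ka q * \<nu> q)" "smooth_on W (\<lambda>q. ka q * \<nu> q / 2)"
      by (intro smooth_intros W sk smooth_k s\<nu>; simp)+
    note d = s[THEN smooth_on_differentiable, OF p] smooth_on_differentiable[OF s\<nu> p]
    have "0 = dzbar g p" using sg(2)[OF p] by simp
    also have "\<dots> = dzbar (\<lambda>q. ka q * \<nu> q / 2 + kb q) p" by (rule dz_cong(2)[OF W(1) p g2])
    also have "\<dots> = (dzbar ka p * \<nu> p + ka p * dzbar \<nu> p) / 2 + dzbar kb p"
      unfolding dz_rules(2)[OF d(4,2)] dz_rules1(10)[OF d(3)] dz_rules(6)[OF d(1,5)] ..
    finally have 1: "kb p * \<nu> p + ka p * dzbar \<nu> p / 2 + kc p - cnj (s p) / 2 * ka p = 0"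
      unfolding dzbar_k[OF pU] by (simp add: field_simps)
    have 2: "kc p + \<nu> p * kb p + (\<nu> p)\<^sup>2 / 4 * ka p = 0" using root[OF p] by (simp add: mink_eta \<nu>[OF p])
    \<comment> \<open>Subtracting the quadratic equation from \<open>dzbar g p = 0\<close> leaves
      \<open>ka p / 2\<close> times the conjugate of \<open>theta s \<mu> p\<close>.\<close>
    have "ka p * (dzbar \<nu> p / 2 - (\<nu> p)\<^sup>2 / 4 - cnj (s p) / 2)
       = (kb p * \<nu> p + ka p * dzbar \<nu> p / 2 + kc p - cnj (s p) / 2 * ka p) - (kc p + \<nu> p * kb p + (\<nu> p)\<^sup>2 / 4 * ka p)"
      by (simp add: algebra_simps)
    then have "ka p * (dzbar \<nu> p / 2 - (\<nu> p)\<^sup>2 / 4 - cnj (s p) / 2) = 0" unfolding 1 2 by simp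
    then have "dzbar \<nu> p / 2 - (\<nu> p)\<^sup>2 / 4 - cnj (s p) / 2 = 0" using ka[OF p] by simp
    moreover have "dzbar \<nu> p - ((\<nu> p)\<^sup>2 / 2 + cnj (s p)) = 2 * (dzbar \<nu> p / 2 - (\<nu> p)\<^sup>2 / 4 - cnj (s p) / 2)"
      by (simp add: algebra_simps)
    ultimately have "dzbar \<nu> p = (\<nu> p)\<^sup>2 / 2 + cnj (s p)" by (metis eq_iff_diff_eq_0 mult_zero_right)
    moreover have "dzbar (\<lambda>q. cnj (\<mu> q)) p = dzbar \<nu> p" by (rule dz_cong(2)[OF W(1) p]) (simp add: \<nu>)
    ultimately show ?thesis using theta_cnj[OF smooth_on_differentiable[OF s\<mu> p]] \<nu>[OF p] by simp
  qed
  then show ?thesis using s\<mu> root by (simp add: defines_adjoint_def)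
qed

text \<open>\<open>S\<close> is taken to be the set of points without a local continuous root. It
  consists of zeros of \<open>disc\<close> and cannot accumulate in \<open>B\<close>: such zeros are
  isolated unless \<open>disc\<close> vanishes on a ball, where the square root 0 gives a root.
  Elsewhere the other root comes from the opposite sign of the square root.\<close>

theorem nonisotropic_roots:
  assumes B: "open B" "B \<subseteq> U" and ka0: "\<And>p. p \<in> B \<Longrightarrow> ka p \<noteq> 0"
  shows "p \<in> B \<Longrightarrow> \<exists>m1 m2. \<forall>m. eta_sq m p = ka p / 4 * (cnj m - cnj m1) * (cnj m - cnj m2)"
    and "\<exists>S. S \<subseteq> {p \<in> B. (kb p)\<^sup>2 = ka p * kc p} \<and> (\<forall>p\<in>B. \<not> p islimpt S) \<and>
      (\<forall>p\<in>S. \<not> (\<exists>W \<mu>. open W \<and> p \<in> W \<and> W \<subseteq> B \<and> continuous_root W \<mu>)) \<and>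
      (\<forall>p\<in>B - S. \<exists>W \<mu>1 \<mu>2. open W \<and> p \<in> W \<and> W \<subseteq> B \<and> adjoint_pair W \<mu>1 \<mu>2)"
proof -
  show "\<exists>m1 m2. \<forall>m. eta_sq m p = ka p / 4 * (cnj m - cnj m1) * (cnj m - cnj m2)" if p: "p \<in> B"
  proof (intro exI allI)
    fix m
    show "eta_sq m p = ka p / 4 * (cnj m - cnj (cnj (2 * (csqrt (disc p) - kb p) / ka p)))
        * (cnj m - cnj (cnj (2 * (- csqrt (disc p) - kb p) / ka p)))"
      by (rule root_factorization[where w = "csqrt (disc p)", OF _ ka0[OF p]]) simp_all
  qed
  define good where "good p \<longleftrightarrow> (\<exists>W \<mu>. open W \<and> p \<in> W \<and> W \<subseteq> B \<and> continuous_root W \<mu>)" for p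
  define S where "S = {p \<in> B. \<not> good p}"
  have ck: "continuous_on V ka" "continuous_on V kb" "continuous_on V disc" if "V \<subseteq> U" for V
    using smooth_k smooth_on_continuous_on continuous_on_subset that by blast+
  have root_of: "\<exists>\<mu>. continuous_on V \<mu> \<and> (\<forall>q\<in>V. eta_sq (\<mu> q) q = 0) \<and>
       (\<forall>q\<in>V. cnj (\<mu> q) = 2 * (g q - kb q) / ka q)"
    if V: "V \<subseteq> B" and g: "continuous_on V g" "\<And>q. q \<in> V \<Longrightarrow> (g q)\<^sup>2 = disc q" for V g
  proof (intro exI conjI ballI)
    define \<mu> where "\<mu> q = cnj (2 * (g q - kb q) / ka q)" for q
    show "continuous_on V \<mu>" unfolding \<mu>_def using V B ka0 by (intro continuous_intros g ck) auto
    fix q assume q: "q \<in> V"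
    have "eta_sq (\<mu> q) q
        = ka q / 4 * (cnj (\<mu> q) - cnj (\<mu> q)) * (cnj (\<mu> q) - cnj (cnj (2 * (- g q - kb q) / ka q)))"
      by (rule root_factorization[OF g(2)[OF q]]) (use ka0 V q in \<open>auto simp: \<mu>_def\<close>)
    then show "eta_sq (\<mu> q) q = 0" by simp
    show "cnj (\<mu> q) = 2 * (g q - kb q) / ka q" by (simp add: \<mu>_def)
  qed
  have good_nz: "good p" if p: "p \<in> B" "disc p \<noteq> 0" for p
  proof -
    obtain V g where V: "open V" "p \<in> V" "V \<subseteq> B" "continuous_on V g" "\<And>z. z \<in> V \<Longrightarrow> (g z)\<^sup>2 = disc z"
      using local_continuous_square_root[OF ck(3)[OF B(2)] B(1) p] by blast
    then show ?thesis unfolding good_def using root_of[OF V(3,4,5)] by blast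
  qed
  have 1: "S \<subseteq> {p \<in> B. (kb p)\<^sup>2 = ka p * kc p}" using good_nz by (auto simp: S_def disc_def)
  have 2: "\<not> p islimpt S" if p: "p \<in> B" for p
  proof -
    obtain r where r: "r > 0" "ball p r \<subseteq> B" using B(1) p open_contains_ball by blast
    have hb: "disc holomorphic_on ball p r" using disc_holomorphic r B holomorphic_on_subset by blast
    show ?thesis
    proof (cases "\<forall>z\<in>ball p r. disc z = 0")
      case True
      have "good q" if "q \<in> ball p r" for q
      proof -
        have "\<exists>\<mu>. continuous_on (ball p r) \<mu> \<and> (\<forall>q\<in>ball p r. eta_sq (\<mu> q) q = 0) \<and>
          (\<forall>q\<in>ball p r. cnj (\<mu> q) = 2 * ((\<lambda>q. 0) q - kb q) / ka q)"
          by (rule root_of[OF r(2)]) (use True in auto)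
        then show ?thesis unfolding good_def using that r(2) open_ball by blast
      qed
      then have "ball p r \<inter> S = {}" by (auto simp: S_def)
      then show ?thesis using r(1) by (auto simp: islimpt_def intro!: exI[of _ "ball p r"])
    next
      case False
      then obtain \<phi> where \<phi>: "\<phi> \<in> ball p r" "disc \<phi> \<noteq> 0" by blast
      have "\<exists>e>0. \<forall>z\<in>ball p e - {p}. z \<in> B \<and> disc z \<noteq> 0"
      proof (cases "disc p = 0")
        case True
        show ?thesis using isolated_zeros[OF hb open_ball connected_ball _ True \<phi>] r by (metis centre_in_ball DiffD1 subsetD)
      next
        case False
        have "open (B \<inter> disc -` (- {0}))" by (rule continuous_open_preimage[OF ck(3)[OF B(2)] B(1)]) auto
        then obtain e where "e > 0" "ball p e \<subseteq> B \<inter> disc -` (- {0})" using False p open_contains_ball by blast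
        then show ?thesis by blast
      qed
      then obtain e where e: "e > 0" "\<And>z. z \<in> ball p e - {p} \<Longrightarrow> z \<in> B \<and> disc z \<noteq> 0" by blast
      have "q = p" if "q \<in> S" "q \<in> ball p e" for q using that e(2)[of q] good_nz[of q] by (auto simp: S_def)
      then show ?thesis using e(1) by (auto simp: islimpt_def intro!: exI[of _ "ball p e"])
    qed
  qed
  have 3: "\<exists>W \<mu>1 \<mu>2. open W \<and> p \<in> W \<and> W \<subseteq> B \<and> adjoint_pair W \<mu>1 \<mu>2"
    if p: "p \<in> B - S" for p
  proof -
    have "good p" using p by (auto simp: S_def)
    then obtain W \<mu> where W: "open W" "p \<in> W" "W \<subseteq> B" "continuous_on W \<mu>"
      "\<And>q. q \<in> W \<Longrightarrow> eta_sq (\<mu> q) q = 0" unfolding good_def by blast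
    have WU: "W \<subseteq> U" using W B by auto
    have kaW: "ka q \<noteq> 0" if "q \<in> W" for q using ka0 W that by auto
    define g where "g q = ka q * cnj (\<mu> q) / 2 + kb q" for q
    have cg: "continuous_on W (\<lambda>q. - g q)" unfolding g_def by (intro continuous_intros W ck WU) auto
    have g2: "(g q)\<^sup>2 = disc q" if "q \<in> W" for q unfolding g_def by (rule root_square[OF W(5)[OF that]])
    have "\<exists>\<mu>2. continuous_on W \<mu>2 \<and> (\<forall>q\<in>W. eta_sq (\<mu>2 q) q = 0) \<and>
        (\<forall>q\<in>W. cnj (\<mu>2 q) = 2 * (- g q - kb q) / ka q)"
      by (rule root_of[OF W(3) cg]) (simp add: g2)
    then obtain \<mu>2 where \<mu>2: "continuous_on W \<mu>2" "\<And>q. q \<in> W \<Longrightarrow> eta_sq (\<mu>2 q) q = 0"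
      "\<And>q. q \<in> W \<Longrightarrow> cnj (\<mu>2 q) = 2 * (- g q - kb q) / ka q" by blast
    have \<mu>: "cnj (\<mu> q) = 2 * (g q - kb q) / ka q" if "q \<in> W" for q using kaW[OF that] by (simp add: g_def)
    show ?thesis
      using W(1-3) continuous_root_defines_adjoint[OF W(1) WU kaW W(4,5)]
        continuous_root_defines_adjoint[OF W(1) WU kaW \<mu>2(1,2)] root_factorization[OF g2 kaW \<mu> \<mu>2(3)] by blast
  qed
  have 4: "\<forall>p\<in>S. \<not> good p" by (auto simp: S_def)
  show "\<exists>S. S \<subseteq> {p \<in> B. (kb p)\<^sup>2 = ka p * kc p} \<and> (\<forall>p\<in>B. \<not> p islimpt S) \<and>
      (\<forall>p\<in>S. \<not> (\<exists>W \<mu>. open W \<and> p \<in> W \<and> W \<subseteq> B \<and> continuous_root W \<mu>)) \<and>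
      (\<forall>p\<in>B - S. \<exists>W \<mu>1 \<mu>2. open W \<and> p \<in> W \<and> W \<subseteq> B \<and> adjoint_pair W \<mu>1 \<mu>2)"
    using 1 2 3 4 unfolding good_def by (intro exI[of _ S]) blast
qed

text \<open>Differentiating \<open>ka = 0\<close> gives \<open>kb = 0\<close>, and differentiating
  once more gives \<open>kc = 0\<close>.\<close>

lemma isotropic:
  assumes B: "open B" "B \<subseteq> U" and 0: "\<And>p. p \<in> B \<Longrightarrow> ka p = 0" and p: "p \<in> B"
  shows "kb p = 0" "kc p = 0" "eta_sq m p = 0"
proof -
  have b: "kb q = 0" if "q \<in> B" for q
  proof -
    have "dzbar ka q = dzbar (\<lambda>q. 0) q" by (rule dz_cong(2)[OF B(1) that 0])
    then show ?thesis using dzbar_k(1)[of q] that B by auto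
  qed
  have "dzbar kb p = dzbar (\<lambda>q. 0) p" by (rule dz_cong(2)[OF B(1) p b])
  then show "kc p = 0" using dzbar_k(2)[of p] p B 0[OF p] by auto
  then show "kb p = 0" "eta_sq m p = 0" using b[OF p] 0[OF p] by (simp_all add: mink_eta)
qed

subsection \<open>Local solutions of the Riccati equation\<close>

text \<open>The substitution \<open>cnj \<mu> = - 2 b\<^sub>zbar / b\<close> turns the Riccati equation into the linear equation
  \<open>b\<^sub>zbar\<^sub>zbar + (cnj s / 2) b = 0\<close>.\<close>

lemma linear_solutions:
  assumes B: "open B" "B \<subseteq> U" "p \<in> B"
  obtains W b1 b2 where "open W" "p \<in> W" "W \<subseteq> B" "smooth_on W b1" "smooth_on W b2"
    "\<And>q. q \<in> W \<Longrightarrow> dzbar (dzbar b1) q = - (cnj (s q) / 2) * b1 q" "\<And>q. q \<in> W \<Longrightarrow> dzbar (dzbar b2) q = - (cnj (s q) / 2) * b2 q"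
    "b1 p = 1" "dzbar b1 p = 0" "b2 p = 0" "dzbar b2 p = 1"
    "\<And>q. q \<in> W \<Longrightarrow> b1 q * dzbar b2 q - b2 q * dzbar b1 q \<noteq> 0"
proof -
  \<comment> \<open>The companion matrix for the pair formed by b and its \<open>dzbar\<close>
    derivative.\<close>
  define A where "A q = (\<chi> i j. if i = (1::2) then (if j = (2::2) then 1 else 0) else (if j = 1 then - (cnj (s q) / 2) else 0))" for q
  have "smooth_on B A" unfolding A_def[abs_def]
  proof (intro smooth_intros B(1))
    fix i j :: 2
    show "smooth_on B (\<lambda>q. if i = 1 then (if j = 2 then 1 else 0) else (if j = 1 then - (cnj (s q) / 2) else 0))"
      by (cases "i = 1"; cases "j = 2"; cases "j = 1"; simp)
         (intro smooth_intros B(1) smooth_on_subset[OF smooth_s B(2)]; simp)+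
  qed
  then obtain W \<Phi> where W: "open W" "p \<in> W" "W \<subseteq> B" "smooth_on W \<Phi>" "\<Phi> p = mat 1" "\<And>z. z \<in> W \<Longrightarrow> invertible (\<Phi> z)"
    "\<And>z c. z \<in> W \<Longrightarrow> vdzbar (\<lambda>w. \<Phi> w *v c) z = A z *v (\<Phi> z *v c)"
    by (rule dbar_fundamental_matrix[OF B(1,3)]) (rule that; assumption)
  have A1: "(A z *v x) $ 1 = x $ 2" "(A z *v x) $ 2 = - (cnj (s z) / 2) * x $ 1" for z x
    by (simp_all add: A_def matrix_vector_mult_def sum_2)
  define u where "u c z = \<Phi> z *v c" for c z
  have su: "smooth_on W (u c)" for c unfolding u_def[abs_def] by (intro smooth_intros W)
  have du: "dzbar (\<lambda>w. u c w $ 1) z = u c z $ 2" "dzbar (\<lambda>w. u c w $ 2) z = - (cnj (s z) / 2) * u c z $ 1" if "z \<in> W" for c z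
    using W(7)[OF that, of c] unfolding vdz_nth(2)[symmetric] by (simp_all add: u_def[abs_def] A1)
  define b1 b2 where "b1 z = u (axis 1 1) z $ 1" and "b2 z = u (axis 2 1) z $ 1" for z
  have sb: "smooth_on W b1" "smooth_on W b2" unfolding b1_def[abs_def] b2_def[abs_def] by (intro smooth_intros W su)+
  have d1: "dzbar b1 z = u (axis 1 1) z $ 2" "dzbar b2 z = u (axis 2 1) z $ 2" if "z \<in> W" for z
    unfolding b1_def[abs_def] b2_def[abs_def] using du(1)[OF that] by simp_all
  have d2: "dzbar (dzbar b1) z = - (cnj (s z) / 2) * b1 z" "dzbar (dzbar b2) z = - (cnj (s z) / 2) * b2 z" if "z \<in> W" for z
    using dz_cong(2)[OF W(1) that, of "dzbar b1" "\<lambda>w. u (axis 1 1) w $ 2"] dz_cong(2)[OF W(1) that, of "dzbar b2" "\<lambda>w. u (axis 2 1) w $ 2"]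
      d1 du(2)[OF that] by (simp_all add: b1_def b2_def)
  have i: "b1 p = 1" "dzbar b1 p = 0" "b2 p = 0" "dzbar b2 p = 1"
    unfolding d1[OF W(2)] by (simp_all add: b1_def b2_def u_def W(5) axis_def)
  \<comment> \<open>The Wronskian of the two solutions, equal to 1 at \<open>p\<close> and hence
    nonzero nearby.\<close>
  define w where "w q = b1 q * dzbar b2 q - b2 q * dzbar b1 q" for q
  have "smooth_on W w" unfolding w_def[abs_def] by (intro smooth_intros W sb)
  then have "open (W \<inter> w -` (- {0}))" by (intro continuous_open_preimage smooth_on_continuous_on W) auto
  moreover have "p \<in> W \<inter> w -` (- {0})" using W(2) by (simp add: w_def i)
  ultimately show ?thesis
    using that[of "W \<inter> w -` (- {0})" b1 b2] sb d2 i W(3) smooth_on_subset[of W _ "W \<inter> w -` (- {0})"]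
    by (auto simp: w_def)
qed

lemma riccati_of_linear:
  assumes W: "open W" "W \<subseteq> U" and b: "smooth_on W b" "\<And>q. q \<in> W \<Longrightarrow> b q \<noteq> 0"
    "\<And>q. q \<in> W \<Longrightarrow> dzbar (dzbar b) q = - (cnj (s q) / 2) * b q"
  defines "\<mu> \<equiv> \<lambda>q. cnj (- 2 * dzbar b q / b q)"
  shows "smooth_on W \<mu>" "\<And>q. q \<in> W \<Longrightarrow> theta s \<mu> q = 0"
proof -
  show s\<mu>: "smooth_on W \<mu>" unfolding \<mu>_def by (intro smooth_intros W b)
  fix q assume q: "q \<in> W"
  have s: "smooth_on W (dzbar b)" "smooth_on W (\<lambda>q. inverse (b q))"
    by (intro smooth_intros W b)+
  note d = s[THEN smooth_on_differentiable, OF q] smooth_on_differentiable[OF smooth_on_mult[OF W(1) smooth_on_const[OF W(1)] s(1)] q, of "- 2"] smooth_on_differentiable[OF b(1) q]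
  have "dzbar (\<lambda>q. cnj (\<mu> q)) q = dzbar (\<lambda>q. (- 2 * dzbar b q) * inverse (b q)) q"
    by (simp add: \<mu>_def divide_inverse)
  also have "\<dots> = (- 2 * dzbar (dzbar b) q) * inverse (b q) + (- 2 * dzbar b q) * (- dzbar b q / (b q)\<^sup>2)"
    unfolding dz_rules(6)[OF d(3,2)] dz_rules1(6)[OF d(1)] dz_inverse(2)[OF d(4) b(2)[OF q]] ..
  also have "\<dots> = (cnj (\<mu> q))\<^sup>2 / 2 + cnj (s q)"
    using b(2)[OF q] unfolding b(3)[OF q] \<mu>_def by (simp add: field_simps power2_eq_square)
  finally show "theta s \<mu> q = 0" using theta_cnj[OF smooth_on_differentiable[OF s\<mu> q]] by simp
qed

text \<open>One neighbourhood has to serve infinitely many solutions. Where |b1| > |b2|, no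
  combination b1 + c b2 with |c| at most 1 has a zero. At \<open>p\<close> the resulting solution
  has the value -2 times the conjugate of c, so different parameters are told apart there.\<close>

lemma riccati_family:
  assumes B: "open B" "B \<subseteq> U" "p \<in> B"
  obtains W M and C :: "complex set" where "open W" "p \<in> W" "W \<subseteq> B" "infinite C"
    "\<And>c. c \<in> C \<Longrightarrow> smooth_on W (M c)" "\<And>c q. c \<in> C \<Longrightarrow> q \<in> W \<Longrightarrow> theta s (M c) q = 0"
    "inj_on (\<lambda>c. M c p) C"
proof -
  obtain W b1 b2 where W: "open W" "p \<in> W" "W \<subseteq> B" "smooth_on W b1" "smooth_on W b2"
    and b: "\<And>q. q \<in> W \<Longrightarrow> dzbar (dzbar b1) q = - (cnj (s q) / 2) * b1 q" "\<And>q. q \<in> W \<Longrightarrow> dzbar (dzbar b2) q = - (cnj (s q) / 2) * b2 q"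
    and i: "b1 p = 1" "dzbar b1 p = 0" "b2 p = 0" "dzbar b2 p = 1"
    using linear_solutions[OF B] by metis
  define V where "V = W \<inter> (\<lambda>q. norm (b1 q) - norm (b2 q)) -` {0<..}"
  have cb: "continuous_on W b1" "continuous_on W b2" using W smooth_on_continuous_on by auto
  have V: "open V" "p \<in> V" "V \<subseteq> W" unfolding V_def
    using W i by (auto intro!: continuous_open_preimage continuous_intros cb)
  define C :: "complex set" where "C = cball 0 1"
  define M where "M c q = cnj (- 2 * dzbar (\<lambda>q. b1 q + c * b2 q) q / (b1 q + c * b2 q))" for c q
  have VU: "V \<subseteq> U" using V W B by auto
  have s: "smooth_on V b1" "smooth_on V b2" using W V smooth_on_subset by blast+
  have main: "smooth_on V (M c) \<and> (\<forall>q\<in>V. theta s (M c) q = 0) \<and> M c p = cnj (- 2 * c)" if c: "c \<in> C" for c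
  proof -
    have sc: "smooth_on V (\<lambda>q. b1 q + c * b2 q)" "smooth_on V (\<lambda>q. c * b2 q)" "smooth_on V (dzbar b1)" "smooth_on V (dzbar b2)" "smooth_on V (\<lambda>q. c * dzbar b2 q)"
      by (intro smooth_intros V s)+
    have nz: "b1 q + c * b2 q \<noteq> 0" if "q \<in> V" for q
    proof
      assume "b1 q + c * b2 q = 0"
      then have "norm (b1 q) = norm c * norm (b2 q)" by (metis add_eq_0_iff norm_minus_cancel norm_mult)
      also have "\<dots> \<le> 1 * norm (b2 q)" using c by (intro mult_right_mono) (auto simp: C_def)
      finally show False using that by (simp add: V_def)
    qed
    note sd = smooth_on_differentiable
    have d1: "dzbar (\<lambda>q. b1 q + c * b2 q) q = dzbar b1 q + c * dzbar b2 q" if "q \<in> V" for q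
      unfolding dz_rules(2)[OF sd[OF s(1) that] sd[OF sc(2) that]] dz_rules1(6)[OF sd[OF s(2) that]] ..
    have "dzbar (dzbar (\<lambda>q. b1 q + c * b2 q)) q = - (cnj (s q) / 2) * (b1 q + c * b2 q)" if q: "q \<in> V" for q
    proof -
      have "dzbar (dzbar (\<lambda>q. b1 q + c * b2 q)) q = dzbar (\<lambda>q. dzbar b1 q + c * dzbar b2 q) q"
        by (rule dz_cong(2)[OF V(1) q d1])
      also have "\<dots> = dzbar (dzbar b1) q + c * dzbar (dzbar b2) q"
        unfolding dz_rules(2)[OF sd[OF sc(3) q] sd[OF sc(5) q]] dz_rules1(6)[OF sd[OF sc(4) q]] ..
      finally show ?thesis using b q V(3) by (auto simp: algebra_simps)
    qed
    from riccati_of_linear[OF V(1) VU sc(1) nz this]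
    show ?thesis by (simp add: M_def[abs_def] d1[OF V(2)] i)
  qed
  have "infinite C" unfolding C_def using uncountable_cball[of 1 "0::complex"] countable_finite by auto
  moreover have "inj_on (\<lambda>c. M c p) C" by (rule inj_onI) (use main in simp)
  ultimately show ?thesis using that[of V C M] V W(3) main by blast
qed

text \<open>Infinitely many values at the single point \<open>p\<close>, and not just infinitely
  many functions, are recorded; through \<open>infinite_adjoint_transforms\<close> they give
  infinitely many adjoint maps.\<close>

lemma riccati_solutions_infinite:
  assumes "open B" "B \<subseteq> U" "p \<in> B"
  obtains W where "open W" "p \<in> W" "W \<subseteq> B" "infinite ((\<lambda>\<mu>. \<mu> p) ` riccati_solutions W s)"
proof -
  obtain W M and C :: "complex set" where W: "open W" "p \<in> W" "W \<subseteq> B" and M: "infinite C"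
    "\<And>c. c \<in> C \<Longrightarrow> smooth_on W (M c)" "\<And>c q. c \<in> C \<Longrightarrow> q \<in> W \<Longrightarrow> theta s (M c) q = 0"
    "inj_on (\<lambda>c. M c p) C" using riccati_family[OF assms] by metis
  have rM: "restrict (M c) W \<in> riccati_solutions W s" if "c \<in> C" for c
    by (rule restrict_riccati_solution[OF W(1) M(2)[OF that] M(3)[OF that]])
  have "(\<lambda>c. M c p) ` C \<subseteq> (\<lambda>\<mu>. \<mu> p) ` riccati_solutions W s"
  proof (rule image_subsetI)
    fix c assume "c \<in> C"
    then show "M c p \<in> (\<lambda>\<mu>. \<mu> p) ` riccati_solutions W s"
      using rM W(2)
      by (intro image_eqI[of _ _ "restrict (M c) W"]) auto
  qed
  moreover have "infinite ((\<lambda>c. M c p) ` C)" using M(1,4) finite_imageD by blast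
  ultimately show ?thesis using that W infinite_super by blast
qed

end

section \<open>Adjoint maps\<close>

context conformal_surface begin

text \<open>By the Cauchy-Schwarz inequality a real null vector with negative product with the
  future vector \<open>Y p\<close> is itself in the future half of the cone, so it can be rescaled
  to time component 1.\<close>

lemma null_vector_future:
  assumes p: "p \<in> U" and x: "vcnj x = x" "mink x x = 0" "mink x (Y p) = -1"
  shows "Re (x $ None) > 0" "x = (x $ None) *s null_vec (sphere_point x)" "sphere_point x \<in> sphere 0 1"
    "cnj (x $ None) = x $ None"
proof -
  define a where "a = Re (x $ None)"
  define w :: "real ^ 'n" where "w = (\<chi> i. Re (x $ Some i))"
  have rj: "x $ j = complex_of_real (Re (x $ j))" for j
    using x(1) by (metis Reals_cnj_iff of_real_Re vcnj_nth)
  have xn: "x $ None = complex_of_real a" and xs: "x $ Some i = complex_of_real (w $ i)" for i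
    using rj by (simp_all add: a_def w_def)
  have "complex_of_real (w \<bullet> w - a * a) = mink x x" by (simp add: mink_def xn xs inner_vec_def)
  then have aw: "w \<bullet> w = a * a" using x(2) by (metis eq_iff_diff_eq_0 of_real_eq_0_iff)
  obtain c where c: "0 < c" "Y p = complex_of_real c *s null_vec (f p)" using Y_pos[OF p] by blast
  have "complex_of_real (c * (w \<bullet> f p - a)) = mink x (Y p)"
    by (simp add: mink_def null_vec_def xn xs inner_vec_def c(2) sum_distrib_left mult_ac right_diff_distrib)
  then have "complex_of_real (c * (w \<bullet> f p - a)) = complex_of_real (-1)" using x(3) by simp
  then have "c * (w \<bullet> f p - a) = -1" by (simp only: of_real_eq_iff)
  then have "w \<bullet> f p - a < 0" using c(1) by (metis mult_less_0_iff neg_less_0_iff_less not_less_iff_gr_or_eq zero_less_one)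
  moreover have "\<bar>w \<bullet> f p\<bar> \<le> norm w * 1" using Cauchy_Schwarz_ineq2[of w "f p"] sphere_f[OF p] by simp
  moreover have nw: "norm w = \<bar>a\<bar>" unfolding norm_eq_sqrt_inner aw by simp
  ultimately have a: "a > 0" by linarith
  then show "Re (x $ None) > 0" "cnj (x $ None) = x $ None" by (simp_all add: xn)
  have sp: "sphere_point x = (1 / a) *\<^sub>R w"
    by (simp add: sphere_point_def vec_eq_iff xn xs flip: of_real_divide)
  show "x = (x $ None) *s null_vec (sphere_point x)"
    unfolding vec_eq_iff
  proof
    fix j show "x $ j = ((x $ None) *s null_vec (sphere_point x)) $ j"
      using a by (cases j) (simp_all add: null_vec_def xn xs sp)
  qed
  show "sphere_point x \<in> sphere 0 1" using a nw by (simp add: sp)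
qed

text \<open>\<open>adjoint_lift\<close> as a function of the value of \<mu> at one point. The
  modulus is written as \<open>m * cnj m\<close>, the form that can be differentiated by the Leibniz
  rule.\<close>

definition hat :: "complex \<Rightarrow> complex \<Rightarrow> 'n mvec" where
  "hat m p = (m * cnj m / 2) *s Y p + cnj m *s Yz p + m *s Yb p + N p"

lemma adjoint_lift_hat: "adjoint_lift Y N \<mu> p = hat (\<mu> p) p"
  unfolding adjoint_lift_def hat_def complex_norm_square[symmetric] by simp

lemma hat_facts:
  assumes p: "p \<in> U"
  shows "vcnj (hat m p) = hat m p" "mink (hat m p) (hat m p) = 0" "mink (hat m p) (Y p) = -1" "mink (Y p) (hat m p) = -1"
    "mink (hat m p) (Yz p) = m / 2" "mink (hat m p) (Yb p) = cnj m / 2" "hat m p \<in> Vbundle Y p"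
proof -
  show "vcnj (hat m p) = hat m p"
    by (simp add: hat_def Y_real[OF p] N_real[OF p] Yb_eq[OF p] mult.commute add_ac)
  show "mink (hat m p) (hat m p) = 0" "mink (hat m p) (Y p) = -1" "mink (Y p) (hat m p) = -1"
    "mink (hat m p) (Yz p) = m / 2" "mink (hat m p) (Yb p) = cnj m / 2"
    by (simp_all add: hat_def mink_all[OF p] algebra_simps)
  show "hat m p \<in> Vbundle Y p"
    by (rule Vbundle_combI[OF p, of _ "m * cnj m / 2" "cnj m" m 1]) (simp add: hat_def)
qed

text \<open>A point of the sphere determines its lift up to a factor. The product -1 with
  \<open>Y\<close> fixes the factor, and the product with \<open>Yz\<close> is half of
  \<mu>.\<close>

lemma adjoint_map_inj:
  assumes p: "p \<in> U" and eq: "adjoint_map Y N \<mu> p = adjoint_map Y N \<mu>' p"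
  shows "\<mu> p = \<mu>' p"
proof -
  define x y where "x = hat (\<mu> p) p" and "y = hat (\<mu>' p) p"
  note hx = hat_facts[OF p, of "\<mu> p", folded x_def] and hy = hat_facts[OF p, of "\<mu>' p", folded y_def]
  note nx = null_vector_future[OF p hx(1,2,3)] and ny = null_vector_future[OF p hy(1,2,3)]
  have sp: "sphere_point x = sphere_point y" using eq by (simp add: adjoint_map_def adjoint_lift_hat x_def y_def)
  have y0: "y $ None \<noteq> 0" using ny(1) by auto
  define r where "r = x $ None / y $ None"
  have "x = (x $ None) *s null_vec (sphere_point y)" using nx(2) sp by simp
  also have "\<dots> = r *s ((y $ None) *s null_vec (sphere_point y))" using y0 by (simp add: r_def)
  also have "\<dots> = r *s y" using ny(2) by simp
  finally have xy: "x = r *s y" .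
  have "r = 1" using hx(3) hy(3) unfolding xy by simp
  then show ?thesis using hx(5) hy(5) xy by simp
qed

lemma infinite_adjoint_transforms:
  assumes p: "p \<in> U" "p \<in> W" and inf: "infinite ((\<lambda>\<mu>. \<mu> p) ` {\<mu>. defines_adjoint W Y \<kappa> s \<mu>})"
  shows "infinite (adjoint_transforms W Y N \<kappa> s)"
proof
  assume "finite (adjoint_transforms W Y N \<kappa> s)"
  then have "finite ((\<lambda>g. g p) ` adjoint_transforms W Y N \<kappa> s)" by simp
  moreover have "(\<lambda>m. sphere_point (hat m p)) ` ((\<lambda>\<mu>. \<mu> p) ` {\<mu>. defines_adjoint W Y \<kappa> s \<mu>})
      \<subseteq> (\<lambda>g. g p) ` adjoint_transforms W Y N \<kappa> s"
  proof
    fix y assume "y \<in> (\<lambda>m. sphere_point (hat m p)) ` ((\<lambda>\<mu>. \<mu> p) ` {\<mu>. defines_adjoint W Y \<kappa> s \<mu>})"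
    then obtain \<mu> where \<mu>: "defines_adjoint W Y \<kappa> s \<mu>" "y = sphere_point (hat (\<mu> p) p)" by auto
    have "restrict (adjoint_map Y N \<mu>) W \<in> adjoint_transforms W Y N \<kappa> s" using \<mu>(1) by (auto simp: adjoint_transforms_def)
    moreover have "y = restrict (adjoint_map Y N \<mu>) W p" using \<mu>(2) p by (simp add: adjoint_map_def adjoint_lift_hat)
    ultimately show "y \<in> (\<lambda>g. g p) ` adjoint_transforms W Y N \<kappa> s" by blast
  qed
  moreover have "inj_on (\<lambda>m. sphere_point (hat m p)) ((\<lambda>\<mu>. \<mu> p) ` {\<mu>. defines_adjoint W Y \<kappa> s \<mu>})"
  proof (rule inj_onI)
    fix m m' assume "sphere_point (hat m p) = sphere_point (hat m' p)"
    then have "adjoint_map Y N (\<lambda>_. m) p = adjoint_map Y N (\<lambda>_. m') p" by (simp add: adjoint_map_def adjoint_lift_hat)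
    from adjoint_map_inj[OF p(1) this] show "m = m'" .
  qed
  ultimately show False using inf finite_subset finite_imageD by metis
qed

lemma Vbundle_f: "p \<in> U \<Longrightarrow> Vbundle (null_vec \<circ> f) p = Vbundle Y p"
proof -
  assume p: "p \<in> U"
  have "Vbundle (null_vec \<circ> f) p = Vbundle (\<lambda>q. rr q *s Y q) p"
    by (rule Vbundle_cong[OF open_U p]) (simp add: Y0)
  also have "\<dots> = Vbundle Y p" by (rule Vbundle_scale[OF open_U p smooth_rr smooth_Y rr(2)])
  finally show ?thesis .
qed

end

text \<open>The formula of \<open>immersion_frame\<close> under mere differentiability: it is
  applied to the dual map in order to decide where that map is immersed.\<close>

lemma metric_det_frame:
  assumes "g differentiable at p"
  shows "complex_of_real (metric_det g p) = 4 * frame_det (vdz (\<lambda>q. null_vec (g q)) p) (vdzbar (\<lambda>q. null_vec (g q)) p)"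
proof -
  define X where "X = (\<lambda>q. null_vec (g q))"
  have "((\<lambda>q. null_vec (g q) - null_vec 0 + null_vec 0) has_derivative (\<lambda>v. null_vec (ddir v g p) - null_vec 0)) (at p)"
    by (rule has_derivative_add_const[OF bounded_linear.has_derivative[OF bounded_linear_null_vec has_derivative_ddir[OF assms]]])
  then have dX: "X differentiable at p" unfolding differentiable_def X_def by auto
  let ?a = "vdz X p" and ?b = "vdzbar X p"
  have m: "mink (ddir v X p) (ddir w X p) = complex_of_real (metric g p v w)" for v w
    unfolding X_def by (rule mink_ddir_null_vec[OF assms])
  have m11: "complex_of_real (metric g p 1 1) = mink ?a ?a + 2 * mink ?a ?b + mink ?b ?b"
    and mii: "complex_of_real (metric g p \<i> \<i>) = 2 * mink ?a ?b - mink ?a ?a - mink ?b ?b"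
    and m1i: "complex_of_real (metric g p 1 \<i>) = \<i> * (mink ?a ?a - mink ?b ?b)"
    unfolding m[symmetric] ddir_1_i[OF dX] by (simp_all add: mink_commute[of ?b ?a] algebra_simps)
  show ?thesis
    unfolding metric_det_def of_real_diff of_real_mult of_real_power m11 mii m1i frame_det_def X_def[symmetric]
    by (simp add: algebra_simps power2_eq_square)
qed

section \<open>The dual Willmore surface\<close>

locale dual_surface = willmore_conformal_surface +
  fixes W :: "complex set" and \<mu> :: "complex \<Rightarrow> complex"
  assumes open_W: "open W" and WU: "W \<subseteq> U" and smooth_\<mu>: "smooth_on W \<mu>"
    and eta0: "\<And>q. q \<in> W \<Longrightarrow> eta Y \<kappa> (\<mu> q) q = 0" and theta0: "\<And>q. q \<in> W \<Longrightarrow> theta s \<mu> q = 0"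
begin

lemma inU: "q \<in> W \<Longrightarrow> q \<in> U" using WU by auto

lemmas sW = smooth_on_subset[OF _ WU]

text \<open>\<open>Y\<close>, \<open>Yh\<close>, \<open>PP\<close> and the conjugate of
  \<open>PP\<close> form a null frame of V adapted to both surfaces: the first pair has product -1,
  the second 1/2, and the two pairs are orthogonal to each other.\<close>

definition "PP q = Yz q + (\<mu> q / 2) *s Y q"
definition "\<rho> q = cnj (dzbar \<mu> q) - 2 * nn q"
definition "Yh q = hat (\<mu> q) q"

lemma smooth_dual: "smooth_on W PP" "smooth_on W \<rho>" "smooth_on W Yh"
  unfolding PP_def[abs_def] \<rho>_def[abs_def] Yh_def[abs_def] hat_def
  by (intro smooth_intros open_W smooth_\<mu> sW smooth_Y smooth_nn smooth_N smooth_on_vdz[OF open_U smooth_Y]; simp)+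

lemma PP_facts:
  assumes q: "q \<in> W"
  shows "mink (PP q) (PP q) = 0" "mink (PP q) (vcnj (PP q)) = 1/2" "mink (PP q) (Yh q) = 0" "mink (Yh q) (PP q) = 0"
    "mink (vcnj (PP q)) (Yh q) = 0" "mink (Yh q) (vcnj (PP q)) = 0" "mink (PP q) (Y q) = 0" "PP q \<in> Vbundle Y q" "vcnj (PP q) \<in> Vbundle Y q"
proof -
  note p = inU[OF q]
  have vP: "vcnj (PP q) = Yb q + (cnj (\<mu> q) / 2) *s Y q" by (simp add: PP_def Yb_eq[OF p] Y_real[OF p])
  note h = hat_facts[OF p, of "\<mu> q", folded Yh_def]
  show "mink (PP q) (PP q) = 0" "mink (PP q) (vcnj (PP q)) = 1/2" "mink (PP q) (Y q) = 0"
    unfolding vP by (simp_all add: PP_def mink_all[OF p])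
  show *: "mink (Yh q) (PP q) = 0" "mink (Yh q) (vcnj (PP q)) = 0" unfolding vP by (simp_all add: PP_def h)
  show "mink (PP q) (Yh q) = 0" "mink (vcnj (PP q)) (Yh q) = 0" using * by (simp_all add: mink_commute)
  show "PP q \<in> Vbundle Y q" by (rule Vbundle_combI[OF p, of _ "\<mu> q / 2" 1 0 0]) (simp add: PP_def)
  show "vcnj (PP q) \<in> Vbundle Y q" by (rule Vbundle_combI[OF p, of _ "cnj (\<mu> q) / 2" 0 1 0]) (simp add: vP)
qed

lemma dz_\<mu>: "q \<in> W \<Longrightarrow> dz \<mu> q = (\<mu> q)\<^sup>2 / 2 + s q"
  using theta0[of q] by (simp add: theta_def algebra_simps)

lemma Yhz:
  assumes q: "q \<in> W"
  shows "vdz Yh q = (\<mu> q / 2) *s Yh q + \<rho> q *s PP q"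
proof -
  note p = inU[OF q]
  have sm: "smooth_on W (\<lambda>q. \<mu> q * cnj (\<mu> q) / 2)" "smooth_on W (\<lambda>q. cnj (\<mu> q))" "smooth_on W \<mu>"
    "smooth_on W Y" "smooth_on W Yz" "smooth_on W Yb" "smooth_on W N" "smooth_on W (\<lambda>q. \<mu> q * cnj (\<mu> q))"
    by (intro smooth_intros open_W smooth_\<mu> sW smooth_Y smooth_N smooth_on_vdz[OF open_U smooth_Y]; simp)+
  note d = sm[THEN smooth_on_differentiable, OF q]
  note dv = differentiable_vscale
  have d1: "(\<lambda>q. (\<mu> q * cnj (\<mu> q) / 2) *s Y q) differentiable at q" "(\<lambda>q. cnj (\<mu> q) *s Yz q) differentiable at q"
     "(\<lambda>q. \<mu> q *s Yb q) differentiable at q"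
    "(\<lambda>q. (\<mu> q * cnj (\<mu> q) / 2) *s Y q + cnj (\<mu> q) *s Yz q) differentiable at q"
    "(\<lambda>q. (\<mu> q * cnj (\<mu> q) / 2) *s Y q + cnj (\<mu> q) *s Yz q + \<mu> q *s Yb q) differentiable at q"
    using d by (auto intro!: dv differentiable_add)
  have dm: "dz (\<lambda>q. \<mu> q * cnj (\<mu> q) / 2) q = (dz \<mu> q * cnj (\<mu> q) + \<mu> q * cnj (dzbar \<mu> q)) / 2"
    unfolding dz_rules1(9)[OF d(8)] dz_rules(5)[OF d(3,2)] dz_rules1(3)[OF d(3)] ..
  have "vdz Yh q = (dz (\<lambda>q. \<mu> q * cnj (\<mu> q) / 2) q *s Y q + (\<mu> q * cnj (\<mu> q) / 2) *s Yz q)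
     + (cnj (dzbar \<mu> q) *s Yz q + cnj (\<mu> q) *s Yzz q) + (dz \<mu> q *s Yb q + \<mu> q *s vdz Yb q) + vdz N q"
    unfolding Yh_def[abs_def] hat_def
    unfolding vdz_rules(1)[OF d1(5) d(7)] vdz_rules(1)[OF d1(4,3)] vdz_rules(1)[OF d1(1,2)]
      vdz_scale(1)[OF d(1,4)] vdz_scale(1)[OF d(2,5)] vdz_scale(1)[OF d(3,6)] dz_rules1(3)[OF d(3)] ..
  \<comment> \<open>The Riccati equation has entered through \<open>dz_\<mu>\<close>. The last
    summand is twice \<open>eta\<close> and is about to vanish.\<close>
  also have "\<dots> = (\<mu> q / 2) *s Yh q + \<rho> q *s PP q + 2 *s (D1 q + (cnj (\<mu> q) / 2) *s \<kappa> q)"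
    unfolding dm dz_\<mu>[OF q] Yzb_commute[OF p] Yzb_eq[OF p] Nz_eq[OF p] Yzz_eq[OF p] Yh_def hat_def PP_def \<rho>_def
    by (simp add: vec_eq_iff field_simps power2_eq_square)
  also have "D1 q + (cnj (\<mu> q) / 2) *s \<kappa> q = 0" using eta0[OF q] by (simp add: eta_def)
  finally show ?thesis by simp
qed

lemma Yh_null: "q \<in> W \<Longrightarrow> mink (Yh q) (Yh q) = 0"
  using hat_facts(2)[OF inU] by (simp add: Yh_def)

lemma Yh_real: "q \<in> W \<Longrightarrow> vcnj (Yh q) = Yh q"
  using hat_facts(1)[OF inU] by (simp add: Yh_def)

lemma Yhb: "q \<in> W \<Longrightarrow> vdzbar Yh q = (cnj (\<mu> q) / 2) *s Yh q + cnj (\<rho> q) *s vcnj (PP q)"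
  using vdzbar_real(1)[OF open_W smooth_dual(3) _ Yh_real] Yhz by (simp add: Yh_real)

abbreviation "g \<equiv> adjoint_map Y N \<mu>"

lemma g_eq: "g q = sphere_point (Yh q)"
  by (simp add: adjoint_map_def adjoint_lift_hat Yh_def)

lemma Yh_null_vec:
  assumes q: "q \<in> W"
  shows "Re (Yh q $ None) > 0" "Yh q $ None \<noteq> 0" "cnj (Yh q $ None) = Yh q $ None"
    "null_vec (g q) = inverse (Yh q $ None) *s Yh q" "g q \<in> sphere 0 1"
proof -
  note h = hat_facts[OF inU[OF q], of "\<mu> q", folded Yh_def]
  note n = null_vector_future[OF inU[OF q] h(1-3)]
  show "Re (Yh q $ None) > 0" "cnj (Yh q $ None) = Yh q $ None" using n by auto
  then show y0: "Yh q $ None \<noteq> 0" by auto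
  show "g q \<in> sphere 0 1" using n by (simp add: g_eq)
  have "inverse (Yh q $ None) *s Yh q = inverse (Yh q $ None) *s ((Yh q $ None) *s null_vec (sphere_point (Yh q)))" using n(2) by simp
  then show "null_vec (g q) = inverse (Yh q $ None) *s Yh q" using y0 by (simp add: g_eq)
qed

definition "\<tau> q = inverse (Yh q $ None)"

lemma smooth_\<tau>: "smooth_on W \<tau>"
  unfolding \<tau>_def[abs_def] by (intro smooth_intros open_W smooth_dual Yh_null_vec)

lemma null_vec_g: "q \<in> W \<Longrightarrow> (null_vec \<circ> g) q = \<tau> q *s Yh q"
  using Yh_null_vec(4) by (simp add: \<tau>_def)

lemma smooth_g: "smooth_on W g"
proof -
  have "smooth_on W (\<lambda>q. \<chi> i. Re (Yh q $ Some i * \<tau> q))" by (intro smooth_intros open_W smooth_dual smooth_\<tau>)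
  then show ?thesis
    by (rule smooth_on_cong[OF open_W]) (simp add: g_eq sphere_point_def \<tau>_def divide_inverse)
qed

lemma dg:
  assumes q: "q \<in> W"
  shows "vdz (null_vec \<circ> g) q = (dz \<tau> q + \<tau> q * \<mu> q / 2) *s Yh q + (\<tau> q * \<rho> q) *s PP q"
    "vdzbar (null_vec \<circ> g) q = (dzbar \<tau> q + \<tau> q * cnj (\<mu> q) / 2) *s Yh q + (\<tau> q * cnj (\<rho> q)) *s vcnj (PP q)"
proof -
  note d = smooth_on_differentiable[OF smooth_\<tau> q] smooth_on_differentiable[OF smooth_dual(3) q]
  have "vdz (null_vec \<circ> g) q = vdz (\<lambda>q. \<tau> q *s Yh q) q" "vdzbar (null_vec \<circ> g) q = vdzbar (\<lambda>q. \<tau> q *s Yh q) q"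
    by (rule vdz_cong[OF open_W q null_vec_g], assumption)+
  then show "vdz (null_vec \<circ> g) q = (dz \<tau> q + \<tau> q * \<mu> q / 2) *s Yh q + (\<tau> q * \<rho> q) *s PP q"
    "vdzbar (null_vec \<circ> g) q = (dzbar \<tau> q + \<tau> q * cnj (\<mu> q) / 2) *s Yh q + (\<tau> q * cnj (\<rho> q)) *s vcnj (PP q)"
    unfolding vdz_scale[OF d] Yhz[OF q] Yhb[OF q] by (simp_all add: vec_eq_iff algebra_simps)
qed

lemma conformal_g: "conformal_on W g"
  unfolding conformal_on_def
  by (auto simp: dg PP_facts Yh_null)

lemma inj_iff:
  assumes q: "q \<in> W"
  shows "inj (frechet_derivative g (at q)) \<longleftrightarrow> \<rho> q \<noteq> 0"
proof -
  have dgq: "g differentiable at q" using smooth_on_differentiable[OF smooth_g q] .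
  have "mink (Yh q) (Yh q) = 0" using hat_facts(2)[OF inU[OF q]] by (simp add: Yh_def)
  then have m: "mink (vdz (null_vec \<circ> g) q) (vdz (null_vec \<circ> g) q) = 0" "mink (vdz (null_vec \<circ> g) q) (vdzbar (null_vec \<circ> g) q) = \<tau> q * \<rho> q * (\<tau> q * cnj (\<rho> q)) / 2"
    unfolding dg[OF q] by (simp_all add: PP_facts[OF q])
  have c: "(\<lambda>q. null_vec (g q)) = null_vec \<circ> g" by auto
  have "cnj (\<tau> q) = \<tau> q" using Yh_null_vec(3)[OF q] by (simp add: \<tau>_def)
  then have "\<tau> q * \<rho> q * (\<tau> q * cnj (\<rho> q)) = (\<tau> q * \<rho> q) * cnj (\<tau> q * \<rho> q)" by simp
  also have "\<dots> = complex_of_real ((norm (\<tau> q * \<rho> q))\<^sup>2)" by (simp only: complex_norm_square)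
  finally have e: "\<tau> q * \<rho> q * (\<tau> q * cnj (\<rho> q)) = complex_of_real ((norm (\<tau> q * \<rho> q))\<^sup>2)" .
  have "complex_of_real (metric_det g q) = complex_of_real (((norm (\<tau> q * \<rho> q))\<^sup>2)\<^sup>2)"
    unfolding metric_det_frame[OF dgq] c frame_det_def m e by (simp add: power_divide)
  then have "metric_det g q = ((norm (\<tau> q * \<rho> q))\<^sup>2)\<^sup>2" by (simp only: of_real_eq_iff)
  then show ?thesis
    using metric_det_pos_iff_inj[OF dgq] Yh_null_vec(2)[OF q] by (simp add: \<tau>_def)
qed

section \<open>The canonical lift of the dual surface and its invariants\<close>

definition "W' = {q \<in> W. \<rho> q \<noteq> 0}"

lemma W'_facts: "open W'" "W' \<subseteq> W" "q \<in> W' \<Longrightarrow> q \<in> W" "q \<in> W' \<Longrightarrow> \<rho> q \<noteq> 0"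
proof -
  have "open (W \<inter> \<rho> -` (- {0}))" by (intro continuous_open_preimage smooth_on_continuous_on smooth_dual open_W) auto
  then show "open W'" by (simp add: W'_def vimage_def Int_def)
qed (auto simp: W'_def)

text \<open>1/|\<rho>|, written through the square of the modulus so that smoothness reduces to that
  of the real square root; \<open>uu\<close> is then the unimodular part of \<rho>.\<close>

definition "ir q = complex_of_real (inverse (sqrt (Re (\<rho> q * cnj (\<rho> q)))))"
definition "uu q = ir q * \<rho> q"
definition "al q = dz ir q / ir q + \<mu> q / 2"
definition "Yt q = ir q *s Yh q"

lemma ir_facts:
  assumes q: "q \<in> W'"
  shows "cnj (ir q) = ir q" "Re (ir q) > 0" "ir q \<noteq> 0" "uu q * cnj (uu q) = 1" "uu q \<noteq> 0"
proof -
  have n: "Re (\<rho> q * cnj (\<rho> q)) = (norm (\<rho> q))\<^sup>2" by (metis Re_complex_of_real complex_norm_square)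
  have "ir q = complex_of_real (inverse (norm (\<rho> q)))" unfolding ir_def n by simp
  moreover have "norm (\<rho> q) > 0" using W'_facts(4)[OF q] by simp
  ultimately show "cnj (ir q) = ir q" "Re (ir q) > 0" "ir q \<noteq> 0" by simp_all
  have "uu q * cnj (uu q) = complex_of_real ((norm (uu q))\<^sup>2)" by (simp only: complex_norm_square)
  moreover have "norm (uu q) = 1"
    using \<open>ir q = complex_of_real (inverse (norm (\<rho> q)))\<close> \<open>norm (\<rho> q) > 0\<close> by (simp add: uu_def norm_mult norm_inverse)
  ultimately show "uu q * cnj (uu q) = 1" by simp
  then show "uu q \<noteq> 0" by auto
qed

lemma smooth_ir: "smooth_on W' ir" "smooth_on W' uu" "smooth_on W' al" "smooth_on W' Yt"
proof -
  note s = smooth_on_subset[OF _ W'_facts(2)]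
  have n: "Re (\<rho> q * cnj (\<rho> q)) = (norm (\<rho> q))\<^sup>2" for q by (metis Re_complex_of_real complex_norm_square)
  show ir: "smooth_on W' ir" unfolding ir_def[abs_def]
    by (intro smooth_intros W'_facts(1) s smooth_dual) (use W'_facts(4) n in \<open>auto simp del: times_complex.sel\<close>)
  show "smooth_on W' uu" "smooth_on W' al" "smooth_on W' Yt"
    unfolding uu_def[abs_def] al_def[abs_def] Yt_def[abs_def]
    by (intro smooth_intros W'_facts(1) s smooth_dual ir smooth_\<mu> ir_facts(3); simp)+
qed

lemma Ytz:
  assumes q: "q \<in> W'"
  shows "vdz Yt q = al q *s Yt q + uu q *s PP q" "vdzbar Yt q = cnj (al q) *s Yt q + cnj (uu q) *s vcnj (PP q)"
proof -
  have z: "vdz Yt q = al q *s Yt q + uu q *s PP q" if q: "q \<in> W'" for q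
  proof -
    note qW = W'_facts(3)[OF q]
    note d = smooth_on_differentiable[OF smooth_ir(1) q] smooth_on_differentiable[OF smooth_dual(3) qW]
    show ?thesis unfolding Yt_def[abs_def] vdz_scale[OF d] Yhz[OF qW] al_def uu_def
      using ir_facts(3)[OF q] by (simp add: vec_eq_iff field_simps)
  qed
  have r: "vcnj (Yt q) = Yt q" if "q \<in> W'" for q using ir_facts(1)[OF that] Yh_real W'_facts(3)[OF that] by (simp add: Yt_def)
  show "vdz Yt q = al q *s Yt q + uu q *s PP q" by (rule z[OF q])
  show "vdzbar Yt q = cnj (al q) *s Yt q + cnj (uu q) *s vcnj (PP q)"
  proof -
    have "vdzbar Yt q = vcnj (vdz Yt q)" by (rule vdzbar_real(1)[OF W'_facts(1) smooth_ir(4) q r])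
    then show ?thesis unfolding z[OF q] by (simp add: r[OF q])
  qed
qed

lemma Yt_mink:
  assumes q: "q \<in> W'"
  shows "mink (Yt q) (Yt q) = 0" "mink (Yt q) (PP q) = 0" "mink (PP q) (Yt q) = 0" "mink (Yt q) (vcnj (PP q)) = 0" "mink (vcnj (PP q)) (Yt q) = 0"
  using PP_facts[OF W'_facts(3)[OF q]] hat_facts(2)[OF inU[OF W'_facts(3)[OF q]]] by (simp_all add: Yt_def Yh_def)

lemma lift_g: "canonical_lift W' g Yt"
  unfolding canonical_lift_def
proof (intro conjI ballI allI)
  show "smooth_on W' Yt" by (rule smooth_ir)
  fix q assume q: "q \<in> W'"
  note qW = W'_facts(3)[OF q]
  show "\<exists>c::real. 0 < c \<and> Yt q = complex_of_real c *s null_vec (g q)"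
  proof (intro exI conjI)
    show "0 < Re (ir q) * Re (Yh q $ None)" using ir_facts(2)[OF q] Yh_null_vec(1)[OF qW] by simp
    have "complex_of_real (Re (ir q) * Re (Yh q $ None)) = ir q * Yh q $ None"
      using ir_facts(1)[OF q] Yh_null_vec(3)[OF qW] by (metis Reals_cnj_iff of_real_Re of_real_mult)
    then show "Yt q = complex_of_real (Re (ir q) * Re (Yh q $ None)) *s null_vec (g q)"
      using Yh_null_vec(2)[OF qW] by (simp add: Yt_def Yh_null_vec(4)[OF qW])
  qed
  fix v
  have d: "Yt differentiable at q" using smooth_on_differentiable[OF smooth_ir(4) q] .
  have "mink (dir_deriv v Yt q) (dir_deriv v Yt q) = v * cnj v * (uu q * cnj (uu q))"
    unfolding dir_deriv_eq_ddir ddir_vdz[OF d] Ytz[OF q]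
    by (simp add: PP_facts[OF qW] Yt_mink[OF q] mink_commute[of "vcnj (PP q)" "PP q"])
  then show "mink (dir_deriv v Yt q) (dir_deriv v Yt q) = complex_of_real ((norm v)\<^sup>2)"
    by (simp only: ir_facts(4)[OF q] complex_norm_square mult_1_right)
qed

sublocale dual: conformal_lift W' g Yt
  by unfold_locales (use W'_facts Yh_null_vec(5) lift_g in auto)

definition "Nt q = 2 *s vdzbar (vdz Yt) q + (2 * mink (vdzbar (vdz Yt) q) (vdzbar (vdz Yt) q)) *s Yt q"
definition "\<kappa>t q = uu q *s \<kappa> q"
definition "st q = - 2 * (dz al q + (al q)\<^sup>2)"

lemma PPz:
  assumes q: "q \<in> W"
  shows "vdz PP q = \<kappa> q + (\<mu> q / 2) *s PP q" "vdzbar PP q = Yzb q + (dzbar \<mu> q / 2) *s Y q + (\<mu> q / 2) *s Yb q"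
proof -
  note p = inU[OF q]
  have sm: "smooth_on W (\<lambda>q. \<mu> q / 2)" "smooth_on W \<mu>" "smooth_on W Y" "smooth_on W Yz" "smooth_on W (\<lambda>q. (\<mu> q / 2) *s Y q)"
    by (intro smooth_intros open_W smooth_\<mu> sW smooth_Y smooth_on_vdz[OF open_U smooth_Y]; simp)+
  note d = sm[THEN smooth_on_differentiable, OF q]
  show "vdz PP q = \<kappa> q + (\<mu> q / 2) *s PP q"
    unfolding PP_def[abs_def] vdz_rules(1)[OF d(4,5)] vdz_scale(1)[OF d(1,3)] dz_rules1(9)[OF d(2)] dz_\<mu>[OF q] Yzz_eq[OF p]
    by (simp add: vec_eq_iff field_simps power2_eq_square)
  show "vdzbar PP q = Yzb q + (dzbar \<mu> q / 2) *s Y q + (\<mu> q / 2) *s Yb q"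
    unfolding PP_def[abs_def] vdz_rules(2)[OF d(4,5)] vdz_scale(2)[OF d(1,3)] dz_rules1(10)[OF d(2)] by (simp add: add.assoc)
qed

text \<open>The coefficient of \<open>PP\<close> in the second derivative need not be computed: the
  identity \<open>dual.mink_2\<close> for a canonical lift forces it to be 0. What remains is
  already the normal form defining Hopf differential and Schwarzian.\<close>

lemma Ytzz:
  assumes q: "q \<in> W'"
  shows "al q * uu q + dz uu q + uu q * \<mu> q / 2 = 0" "vdz (vdz Yt) q + (st q / 2) *s Yt q = \<kappa>t q"
    "vdzbar (vdz Yt) q \<in> Vbundle Y q"
proof -
  note qW = W'_facts(3)[OF q] note p = inU[OF qW]
  note s = smooth_on_subset[OF _ W'_facts(2)]
  have sm: "smooth_on W' al" "smooth_on W' uu" "smooth_on W' Yt" "smooth_on W' PP" "smooth_on W' (\<lambda>q. al q *s Yt q)" "smooth_on W' (\<lambda>q. uu q *s PP q)"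
    by (intro smooth_intros W'_facts(1) smooth_ir s smooth_dual)+
  note d = sm[THEN smooth_on_differentiable, OF q]
  have "vdz (vdz Yt) q = vdz (\<lambda>q. al q *s Yt q + uu q *s PP q) q"
    by (rule vdz_cong(1)[OF W'_facts(1) q Ytz(1)])
  also have "\<dots> = (dz al q *s Yt q + al q *s (al q *s Yt q + uu q *s PP q)) + (dz uu q *s PP q + uu q *s (\<kappa> q + (\<mu> q / 2) *s PP q))"
    unfolding vdz_rules(1)[OF d(5,6)] vdz_scale(1)[OF d(1,3)] vdz_scale(1)[OF d(2,4)] Ytz[OF q] PPz[OF qW] ..
  finally have zz: "vdz (vdz Yt) q = (dz al q + (al q)\<^sup>2) *s Yt q + (al q * uu q + dz uu q + uu q * \<mu> q / 2) *s PP q + uu q *s \<kappa> q"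
    by (simp add: vec_eq_iff algebra_simps power2_eq_square)
  have vb: "vdzbar Yt q \<in> Vbundle Y q" unfolding Ytz[OF q] Yt_def Yh_def
    using PP_facts[OF qW] hat_facts(7)[OF p] by (intro vec.subspace_add vec.subspace_scale) (auto simp: Vbundle_def)
  then have "mink (vdzbar Yt q) (\<kappa> q) = 0" using \<kappa>_perp[OF p] by (auto simp: mperp_def)
  then have k0: "mink (\<kappa> q) (vdzbar Yt q) = 0" by (simp add: mink_commute[of "\<kappa> q" "vdzbar Yt q"])
  have "mink (vdz (vdz Yt) q) (vdzbar Yt q) = 0" by (rule dual.mink_2(7)[OF q])
  then have "(al q * uu q + dz uu q + uu q * \<mu> q / 2) * (cnj (uu q) * (1/2)) = 0"
    unfolding zz mink_simps k0 unfolding Ytz[OF q] using PP_facts[OF qW] Yt_mink[OF q] by simp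
  then show e: "al q * uu q + dz uu q + uu q * \<mu> q / 2 = 0" using ir_facts(5)[OF q] by simp
  show "vdz (vdz Yt) q + (st q / 2) *s Yt q = \<kappa>t q"
  proof -
    have st2: "st q / 2 = - (dz al q + (al q)\<^sup>2)" by (simp add: st_def)
    show ?thesis unfolding zz e st2 by (simp add: \<kappa>t_def vec_eq_iff algebra_simps)
  qed
  have "vdzbar (vdz Yt) q = vdzbar (\<lambda>q. al q *s Yt q + uu q *s PP q) q"
    by (rule vdz_cong(2)[OF W'_facts(1) q Ytz(1)])
  also have "\<dots> = (dzbar al q *s Yt q + al q *s vdzbar Yt q) + (dzbar uu q *s PP q + uu q *s vdzbar PP q)"
    unfolding vdz_rules(2)[OF d(5,6)] vdz_scale(2)[OF d(1,3)] vdz_scale(2)[OF d(2,4)] ..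
  finally have zb: "vdzbar (vdz Yt) q = (dzbar al q *s Yt q + al q *s vdzbar Yt q) + (dzbar uu q *s PP q + uu q *s vdzbar PP q)" .
  have "vdzbar PP q \<in> Vbundle Y q"
    by (rule Vbundle_combI[OF p, of _ "dzbar \<mu> q / 2 - nn q" 0 "\<mu> q / 2" "1/2"])
       (simp add: PPz[OF qW] Yzb_eq[OF p] vec_eq_iff algebra_simps)
  then show "vdzbar (vdz Yt) q \<in> Vbundle Y q" unfolding zb
    using vb PP_facts(8)[OF qW] hat_facts(7)[OF p, of "\<mu> q"] unfolding Yt_def Yh_def
    by (intro vec.subspace_add vec.subspace_scale) (auto simp: Vbundle_def)
qed

lemma normal_t: "normal_section W' Yt Nt"
  unfolding Nt_def[abs_def] by (rule dual.normal_section_exists)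

lemma Vbundle_dual:
  assumes q: "q \<in> W'"
  shows "Vbundle Yt q = Vbundle Y q"
proof
  note qW = W'_facts(3)[OF q] note p = inU[OF qW]
  note sub = vec.subspace_span[of "{Y q, Yz q, Yb q, Yzb q}", folded Vbundle_def]
  note subt = vec.subspace_span[of "{Yt q, vdz Yt q, vdzbar Yt q, vdzbar (vdz Yt) q}", folded Vbundle_def]
  note PPf = PP_facts[OF qW] and hf = hat_facts[OF p, of "\<mu> q", folded Yh_def]
  have Yt: "Yt q \<in> Vbundle Y q" unfolding Yt_def by (rule vec.subspace_scale[OF sub hf(7)])
  have 1: "vdz Yt q \<in> Vbundle Y q" "vdzbar Yt q \<in> Vbundle Y q"
    unfolding Ytz[OF q] by (intro vec.subspace_add[OF sub] vec.subspace_scale[OF sub] Yt PPf)+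
  show le: "Vbundle Yt q \<subseteq> Vbundle Y q" unfolding Vbundle_def[of Yt]
    by (rule vec.span_minimal[OF _ sub]) (use Yt 1 Ytzz(3)[OF q] in auto)
  have b: "Yt q \<in> Vbundle Yt q" "vdz Yt q \<in> Vbundle Yt q" "vdzbar Yt q \<in> Vbundle Yt q" "vdzbar (vdz Yt) q \<in> Vbundle Yt q"
    by (auto simp: Vbundle_def vec.span_base)
  have "uu q *s PP q = vdz Yt q - al q *s Yt q" "cnj (uu q) *s vcnj (PP q) = vdzbar Yt q - cnj (al q) *s Yt q"
    unfolding Ytz[OF q] by simp_all
  then have uP: "uu q *s PP q \<in> Vbundle Yt q" "cnj (uu q) *s vcnj (PP q) \<in> Vbundle Yt q"
    using vec.subspace_diff[OF subt] vec.subspace_scale[OF subt] b by metis+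
  have P: "PP q \<in> Vbundle Yt q" "vcnj (PP q) \<in> Vbundle Yt q"
    using vec.subspace_scale[OF subt uP(1), of "inverse (uu q)"] vec.subspace_scale[OF subt uP(2), of "inverse (cnj (uu q))"]
      ir_facts(5)[OF q] by simp_all
  have Yh: "Yh q \<in> Vbundle Yt q"
    using vec.subspace_scale[OF subt b(1), of "inverse (ir q)"] ir_facts(3)[OF q] by (simp add: Yt_def)
  have nt: "Nt q \<in> Vbundle Yt q" "mink (Yt q) (Nt q) = -1" using normal_t q by (auto simp: normal_section_def)
  obtain a1 a2 a3 a4 where n: "Nt q = a1 *s Y q + a2 *s Yz q + a3 *s Yb q + a4 *s Yzb q"
    using subsetD[OF le nt(1)] unfolding Vbundle_def in_span4 by blast
  \<comment> \<open>What is left of \<open>Nt q\<close> after subtracting its components along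
    \<open>Yh\<close> and along \<open>PP\<close> and its conjugate is \<open>d *s Y q\<close>.
    Since \<open>Yt\<close> is orthogonal to the subtracted vectors and has product -1 with
    \<open>Nt\<close>, this rest is nonzero, so \<open>Y q\<close> lies in the bundle of the dual
    surface.\<close>
  define d where "d = a1 - a4 * nn q - a2 * \<mu> q / 2 - a3 * cnj (\<mu> q) / 2 + (a4 / 2) * (\<mu> q * cnj (\<mu> q) / 2)"
  define e where "e = Nt q - (a4 / 2) *s Yh q - (a2 - a4 / 2 * cnj (\<mu> q)) *s PP q - (a3 - a4 / 2 * \<mu> q) *s vcnj (PP q)"
  have vP: "vcnj (PP q) = Yb q + (cnj (\<mu> q) / 2) *s Y q" by (simp add: PP_def Yb_eq[OF p] Y_real[OF p])
  have eY: "e = d *s Y q" unfolding e_def n d_def vP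
    unfolding Yh_def hat_def PP_def Yzb_eq[OF p] by (simp add: vec_eq_iff field_simps)
  have eV: "e \<in> Vbundle Yt q" unfolding e_def
    by (intro vec.subspace_diff[OF subt] vec.subspace_scale[OF subt] nt Yh P)
  have "mink (Yt q) e = -1" unfolding e_def using nt(2) by (simp add: Yt_def PP_facts[OF qW] hf(2))
  then have "d \<noteq> 0" unfolding eY by auto
  then have Y: "Y q \<in> Vbundle Yt q" using vec.subspace_scale[OF subt eV, of "inverse d"] by (simp add: eY)
  have "Yz q = PP q - (\<mu> q / 2) *s Y q" "Yb q = vcnj (PP q) - (cnj (\<mu> q) / 2) *s Y q" unfolding vP by (simp_all add: PP_def)
  then have Y2: "Yz q \<in> Vbundle Yt q" "Yb q \<in> Vbundle Yt q"
    using vec.subspace_diff[OF subt] vec.subspace_scale[OF subt] P Y by metis+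
  have "Yzb q = (1/2) *s (Yh q - (\<mu> q * cnj (\<mu> q) / 2) *s Y q - cnj (\<mu> q) *s Yz q - \<mu> q *s Yb q) - nn q *s Y q"
    unfolding Yzb_eq[OF p] Yh_def hat_def by simp
  then have "Yzb q \<in> Vbundle Yt q"
    using vec.subspace_diff[OF subt] vec.subspace_scale[OF subt] Yh Y Y2 by metis
  then show "Vbundle Y q \<subseteq> Vbundle Yt q" unfolding Vbundle_def[of Y]
    by (intro vec.span_minimal[OF _ subt]) (use Y Y2 in auto)
qed

lemma hopf_t: "hopf_schwarzian W' Yt \<kappa>t st"
  unfolding hopf_schwarzian_def
proof (intro ballI conjI)
  fix q assume q: "q \<in> W'"
  show "\<kappa>t q \<in> mperp (Vbundle Yt q)"
    unfolding Vbundle_dual[OF q] \<kappa>t_def by (intro mperp_scale \<kappa>_perp inU W'_facts(3)[OF q])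
  show "vdz (vdz Yt) q + (st q / 2) *s Yt q = \<kappa>t q" by (rule Ytzz(2)[OF q])
qed

sublocale dual: conformal_surface W' g Yt Nt \<kappa>t st
  by unfold_locales (rule normal_t hopf_t)+

text \<open>Both surfaces have the same V, hence the same \<open>Dzbar\<close>. As
  \<open>eta\<close> vanishes, \<open>Dzbar\<close> sends multiples of \<open>\<kappa>\<close> to
  multiples of \<open>\<kappa>\<close>, and everything becomes a scalar computation with
  \<open>uu\<close> and \<open>al\<close>, the functions from which \<open>st\<close> is
  built.\<close>

lemma dual_EL:
  assumes q: "q \<in> W'"
  shows "dual.EL q = 0"
proof -
  note s = smooth_on_subset[OF _ W'_facts(2)]
  have W'U: "W' \<subseteq> U" using W'_facts(2) WU by auto
  have D: "Dzbar Yt \<psi> q = Dzbar Y \<psi> q" if "q \<in> W'" for \<psi> q by (simp add: Dzbar_def Vbundle_dual[OF that])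
  have D1: "D1 q = - (cnj (\<mu> q) / 2) *s \<kappa> q" if "q \<in> W'" for q
    using eta0[OF W'_facts(3)[OF that]] by (simp add: eta_def eq_neg_iff_add_eq_0)
  note nf = normal_field_\<kappa>[OF W'_facts(1) W'U]
  have sh: "smooth_on W' (\<lambda>q. uu q * cnj (al q))" "smooth_on W' (\<lambda>q. cnj (al q))" "smooth_on W' (\<lambda>q. cnj (uu q))"
    by (intro smooth_intros W'_facts(1) smooth_ir)+
  note sd = smooth_on_differentiable
  \<comment> \<open>The conjugate of the first part of \<open>Ytzz\<close>, combined with the
    derivative of |uu|^2 = 1.\<close>
  have h: "dzbar uu q - uu q * cnj (\<mu> q) / 2 = uu q * cnj (al q)" if q: "q \<in> W'" for q
  proof -
    have "cnj (al q * uu q + dz uu q + uu q * \<mu> q / 2) = 0" using Ytzz(1)[OF q] by simp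
    then have c: "cnj (al q) * cnj (uu q) + cnj (dz uu q) + cnj (uu q) * cnj (\<mu> q) / 2 = 0" by simp
    have "dzbar (\<lambda>q. uu q * cnj (uu q)) q = dzbar (\<lambda>q. 1) q"
      by (rule dz_cong(2)[OF W'_facts(1) q]) (rule ir_facts(4))
    then have "dzbar uu q * cnj (uu q) + uu q * cnj (dz uu q) = 0"
      using dz_rules(6)[OF sd[OF smooth_ir(2) q] sd[OF sh(3) q]] dz_rules1(4)[OF sd[OF smooth_ir(2) q]] by simp
    moreover have "(dzbar uu q - uu q * cnj (\<mu> q) / 2 - uu q * cnj (al q)) * cnj (uu q)
       = (dzbar uu q * cnj (uu q) + uu q * cnj (dz uu q))
         - uu q * (cnj (al q) * cnj (uu q) + cnj (dz uu q) + cnj (uu q) * cnj (\<mu> q) / 2)"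
      by (simp add: algebra_simps)
    ultimately have "(dzbar uu q - uu q * cnj (\<mu> q) / 2 - uu q * cnj (al q)) * cnj (uu q) = 0" unfolding c by simp
    then show ?thesis using ir_facts(5)[OF q] by simp
  qed
  have 1: "Dzbar Yt \<kappa>t q = (uu q * cnj (al q)) *s \<kappa> q" if q: "q \<in> W'" for q
  proof -
    have "Dzbar Yt \<kappa>t q = dzbar uu q *s \<kappa> q + uu q *s D1 q"
      unfolding D[OF q] \<kappa>t_def[abs_def] by (rule Dzbar_scale[OF nf smooth_ir(2) q])
    also have "\<dots> = (dzbar uu q - uu q * cnj (\<mu> q) / 2) *s \<kappa> q" unfolding D1[OF q] by (simp add: vec_eq_iff algebra_simps)
    finally show ?thesis unfolding h[OF q] .
  qed
  have "Dzbar Yt (Dzbar Yt \<kappa>t) q = Dzbar Y (\<lambda>q. (uu q * cnj (al q)) *s \<kappa> q) q"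
    unfolding D[OF q] by (rule Dzbar_cong[OF W'_facts(1) W'U q 1])
  also have "\<dots> = dzbar (\<lambda>q. uu q * cnj (al q)) q *s \<kappa> q + (uu q * cnj (al q)) *s D1 q"
    by (rule Dzbar_scale[OF nf sh(1) q])
  also have "dzbar (\<lambda>q. uu q * cnj (al q)) q = dzbar uu q * cnj (al q) + uu q * cnj (dz al q)"
    unfolding dz_rules(6)[OF sd[OF smooth_ir(2) q] sd[OF sh(2) q]] dz_rules1(4)[OF sd[OF smooth_ir(3) q]] ..
  also have "(dzbar uu q * cnj (al q) + uu q * cnj (dz al q)) *s \<kappa> q + (uu q * cnj (al q)) *s D1 q
     = ((dzbar uu q - uu q * cnj (\<mu> q) / 2) * cnj (al q) + uu q * cnj (dz al q)) *s \<kappa> q"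
    unfolding D1[OF q] by (simp add: vec_eq_iff algebra_simps)
  finally have DD: "Dzbar Yt (Dzbar Yt \<kappa>t) q = (uu q * cnj (al q) * cnj (al q) + uu q * cnj (dz al q)) *s \<kappa> q"
    unfolding h[OF q] .
  have st2: "cnj (st q) / 2 = - (cnj (dz al q) + (cnj (al q))\<^sup>2)" by (simp add: st_def)
  show ?thesis unfolding dual.EL_def DD st2 by (simp add: \<kappa>t_def vec_eq_iff power2_eq_square algebra_simps)
qed

theorem dual_willmore: "dual_willmore_surface W f g"
proof -
  have W'_eq: "{p \<in> W. inj (frechet_derivative g (at p))} = W'" using inj_iff by (auto simp: W'_def)
  have imm: "immersion_on W' g"
    unfolding immersion_on_def using smooth_on_subset[OF smooth_g W'_facts(2)] Yh_null_vec(5) W'_facts inj_iff by blast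
  have wW': "willmore_surface W' g" by (rule dual.willmore_surface_if_EL[OF imm dual_EL])
  have V: "Vbundle (null_vec \<circ> g) p = Vbundle (null_vec \<circ> f) p" if "p \<in> W'" for p
    unfolding dual.Vbundle_f[OF that] Vbundle_dual[OF that] Vbundle_f[OF inU[OF W'_facts(3)[OF that]]] ..
  have pt: "g p \<in> sphere 0 1 \<and> g p \<noteq> f p \<and> null_vec (g p) \<in> Vbundle (null_vec \<circ> f) p \<and>
     (\<forall>v. dir_deriv v (null_vec \<circ> g) p \<in> Vbundle (null_vec \<circ> f) p)" if q: "p \<in> W" for p
  proof (intro conjI allI)
    note pU = inU[OF q]
    note sub = vec.subspace_span[of "{Y p, Yz p, Yb p, Yzb p}", folded Vbundle_def]
    note hf = hat_facts[OF pU, of "\<mu> p", folded Yh_def]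
    show "g p \<in> sphere 0 1" by (rule Yh_null_vec(5)[OF q])
    show "g p \<noteq> f p"
    proof
      assume "g p = f p"
      then have "inverse (Yh p $ None) *s Yh p = rr p *s Y p" using Yh_null_vec(4)[OF q] Y0(4)[OF pU] by simp
      then have "mink (inverse (Yh p $ None) *s Yh p) (Y p) = mink (rr p *s Y p) (Y p)" by simp
      then show False using hf(3) Y_null[OF pU] Yh_null_vec(2)[OF q] by simp
    qed
    show "null_vec (g p) \<in> Vbundle (null_vec \<circ> f) p"
      unfolding Vbundle_f[OF pU] Yh_null_vec(4)[OF q] by (rule vec.subspace_scale[OF sub hf(7)])
    have "smooth_on W (\<lambda>q. null_vec (g q))" by (rule smooth_null_vec[OF open_W smooth_g])
    then have d: "(null_vec \<circ> g) differentiable at p" using smooth_on_differentiable[OF _ q] by (simp add: o_def)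
    show "dir_deriv v (null_vec \<circ> g) p \<in> Vbundle (null_vec \<circ> f) p" for v
      unfolding Vbundle_f[OF pU] dir_deriv_eq_ddir ddir_vdz[OF d] dg[OF q]
      by (intro vec.subspace_add[OF sub] vec.subspace_scale[OF sub] hf(7) PP_facts[OF q])
  qed
  show ?thesis unfolding dual_willmore_surface_def Let_def W'_eq
    using smooth_g conformal_g pt wW' V by auto
qed

end

section \<open>Saturation of a pair of holomorphic vector fields\<close>

text \<open>Independence of the pair and not of the set {a, b}: the latter would be independent for
  a = b \<noteq> 0.\<close>

definition indep2 :: "complex ^ 'm \<Rightarrow> complex ^ 'm \<Rightarrow> bool" where
  "indep2 a b \<longleftrightarrow> (\<forall>x y. x *s a + y *s b = 0 \<longrightarrow> x = 0 \<and> y = 0)"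

lemma in_span2: "v \<in> vec.span {a, b} \<longleftrightarrow> (\<exists>x y. v = x *s a + y *s (b :: complex ^ 'm))"
proof
  assume "v \<in> vec.span {a, b}"
  then obtain x where "v - x *s a \<in> vec.span {b}" by (auto simp: vec.span_breakdown_eq)
  then obtain y where "v - x *s a = y *s b" by (auto simp: vec.span_singleton)
  then have "v = x *s a + y *s b" by (simp add: algebra_simps)
  then show "\<exists>x y. v = x *s a + y *s b" by blast
next
  assume "\<exists>x y. v = x *s a + y *s b"
  then obtain x y where v: "v = x *s a + y *s b" by blast
  show "v \<in> vec.span {a, b}" unfolding v by (intro vec.span_add vec.span_scale vec.span_base) simp_all
qed

text \<open>Turns independence into the nonvanishing of scalar functions, to which continuity and
  the identity theorem apply.\<close>

lemma indep2_iff_minor: "indep2 a b \<longleftrightarrow> (\<exists>i j. a $ i * b $ j \<noteq> a $ j * b $ i)"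
proof
  assume i: "indep2 a b"
  show "\<exists>i j. a $ i * b $ j \<noteq> a $ j * b $ i"
  proof (rule ccontr)
    assume "\<not> (\<exists>i j. a $ i * b $ j \<noteq> a $ j * b $ i)"
    then have m: "a $ i * b $ j = a $ j * b $ i" for i j by blast
    have "(b $ i) *s a + (- (a $ i)) *s b = 0" for i
      using m[of i] by (simp add: vec_eq_iff mult.commute)
    then have "a $ i = 0" for i using i unfolding indep2_def by (metis neg_equal_0_iff_equal)
    then have "1 *s a + 0 *s b = 0" by (simp add: vec_eq_iff)
    then show False using i unfolding indep2_def by (metis zero_neq_one)
  qed
next
  assume "\<exists>i j. a $ i * b $ j \<noteq> a $ j * b $ i"
  then obtain i j where ij: "a $ i * b $ j - a $ j * b $ i \<noteq> 0" by auto
  show "indep2 a b" unfolding indep2_def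
  proof (intro allI impI)
    fix x y assume "x *s a + y *s b = 0"
    then have e: "x * a $ k + y * b $ k = 0" for k by (metis vector_add_component vector_smult_component zero_index)
    have "x * (a $ i * b $ j - a $ j * b $ i) = (x * a $ i + y * b $ i) * b $ j - (x * a $ j + y * b $ j) * b $ i"
      "y * (a $ i * b $ j - a $ j * b $ i) = (x * a $ j + y * b $ j) * a $ i - (x * a $ i + y * b $ i) * a $ j"
      by (simp_all add: algebra_simps)
    then show "x = 0 \<and> y = 0" using ij unfolding e by simp
  qed
qed

lemma indep2_iff_dim: "indep2 a b \<longleftrightarrow> vec.dim {a, b} = 2"
proof
  assume i: "indep2 a b"
  have "b \<noteq> 0" using i unfolding indep2_def by (metis add.right_neutral vector_smult_lzero vector_smult_rzero zero_neq_one)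
  moreover have a: "a \<notin> vec.span {b}"
  proof
    assume "a \<in> vec.span {b}"
    then obtain k where "a = k *s b" by (auto simp: vec.span_singleton)
    then have "1 *s a + (- k) *s b = 0" by (simp add: vec_eq_iff)
    then show False using i unfolding indep2_def by (metis zero_neq_one)
  qed
  ultimately have "vec.independent {a, b}"
    by (intro vec.independent_insertI) (simp_all add: vec.independent_empty)
  moreover have "a \<noteq> b" using a vec.span_base[of b "{b}"] by auto
  then have "card {a, b} = 2" by simp
  ultimately show "vec.dim {a, b} = 2" using vec.dim_eq_card_independent by metis
next
  assume d: "vec.dim {a, b} = 2"
  show "indep2 a b" unfolding indep2_def
  proof (intro allI impI, rule ccontr)
    fix x y assume e: "x *s a + y *s b = 0" and n: "\<not> (x = 0 \<and> y = 0)"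
    have "\<exists>c. {a, b} \<subseteq> vec.span {c}"
    proof (cases "x = 0")
      case True
      then have "b = 0" using e n by simp
      then show ?thesis by (intro exI[of _ a]) (auto intro: vec.span_base vec.span_zero)
    next
      case False
      have "a = (- y / x) *s b"
      proof -
        have "x * a $ k = - y * b $ k" for k
          using arg_cong[OF e, of "\<lambda>v. v $ k"] by (simp add: eq_neg_iff_add_eq_0)
        then show ?thesis using False by (simp add: vec_eq_iff field_simps)
      qed
      then have "a \<in> vec.span {b}" unfolding vec.span_singleton by blast
      then show ?thesis by (intro exI[of _ b]) (simp add: vec.span_base)
    qed
    then obtain c where "{a, b} \<subseteq> vec.span {c}" by blast
    then have "vec.dim {a, b} \<le> card {c}" by (intro vec.dim_le_card) auto
    then show False using d by simp
  qed
qed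

lemma indep2_span_cong: "vec.span {a, b} = vec.span {c, d} \<Longrightarrow> indep2 a b \<longleftrightarrow> indep2 c d"
  unfolding indep2_iff_dim by (metis vec.dim_span)

lemma span2_combination:
  assumes "x * y' - x' * y \<noteq> 0"
  shows "vec.span {x *s a + y *s b, x' *s a + y' *s b} = vec.span {a, b :: complex ^ 'm}"
proof
  show "vec.span {x *s a + y *s b, x' *s a + y' *s b} \<subseteq> vec.span {a, b}"
    by (rule vec.span_minimal) (auto simp: in_span2)
  have "a = (y' / (x * y' - x' * y)) *s (x *s a + y *s b) + (- y / (x * y' - x' * y)) *s (x' *s a + y' *s b)"
    "b = (- x' / (x * y' - x' * y)) *s (x *s a + y *s b) + (x / (x * y' - x' * y)) *s (x' *s a + y' *s b)"
    using assms by (simp_all add: vec_eq_iff divide_simps) (simp_all add: algebra_simps)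
  then have "a \<in> vec.span {x *s a + y *s b, x' *s a + y' *s b}" "b \<in> vec.span {x *s a + y *s b, x' *s a + y' *s b}"
    unfolding in_span2 by blast+
  then have "{a, b} \<subseteq> vec.span {x *s a + y *s b, x' *s a + y' *s b}" by simp
  then show "vec.span {a, b} \<subseteq> vec.span {x *s a + y *s b, x' *s a + y' *s b}"
    by (rule vec.span_minimal) simp
qed

lemma matvec_combination: "(A :: complex ^ 'm ^ 'm) *v (x *s a + y *s b) = x *s (A *v a) + y *s (A *v b)"
  by (simp add: matrix_vector_right_distrib vector_scalar_commute)

lemma invertible_matvec_0: "invertible (A :: complex ^ 'm ^ 'm) \<Longrightarrow> A *v x = 0 \<Longrightarrow> x = 0"
proof -
  assume "invertible A" and x: "A *v x = 0"
  then obtain B where B: "B ** A = mat 1" by (auto simp: invertible_def)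
  have "x = B *v (A *v x)" unfolding matrix_vector_mul_assoc B by simp
  then show "x = 0" unfolding x by simp
qed

lemma span2_matvec_eq:
  assumes "vec.span {a, b} = vec.span {c, d}"
  shows "vec.span {A *v a, A *v b} = vec.span {A *v c, (A :: complex ^ 'm ^ 'm) *v d}"
proof -
  have "vec.span {A *v a, A *v b} = (\<lambda>x. A *v x) ` vec.span {a, b}" for a b
  proof (intro set_eqI iffI)
    fix v assume "v \<in> vec.span {A *v a, A *v b}"
    then obtain x y where "v = A *v (x *s a + y *s b)" unfolding in_span2 matvec_combination by blast
    moreover have "x *s a + y *s b \<in> vec.span {a, b}" unfolding in_span2 by blast
    ultimately show "v \<in> (\<lambda>x. A *v x) ` vec.span {a, b}" by blast
  next
    fix v assume "v \<in> (\<lambda>x. A *v x) ` vec.span {a, b}"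
    then obtain w where w: "v = A *v w" "w \<in> vec.span {a, b}" by blast
    then obtain x y where "w = x *s a + y *s b" unfolding in_span2 by blast
    then show "v \<in> vec.span {A *v a, A *v b}" unfolding in_span2 w(1) matvec_combination[symmetric] by blast
  qed
  then show ?thesis using assms by simp
qed

lemma indep2_matvec: "invertible (A :: complex ^ 'm ^ 'm) \<Longrightarrow> indep2 (A *v a) (A *v b) \<longleftrightarrow> indep2 a b"
proof -
  assume "invertible A"
  then have "A *v w = 0 \<longleftrightarrow> w = 0" for w using invertible_matvec_0 by auto
  then show ?thesis unfolding indep2_def matvec_combination[symmetric] by simp
qed

lemma holomorphic_vector_division:
  assumes F: "\<And>k. (\<lambda>z. F z $ k) holomorphic_on ball p r" and r: "0 < r" and F0: "F p = (0 :: complex ^ 'm)"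
  obtains G where "\<And>k. (\<lambda>z. G z $ k) holomorphic_on ball p r" "\<And>z. z \<in> ball p r \<Longrightarrow> F z = (z - p) *s G z"
proof -
  define G where "G z = (\<chi> k. if z = p then deriv (\<lambda>z. F z $ k) p else (F z $ k - F p $ k) / (z - p))" for z
  show ?thesis
  proof (rule that[of G])
    show "(\<lambda>z. G z $ k) holomorphic_on ball p r" for k
      unfolding G_def vec_lambda_beta by (rule pole_lemma[OF F]) (use r in simp)
    show "F z = (z - p) *s G z" for z
      unfolding vec_eq_iff vector_smult_component G_def vec_lambda_beta by (cases "z = p") (simp_all add: F0)
  qed
qed

lemma continuous_zero_at_centre:
  fixes c :: "complex \<Rightarrow> complex"
  assumes r: "0 < r" and c: "continuous_on (ball p r) c" "\<And>z. z \<in> ball p r \<Longrightarrow> z \<noteq> p \<Longrightarrow> c z = 0"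
  shows "c p = 0"
proof -
  have l: "(c \<longlongrightarrow> c p) (at p)"
    using r c(1) continuous_on_eq_continuous_at[OF open_ball] isCont_def by (metis centre_in_ball)
  have "\<forall>\<^sub>F z in at p. z \<in> ball p r - {p}" using r by (intro eventually_at_in_open) auto
  then have "\<forall>\<^sub>F z in at p. c z = 0" by (rule eventually_mono) (use c(2) in auto)
  then have "(c \<longlongrightarrow> 0) (at p)" by (rule tendsto_eventually)
  then show ?thesis using l tendsto_unique[OF trivial_limit_at] by blast
qed

text \<open>Dividing by \<open>z - p\<close> a combination which vanishes at \<open>p\<close> lowers the order of the zero of the minor.\<close>

lemma saturate_pair:
  fixes g h :: "complex \<Rightarrow> complex ^ 'm"
  assumes r: "0 < r"
    and "\<And>k. (\<lambda>z. g z $ k) holomorphic_on ball p r" "\<And>k. (\<lambda>z. h z $ k) holomorphic_on ball p r"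
    and "\<And>z. z \<in> ball p r \<Longrightarrow> g z $ i * h z $ j - g z $ j * h z $ i = (z - p) ^ n * u z"
    and "u holomorphic_on ball p r" "\<And>z. z \<in> ball p r \<Longrightarrow> u z \<noteq> 0"
  shows "\<exists>G H. (\<forall>k. (\<lambda>z. G z $ k) holomorphic_on ball p r) \<and> (\<forall>k. (\<lambda>z. H z $ k) holomorphic_on ball p r) \<and>
    (\<forall>z\<in>ball p r. indep2 (G z) (H z)) \<and> (\<forall>z\<in>ball p r - {p}. vec.span {G z, H z} = vec.span {g z, h z})"
  using assms(2-)
proof (induction n arbitrary: g h)
  case 0
  have "indep2 (g z) (h z)" if "z \<in> ball p r" for z
    unfolding indep2_iff_minor using 0(3,5)[OF that] by (intro exI[of _ i] exI[of _ j]) auto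
  then show ?case using 0(1,2) by (intro exI[of _ g] exI[of _ h]) auto
next
  case (Suc n)
  have reduce: ?case if g': "\<And>k. (\<lambda>z. g' z $ k) holomorphic_on ball p r" "\<And>k. (\<lambda>z. h' z $ k) holomorphic_on ball p r"
    and m: "\<And>z. z \<in> ball p r \<Longrightarrow> (z - p) * (g' z $ i * h' z $ j - g' z $ j * h' z $ i) = g z $ i * h z $ j - g z $ j * h z $ i"
    and sp: "\<And>z. z \<in> ball p r - {p} \<Longrightarrow> vec.span {g' z, h' z} = vec.span {g z, h z}" for g' h'
  proof -
    have "g' z $ i * h' z $ j - g' z $ j * h' z $ i = (z - p) ^ n * u z" if z: "z \<in> ball p r" for z
    proof -
      \<comment> \<open>Off \<open>p\<close> the identity is cancelled by z - p; at \<open>p\<close>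
        the difference of its two sides vanishes by continuity.\<close>
      define D where "D z = g' z $ i * h' z $ j - g' z $ j * h' z $ i - (z - p) ^ n * u z" for z
      have off: "g' z $ i * h' z $ j - g' z $ j * h' z $ i = (z - p) ^ n * u z" if "z \<in> ball p r" "z \<noteq> p" for z
        using m[OF that(1)] Suc.prems(3)[OF that(1)] that(2) by (simp add: mult.assoc)
      show ?thesis
      proof (cases "z = p")
        case True
        have "D holomorphic_on ball p r"
          unfolding D_def[abs_def] by (intro holomorphic_intros g' Suc.prems(4))
        then have "continuous_on (ball p r) D" by (rule holomorphic_on_imp_continuous_on)
        then have "D p = 0" by (rule continuous_zero_at_centre[OF r]) (simp add: D_def off)
        then show ?thesis using True by (simp add: D_def)
      qed (use off z in auto)
    qed
    from Suc.IH[OF g' this Suc.prems(4,5)] show ?thesis using sp by metis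
  qed
  show ?case
  proof (cases "indep2 (g p) (h p)")
    case True
    have "indep2 (g z) (h z)" if "z \<in> ball p r" for z
    proof (cases "z = p")
      case False
      then have "g z $ i * h z $ j - g z $ j * h z $ i \<noteq> 0" using Suc.prems(3,5)[OF that] by simp
      then show ?thesis unfolding indep2_iff_minor by (intro exI[of _ i] exI[of _ j]) auto
    qed (use True in simp)
    then show ?thesis using Suc.prems(1,2) by (intro exI[of _ g] exI[of _ h]) auto
  next
    case False
    then obtain x y where xy: "x *s g p + y *s h p = 0" "\<not> (x = 0 \<and> y = 0)" unfolding indep2_def by blast
    show ?thesis
    proof (cases "x = 0")
      case True
      then have "h p = 0" using xy by simp
      then obtain h' where h': "\<And>k. (\<lambda>z. h' z $ k) holomorphic_on ball p r" "\<And>z. z \<in> ball p r \<Longrightarrow> h z = (z - p) *s h' z"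
        using holomorphic_vector_division[of h p r] Suc.prems(2) r by blast
      show ?thesis
      proof (rule reduce[OF Suc.prems(1) h'(1)])
        show "(z - p) * (g z $ i * h' z $ j - g z $ j * h' z $ i) = g z $ i * h z $ j - g z $ j * h z $ i"
          if "z \<in> ball p r" for z
          unfolding h'(2)[OF that] by (simp add: algebra_simps)
        show "vec.span {g z, h' z} = vec.span {g z, h z}" if z: "z \<in> ball p r - {p}" for z
          using span2_combination[of 1 "z - p" 0 0 "g z" "h' z"] z h'(2)[of z] by auto
      qed
    next
      case False
      define F where "F z = g z + (y / x) *s h z" for z
      have "\<And>k. (\<lambda>z. F z $ k) holomorphic_on ball p r"
        unfolding F_def vector_add_component vector_smult_component by (intro holomorphic_intros Suc.prems(1,2))
      moreover have "F p = 0"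
      proof -
        have "x *s F p = 0" using xy(1) False by (simp add: F_def vec_eq_iff distrib_left)
        then show ?thesis using False by (simp add: vec_eq_iff)
      qed
      ultimately obtain g' where g': "\<And>k. (\<lambda>z. g' z $ k) holomorphic_on ball p r" "\<And>z. z \<in> ball p r \<Longrightarrow> F z = (z - p) *s g' z"
        using holomorphic_vector_division[of F p r] r by blast
      have g: "g z = (z - p) *s g' z + (- y / x) *s h z" if "z \<in> ball p r" for z
        using g'(2)[OF that] unfolding F_def by (simp add: vec_eq_iff algebra_simps)
      show ?thesis
      proof (rule reduce[OF g'(1) Suc.prems(2)])
        show "(z - p) * (g' z $ i * h z $ j - g' z $ j * h z $ i) = g z $ i * h z $ j - g z $ j * h z $ i"
          if "z \<in> ball p r" for z
          unfolding g[OF that] by (simp add: algebra_simps)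
        show "vec.span {g' z, h z} = vec.span {g z, h z}" if z: "z \<in> ball p r - {p}" for z
          using span2_combination[of "z - p" 1 0 "- y / x" "g' z" "h z"] z g[of z] by auto
      qed
    qed
  qed
qed

text \<open>Independence at one point of the connected ball makes some minor not identically zero.
  Near \<open>p\<close> this minor is a power of z - p times a function without zeros, which starts
  the descent of \<open>saturate_pair\<close>.\<close>

lemma saturation:
  fixes g h :: "complex \<Rightarrow> complex ^ 'm"
  assumes r: "0 < r" and g: "\<And>k. (\<lambda>z. g z $ k) holomorphic_on ball p r" and h: "\<And>k. (\<lambda>z. h z $ k) holomorphic_on ball p r"
    and q: "q \<in> ball p r" "indep2 (g q) (h q)"
  obtains e G H where "0 < e" "e \<le> r" "\<And>k. (\<lambda>z. G z $ k) holomorphic_on ball p e" "\<And>k. (\<lambda>z. H z $ k) holomorphic_on ball p e"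
    "\<And>z. z \<in> ball p e \<Longrightarrow> indep2 (G z) (H z)" "\<And>z. z \<in> ball p e - {p} \<Longrightarrow> vec.span {G z, H z} = vec.span {g z, h z}"
proof -
  obtain i j where ij: "g q $ i * h q $ j - g q $ j * h q $ i \<noteq> 0" using q(2) unfolding indep2_iff_minor by auto
  define m where "m z = g z $ i * h z $ j - g z $ j * h z $ i" for z
  have hm: "m holomorphic_on ball p r" unfolding m_def[abs_def] by (intro holomorphic_intros g h)
  have "\<exists>e n u. 0 < e \<and> e \<le> r \<and> u holomorphic_on ball p e \<and> (\<forall>z\<in>ball p e. m z = (z - p) ^ n * u z \<and> u z \<noteq> 0)"
  proof (cases "m p = 0")
    case True
    have nc: "\<not> m constant_on ball p r"
      using True q(1) ij r unfolding constant_on_def m_def by (metis centre_in_ball)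
    obtain u e n where u: "0 < (n::nat)" "0 < e" "ball p e \<subseteq> ball p r" "u holomorphic_on ball p e"
      "\<And>w. w \<in> ball p e \<Longrightarrow> m w = (w - p) ^ n * u w" "\<And>w. w \<in> ball p e \<Longrightarrow> u w \<noteq> 0"
      using holomorphic_factor_zero_nonconstant[OF hm open_ball connected_ball _ True nc] r by (metis centre_in_ball)
    have "e \<le> r" using u(2,3) r by (simp add: ball_subset_ball_iff)
    then show ?thesis using u by blast
  next
    case False
    have "continuous_on (ball p r) m" using hm by (rule holomorphic_on_imp_continuous_on)
    then have "open (ball p r \<inter> m -` (- {0}))" by (rule continuous_open_preimage) auto
    moreover have "p \<in> ball p r \<inter> m -` (- {0})" using False r by simp
    ultimately obtain e where e: "e > 0" "ball p e \<subseteq> ball p r \<inter> m -` (- {0})" by (meson open_contains_ball)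
    then have "e \<le> r" using r by (simp add: ball_subset_ball_iff)
    moreover have "m holomorphic_on ball p e" using e(2) hm holomorphic_on_subset by blast
    ultimately show ?thesis using e by (intro exI[of _ e] exI[of _ "0::nat"] exI[of _ m]) auto
  qed
  then obtain e n u where e: "0 < e" "e \<le> r" and u: "u holomorphic_on ball p e" "\<And>z. z \<in> ball p e \<Longrightarrow> m z = (z - p) ^ n * u z"
    "\<And>z. z \<in> ball p e \<Longrightarrow> u z \<noteq> 0" by blast
  have sub: "ball p e \<subseteq> ball p r" using e(2) by (rule subset_ball)
  from saturate_pair[OF e(1) holomorphic_on_subset[OF g sub] holomorphic_on_subset[OF h sub] u(2)[unfolded m_def] u(1,3)]
  show ?thesis using that e by blast
qed

text \<open>The identity theorem, applied to every minor of the pair.\<close>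

lemma holomorphic_pair_dichotomy:
  fixes g h :: "complex \<Rightarrow> complex ^ 'm"
  assumes r: "0 < r" and g: "\<And>k. (\<lambda>z. g z $ k) holomorphic_on ball p r" and h: "\<And>k. (\<lambda>z. h z $ k) holomorphic_on ball p r"
    and e: "0 < e" "ball a e \<subseteq> ball p r" "\<And>z. z \<in> ball a e \<Longrightarrow> \<not> indep2 (g z) (h z)" and q: "q \<in> ball p r"
  shows "\<not> indep2 (g q) (h q)"
proof -
  have "g q $ i * h q $ j = g q $ j * h q $ i" for i j
  proof -
    have m: "(\<lambda>z. g z $ i * h z $ j - g z $ j * h z $ i) holomorphic_on ball p r" by (intro holomorphic_intros g h)
    have "g q $ i * h q $ j - g q $ j * h q $ i = 0"
    proof (rule analytic_continuation[OF m open_ball connected_ball e(2) _ _ _ q])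
      show "a \<in> ball p r" using e(1,2) centre_in_ball[of a e] by blast
      show "a islimpt ball a e" using e(1) by (simp add: islimpt_ball)
      show "g z $ i * h z $ j - g z $ j * h z $ i = 0" if "z \<in> ball a e" for z
        using e(3)[OF that] unfolding indep2_iff_minor by simp
    qed
    then show ?thesis by simp
  qed
  then show ?thesis unfolding indep2_iff_minor by blast
qed

section \<open>Linear algebra with smooth coefficients\<close>

lemma smooth_on_prod:
  fixes f :: "'i \<Rightarrow> 'a::real_normed_vector \<Rightarrow> complex"
  assumes "open S" "\<And>i. i \<in> I \<Longrightarrow> smooth_on S (f i)"
  shows "smooth_on S (\<lambda>x. \<Prod>i\<in>I. f i x)"
  using assms(2) by (induction I rule: infinite_finite_induct) (auto intro!: smooth_intros assms(1))

lemma smooth_on_det: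
  fixes A :: "'a::real_normed_vector \<Rightarrow> complex ^ 'm ^ 'm"
  assumes "open S" "smooth_on S A"
  shows "smooth_on S (\<lambda>x. det (A x))"
  unfolding det_def by (intro smooth_intros smooth_on_prod assms)

text \<open>Cramer's rule exhibits the solution as a quotient of polynomials in the
  coefficients.\<close>

lemma smooth_linear_solution:
  fixes A :: "'a::real_normed_vector \<Rightarrow> complex ^ 'm ^ 'm"
  assumes S: "open S" "smooth_on S A" "smooth_on S b" and inv: "\<And>x. x \<in> S \<Longrightarrow> invertible (A x)"
  obtains g where "smooth_on S g" "\<And>x. x \<in> S \<Longrightarrow> A x *v g x = b x"
proof -
  define g where "g x = (\<chi> k. det (\<chi> i j. if j = k then b x $ i else A x $ i $ j) / det (A x))" for x
  have d: "det (A x) \<noteq> 0" if "x \<in> S" for x using inv[OF that] by (simp add: invertible_det_nz)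
  show ?thesis
  proof (rule that[of g])
    have "smooth_on S (\<lambda>x. if j = k then b x $ i else A x $ i $ j)" for i j k :: 'm
      by (cases "j = k") (auto intro!: smooth_intros S)
    then show "smooth_on S g" unfolding g_def[abs_def]
      by (intro smooth_on_vec_lambda smooth_on_divide smooth_on_det S d)
    show "A x *v g x = b x" if "x \<in> S" for x
      using cramer[OF d[OF that], of "g x" "b x"] by (simp add: g_def)
  qed
qed

text \<open>The derivative of the matrix is expressed with the vector frozen at \<open>z\<close>,
  the form in which \<open>dbar_fundamental_matrix\<close> supplies it.\<close>

lemma vdzbar_matvec:
  fixes A :: "complex \<Rightarrow> complex ^ 'm ^ 'm"
  assumes "smooth_on S A" "smooth_on S g" "z \<in> S"
  shows "vdzbar (\<lambda>w. A w *v g w) z = vdzbar (\<lambda>w. A w *v g z) z + A z *v vdzbar g z"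
proof -
  note D = smooth_on_has_derivative[OF assms(1,3)] and d = smooth_on_has_derivative[OF assms(2,3)]
  have h: "((\<lambda>w. A w *v g w) has_derivative (\<lambda>v. A z *v ddir v g z + ddir v A z *v g z)) (at z)"
    by (rule bounded_bilinear.FDERIV[OF bounded_bilinear_matvec D d])
  have h0: "((\<lambda>w. A w *v g z) has_derivative (\<lambda>v. A z *v 0 + ddir v A z *v g z)) (at z)"
    by (rule bounded_bilinear.FDERIV[OF bounded_bilinear_matvec D has_derivative_const])
  have e: "vdzbar (\<lambda>w. A w *v g w) z = (1/2) *s (ddir 1 (\<lambda>w. A w *v g w) z + \<i> *s ddir \<i> (\<lambda>w. A w *v g w) z)"
    by (rule vdzbar_eq) (use h differentiable_def in blast)
  have e0: "vdzbar (\<lambda>w. A w *v g z) z = (1/2) *s (ddir 1 (\<lambda>w. A w *v g z) z + \<i> *s ddir \<i> (\<lambda>w. A w *v g z) z)"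
    by (rule vdzbar_eq) (use h0 differentiable_def in blast)
  have e1: "vdzbar g z = (1/2) *s (ddir 1 g z + \<i> *s ddir \<i> g z)"
    by (rule vdzbar_eq[OF smooth_on_differentiable[OF assms(2,3)]])
  show ?thesis
    unfolding e e0 e1 ddir_eqI[OF h] ddir_eqI[OF h0]
    by (simp add: matrix_vector_right_distrib vector_scalar_commute vector_add_ldistrib matrix_vector_mult_0_right algebra_simps)
qed

text \<open>The case of 1 by 1 matrices: an integrating factor, which makes a section that
  \<open>Dzbar\<close> maps to a multiple of itself holomorphic.\<close>

lemma scalar_dbar_solution:
  assumes W: "open W" "p \<in> W" and a: "smooth_on W a"
  obtains V b where "open V" "p \<in> V" "V \<subseteq> W" "smooth_on V b" "\<And>z. z \<in> V \<Longrightarrow> b z \<noteq> 0"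
    "\<And>z. z \<in> V \<Longrightarrow> dzbar b z = a z * b z"
proof -
  define A :: "complex \<Rightarrow> complex ^ 1 ^ 1" where "A z = (\<chi> i j. a z)" for z
  have "smooth_on W A" unfolding A_def[abs_def] by (intro smooth_intros W a)
  then obtain V \<Phi> where V: "open V" "p \<in> V" "V \<subseteq> W" "smooth_on V \<Phi>" "\<Phi> p = mat 1" "\<And>z. z \<in> V \<Longrightarrow> invertible (\<Phi> z)"
    "\<And>z c. z \<in> V \<Longrightarrow> vdzbar (\<lambda>w. \<Phi> w *v c) z = A z *v (\<Phi> z *v c)"
    by (rule dbar_fundamental_matrix[OF W]) (rule that; assumption)
  define c :: "complex ^ 1" where "c = (\<chi> i. 1)"
  show ?thesis
  proof (rule that[of V "\<lambda>z. (\<Phi> z *v c) $ 1"])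
    show "smooth_on V (\<lambda>z. (\<Phi> z *v c) $ 1)" by (intro smooth_intros V)
    fix z assume z: "z \<in> V"
    show "(\<Phi> z *v c) $ 1 \<noteq> 0"
    proof
      assume "(\<Phi> z *v c) $ 1 = 0"
      then have "\<Phi> z *v c = 0" by (simp add: vec_eq_iff forall_1)
      then have "c = 0" by (rule invertible_matvec_0[OF V(6)[OF z]])
      then show False by (simp add: c_def vec_eq_iff)
    qed
    show "dzbar (\<lambda>z. (\<Phi> z *v c) $ 1) z = a z * (\<Phi> z *v c) $ 1"
      using arg_cong[OF V(7)[OF z, of c], of "\<lambda>x. x $ 1"] unfolding vdz_nth
      by (simp add: A_def matrix_vector_mult_def sum_1)
  qed (rule V)+
qed

section \<open>Smooth frames\<close>

lemma smooth_frame_cong: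
  "(\<And>q. q \<in> B \<Longrightarrow> E q = E' q) \<Longrightarrow> smooth_frame B k \<Psi> E \<Longrightarrow> smooth_frame B k \<Psi> E'"
  unfolding smooth_frame_def by metis

lemma smooth_frame_2I:
  assumes "smooth_on B \<psi>" "smooth_on B \<phi>" "\<And>q. q \<in> B \<Longrightarrow> E q = vec.span {\<psi> q, \<phi> q}" "\<And>q. q \<in> B \<Longrightarrow> indep2 (\<psi> q) (\<phi> q)"
  shows "smooth_frame B 2 (\<lambda>j. if j = 0 then \<psi> else \<phi>) E"
proof -
  have "{..<2::nat} = {0, 1}" by auto
  then show ?thesis using assms by (simp add: smooth_frame_def indep2_iff_dim vec.dim_span)
qed

lemma smooth_frame_1_iff:
  "smooth_frame B 1 \<Psi> E \<longleftrightarrow> smooth_on B (\<Psi> 0) \<and> (\<forall>q\<in>B. E q = vec.span {\<Psi> 0 q} \<and> \<Psi> 0 q \<noteq> 0)"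
proof -
  have "vec.dim {x} = 1 \<longleftrightarrow> x \<noteq> 0" for x :: "complex ^ 'a" by (simp add: vec.dim_singleton)
  then show ?thesis by (auto simp: smooth_frame_def lessThan_Suc vec.dim_span)
qed

lemma span2_mperp: "a \<in> mperp V \<Longrightarrow> b \<in> mperp V \<Longrightarrow> vec.span {a, b} \<subseteq> mperp V"
  by (auto simp: in_span2 mperp_def)

lemma span1_mperp: "a \<in> mperp V \<Longrightarrow> vec.span {a} \<subseteq> mperp V"
  by (auto simp: vec.span_singleton mperp_def)

text \<open>The diagonal of the Minkowski form. It turns \<open>mink\<close> into a single sum over
  the index type, so that a map involving \<open>mink\<close> can be given by a matrix.\<close>

definition signature :: "'n option \<Rightarrow> complex" where
  "signature j = (case j of None \<Rightarrow> -1 | Some i \<Rightarrow> 1)"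

lemma mink_signature_sum: "mink x y = (\<Sum>j\<in>UNIV. signature j * x $ j * y $ j)"
  by (simp add: mink_def signature_def UNIV_option_conv sum.reindex)

context willmore_conformal_surface begin

subsection \<open>The S-Willmore case\<close>

text \<open>No regularity of \<mu> is assumed: near a point it is a quotient of a component of
  \<open>D1\<close> by one of \<open>\<kappa>\<close>. Applying \<open>Dzbar\<close> to D1 = \<nu>
  \<kappa> and comparing with \<open>DD\<kappa>\<close> gives the Riccati equation.\<close>

lemma eta_zero_riccati:
  assumes W: "open W" "W \<subseteq> U" and e: "\<And>q. q \<in> W \<Longrightarrow> \<kappa> q \<noteq> 0" "\<And>q. q \<in> W \<Longrightarrow> eta Y \<kappa> (\<mu> q) q = 0"
  shows "smooth_on W \<mu>" "\<And>q. q \<in> W \<Longrightarrow> theta s \<mu> q = 0"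
proof -
  define \<nu> where "\<nu> q = - (1/2) * cnj (\<mu> q)" for q
  have D1: "D1 q = \<nu> q *s \<kappa> q" if "q \<in> W" for q
    using e(2)[OF that] by (simp add: eta_def \<nu>_def eq_neg_iff_add_eq_0)
  note sk = smooth_on_subset[OF smooth_\<kappa>] and sD = smooth_on_subset[OF smooth_D\<kappa>(1)]
  show s\<mu>: "smooth_on W \<mu>"
  proof (rule smooth_on_local)
    fix p assume p: "p \<in> W"
    obtain j where j: "\<kappa> p $ j \<noteq> 0" using e(1)[OF p] by (auto simp: vec_eq_iff)
    define V where "V = W \<inter> (\<lambda>q. \<kappa> q $ j) -` (- {0})"
    have "continuous_on W (\<lambda>q. \<kappa> q $ j)" by (intro smooth_on_continuous_on smooth_intros W sk)
    then have V: "open V" "V \<subseteq> U" unfolding V_def using W by (auto intro!: continuous_open_preimage)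
    have "smooth_on V (\<lambda>q. cnj ((- 2 * (D1 q $ j)) / (\<kappa> q $ j)))"
      by (intro smooth_on_cnj smooth_on_divide smooth_on_mult smooth_on_const smooth_on_vec_nth V sk sD) (simp add: V_def)
    then have "smooth_on V \<mu>"
    proof (rule smooth_on_cong[OF V(1)])
      show "cnj ((- 2 * (D1 q $ j)) / (\<kappa> q $ j)) = \<mu> q" if "q \<in> V" for q
        using that D1[of q] by (simp add: V_def \<nu>_def)
    qed
    then show "\<exists>T. p \<in> T \<and> open T \<and> smooth_on T \<mu>" using V p j by (auto simp: V_def intro!: exI[of _ V])
  qed
  fix q assume q: "q \<in> W"
  note qU = subsetD[OF W(2) q]
  have sc: "smooth_on W (\<lambda>q. cnj (\<mu> q))" by (rule smooth_on_cnj[OF W(1) s\<mu>])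
  then have s\<nu>: "smooth_on W \<nu>" unfolding \<nu>_def[abs_def] by (rule smooth_on_mult[OF W(1) smooth_on_const[OF W(1)]])
  have d: "dzbar \<nu> q = - (1/2) * dzbar (\<lambda>q. cnj (\<mu> q)) q"
    unfolding \<nu>_def[abs_def] by (rule dz_rules1(6)[OF smooth_on_differentiable[OF sc q]])
  have "- (cnj (s q) / 2) *s \<kappa> q = Dzbar Y D1 q" using DD\<kappa>[OF qU] ..
  also have "\<dots> = Dzbar Y (\<lambda>q. \<nu> q *s \<kappa> q) q" by (rule Dzbar_cong[OF W q D1])
  also have "\<dots> = dzbar \<nu> q *s \<kappa> q + \<nu> q *s D1 q" by (rule Dzbar_scale[OF normal_field_\<kappa>[OF W] s\<nu> q])
  also have "\<dots> = (dzbar \<nu> q + (\<nu> q)\<^sup>2) *s \<kappa> q" unfolding D1[OF q] by (simp add: vec_eq_iff power2_eq_square algebra_simps)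
  finally have "- (cnj (s q) / 2) = dzbar \<nu> q + (\<nu> q)\<^sup>2" using vec.scale_right_imp_eq[OF e(1)[OF q]] by blast
  then have "dzbar (\<lambda>q. cnj (\<mu> q)) q = (cnj (\<mu> q))\<^sup>2 / 2 + cnj (s q)"
    unfolding d \<nu>_def by (simp add: power2_eq_square field_simps)
  then show "theta s \<mu> q = 0" using theta_cnj[OF smooth_on_differentiable[OF s\<mu> q]] by simp
qed

lemma eta_zero_exists:
  assumes B: "open B" "B \<subseteq> U" and p: "p \<in> B" "\<kappa> p \<noteq> 0" and sw: "s_willmore U Y \<kappa>"
  obtains W \<mu> where "open W" "p \<in> W" "W \<subseteq> B" "\<And>q. q \<in> W \<Longrightarrow> \<kappa> q \<noteq> 0" "\<And>q. q \<in> W \<Longrightarrow> eta Y \<kappa> (\<mu> q) q = 0"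
proof -
  define W where "W = B \<inter> \<kappa> -` (- {0})"
  have "open W" unfolding W_def
    by (rule continuous_open_preimage[OF smooth_on_continuous_on[OF smooth_on_subset[OF smooth_\<kappa> B(2)]] B(1)]) auto
  moreover have "\<exists>m. eta Y \<kappa> m q = 0" if "q \<in> W" for q
  proof -
    have "D1 q \<in> vec.span {\<kappa> q}" using sw that B by (auto simp: s_willmore_def W_def)
    then obtain c where "D1 q = c *s \<kappa> q" by (auto simp: vec.span_singleton)
    then have "eta Y \<kappa> (cnj (-2 * c)) q = 0" by (simp add: eta_def vec_eq_iff)
    then show ?thesis by blast
  qed
  then obtain \<mu> where "\<And>q. q \<in> W \<Longrightarrow> eta Y \<kappa> (\<mu> q) q = 0" by metis
  ultimately show ?thesis using that[of W \<mu>] p by (auto simp: W_def)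
qed

lemma eta_zero_dual_willmore:
  assumes "open W" "W \<subseteq> U" "\<And>q. q \<in> W \<Longrightarrow> \<kappa> q \<noteq> 0" "\<And>q. q \<in> W \<Longrightarrow> eta Y \<kappa> (\<mu> q) q = 0"
  shows "dual_willmore_surface W f (adjoint_map Y N \<mu>)"
proof -
  interpret dual_surface U f Y N \<kappa> s W \<mu>
    by unfold_locales (use assms eta_zero_riccati[OF assms] in auto)
  show ?thesis by (rule dual_willmore)
qed

subsection \<open>The bundle spanned by the Hopf differential and its derivative\<close>

lemma wedge_support_iff: "p \<in> wedge_support B Y \<kappa> \<longleftrightarrow> p \<in> B \<and> indep2 (\<kappa> p) (D1 p)"
  by (simp add: wedge_support_def indep2_iff_dim)

lemma open_wedge_support:
  assumes B: "open B" "B \<subseteq> U"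
  shows "open (wedge_support B Y \<kappa>)"
proof -
  have "wedge_support B Y \<kappa> = (\<Union>i j. B \<inter> (\<lambda>q. \<kappa> q $ i * D1 q $ j - \<kappa> q $ j * D1 q $ i) -` (- {0}))"
    by (auto simp: wedge_support_iff indep2_iff_minor)
  also have "open \<dots>"
    by (intro open_UN ballI continuous_open_preimage smooth_on_continuous_on smooth_intros B
      smooth_on_subset[OF smooth_\<kappa> B(2)] smooth_on_subset[OF smooth_D\<kappa>(1) B(2)]) auto
  finally show ?thesis .
qed

lemma holomorphic_pair:
  assumes B: "open B" "B \<subseteq> U" "p \<in> B"
  obtains W \<psi> \<phi> where "open W" "p \<in> W" "W \<subseteq> B" "normal_field W \<psi>" "normal_field W \<phi>"
    "\<And>q. q \<in> W \<Longrightarrow> Dzbar Y \<psi> q = 0" "\<And>q. q \<in> W \<Longrightarrow> Dzbar Y \<phi> q = 0"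
    "\<And>q. q \<in> W \<Longrightarrow> vec.span {\<psi> q, \<phi> q} = hopf_span q"
proof -
  obtain W b1 b2 where W: "open W" "p \<in> W" "W \<subseteq> B" "smooth_on W b1" "smooth_on W b2"
    and b: "\<And>q. q \<in> W \<Longrightarrow> dzbar (dzbar b1) q = - (cnj (s q) / 2) * b1 q" "\<And>q. q \<in> W \<Longrightarrow> dzbar (dzbar b2) q = - (cnj (s q) / 2) * b2 q"
    and w: "\<And>q. q \<in> W \<Longrightarrow> b1 q * dzbar b2 q - b2 q * dzbar b1 q \<noteq> 0"
    by (rule linear_solutions[OF B]) (rule that; assumption)
  have WU: "W \<subseteq> U" using W B by auto
  note nk = normal_field_\<kappa>[OF W(1) WU] note nD = normal_field_Dzbar[OF nk]
  define \<psi> where "\<psi> b q = (- dzbar b q) *s \<kappa> q + b q *s D1 q" for b q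
  have n: "normal_field W (\<psi> b) \<and> (\<forall>q\<in>W. Dzbar Y (\<psi> b) q = 0)"
    if sb: "smooth_on W b" and eq: "\<And>q. q \<in> W \<Longrightarrow> dzbar (dzbar b) q = - (cnj (s q) / 2) * b q" for b
  proof (intro conjI ballI)
    have sdb: "smooth_on W (\<lambda>q. - dzbar b q)" by (intro smooth_intros W sb)
    note n1 = normal_field_scale[OF sdb nk] and n2 = normal_field_scale[OF sb nD]
    show "normal_field W (\<psi> b)" unfolding \<psi>_def[abs_def] by (rule normal_field_add[OF n1 n2])
    fix q assume q: "q \<in> W"
    have "Dzbar Y (\<psi> b) q = (dzbar (\<lambda>q. - dzbar b q) q *s \<kappa> q + (- dzbar b q) *s D1 q) + (dzbar b q *s D1 q + b q *s Dzbar Y D1 q)"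
      unfolding \<psi>_def[abs_def] Dzbar_add[OF n1 n2 q] Dzbar_scale[OF nk sdb q] Dzbar_scale[OF nD sb q] ..
    also have "dzbar (\<lambda>q. - dzbar b q) q = - dzbar (dzbar b) q"
      by (rule dz_rules1(2)[OF smooth_on_differentiable[OF smooth_on_dz(2)[OF W(1) sb] q]])
    also have "(- dzbar (dzbar b) q *s \<kappa> q + (- dzbar b q) *s D1 q) + (dzbar b q *s D1 q + b q *s Dzbar Y D1 q) = 0"
      unfolding eq[OF q] DD\<kappa>[OF subsetD[OF WU q]] by (simp add: vec_eq_iff)
    finally show "Dzbar Y (\<psi> b) q = 0" .
  qed
  show ?thesis
  proof (rule that[OF W(1-3)])
    show "normal_field W (\<psi> b1)" "normal_field W (\<psi> b2)" "\<And>q. q \<in> W \<Longrightarrow> Dzbar Y (\<psi> b1) q = 0" "\<And>q. q \<in> W \<Longrightarrow> Dzbar Y (\<psi> b2) q = 0"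
      using n[OF W(4) b(1)] n[OF W(5) b(2)] by auto
    \<comment> \<open>The determinant of this change of basis is the Wronskian of the two
      solutions.\<close>
    show "vec.span {\<psi> b1 q, \<psi> b2 q} = hopf_span q" if "q \<in> W" for q
      unfolding \<psi>_def by (rule span2_combination) (use w[OF that] in \<open>simp add: algebra_simps\<close>)
  qed
qed

lemma span_perp: "p \<in> U \<Longrightarrow> hopf_span p \<subseteq> mperp (Vbundle Y p)"
  by (intro span2_mperp \<kappa>_perp Dzbar_mperp)

theorem wedge_holomorphic_subbundle:
  assumes B: "open B" "B \<subseteq> U"
  shows "holomorphic_subbundle (wedge_support B Y \<kappa>) Y 2 (\<lambda>p. hopf_span p)"
  unfolding holomorphic_subbundle_def
proof (intro conjI ballI)
  have wU: "wedge_support B Y \<kappa> \<subseteq> U" using B by (auto simp: wedge_support_iff)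
  fix p assume p: "p \<in> wedge_support B Y \<kappa>"
  then show "hopf_span p \<subseteq> mperp (Vbundle Y p)" using span_perp wU by blast
  obtain W \<psi> \<phi> where W: "open W" "p \<in> W" "W \<subseteq> wedge_support B Y \<kappa>" "normal_field W \<psi>" "normal_field W \<phi>"
    "\<And>q. q \<in> W \<Longrightarrow> Dzbar Y \<psi> q = 0" "\<And>q. q \<in> W \<Longrightarrow> Dzbar Y \<phi> q = 0"
    "\<And>q. q \<in> W \<Longrightarrow> vec.span {\<psi> q, \<phi> q} = hopf_span q"
    by (rule holomorphic_pair[OF open_wedge_support[OF B] wU p]) (rule that; assumption)
  have "smooth_frame W 2 (\<lambda>j. if j = 0 then \<psi> else \<phi>) (\<lambda>p. hopf_span p)"
  proof (rule smooth_frame_2I)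
    show "smooth_on W \<psi>" "smooth_on W \<phi>" using W(4,5) by (auto simp: normal_field_def)
    fix q assume q: "q \<in> W"
    show "hopf_span q = vec.span {\<psi> q, \<phi> q}" using W(8)[OF q] ..
    show "indep2 (\<psi> q) (\<phi> q)" using indep2_span_cong[OF W(8)[OF q]] subsetD[OF W(3) q] by (simp add: wedge_support_iff)
  qed
  then show "\<exists>B' \<Psi>. open B' \<and> p \<in> B' \<and> B' \<subseteq> wedge_support B Y \<kappa> \<and> smooth_frame B' 2 \<Psi> (\<lambda>p. hopf_span p) \<and>
      (\<forall>j<2. \<forall>q\<in>B'. Dzbar Y (\<Psi> j) q = 0)"
    using W by (intro exI[of _ W] exI[of _ "\<lambda>j. if j = 0 then \<psi> else \<phi>"]) auto
qed

text \<open>A frame \<open>\<Phi>\<close> of the trivial bundle, in which the holomorphic sections of the normal bundle have holomorphic coordinates.\<close>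

lemma holomorphic_trivialization:
  assumes B: "open B" "B \<subseteq> U" "p \<in> B"
  obtains e \<Phi> g h where "0 < e" "ball p e \<subseteq> B" "smooth_on (ball p e) \<Phi>" "\<Phi> p = mat 1" "\<And>z. z \<in> ball p e \<Longrightarrow> invertible (\<Phi> z)"
    "\<And>k. (\<lambda>z. g z $ k) holomorphic_on ball p e" "\<And>k. (\<lambda>z. h z $ k) holomorphic_on ball p e"
    "\<And>z. z \<in> ball p e \<Longrightarrow> vec.span {\<Phi> z *v g z, \<Phi> z *v h z} = hopf_span z"
proof -
  obtain W \<psi> \<phi> where W: "open W" "p \<in> W" "W \<subseteq> B" "normal_field W \<psi>" "normal_field W \<phi>"
    "\<And>q. q \<in> W \<Longrightarrow> Dzbar Y \<psi> q = 0" "\<And>q. q \<in> W \<Longrightarrow> Dzbar Y \<phi> q = 0"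
    "\<And>q. q \<in> W \<Longrightarrow> vec.span {\<psi> q, \<phi> q} = hopf_span q"
    by (rule holomorphic_pair[OF B]) (rule that; assumption)
  have WU: "W \<subseteq> U" using W B by auto
  note sW = smooth_on_subset[OF _ WU]
  \<comment> \<open>The zero-order term of \<open>vdzbar_normal_field\<close> as a matrix: a normal
    section is D-holomorphic exactly when its ambient \<open>vdzbar\<close> derivative is this
    matrix applied to it.\<close>
  define A where "A q = (\<chi> i j. signature j * (- 2 * cnj (\<kappa> q $ j) * Yz q $ i + 2 * cnj (D1 q $ j) * Y q $ i))" for q
  have sA: "smooth_on W A" unfolding A_def[abs_def]
    by (intro smooth_on_vec_lambda smooth_on_mult smooth_on_add smooth_on_const smooth_on_cnj smooth_on_vec_nth W(1)
      sW smooth_\<kappa> smooth_D\<kappa> smooth_Y smooth_on_vdz(1)[OF open_U smooth_Y])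
  have Av: "A q *v x = - (2 * mink x (vcnj (\<kappa> q))) *s Yz q + (2 * mink x (vcnj (D1 q))) *s Y q" for q x
  proof -
    have "(A q *v x) $ i = (- (2 * mink x (vcnj (\<kappa> q))) *s Yz q + (2 * mink x (vcnj (D1 q))) *s Y q) $ i" for i
      unfolding mink_signature_sum
      by (simp add: A_def matrix_vector_mult_def sum_distrib_left sum_distrib_right sum.distrib sum_subtractf sum_negf algebra_simps)
    then show ?thesis by (simp add: vec_eq_iff)
  qed
  obtain V \<Phi> where V: "open V" "p \<in> V" "V \<subseteq> W" "smooth_on V \<Phi>" "\<Phi> p = mat 1" "\<And>z. z \<in> V \<Longrightarrow> invertible (\<Phi> z)"
    "\<And>z c. z \<in> V \<Longrightarrow> vdzbar (\<lambda>w. \<Phi> w *v c) z = A z *v (\<Phi> z *v c)"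
    by (rule dbar_fundamental_matrix[OF W(1,2) sA]) (rule that; assumption)
  have coord: "\<exists>g. (\<forall>k. (\<lambda>z. g z $ k) holomorphic_on V) \<and> (\<forall>z\<in>V. \<Phi> z *v g z = \<psi> z)"
    if n: "normal_field W \<psi>" and D: "\<And>q. q \<in> W \<Longrightarrow> Dzbar Y \<psi> q = 0" for \<psi>
  proof -
    have s\<psi>: "smooth_on V \<psi>" using n V(3) smooth_on_subset by (auto simp: normal_field_def)
    obtain g where g: "smooth_on V g" "\<And>z. z \<in> V \<Longrightarrow> \<Phi> z *v g z = \<psi> z"
      by (rule smooth_linear_solution[OF V(1,4) s\<psi> V(6)]) (assumption, (rule that; assumption))
    have "vdzbar g z = 0" if z: "z \<in> V" for z
    proof -
      note zW = subsetD[OF V(3) z]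
      have "A z *v \<psi> z = vdzbar \<psi> z"
        unfolding vdzbar_normal_field[OF n zW] D[OF zW] Av by simp
      also have "\<dots> = vdzbar (\<lambda>w. \<Phi> w *v g w) z" by (rule vdz_cong(2)[OF V(1) z]) (simp add: g(2))
      also have "\<dots> = A z *v (\<Phi> z *v g z) + \<Phi> z *v vdzbar g z"
        unfolding vdzbar_matvec[OF V(4) g(1) z] V(7)[OF z] ..
      finally have "\<Phi> z *v vdzbar g z = 0" unfolding g(2)[OF z] by simp
      then show ?thesis by (rule invertible_matvec_0[OF V(6)[OF z]])
    qed
    then have "(\<lambda>z. g z $ k) holomorphic_on V" for k
      by (intro dzbar_eq_0_holomorphic[OF V(1) smooth_on_vec_nth[OF V(1) g(1)]]) (simp flip: vdz_nth)
    then show ?thesis using g(2) by blast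
  qed
  obtain g where g: "\<And>k. (\<lambda>z. g z $ k) holomorphic_on V" "\<And>z. z \<in> V \<Longrightarrow> \<Phi> z *v g z = \<psi> z"
    using coord[OF W(4,6)] by blast
  obtain h where h: "\<And>k. (\<lambda>z. h z $ k) holomorphic_on V" "\<And>z. z \<in> V \<Longrightarrow> \<Phi> z *v h z = \<phi> z"
    using coord[OF W(5,7)] by blast
  obtain e where e: "e > 0" "ball p e \<subseteq> V" using V(1,2) open_contains_ball by blast
  show ?thesis
  proof (rule that[OF e(1), of \<Phi> g h])
    show "ball p e \<subseteq> B" using e V W by auto
    show "\<Phi> p = mat 1" by (rule V(5))
    show "smooth_on (ball p e) \<Phi>" by (rule smooth_on_subset[OF V(4) e(2)])
    show "invertible (\<Phi> z)" if "z \<in> ball p e" for z using V(6) e(2) that by auto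
    show "(\<lambda>z. g z $ k) holomorphic_on ball p e" "(\<lambda>z. h z $ k) holomorphic_on ball p e" for k
      by (rule holomorphic_on_subset[OF _ e(2)], rule g h)+
    show "vec.span {\<Phi> z *v g z, \<Phi> z *v h z} = hopf_span z" if "z \<in> ball p e" for z
    proof -
      have z: "z \<in> V" using that e(2) by blast
      show ?thesis unfolding g(2)[OF z] h(2)[OF z] by (rule W(8)[OF subsetD[OF V(3) z]])
    qed
  qed
qed

text \<open>In a holomorphic trivialization dependence on a small ball propagates to the whole
  coordinate ball. Hence the set of points near which \<open>\<kappa>\<close> and \<open>D1\<close>
  are dependent is open and relatively closed in the connected \<open>U\<close>; were it nonempty,
  it would contain the point at which the S-Willmore condition fails.\<close>

lemma wedge_dense:
  assumes conn: "connected U" and ns: "\<not> s_willmore U Y \<kappa>" and p: "p \<in> U" "0 < d" "ball p d \<subseteq> U"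
  shows "\<exists>q\<in>ball p d. indep2 (\<kappa> q) (D1 q)"
proof (rule ccontr)
  assume none: "\<not> (\<exists>q\<in>ball p d. indep2 (\<kappa> q) (D1 q))"
  define Z where "Z = {a. \<exists>e>0. ball a e \<subseteq> U \<and> (\<forall>q\<in>ball a e. \<not> indep2 (\<kappa> q) (D1 q))}"
  have oZ: "open Z"
    unfolding open_contains_ball
  proof
    fix a assume "a \<in> Z"
    then obtain e where e: "e > 0" "ball a e \<subseteq> U" "\<And>q. q \<in> ball a e \<Longrightarrow> \<not> indep2 (\<kappa> q) (D1 q)" by (auto simp: Z_def)
    have "b \<in> Z" if "b \<in> ball a e" for b
    proof -
      obtain e' where "e' > 0" "ball b e' \<subseteq> ball a e" using \<open>b \<in> ball a e\<close> open_ball open_contains_ball by blast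
      then show ?thesis using e unfolding Z_def by blast
    qed
    then show "\<exists>e>0. ball a e \<subseteq> Z" using e(1) by blast
  qed
  have oZ': "open (U - Z)"
    unfolding open_contains_ball
  proof
    fix a assume a: "a \<in> U - Z"
    obtain e \<Phi> g h where e: "0 < e" "ball a e \<subseteq> U" "smooth_on (ball a e) \<Phi>" "\<Phi> a = mat 1" "\<And>z. z \<in> ball a e \<Longrightarrow> invertible (\<Phi> z)"
      and gh: "\<And>k. (\<lambda>z. g z $ k) holomorphic_on ball a e" "\<And>k. (\<lambda>z. h z $ k) holomorphic_on ball a e"
      and sp: "\<And>z. z \<in> ball a e \<Longrightarrow> vec.span {\<Phi> z *v g z, \<Phi> z *v h z} = hopf_span z"
      by (rule holomorphic_trivialization[OF open_U order_refl, of a]) (use a in blast, (rule that; assumption))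
    have ind: "indep2 (g z) (h z) \<longleftrightarrow> indep2 (\<kappa> z) (D1 z)" if "z \<in> ball a e" for z
      using indep2_matvec[OF e(5)[OF that]] indep2_span_cong[OF sp[OF that]] by blast
    have "b \<notin> Z" if b: "b \<in> ball a e" for b
    proof
      assume "b \<in> Z"
      then obtain d where d: "d > 0" "\<And>q. q \<in> ball b d \<Longrightarrow> \<not> indep2 (\<kappa> q) (D1 q)" by (auto simp: Z_def)
      obtain e' where e': "e' > 0" "ball b e' \<subseteq> ball a e" using b open_ball open_contains_ball by blast
      define c where "c = min d e'"
      have c: "c > 0" "ball b c \<subseteq> ball a e" "\<And>q. q \<in> ball b c \<Longrightarrow> \<not> indep2 (g q) (h q)"
      proof -
        show "c > 0" using d e' by (simp add: c_def)
        show "ball b c \<subseteq> ball a e" using e'(2) by (auto simp: c_def)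
        then show "\<not> indep2 (g q) (h q)" if "q \<in> ball b c" for q using ind[of q] d(2)[of q] that by (auto simp: c_def)
      qed
      have "\<not> indep2 (\<kappa> q) (D1 q)" if "q \<in> ball a e" for q
        using holomorphic_pair_dichotomy[OF e(1) gh c that] ind[OF that] by blast
      then have "a \<in> Z" using e(1,2) unfolding Z_def by blast
      then show False using a by blast
    qed
    then show "\<exists>e>0. ball a e \<subseteq> U - Z" using e(1,2) by blast
  qed
  have "Z \<inter> U = {} \<or> (U - Z) \<inter> U = {}"
    by (rule connectedD[OF conn oZ oZ']) auto
  moreover have "p \<in> Z \<inter> U" using p none unfolding Z_def by blast
  ultimately have UZ: "U \<subseteq> Z" by blast
  obtain p0 where p0: "p0 \<in> U" "\<kappa> p0 \<noteq> 0" "D1 p0 \<notin> vec.span {\<kappa> p0}" using ns by (auto simp: s_willmore_def)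
  have "indep2 (\<kappa> p0) (D1 p0)" unfolding indep2_def
  proof (intro allI impI)
    fix x y assume e: "x *s \<kappa> p0 + y *s D1 p0 = 0"
    have "y = 0"
    proof (rule ccontr)
      assume y: "y \<noteq> 0"
      have "D1 p0 = inverse y *s (y *s D1 p0)" using y by simp
      also have "y *s D1 p0 = (- x) *s \<kappa> p0" using e by (simp add: eq_neg_iff_add_eq_0 add.commute)
      finally have "D1 p0 = (inverse y * (- x)) *s \<kappa> p0" by simp
      then show False using p0(3) unfolding vec.span_singleton by blast
    qed
    then show "x = 0 \<and> y = 0" using e p0(2) by simp
  qed
  moreover obtain e where "e > 0" "\<And>q. q \<in> ball p0 e \<Longrightarrow> \<not> indep2 (\<kappa> q) (D1 q)"
    using subsetD[OF UZ p0(1)] by (auto simp: Z_def)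
  ultimately show False using centre_in_ball[of p0 e] by blast
qed

theorem wedge_subbundle_extends:
  assumes conn: "connected U" and ns: "\<not> s_willmore U Y \<kappa>" and B: "open B" "B \<subseteq> U"
  shows "\<exists>E. smooth_subbundle B Y 2 E \<and> (\<forall>p\<in>wedge_support B Y \<kappa>. E p = hopf_span p)"
proof -
  \<comment> \<open>A local frame that agrees with the span of \<open>\<kappa>\<close> and
    \<open>D1\<close> except possibly at its centre.\<close>
  define good where "good p e F G \<longleftrightarrow> 0 < e \<and> ball p e \<subseteq> B \<and> smooth_on (ball p e) F \<and> smooth_on (ball p e) G \<and>
      (\<forall>z\<in>ball p e. indep2 (F z) (G z)) \<and> (\<forall>z\<in>ball p e - {p}. vec.span {F z, G z} = hopf_span z)" for p e F G
  have "\<exists>e F G. good p e F G" if p: "p \<in> B" for p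
  proof -
    obtain r \<Phi> g h where r: "0 < r" "ball p r \<subseteq> B" "smooth_on (ball p r) \<Phi>" "\<Phi> p = mat 1" "\<And>z. z \<in> ball p r \<Longrightarrow> invertible (\<Phi> z)"
      and gh: "\<And>k. (\<lambda>z. g z $ k) holomorphic_on ball p r" "\<And>k. (\<lambda>z. h z $ k) holomorphic_on ball p r"
      and sp: "\<And>z. z \<in> ball p r \<Longrightarrow> vec.span {\<Phi> z *v g z, \<Phi> z *v h z} = hopf_span z"
      by (rule holomorphic_trivialization[OF B p]) (rule that; assumption)
    obtain q where q: "q \<in> ball p r" "indep2 (\<kappa> q) (D1 q)"
      using wedge_dense[OF conn ns _ r(1)] p r(2) B by blast
    have "indep2 (g q) (h q)" using indep2_matvec[OF r(5)[OF q(1)]] indep2_span_cong[OF sp[OF q(1)]] q(2) by blast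
    then obtain e G H where e: "0 < e" "e \<le> r"
      and GH: "\<And>k. (\<lambda>z. G z $ k) holomorphic_on ball p e" "\<And>k. (\<lambda>z. H z $ k) holomorphic_on ball p e"
      "\<And>z. z \<in> ball p e \<Longrightarrow> indep2 (G z) (H z)" "\<And>z. z \<in> ball p e - {p} \<Longrightarrow> vec.span {G z, H z} = vec.span {g z, h z}"
      by (rule saturation[OF r(1) gh q(1)]) (rule that; assumption)
    have sub: "ball p e \<subseteq> ball p r" using e(2) by (rule subset_ball)
    have sG: "smooth_on (ball p e) G" "smooth_on (ball p e) H"
      using holomorphic_smooth(1)[OF open_ball GH(1)] holomorphic_smooth(1)[OF open_ball GH(2)] by (simp_all add: smooth_on_vec_iff)
    show ?thesis
      unfolding good_def
    proof (intro exI conjI ballI)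
      show "0 < e" "ball p e \<subseteq> B" using e r sub by auto
      show "smooth_on (ball p e) (\<lambda>z. \<Phi> z *v G z)" "smooth_on (ball p e) (\<lambda>z. \<Phi> z *v H z)"
        by (intro smooth_on_matvec open_ball smooth_on_subset[OF r(3) sub] sG)+
      show "indep2 (\<Phi> z *v G z) (\<Phi> z *v H z)" if "z \<in> ball p e" for z
        using indep2_matvec[OF r(5)] GH(3)[OF that] sub that by blast
      show "vec.span {\<Phi> z *v G z, \<Phi> z *v H z} = hopf_span z" if z: "z \<in> ball p e - {p}" for z
        using span2_matvec_eq[OF GH(4)[OF z]] sp[of z] z sub by blast
    qed
  qed
  then obtain e F G where "\<And>p. p \<in> B \<Longrightarrow> good p (e p) (F p) (G p)" by metis
  then have loc: "\<And>p. p \<in> B \<Longrightarrow> 0 < e p" "\<And>p. p \<in> B \<Longrightarrow> ball p (e p) \<subseteq> B"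
    "\<And>p. p \<in> B \<Longrightarrow> smooth_on (ball p (e p)) (F p)" "\<And>p. p \<in> B \<Longrightarrow> smooth_on (ball p (e p)) (G p)"
    "\<And>p z. p \<in> B \<Longrightarrow> z \<in> ball p (e p) \<Longrightarrow> indep2 (F p z) (G p z)"
    "\<And>p z. p \<in> B \<Longrightarrow> z \<in> ball p (e p) - {p} \<Longrightarrow> vec.span {F p z, G p z} = hopf_span z"
    unfolding good_def by blast+
  \<comment> \<open>Outside the wedge support the value is taken from the frame centred at the point
    itself. That frame also shows that the other points of its ball belong to the support, so no two
    choices ever have to be compared.\<close>
  define E where "E p = (if p \<in> wedge_support B Y \<kappa> then hopf_span p else vec.span {F p p, G p p})" for p
  \<comment> \<open>At the centre, orthogonality to V is obtained by continuity from the surrounding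
    points.\<close>
  have perp: "H p \<in> mperp (Vbundle Y p)"
    if p: "p \<in> B" and H: "smooth_on (ball p (e p)) H" "\<And>z. z \<in> ball p (e p) - {p} \<Longrightarrow> H z \<in> hopf_span z" for p H
  proof -
    have bU: "ball p (e p) \<subseteq> U" using loc(2)[OF p] B by auto
    have "mink (H p) (X p) = 0" if X: "smooth_on U X" "\<And>z w. z \<in> U \<Longrightarrow> w \<in> mperp (Vbundle Y z) \<Longrightarrow> mink w (X z) = 0" for X
    proof (rule continuous_zero_at_centre[OF loc(1)[OF p], where c = "\<lambda>z. mink (H z) (X z)"])
      show "continuous_on (ball p (e p)) (\<lambda>z. mink (H z) (X z))"
        by (intro smooth_on_continuous_on smooth_on_mink open_ball H smooth_on_subset[OF X(1) bU])
      fix z assume z: "z \<in> ball p (e p)" "z \<noteq> p"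
      have zU: "z \<in> U" using bU z(1) by blast
      have "H z \<in> mperp (Vbundle Y z)" using subsetD[OF span_perp[OF zU] H(2)[of z]] z by blast
      then show "mink (H z) (X z) = 0" by (rule X(2)[OF zU])
    qed
    note m = this
    have pU: "p \<in> U" using p B by auto
    show ?thesis unfolding mperp_iff[OF pU]
      using m[OF smooth_Y] m[OF smooth_on_vdz(1)[OF open_U smooth_Y]] m[OF smooth_on_vdz(2)[OF open_U smooth_Y]] m[OF smooth_N] perp_dest
      by blast
  qed
  have "smooth_subbundle B Y 2 E"
    unfolding smooth_subbundle_def
  proof (intro conjI ballI)
    fix p assume p: "p \<in> B"
    have pU: "p \<in> U" using p B by auto
    have "F p z \<in> hopf_span z" "G p z \<in> hopf_span z" if "z \<in> ball p (e p) - {p}" for z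
      unfolding loc(6)[OF p that, symmetric] by (simp_all add: vec.span_base)
    note sp = this
    have "vec.span {F p p, G p p} \<subseteq> mperp (Vbundle Y p)"
      by (rule span2_mperp[OF perp[OF p loc(3)[OF p] sp(1)] perp[OF p loc(4)[OF p] sp(2)]])
    then show "E p \<subseteq> mperp (Vbundle Y p)" using span_perp[OF pU] by (simp add: E_def)
    show "\<exists>B' \<Psi>. open B' \<and> p \<in> B' \<and> B' \<subseteq> B \<and> smooth_frame B' 2 \<Psi> E"
    proof (cases "p \<in> wedge_support B Y \<kappa>")
      case True
      obtain B' \<Psi> where B': "open B'" "p \<in> B'" "B' \<subseteq> wedge_support B Y \<kappa>" "smooth_frame B' 2 \<Psi> (\<lambda>p. hopf_span p)"
        using wedge_holomorphic_subbundle[OF B] True unfolding holomorphic_subbundle_def by blast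
      have "smooth_frame B' 2 \<Psi> E" by (rule smooth_frame_cong[OF _ B'(4)]) (use B'(3) in \<open>auto simp: E_def\<close>)
      then show ?thesis using B' by (intro exI[of _ B'] exI[of _ \<Psi>]) (auto simp: wedge_support_iff)
    next
      case False
      have "smooth_frame (ball p (e p)) 2 (\<lambda>j. if j = 0 then F p else G p) E"
      proof (rule smooth_frame_2I[OF loc(3,4)[OF p]])
        fix z assume z: "z \<in> ball p (e p)"
        show "indep2 (F p z) (G p z)" by (rule loc(5)[OF p z])
        show "E z = vec.span {F p z, G p z}"
        proof (cases "z = p")
          case True then show ?thesis using False by (simp add: E_def)
        next
          case False
          then have sp: "vec.span {F p z, G p z} = hopf_span z" using loc(6)[OF p] z by blast
          then have "z \<in> wedge_support B Y \<kappa>" using indep2_span_cong[OF sp] loc(5)[OF p z] loc(2)[OF p] z by (auto simp: wedge_support_iff)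
          then show ?thesis by (simp add: E_def sp)
        qed
      qed
      then show ?thesis using loc(1,2)[OF p] by (intro exI[of _ "ball p (e p)"] exI) auto
    qed
  qed
  then show ?thesis by (intro exI[of _ E]) (simp add: E_def)
qed

subsection \<open>Holomorphic line subbundles and the Riccati equation\<close>

lemma eta_field:
  assumes W: "open W" "W \<subseteq> U" and \<mu>: "smooth_on W \<mu>"
  defines "\<nu> \<equiv> \<lambda>q. cnj (\<mu> q)"
  shows "normal_field W (\<lambda>q. eta Y \<kappa> (\<mu> q) q)"
    "\<And>q. q \<in> W \<Longrightarrow> Dzbar Y (\<lambda>q. eta Y \<kappa> (\<mu> q) q) q = (dzbar \<nu> q / 2 - cnj (s q) / 2) *s \<kappa> q + (\<nu> q / 2) *s D1 q"
proof -
  note nk = normal_field_\<kappa>[OF W] note nD = normal_field_Dzbar[OF nk]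
  have s\<nu>: "smooth_on W \<nu>" unfolding \<nu>_def by (rule smooth_on_cnj[OF W(1) \<mu>])
  have s2: "smooth_on W (\<lambda>q. \<nu> q / 2)"
    by (rule smooth_on_divide[OF W(1) s\<nu> smooth_on_const[OF W(1)]]) simp
  note n2 = normal_field_scale[OF s2 nk]
  have e: "(\<lambda>q. eta Y \<kappa> (\<mu> q) q) = (\<lambda>q. D1 q + (\<nu> q / 2) *s \<kappa> q)" by (simp add: eta_def \<nu>_def fun_eq_iff)
  show "normal_field W (\<lambda>q. eta Y \<kappa> (\<mu> q) q)" unfolding e by (rule normal_field_add[OF nD n2])
  fix q assume q: "q \<in> W"
  show "Dzbar Y (\<lambda>q. eta Y \<kappa> (\<mu> q) q) q = (dzbar \<nu> q / 2 - cnj (s q) / 2) *s \<kappa> q + (\<nu> q / 2) *s D1 q"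
    unfolding e Dzbar_add[OF nD n2 q] Dzbar_scale[OF nk s2 q] dz_rules1(10)[OF smooth_on_differentiable[OF s\<nu> q]] DD\<kappa>[OF subsetD[OF W(2) q]]
    by (simp add: vec_eq_iff algebra_simps)
qed

lemma eta_nonzero: "indep2 (\<kappa> q) (D1 q) \<Longrightarrow> eta Y \<kappa> m q \<noteq> 0"
proof
  assume i: "indep2 (\<kappa> q) (D1 q)" and "eta Y \<kappa> m q = 0"
  then have "(cnj m / 2) *s \<kappa> q + 1 *s D1 q = 0" by (simp add: eta_def add.commute)
  then show False using i unfolding indep2_def by (metis zero_neq_one)
qed

text \<open>The Riccati equation says that \<open>Dzbar\<close> multiplies \<eta> by half the
  conjugate of \<mu>. The integrating factor \<open>b\<close> removes this multiple without changing
  the line.\<close>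

lemma eta_line_subbundle:
  assumes W: "open W" "W \<subseteq> U" and ind: "\<And>q. q \<in> W \<Longrightarrow> indep2 (\<kappa> q) (D1 q)"
    and \<mu>: "smooth_on W \<mu>" "\<And>q. q \<in> W \<Longrightarrow> theta s \<mu> q = 0" and L: "\<And>q. q \<in> W \<Longrightarrow> L q = vec.span {eta Y \<kappa> (\<mu> q) q}"
  shows "holomorphic_subbundle W Y 1 L"
  unfolding holomorphic_subbundle_def
proof (intro conjI ballI)
  define \<eta> where "\<eta> q = eta Y \<kappa> (\<mu> q) q" for q
  note ef = eta_field[OF W \<mu>(1), folded \<eta>_def]
  fix p assume p: "p \<in> W"
  show "L p \<subseteq> mperp (Vbundle Y p)"
    unfolding L[OF p] by (rule span1_mperp) (use ef(1) p in \<open>auto simp: normal_field_def \<eta>_def\<close>)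
  have D\<eta>: "Dzbar Y \<eta> q = (cnj (\<mu> q) / 2) *s \<eta> q" if q: "q \<in> W" for q
  proof -
    have "dzbar (\<lambda>q. cnj (\<mu> q)) q = (cnj (\<mu> q))\<^sup>2 / 2 + cnj (s q)"
      using theta_cnj[OF smooth_on_differentiable[OF \<mu>(1) q]] \<mu>(2)[OF q] by simp
    then show ?thesis unfolding ef(2)[OF q] by (simp add: \<eta>_def eta_def vec_eq_iff power2_eq_square algebra_simps)
  qed
  have "smooth_on W (\<lambda>q. (- 1/2) * cnj (\<mu> q))"
    by (intro smooth_on_mult smooth_on_const smooth_on_cnj W \<mu>)
  then obtain V b where V: "open V" "p \<in> V" "V \<subseteq> W" "smooth_on V b" "\<And>z. z \<in> V \<Longrightarrow> b z \<noteq> 0"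
    "\<And>z. z \<in> V \<Longrightarrow> dzbar b z = (- 1/2) * cnj (\<mu> z) * b z"
    by (rule scalar_dbar_solution[OF W(1) p]) (rule that; assumption)
  have nV: "normal_field V \<eta>" using ef(1) V smooth_on_subset unfolding normal_field_def by blast
  show "\<exists>B \<Psi>. open B \<and> p \<in> B \<and> B \<subseteq> W \<and> smooth_frame B 1 \<Psi> L \<and> (\<forall>j<1. \<forall>q\<in>B. Dzbar Y (\<Psi> j) q = 0)"
  proof (intro exI conjI allI impI ballI)
    show "open V" "p \<in> V" "V \<subseteq> W" by (rule V)+
    show "smooth_frame V 1 (\<lambda>j q. b q *s \<eta> q) L"
      unfolding smooth_frame_1_iff
    proof (intro conjI ballI)
      show "smooth_on V (\<lambda>q. b q *s \<eta> q)" using nV by (intro smooth_on_vscale V) (simp add: normal_field_def)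
      fix q assume q: "q \<in> V"
      note qW = subsetD[OF V(3) q]
      show "b q *s \<eta> q \<noteq> 0" using V(5)[OF q] eta_nonzero[OF ind[OF qW]] by (simp add: \<eta>_def)
      have "\<eta> q = inverse (b q) *s (b q *s \<eta> q)" using V(5)[OF q] by simp
      then have "\<eta> q \<in> vec.span {b q *s \<eta> q}" "b q *s \<eta> q \<in> vec.span {\<eta> q}"
        unfolding vec.span_singleton by blast+
      then have "vec.span {\<eta> q} = vec.span {b q *s \<eta> q}"
        by (intro equalityI vec.span_minimal) simp_all
      then show "L q = vec.span {b q *s \<eta> q}" unfolding L[OF qW] \<eta>_def .
    qed
    fix q assume q: "q \<in> V"
    show "Dzbar Y (\<lambda>q. b q *s \<eta> q) q = 0"
      unfolding Dzbar_scale[OF nV V(4) q] V(6)[OF q] D\<eta>[OF subsetD[OF V(3) q]] by (simp add: vec_eq_iff)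
  qed
qed

text \<open>A holomorphic local section is c \<eta>. Its \<open>Dzbar\<close> derivative vanishes in
  the directions \<open>\<kappa>\<close> and \<open>D1\<close> separately, and eliminating
  \<open>dzbar c\<close> from the two equations leaves the Riccati equation. Smoothness of c and
  \<mu> is not given and has to be recovered first.\<close>

lemma riccati_of_line_subbundle:
  assumes W: "open W" "W \<subseteq> U" and ind: "\<And>q. q \<in> W \<Longrightarrow> indep2 (\<kappa> q) (D1 q)"
    and hol: "holomorphic_subbundle W Y 1 L" and L: "\<And>q. q \<in> W \<Longrightarrow> L q = vec.span {eta Y \<kappa> (\<mu> q) q}"
  shows "smooth_on W \<mu>" "\<And>q. q \<in> W \<Longrightarrow> theta s \<mu> q = 0"
proof -
  have loc: "\<exists>V. open V \<and> p \<in> V \<and> V \<subseteq> W \<and> smooth_on V \<mu> \<and> theta s \<mu> p = 0" if p: "p \<in> W" for p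
  proof -
    obtain B \<Psi> where B: "open B" "p \<in> B" "B \<subseteq> W" "smooth_frame B 1 \<Psi> L" "\<And>q. q \<in> B \<Longrightarrow> Dzbar Y (\<Psi> 0) q = 0"
      using hol p unfolding holomorphic_subbundle_def by (metis zero_less_one)
    define \<psi> where "\<psi> = \<Psi> 0"
    have \<psi>: "smooth_on B \<psi>" "\<And>q. q \<in> B \<Longrightarrow> L q = vec.span {\<psi> q}" "\<And>q. q \<in> B \<Longrightarrow> \<psi> q \<noteq> 0" "\<And>q. q \<in> B \<Longrightarrow> Dzbar Y \<psi> q = 0"
      using B(4,5) unfolding smooth_frame_1_iff \<psi>_def by auto
    have "\<exists>c. \<psi> q = c *s eta Y \<kappa> (\<mu> q) q" if "q \<in> B" for q
      using \<psi>(2)[OF that] L[of q] B(3) that vec.span_base[of "\<psi> q" "{\<psi> q}"] by (auto simp: vec.span_singleton)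
    then obtain c where c: "\<And>q. q \<in> B \<Longrightarrow> \<psi> q = c q *s eta Y \<kappa> (\<mu> q) q" by metis
    have c0: "c q \<noteq> 0" if "q \<in> B" for q using \<psi>(3)[OF that] c[OF that] by auto
    obtain i j where ij: "\<kappa> p $ i * D1 p $ j - \<kappa> p $ j * D1 p $ i \<noteq> 0" using ind[OF p] unfolding indep2_iff_minor by auto
    define m where "m q = \<kappa> q $ i * D1 q $ j - \<kappa> q $ j * D1 q $ i" for q
    have BU: "B \<subseteq> U" using B W by auto
    note sB = smooth_on_subset[OF _ BU]
    have sm: "smooth_on B m" unfolding m_def[abs_def] by (intro smooth_intros B sB smooth_\<kappa> smooth_D\<kappa>)
    define V where "V = B \<inter> m -` (- {0})"
    have V: "open V" "p \<in> V" "V \<subseteq> B"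
      unfolding V_def using B(1,2) ij smooth_on_continuous_on[OF sm] by (auto intro!: continuous_open_preimage simp: m_def)
    have VW: "V \<subseteq> W" and VU: "V \<subseteq> U" using V B W by auto
    note sV = smooth_on_subset[OF _ V(3)]
    \<comment> \<open>Cramer's rule for \<psi> in the basis \<open>\<kappa>\<close>,
      \<open>D1\<close>: \<open>x\<close> is the coefficient of \<open>\<kappa>\<close>, the next
      quotient is that of \<open>D1\<close>, namely \<open>c\<close>. The conjugate of \<mu> is then
      2 x / c.\<close>
    define x where "x q = (\<psi> q $ i * D1 q $ j - \<psi> q $ j * D1 q $ i) / m q" for q
    have sc0: "smooth_on V (\<lambda>q. (\<kappa> q $ i * \<psi> q $ j - \<kappa> q $ j * \<psi> q $ i) / m q)"
      by (intro smooth_on_divide smooth_on_diff smooth_on_mult smooth_on_vec_nth V sV sB smooth_\<kappa> smooth_D\<kappa> \<psi> sm) (simp add: V_def)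
    have sx: "smooth_on V x" unfolding x_def[abs_def]
      by (intro smooth_on_divide smooth_on_diff smooth_on_mult smooth_on_vec_nth V sV sB smooth_\<kappa> smooth_D\<kappa> \<psi> sm) (simp add: V_def)
    have mq: "m q \<noteq> 0" "q \<in> B" if "q \<in> V" for q using that by (auto simp: V_def)
    have cm: "(\<kappa> q $ i * \<psi> q $ j - \<kappa> q $ j * \<psi> q $ i) / m q = c q" "x q = c q * cnj (\<mu> q) / 2" if q: "q \<in> V" for q
    proof -
      have "\<kappa> q $ i * \<psi> q $ j - \<kappa> q $ j * \<psi> q $ i = c q * m q"
        "\<psi> q $ i * D1 q $ j - \<psi> q $ j * D1 q $ i = c q * cnj (\<mu> q) / 2 * m q"
        unfolding c[OF mq(2)[OF q]] m_def by (simp_all add: eta_def algebra_simps)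
      then show "(\<kappa> q $ i * \<psi> q $ j - \<kappa> q $ j * \<psi> q $ i) / m q = c q" "x q = c q * cnj (\<mu> q) / 2"
        unfolding x_def using mq(1)[OF q] by simp_all
    qed
    have sc: "smooth_on V c" by (rule smooth_on_cong[OF V(1) sc0 cm(1)])
    have "smooth_on V (\<lambda>q. cnj (2 * x q / c q))"
      by (intro smooth_on_cnj smooth_on_divide smooth_on_mult smooth_on_const V sx sc c0 mq(2))
    then have s\<mu>: "smooth_on V \<mu>"
    proof (rule smooth_on_cong[OF V(1)])
      fix q assume q: "q \<in> V"
      have "2 * x q / c q = cnj (\<mu> q)" unfolding cm(2)[OF q] using c0[OF mq(2)[OF q]] by simp
      then show "cnj (2 * x q / c q) = \<mu> q" by simp
    qed
    define \<nu> where "\<nu> q = cnj (\<mu> q)" for q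
    note ef = eta_field[OF V(1) VU s\<mu>, folded \<nu>_def[abs_def]]
    have "0 = Dzbar Y \<psi> p" using \<psi>(4)[OF B(2)] ..
    also have "\<dots> = Dzbar Y (\<lambda>q. c q *s eta Y \<kappa> (\<mu> q) q) p" by (rule Dzbar_cong[OF V(1) VU V(2) c[OF mq(2)]])
    also have "\<dots> = dzbar c p *s eta Y \<kappa> (\<mu> p) p + c p *s ((dzbar \<nu> p / 2 - cnj (s p) / 2) *s \<kappa> p + (\<nu> p / 2) *s D1 p)"
      unfolding Dzbar_scale[OF ef(1) sc V(2)] ef(2)[OF V(2)] by (simp add: \<nu>_def)
    also have "\<dots> = (dzbar c p * \<nu> p / 2 + c p * (dzbar \<nu> p / 2 - cnj (s p) / 2)) *s \<kappa> p + (dzbar c p + c p * \<nu> p / 2) *s D1 p"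
      by (simp add: eta_def \<nu>_def vec_eq_iff algebra_simps)
    finally have z: "dzbar c p * \<nu> p / 2 + c p * (dzbar \<nu> p / 2 - cnj (s p) / 2) = 0" "dzbar c p + c p * \<nu> p / 2 = 0"
      using ind[OF p] unfolding indep2_def by metis+
    have "c p * (dzbar \<nu> p - ((\<nu> p)\<^sup>2 / 2 + cnj (s p)))
       = 2 * (dzbar c p * \<nu> p / 2 + c p * (dzbar \<nu> p / 2 - cnj (s p) / 2)) - \<nu> p * (dzbar c p + c p * \<nu> p / 2)"
      by (simp add: power2_eq_square algebra_simps)
    then have "dzbar \<nu> p = (\<nu> p)\<^sup>2 / 2 + cnj (s p)" using c0[OF B(2)] unfolding z by simp
    then have "theta s \<mu> p = 0"
      using theta_cnj[OF smooth_on_differentiable[OF s\<mu> V(2)]] by (simp add: \<nu>_def[abs_def])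
    then show ?thesis using V VW s\<mu> by blast
  qed
  show "smooth_on W \<mu>" by (rule smooth_on_local) (use loc in blast)
  show "theta s \<mu> q = 0" if "q \<in> W" for q using loc[OF that] by blast
qed

text \<open>Injectivity rests on the coefficient 1 of \<open>D1\<close> in \<open>eta\<close>: it
  singles out one spanning vector in each line.\<close>

theorem riccati_line_subbundle_bij:
  assumes W: "open W" "W \<subseteq> U" and ind: "\<And>q. q \<in> W \<Longrightarrow> indep2 (\<kappa> q) (D1 q)"
  shows "bij_betw (\<lambda>\<mu>. restrict (\<lambda>p. vec.span {eta Y \<kappa> (\<mu> p) p}) W) (riccati_solutions W s)
     {L \<in> extensional W. holomorphic_subbundle W Y 1 L \<and> (\<exists>\<mu>. \<forall>p\<in>W. L p = vec.span {eta Y \<kappa> (\<mu> p) p})}"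
  unfolding bij_betw_def
proof
  show "inj_on (\<lambda>\<mu>. restrict (\<lambda>p. vec.span {eta Y \<kappa> (\<mu> p) p}) W) (riccati_solutions W s)"
  proof (rule inj_onI)
    fix \<mu> \<mu>' assume m: "\<mu> \<in> riccati_solutions W s" "\<mu>' \<in> riccati_solutions W s"
      and eq: "restrict (\<lambda>p. vec.span {eta Y \<kappa> (\<mu> p) p}) W = restrict (\<lambda>p. vec.span {eta Y \<kappa> (\<mu>' p) p}) W"
    have "\<mu> q = \<mu>' q" if q: "q \<in> W" for q
    proof -
      have "vec.span {eta Y \<kappa> (\<mu> q) q} = vec.span {eta Y \<kappa> (\<mu>' q) q}" using fun_cong[OF eq, of q] q by simp
      then have "eta Y \<kappa> (\<mu> q) q \<in> vec.span {eta Y \<kappa> (\<mu>' q) q}" using vec.span_base by blast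
      then obtain c where "eta Y \<kappa> (\<mu> q) q = c *s eta Y \<kappa> (\<mu>' q) q" by (auto simp: vec.span_singleton)
      then have "(cnj (\<mu> q) / 2 - c * (cnj (\<mu>' q) / 2)) *s \<kappa> q + (1 - c) *s D1 q = 0"
        by (simp add: eta_def vec_eq_iff algebra_simps)
      then have "cnj (\<mu> q) / 2 - c * (cnj (\<mu>' q) / 2) = 0 \<and> 1 - c = 0" using ind[OF q] unfolding indep2_def by blast
      then have "cnj (\<mu> q) / 2 - 1 * (cnj (\<mu>' q) / 2) = 0" by (metis eq_iff_diff_eq_0)
      then show ?thesis by simp
    qed
    then show "\<mu> = \<mu>'" using m by (auto simp: riccati_solutions_def intro: extensionalityI)
  qed
  show "(\<lambda>\<mu>. restrict (\<lambda>p. vec.span {eta Y \<kappa> (\<mu> p) p}) W) ` riccati_solutions W s =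
     {L \<in> extensional W. holomorphic_subbundle W Y 1 L \<and> (\<exists>\<mu>. \<forall>p\<in>W. L p = vec.span {eta Y \<kappa> (\<mu> p) p})}" (is "?f ` _ = ?R")
  proof
    show "?f ` riccati_solutions W s \<subseteq> ?R"
    proof (rule image_subsetI)
      fix \<mu> assume m: "\<mu> \<in> riccati_solutions W s"
      have "holomorphic_subbundle W Y 1 (?f \<mu>)"
        by (rule eta_line_subbundle[OF W ind, of \<mu>]) (use m in \<open>auto simp: riccati_solutions_def\<close>)
      then show "?f \<mu> \<in> ?R" by auto
    qed
    show "?R \<subseteq> ?f ` riccati_solutions W s"
    proof
      fix L assume "L \<in> ?R"
      then obtain \<mu> where L: "L \<in> extensional W" "holomorphic_subbundle W Y 1 L" "\<And>p. p \<in> W \<Longrightarrow> L p = vec.span {eta Y \<kappa> (\<mu> p) p}" by blast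
      note r = riccati_of_line_subbundle[OF W ind L(2,3)]
      have "restrict \<mu> W \<in> riccati_solutions W s"
        by (rule restrict_riccati_solution[OF W(1) r])
      moreover have "L = ?f (restrict \<mu> W)"
        by (rule extensionalityI[OF L(1)]) (simp_all add: L(3))
      ultimately show "L \<in> ?f ` riccati_solutions W s" by blast
    qed
  qed
qed

subsection \<open>Existence of adjoint transforms\<close>

lemma isotropic_defines_adjoint:
  assumes B: "open B" "B \<subseteq> U" and 0: "\<And>p. p \<in> B \<Longrightarrow> ka p = 0" and W: "W \<subseteq> B" "smooth_on W \<mu>"
  shows "defines_adjoint W Y \<kappa> s \<mu> \<longleftrightarrow> (\<forall>p\<in>W. theta s \<mu> p = 0)"
  using isotropic(3)[OF B 0] W by (auto simp: defines_adjoint_def)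

lemma isotropic_infinite:
  assumes B: "open B" "B \<subseteq> U" and 0: "\<And>p. p \<in> B \<Longrightarrow> ka p = 0" and p: "p \<in> B"
  obtains W where "open W" "p \<in> W" "W \<subseteq> B" "infinite (riccati_solutions W s)" "infinite (adjoint_transforms W Y N \<kappa> s)"
proof -
  obtain W where W: "open W" "p \<in> W" "W \<subseteq> B" and inf: "infinite ((\<lambda>\<mu>. \<mu> p) ` riccati_solutions W s)"
    by (rule riccati_solutions_infinite[OF B p]) (rule that; assumption)
  have "riccati_solutions W s \<subseteq> {\<mu>. defines_adjoint W Y \<kappa> s \<mu>}"
    using isotropic_defines_adjoint[OF B 0 W(3)] by (auto simp: riccati_solutions_def)
  then have "infinite ((\<lambda>\<mu>. \<mu> p) ` {\<mu>. defines_adjoint W Y \<kappa> s \<mu>})" using inf by (meson image_mono infinite_super)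
  then have "infinite (adjoint_transforms W Y N \<kappa> s)" using infinite_adjoint_transforms B p W(2) by blast
  moreover have "infinite (riccati_solutions W s)" using inf finite_imageI by blast
  ultimately show ?thesis using that W by blast
qed

text \<open>Either the isotropic case holds on all of \<open>B\<close>, or \<open>B\<close> contains
  a nonempty open set with \<open>ka\<close> nonzero. The exceptional set of
  \<open>nonisotropic_roots\<close> cannot exhaust the latter, since it has no limit points
  there.\<close>

lemma local_adjoint_transform_exists:
  assumes B: "open B" "B \<subseteq> U" "B \<noteq> {}"
  shows "\<exists>W. open W \<and> W \<noteq> {} \<and> W \<subseteq> B \<and> adjoint_transforms W Y N \<kappa> s \<noteq> {}"
proof (cases "\<forall>p\<in>B. ka p = 0")
  case True
  obtain p where p: "p \<in> B" using B by blast
  obtain W where "open W" "p \<in> W" "W \<subseteq> B" "infinite (riccati_solutions W s)" "infinite (adjoint_transforms W Y N \<kappa> s)"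
    by (rule isotropic_infinite[OF B(1,2) _ p]) (use True in blast, (rule that; assumption))
  then show ?thesis by (metis empty_iff finite.emptyI)
next
  case False
  define B' where "B' = B \<inter> ka -` (- {0})"
  have "open B'" unfolding B'_def
    by (rule continuous_open_preimage[OF smooth_on_continuous_on[OF smooth_on_subset[OF smooth_k(1) B(2)]] B(1)]) auto
  then have B': "open B'" "B' \<subseteq> U" "B' \<noteq> {}" "\<And>p. p \<in> B' \<Longrightarrow> ka p \<noteq> 0"
    using False B(2) by (auto simp: B'_def)
  obtain S where S: "\<forall>p\<in>B'. \<not> p islimpt S"
    "\<forall>p\<in>B' - S. \<exists>W \<mu>1 \<mu>2. open W \<and> p \<in> W \<and> W \<subseteq> B' \<and>
          adjoint_pair W \<mu>1 \<mu>2"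
    by (rule exE[OF nonisotropic_roots(2)[OF B'(1,2,4)]], assumption, elim conjE, (rule that; assumption))
  have "\<not> B' \<subseteq> S"
  proof
    assume sub: "B' \<subseteq> S"
    obtain p where p: "p \<in> B'" using B' by blast
    have "p islimpt B'" using interior_limit_point[of p B'] B'(1) p by (simp add: interior_open)
    then show False using S(1) p islimpt_subset[OF _ sub] by blast
  qed
  then obtain p where p: "p \<in> B' - S" by blast
  from S(2)[rule_format, OF p] obtain W \<mu> where "open W" "p \<in> W" "W \<subseteq> B'" "defines_adjoint W Y \<kappa> s \<mu>" by (elim exE conjE)
  then have "open W \<and> W \<noteq> {} \<and> W \<subseteq> B \<and> adjoint_transforms W Y N \<kappa> s \<noteq> {}"
    by (auto simp: B'_def adjoint_transforms_def)
  then show ?thesis by blast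
qed

end

theorem mainTheorem3:
  fixes U :: "complex set"
    and f :: "complex \<Rightarrow> real ^ 'n"
    and Y N \<kappa> :: "complex \<Rightarrow> complex ^ 'n option"
    and s :: "complex \<Rightarrow> complex"
  assumes dim: "CARD('n) \<ge> 4"
    and dom: "open U" "connected U"
    and willmore: "willmore_surface U f"
    and lift: "canonical_lift U f Y"
    and normal: "normal_section U Y N"
    and hopf: "hopf_schwarzian U Y \<kappa> s"
  shows
    \<comment> \<open>local existence\<close>
    "(\<forall>B. open B \<and> B \<subseteq> U \<and> B \<noteq> {} \<longrightarrow>
        (\<exists>W. open W \<and> W \<noteq> {} \<and> W \<subseteq> B \<and> adjoint_transforms W Y N \<kappa> s \<noteq> {}))
     \<and>
     \<comment> \<open>part (a); the points of \<open>S\<close> are the branch points of the two-valued root\<close>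
     (\<forall>B. open B \<and> B \<subseteq> U \<and> (\<forall>p\<in>B. mink (\<kappa> p) (\<kappa> p) \<noteq> 0) \<longrightarrow>
        (\<forall>p\<in>B. \<exists>m1 m2. \<forall>m. mink (eta Y \<kappa> m p) (eta Y \<kappa> m p) =
            mink (\<kappa> p) (\<kappa> p) / 4 * (cnj m - cnj m1) * (cnj m - cnj m2)) \<and>
        (\<forall>W \<mu>. open W \<and> W \<subseteq> B \<and> continuous_on W \<mu> \<and>
            (\<forall>p\<in>W. mink (eta Y \<kappa> (\<mu> p) p) (eta Y \<kappa> (\<mu> p) p) = 0) \<longrightarrow>
            (\<forall>p\<in>W. theta s \<mu> p = 0) \<and> defines_adjoint W Y \<kappa> s \<mu>) \<and>
        (\<exists>S. S \<subseteq> {p \<in> B. (mink (Dzbar Y \<kappa> p) (\<kappa> p))\<^sup>2 =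
                            mink (\<kappa> p) (\<kappa> p) * mink (Dzbar Y \<kappa> p) (Dzbar Y \<kappa> p)} \<and>
             (\<forall>p\<in>B. \<not> p islimpt S) \<and>
             (\<forall>p\<in>S. \<not> (\<exists>W \<mu>. open W \<and> p \<in> W \<and> W \<subseteq> B \<and> continuous_on W \<mu> \<and>
                (\<forall>q\<in>W. mink (eta Y \<kappa> (\<mu> q) q) (eta Y \<kappa> (\<mu> q) q) = 0))) \<and>
             (\<forall>p\<in>B - S. \<exists>W \<mu>1 \<mu>2. open W \<and> p \<in> W \<and> W \<subseteq> B \<and>
                defines_adjoint W Y \<kappa> s \<mu>1 \<and> defines_adjoint W Y \<kappa> s \<mu>2 \<and>
                (\<forall>q\<in>W. \<forall>m. mink (eta Y \<kappa> m q) (eta Y \<kappa> m q) =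
                   mink (\<kappa> q) (\<kappa> q) / 4 * (cnj m - cnj (\<mu>1 q)) * (cnj m - cnj (\<mu>2 q))))))
     \<and>
     \<comment> \<open>part (b)\<close>
     (\<forall>B. open B \<and> B \<subseteq> U \<and> (\<forall>p\<in>B. mink (\<kappa> p) (\<kappa> p) = 0) \<longrightarrow>
        (\<forall>p\<in>B. mink (Dzbar Y \<kappa> p) (\<kappa> p) = 0 \<and> mink (Dzbar Y \<kappa> p) (Dzbar Y \<kappa> p) = 0 \<and>
            (\<forall>m. mink (eta Y \<kappa> m p) (eta Y \<kappa> m p) = 0)) \<and>
        (\<forall>W \<mu>. open W \<and> W \<subseteq> B \<and> smooth_on W \<mu> \<longrightarrow>
            (defines_adjoint W Y \<kappa> s \<mu> \<longleftrightarrow> (\<forall>p\<in>W. dz \<mu> p - (\<mu> p)\<^sup>2 / 2 - s p = 0))) \<and>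
        \<comment> \<open>part (b1)\<close>
        (s_willmore U Y \<kappa> \<longrightarrow>
          (\<forall>p\<in>B. \<kappa> p \<noteq> 0 \<longrightarrow>
             (\<exists>W \<mu>. open W \<and> p \<in> W \<and> W \<subseteq> B \<and> smooth_on W \<mu> \<and> (\<forall>q\<in>W. eta Y \<kappa> (\<mu> q) q = 0))) \<and>
          (\<forall>W \<mu>. open W \<and> W \<subseteq> B \<and> (\<forall>q\<in>W. \<kappa> q \<noteq> 0 \<and> eta Y \<kappa> (\<mu> q) q = 0) \<longrightarrow>
             smooth_on W \<mu> \<and> (\<forall>q\<in>W. theta s \<mu> q = 0) \<and>
             dual_willmore_surface W f (adjoint_map Y N \<mu>)) \<and>
          (\<forall>p\<in>B. \<exists>W. open W \<and> p \<in> W \<and> W \<subseteq> B \<and> infinite (adjoint_transforms W Y N \<kappa> s))) \<and>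
        \<comment> \<open>part (b2)\<close>
        (\<not> s_willmore U Y \<kappa> \<longrightarrow>
          holomorphic_subbundle (wedge_support B Y \<kappa>) Y 2 (\<lambda>p. vec.span {\<kappa> p, Dzbar Y \<kappa> p}) \<and>
          (\<exists>E. smooth_subbundle B Y 2 E \<and>
             (\<forall>p\<in>wedge_support B Y \<kappa>. E p = vec.span {\<kappa> p, Dzbar Y \<kappa> p})) \<and>
          (\<forall>W. open W \<and> W \<subseteq> wedge_support B Y \<kappa> \<longrightarrow>
             bij_betw (\<lambda>\<mu>. restrict (\<lambda>p. vec.span {eta Y \<kappa> (\<mu> p) p}) W)
               (riccati_solutions W s)
               {L \<in> extensional W. holomorphic_subbundle W Y 1 L \<and>
                  (\<exists>\<mu>. \<forall>p\<in>W. L p = vec.span {eta Y \<kappa> (\<mu> p) p})}) \<and>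
          (\<forall>p\<in>B. \<exists>W. open W \<and> p \<in> W \<and> W \<subseteq> B \<and>
             infinite (riccati_solutions W s) \<and> infinite (adjoint_transforms W Y N \<kappa> s))))"
proof -
  interpret conformal_surface U f Y N \<kappa> s
    by unfold_locales (use dom lift normal hopf willmore in \<open>auto simp: willmore_surface_def immersion_on_def\<close>)
  \<comment> \<open>From here on the variational hypothesis acts only through
    \<open>EL = 0\<close>.\<close>
  interpret willmore_conformal_surface U f Y N \<kappa> s
    by unfold_locales (rule EL_if_willmore_surface[OF willmore])
  have wU: "wedge_support B Y \<kappa> \<subseteq> U" if "B \<subseteq> U" for B using that by (auto simp: wedge_support_iff)
  show ?thesis
  proof (intro conjI allI impI, goal_cases)
    case (1 B)
    then show ?case using local_adjoint_transform_exists by blast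
  next
    case (2 B)
    then show ?case using nonisotropic_roots(1)[of B, unfolded ka_def] by blast
  next
    case (3 B W \<mu>)
    then have "defines_adjoint W Y \<kappa> s \<mu>" by (intro continuous_root_defines_adjoint) (auto simp: ka_def)
    then show ?case by (simp add: defines_adjoint_def)
  next
    case (4 B W \<mu>)
    then show ?case by (intro continuous_root_defines_adjoint) (auto simp: ka_def)
  next
    case (5 B)
    show ?case by (rule nonisotropic_roots(2)[of B, unfolded ka_def kb_def kc_def]) (use 5 in blast)+
  next
    case (6 B)
    then show ?case using isotropic[of B, unfolded ka_def kb_def kc_def] by blast
  next
    case (7 B W \<mu>)
    then show ?case using isotropic_defines_adjoint[of B W \<mu>] by (auto simp: ka_def theta_def)
  next
    case (8 B)
    show ?case
    proof (intro ballI impI)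
      fix p assume p: "p \<in> B" "\<kappa> p \<noteq> 0"
      obtain W \<mu> where W: "open W" "p \<in> W" "W \<subseteq> B" "\<And>q. q \<in> W \<Longrightarrow> \<kappa> q \<noteq> 0" "\<And>q. q \<in> W \<Longrightarrow> eta Y \<kappa> (\<mu> q) q = 0"
        by (rule eta_zero_exists[of B p]) (use 8 p in blast)+
      have "smooth_on W \<mu>" by (rule eta_zero_riccati(1)) (use W 8 in auto)
      then show "\<exists>W \<mu>. open W \<and> p \<in> W \<and> W \<subseteq> B \<and> smooth_on W \<mu> \<and> (\<forall>q\<in>W. eta Y \<kappa> (\<mu> q) q = 0)" using W by blast
    qed
  next
    case (9 B W \<mu>)
    show ?case by (rule eta_zero_riccati(1)) (use 9 in auto)
  next
    case (10 B W \<mu>)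
    show ?case by (rule ballI, rule eta_zero_riccati(2)[of W]) (use 10 in auto)
  next
    case (11 B W \<mu>)
    show ?case by (rule eta_zero_dual_willmore) (use 11 in auto)
  next
    case (12 B)
    then show ?case using isotropic_infinite[of B, unfolded ka_def] by metis
  next
    case (13 B)
    then show ?case using wedge_holomorphic_subbundle by blast
  next
    case (14 B)
    then show ?case using wedge_subbundle_extends[OF dom(2)] by blast
  next
    case (15 B W)
    show ?case by (rule riccati_line_subbundle_bij) (use 15 wU[of B] in \<open>auto simp: wedge_support_iff\<close>)
  next
    case (16 B)
    then show ?case using isotropic_infinite[of B, unfolded ka_def] by metis
  qed
qed

end
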